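(* Let $d\ge1$, let $S\subset\mathbb{R}^d$ be the standard simplex, let $\boldsymbol\alpha=(\alpha_0,\dots,\alpha_d)$ with all $\alpha_i>-\frac12$, let $w_{\boldsymbol\alpha}$ be the Jacobi weight on $S$, and let $r\ge1$ be an integer. Let $B$ be a weighted $L_p$ space or an Orlicz space (with Luxemburg or Orlicz norm) on $S$ with respect to $w_{\boldsymbol\alpha}(\boldsymbol x)\,d\boldsymbol x$, satisfying, for some $2\le s<\infty$ and some $m>0$, $$\max\big(\|F+G\|_B,\|F-G\|_B\big)\ge\big(\|F\|_B^s+m\|G\|_B^s\big)^{1/s}\quad\text{for all }F,G\in B.$$ Then there are constants $C,C_1>0$, independent of $f$, $t$ and $n$, such that for all $f\in B$, all $t>0$ and all integers $n\ge 0$ $$K_r\big(f,P_{\boldsymbol\alpha}(D)^{r/2},t^r\big)_B\ge C\Big\{\sum_{j=1}^\infty2^{-jrs}K_{r+1}\big(f,P_{\boldsymbol\alpha}(D)^{(r+1)/2},t^{r+1}2^{j(r+1)}\big)_B^s\Big\}^{1/s}$$ and $$K_r\big(f,P_{\boldsymbol\alpha}(D)^{r/2},2^{-nr}\big)_B\ge C_1\,2^{-nr}\Big\{\sum_{j=0}^n2^{jrs}E_{2^j}(f)_B^s\Big\}^{1/s}.$$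
   Context: $S=\{\boldsymbol x=(x_1,\dots,x_d):x_i\ge0,\ x_0:=1-\sum_{i=1}^dx_i\ge0\}$ and $w_{\boldsymbol\alpha}(\boldsymbol x)=x_0^{\alpha_0}\cdots x_d^{\alpha_d}$. The self-adjoint operator $P_{\boldsymbol\alpha}(D)$ is $$P_{\boldsymbol\alpha}(D)=-\sum_{\boldsymbol\xi\in E_S}w_{\boldsymbol\alpha}(\boldsymbol x)^{-1}\frac{\partial}{\partial\boldsymbol\xi}\,\tilde d(\boldsymbol\xi,\boldsymbol x)\,w_{\boldsymbol\alpha}(\boldsymbol x)\,\frac{\partial}{\partial\boldsymbol\xi},$$ where $E_S$ is the set of (unit) directions parallel to the edges of $S$ (one per edge) and $$\tilde d(\boldsymbol\xi,\boldsymbol x)=\sup_{\lambda\ge0,\ \boldsymbol x+\lambda\boldsymbol\xi\in S}d(\boldsymbol x,\boldsymbol x+\lambda\boldsymbol\xi)\ \sup_{\lambda\ge0,\ \boldsymbol x-\lambda\boldsymbol\xi\in S}d(\boldsymbol x,\boldsymbol x-\lambda\boldsymbol\xi)$$ with $d(\cdot,\cdot)$ the Euclidean distance. Let $\Pi_k$ be the polynomials in $d$ variables of total degree $\le k$. Then $\Pi_k=H_0\oplus\cdots\oplus H_k$ (orthogonal sum in $L_2(S,w_{\boldsymbol\alpha})$), where $P_{\boldsymbol\alpha}(D)\varphi=\lambda_\ell\varphi$ for $\varphi\in H_\ell$ with $\lambda_\ell=\ell\big(\ell+d+\sum_{i=0}^d\alpha_i\big)$. Let $P_\ell f$ be the projection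 of $f$ onto $H_\ell$ in the sense of $L_2(S,w_{\boldsymbol\alpha})$. For $\beta>0$, $f\in\mathcal{D}(P_{\boldsymbol\alpha}(D)^\beta)$ means that there is $\psi\in B$ with $P_\ell\psi=\lambda_\ell^\beta P_\ell f$ for all $\ell$, and then $P_{\boldsymbol\alpha}(D)^\beta f=\psi\sim\sum_{\ell=1}^\infty\lambda_\ell^\beta P_\ell f$. The $K$-functional is $$K_r\big(f,P_{\boldsymbol\alpha}(D)^{r/2},t^r\big)_B=\inf\big\{\|f-g\|_B+t^r\|P_{\boldsymbol\alpha}(D)^{r/2}g\|_B:\ g\in\mathcal{D}(P_{\boldsymbol\alpha}(D)^{r/2})\big\}.$$ $E_n(f)_B=\inf\{\|f-P\|_B:P\in\Pi_n\}$. Orlicz spaces on $S$: for a Young function $\Phi$ (increasing, convex on $[0,\infty)$, $\Phi(0)=0$) with complementary function $\Psi(y)=\sup_{x\ge0}(xy-\Phi(x))$, the Luxemburg norm is $\inf\{a>0:\int_S\Phi(|f|/a)\,w_{\boldsymbol\alpha}\,d\boldsymbol x\le1\}$ and the Orlicz norm is $\sup\{\int_S|fg|\,w_{\boldsymbol\alpha}\,d\boldsymbol x:\int_S\Psi(|g|)\,w_{\boldsymbol\alpha}\,d\boldsymbol x\le1\}$. Constants may depend on $B$ and $r$. *)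

theory Defs
  imports "HOL-Analysis.Analysis"
begin

section \<open>The simplex, the Jacobi weight and the operator\<close>

text \<open>The index set \<open>{0,...,d}\<close> is \<open>'d option\<close>: \<open>None\<close> plays the role of 0, so that
  \<open>coord x None\<close> is $x_0 = 1 - \sum_i x_i$.\<close>

fun coord :: "real^'d::finite \<Rightarrow> 'd option \<Rightarrow> real" where
  "coord x None = 1 - (\<Sum>i\<in>UNIV. x $ i)"
| "coord x (Some i) = x $ i"

definition simplex_S :: "(real^'d::finite) set" where
  "simplex_S = {x. \<forall>i. 0 \<le> coord x i}"

definition jacobi_weight :: "('d::finite option \<Rightarrow> real) \<Rightarrow> real^'d \<Rightarrow> real" where
  "jacobi_weight \<alpha> x = (\<Prod>i\<in>UNIV. coord x i powr \<alpha> i)"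

definition jacobi_measure :: "('d::finite option \<Rightarrow> real) \<Rightarrow> (real^'d) measure" where
  "jacobi_measure \<alpha> = density lborel (\<lambda>x. ennreal (indicator simplex_S x * jacobi_weight \<alpha> x))"

text \<open>The orientation of an edge is chosen arbitrarily. The operator below does not depend on it,
  and no two edges of a simplex are parallel, so \<open>edge_directions\<close> has one element per edge.\<close>

definition edge_direction :: "(real^'d::finite) set \<Rightarrow> real^'d" where
  "edge_direction e = (SOME \<xi>. \<exists>a\<in>e. \<exists>b\<in>e. a \<noteq> b \<and> \<xi> = (b - a) /\<^sub>R norm (b - a))"

definition edge_directions :: "(real^'d::finite) set" where
  "edge_directions = edge_direction ` {e. e edge_of simplex_S}"

definition dtilde :: "real^'d::finite \<Rightarrow> real^'d \<Rightarrow> real" where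
  "dtilde \<xi> x =
     (SUP c\<in>{c. 0 \<le> c \<and> x + c *\<^sub>R \<xi> \<in> simplex_S}. dist x (x + c *\<^sub>R \<xi>)) *
     (SUP c\<in>{c. 0 \<le> c \<and> x - c *\<^sub>R \<xi> \<in> simplex_S}. dist x (x - c *\<^sub>R \<xi>))"

definition dir_deriv :: "real^'d::finite \<Rightarrow> (real^'d \<Rightarrow> real) \<Rightarrow> real^'d \<Rightarrow> real" where
  "dir_deriv \<xi> f x = deriv (\<lambda>t. f (x + t *\<^sub>R \<xi>)) 0"

definition P_op :: "('d::finite option \<Rightarrow> real) \<Rightarrow> (real^'d \<Rightarrow> real) \<Rightarrow> real^'d \<Rightarrow> real" where
  "P_op \<alpha> \<phi> x = - (\<Sum>\<xi>\<in>edge_directions. inverse (jacobi_weight \<alpha> x) *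
      dir_deriv \<xi> (\<lambda>y. dtilde \<xi> y * jacobi_weight \<alpha> y * dir_deriv \<xi> \<phi> y) x)"

definition eigenval :: "('d::finite option \<Rightarrow> real) \<Rightarrow> nat \<Rightarrow> real" where
  "eigenval \<alpha> l = real l * (real l + real CARD('d) + (\<Sum>i\<in>UNIV. \<alpha> i))"

definition Poly_deg :: "nat \<Rightarrow> (real^'d::finite \<Rightarrow> real) set" where
  "Poly_deg k = {p. \<exists>c. p = (\<lambda>x. \<Sum>m | (\<Sum>i\<in>UNIV. m i) \<le> k. c m * (\<Prod>i\<in>UNIV. (x $ i) ^ m i))}"

text \<open>The differential equation is imposed in the interior, where the weight is smooth and positive
  for every admissible \<open>\<alpha>\<close>.\<close>

definition H_space :: "('d::finite option \<Rightarrow> real) \<Rightarrow> nat \<Rightarrow> (real^'d \<Rightarrow> real) set" where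
  "H_space \<alpha> l = {\<phi>\<in>Poly_deg l. \<forall>x\<in>interior simplex_S. P_op \<alpha> \<phi> x = eigenval \<alpha> l * \<phi> x}"

text \<open>The \<open>L\<^sub>2\<close>-orthogonality condition makes sense for every \<open>f\<close> integrable against the weight, since
  the elements of \<open>H_space \<alpha> l\<close> are bounded on the simplex.\<close>

definition H_proj :: "('d::finite option \<Rightarrow> real) \<Rightarrow> nat \<Rightarrow> (real^'d \<Rightarrow> real) \<Rightarrow> real^'d \<Rightarrow> real" where
  "H_proj \<alpha> l f = (THE h. h \<in> H_space \<alpha> l \<and>
      (\<forall>\<phi>\<in>H_space \<alpha> l. (LINT x|jacobi_measure \<alpha>. (f x - h x) * \<phi> x) = 0))"


section \<open>Lebesgue and Orlicz spaces\<close>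

text \<open>A norm is an \<open>ennreal\<close>-valued function on all functions; the space belonging to it consists of
  the measurable functions of finite norm. Functions equal almost everywhere are not identified.\<close>

definition norm_L :: "'a measure \<Rightarrow> real \<Rightarrow> ('a \<Rightarrow> real) \<Rightarrow> ennreal" where
  "norm_L M p f = (let I = (\<integral>\<^sup>+x. ennreal (\<bar>f x\<bar> powr p) \<partial>M)
                   in if I = \<infinity> then \<infinity> else ennreal (enn2real I powr (1 / p)))"

definition norm_Linf :: "'a measure \<Rightarrow> ('a \<Rightarrow> real) \<Rightarrow> ennreal" where
  "norm_Linf M f = Inf {a. AE x in M. ennreal \<bar>f x\<bar> \<le> a}"

definition young_fun :: "(real \<Rightarrow> real) \<Rightarrow> bool" where
  "young_fun \<Phi> \<longleftrightarrow> mono_on {0..} \<Phi> \<and> convex_on {0..} \<Phi> \<and> \<Phi> 0 = 0 \<and> (\<exists>x>0. \<Phi> x > 0)"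

text \<open>The complementary function may take the value \<open>\<infinity>\<close>. Truncating negative values by \<open>ennreal\<close> is
  harmless, because \<open>x = 0\<close> contributes the value 0 to the supremum.\<close>

definition complementary :: "(real \<Rightarrow> real) \<Rightarrow> real \<Rightarrow> ennreal" where
  "complementary \<Phi> y = (SUP x\<in>{0..}. ennreal (x * y - \<Phi> x))"

definition norm_Luxemburg :: "'a measure \<Rightarrow> (real \<Rightarrow> real) \<Rightarrow> ('a \<Rightarrow> real) \<Rightarrow> ennreal" where
  "norm_Luxemburg M \<Phi> f =
     Inf {ennreal a | a. a > 0 \<and> (\<integral>\<^sup>+x. ennreal (\<Phi> (\<bar>f x\<bar> / a)) \<partial>M) \<le> 1}"

definition norm_Orlicz :: "'a measure \<Rightarrow> (real \<Rightarrow> real) \<Rightarrow> ('a \<Rightarrow> real) \<Rightarrow> ennreal" where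
  "norm_Orlicz M \<Phi> f =
     Sup {(\<integral>\<^sup>+x. ennreal \<bar>f x * g x\<bar> \<partial>M) | g.
            g \<in> borel_measurable M \<and> (\<integral>\<^sup>+x. complementary \<Phi> \<bar>g x\<bar> \<partial>M) \<le> 1}"

definition Lp_or_Orlicz_norm :: "'a measure \<Rightarrow> (('a \<Rightarrow> real) \<Rightarrow> ennreal) \<Rightarrow> bool" where
  "Lp_or_Orlicz_norm M N \<longleftrightarrow>
     (\<exists>p\<ge>1. N = norm_L M p) \<or> N = norm_Linf M \<or>
     (\<exists>\<Phi>. young_fun \<Phi> \<and> (N = norm_Luxemburg M \<Phi> \<or> N = norm_Orlicz M \<Phi>))"

definition space_of :: "'a measure \<Rightarrow> (('a \<Rightarrow> real) \<Rightarrow> ennreal) \<Rightarrow> ('a \<Rightarrow> real) set" where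
  "space_of M N = {f \<in> borel_measurable M. N f < \<infinity>}"

definition nrm :: "(('a \<Rightarrow> real) \<Rightarrow> ennreal) \<Rightarrow> ('a \<Rightarrow> real) \<Rightarrow> real" where
  "nrm N f = enn2real (N f)"


section \<open>Fractional powers, K-functionals and best approximation\<close>

abbreviation B_space :: "('d::finite option \<Rightarrow> real) \<Rightarrow> ((real^'d \<Rightarrow> real) \<Rightarrow> ennreal) \<Rightarrow> (real^'d \<Rightarrow> real) set"
  where "B_space \<alpha> N \<equiv> space_of (jacobi_measure \<alpha>) N"

definition is_P_power :: "('d::finite option \<Rightarrow> real) \<Rightarrow> ((real^'d \<Rightarrow> real) \<Rightarrow> ennreal) \<Rightarrow> real \<Rightarrow>
    (real^'d \<Rightarrow> real) \<Rightarrow> (real^'d \<Rightarrow> real) \<Rightarrow> bool" where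
  "is_P_power \<alpha> N \<beta> f \<psi> \<longleftrightarrow> \<psi> \<in> B_space \<alpha> N \<and>
     (\<forall>l. H_proj \<alpha> l \<psi> = (\<lambda>x. eigenval \<alpha> l powr \<beta> * H_proj \<alpha> l f x))"

definition P_domain :: "('d::finite option \<Rightarrow> real) \<Rightarrow> ((real^'d \<Rightarrow> real) \<Rightarrow> ennreal) \<Rightarrow> real \<Rightarrow>
    (real^'d \<Rightarrow> real) set" where
  "P_domain \<alpha> N \<beta> = {f \<in> B_space \<alpha> N. \<exists>\<psi>. is_P_power \<alpha> N \<beta> f \<psi>}"

text \<open>The function \<open>\<psi>\<close> is determined by its projections up to a null set, so its norm does not depend
  on the choice.\<close>

definition P_power :: "('d::finite option \<Rightarrow> real) \<Rightarrow> ((real^'d \<Rightarrow> real) \<Rightarrow> ennreal) \<Rightarrow> real \<Rightarrow>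
    (real^'d \<Rightarrow> real) \<Rightarrow> real^'d \<Rightarrow> real" where
  "P_power \<alpha> N \<beta> f = (SOME \<psi>. is_P_power \<alpha> N \<beta> f \<psi>)"

text \<open>\<open>K_fun \<alpha> N r f u\<close> is $K_r(f, P_\alpha(D)^{r/2}, u)_B$; the last argument stands for $t^r$.\<close>

definition K_fun :: "('d::finite option \<Rightarrow> real) \<Rightarrow> ((real^'d \<Rightarrow> real) \<Rightarrow> ennreal) \<Rightarrow> nat \<Rightarrow>
    (real^'d \<Rightarrow> real) \<Rightarrow> real \<Rightarrow> real" where
  "K_fun \<alpha> N r f u = (INF g\<in>P_domain \<alpha> N (real r / 2).
      nrm N (\<lambda>x. f x - g x) + u * nrm N (P_power \<alpha> N (real r / 2) g))"

definition best_approx :: "((real^'d::finite \<Rightarrow> real) \<Rightarrow> ennreal) \<Rightarrow> nat \<Rightarrow> (real^'d \<Rightarrow> real) \<Rightarrow> real" where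
  "best_approx N n f = (INF p\<in>Poly_deg n. nrm N (\<lambda>x. f x - p x))"

end

theory Submission
  imports Defs "HOL-Real_Asymp.Real_Asymp" "HOL-Computational_Algebra.Polynomial"
begin

text \<open>
Write \<open>P\<close> for the differential operator and \<open>Q\<close> for its square root. The resolvents \<open>J\<^sub>\<tau> = (1 + \<tau> Q)\<^sup>-\<^sup>1\<close>
are contractions of \<open>B\<close>, and \<open>(1 + J\<^sub>2\<^sub>\<tau>) J\<^sub>\<tau> = 2 J\<^sub>2\<^sub>\<tau>\<close>. Hence the half sum of \<open>J\<^sub>\<tau> \<psi>\<close> and \<open>J\<^sub>2\<^sub>\<tau> J\<^sub>\<tau> \<psi>\<close>
is \<open>J\<^sub>2\<^sub>\<tau> \<psi>\<close>, and the convexity hypothesis, used at the scales \<open>\<tau> = 2\<^sup>i t\<close>, telescopes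
(\<open>telescoping_sum\<close>): the half differences are \<open>s\<close>-summable, with a sum bounded by the norm of \<open>\<psi>\<close>.
For \<open>\<psi> = Q\<^sup>r g\<close> they control the K-functionals of order \<open>r + 1\<close> of \<open>g\<close> at these scales
(\<open>K_realization\<close>). This is the first inequality; the second follows because \<open>E\<^sub>n\<close> is bounded
by the K-functional of order \<open>r + 1\<close> at \<open>1/n\<close> (\<open>best_approx_le_K\<close>), which is a Jackson inequality.

Both the contraction property of \<open>J\<^sub>\<tau>\<close> and the Jackson inequality come from positive kernels. The
Bernstein--Durrmeyer operators \<open>BD n\<close> have positive symmetric kernels of mass 1, and \<open>P\<close> maps one kernel
to a difference of consecutive ones (\<open>Phmon_kernel\<close>). So \<open>(1 + b P)\<^sup>-\<^sup>1\<close> is a limit of convex combinations of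
them (\<open>mbd_resolvent\<close>), and the root is reached by a convergent iteration (\<open>mbd_JJ\<close>). For the Jackson inequality
one needs combinations with coefficients of both signs. For \<open>\<alpha> > -1/2\<close> they are positive
whenever an associated polynomial is nonnegative on \<open>[0, 1]\<close> (\<open>Kn_positive\<close>). This reduces the matter to a Jackson
kernel and a Green function in one variable (\<open>jackson_kernel\<close>, \<open>green_estimate\<close>).

Positive symmetric kernels of mass at most 1 contract every Lebesgue, Luxemburg and Orlicz norm by Jensen's inequality
and duality (\<open>function_norm_Lp_or_Orlicz\<close>). All estimates are made on polynomials, where functions of \<open>P\<close> are
finite sums; Fatou's property of the norm carries them to the whole space (\<open>domain_approximation\<close>).
\<close>

section \<open>Function norms\<close>

text \<open>The properties of the norm of \<open>B\<close> on which the argument rests. \<open>norm_kernel\<close> states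
that an operator dominated by a symmetric sub-Markov kernel is a contraction: it is what makes positive
kernels useful in every space of the theorem at once. \<open>norm_fatou\<close> replaces completeness and
density arguments, which would fail in a nonseparable space such as \<open>L\<^sub>\<infinity>\<close>.\<close>

locale function_norm = finite_measure M for M :: "'a measure" +
 fixes N :: "('a => real) => ennreal"
 assumes norm_cmult: "f \<in> borel_measurable M ==> N (%x. c * f x) <= ennreal \<bar>c\<bar> * N f"
  and norm_triangle: "f \<in> borel_measurable M ==> g \<in> borel_measurable M ==> N (%x. f x + g x) <= N f + N g"
  and norm_mono: "f \<in> borel_measurable M ==> g \<in> borel_measurable M ==>
   AE x in M. \<bar>f x\<bar> <= \<bar>g x\<bar> ==> N f <= N g"
  and norm_one: "N (%_. 1) < \<infinity>"
  and norm_L1: "\<exists>C::real. 0 <= C \<and> (\<forall>f\<in>borel_measurable M. (\<integral>\<^sup>+x. ennreal \<bar>f x\<bar> \<partial>M) <= ennreal C * N f)"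
  and norm_kernel: "!!k f h. case_prod k \<in> borel_measurable (M \<Otimes>\<^sub>M M) ==> (!!x y. k x y = k y x) ==>
   (!!x. x \<in> space M ==> (\<integral>\<^sup>+y. k x y \<partial>M) <= 1) ==>
   f \<in> borel_measurable M ==> h \<in> borel_measurable M ==>
   AE x in M. ennreal \<bar>h x\<bar> <= (\<integral>\<^sup>+y. k x y * ennreal \<bar>f y\<bar> \<partial>M) ==> N h <= N f"
  and norm_fatou: "!!f g a. (!!n. f n \<in> borel_measurable M) ==> g \<in> borel_measurable M ==>
   AE x in M. (%n. f n x) \<longlonglongrightarrow> g x ==> (!!n. N (f n) <= a) ==> N g <= a"

subsection \<open>Convex gauges\<close>

text \<open>A Young function, its complementary function and the gauge of \<open>L\<^sub>\<infinity>\<close> (0 up to 1,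
then \<open>\<infinity>\<close>) are suprema of affine functions \<open>c x - d\<close> with \<open>c, d \<ge>
0\<close>. Measurability, lower semicontinuity and Jensen's inequality then hold because they hold for each
line, also where the supremum is infinite.\<close>

definition gauge_sup :: "(real \<times> real) set => real => ennreal" where
 "gauge_sup A x = (SUP (c, d)\<in>A. ennreal (c * x - d))"

definition gauge_lines :: "(real \<times> real) set => bool" where
 "gauge_lines A \<longleftrightarrow> A \<subseteq> {0..} \<times> {0..} \<and> (\<exists>(c, d)\<in>A. c > 0) \<and> (\<exists>x>0. gauge_sup A x < \<infinity>)"

lemma gauge_sup_ge: "(c, d) \<in> A ==> ennreal (c * x - d) <= gauge_sup A x"
 unfolding gauge_sup_def by (rule SUP_upper2[where i="(c,d)"]) auto

lemma gauge_sup_leI: "(!!c d. (c, d) \<in> A ==> ennreal (c * x - d) <= y) ==> gauge_sup A x <= y"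
 unfolding gauge_sup_def by (rule SUP_least) auto

lemma gauge_sup_mono:
 assumes "gauge_lines A" "x <= y" shows "gauge_sup A x <= gauge_sup A y"
proof (rule gauge_sup_leI)
 fix c d assume *: "(c, d) \<in> A"
 then have "c * x <= c * y" using assms by (intro mult_left_mono) (auto simp: gauge_lines_def)
 then have "ennreal (c * x - d) <= ennreal (c * y - d)" by (intro ennreal_leI) simp
 then show "ennreal (c * x - d) <= gauge_sup A y" using gauge_sup_ge[OF *, of y] by (rule order_trans)
qed

lemma gauge_sup_measurable [measurable]: "gauge_lines A ==> gauge_sup A \<in> borel_measurable borel"
proof (rule borel_measurableI_le)
 fix y assume A: "gauge_lines A"
 let ?S = "{x. gauge_sup A x <= y}"
 have "is_interval ?S"
  unfolding is_interval_1 using gauge_sup_mono[OF A] order_trans by blast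
 then have "?S \<in> sets borel" by (metis borel_measurable_vimage_halfspace_component_lt real_interval_borel_measurable)
 then show "{x \<in> space borel. gauge_sup A x <= y} \<in> sets borel" by simp
qed

lemma gauge_sup_convex:
 assumes A: "gauge_lines A" and u: "0 <= u" "0 <= v" "u + v <= 1"
 shows "gauge_sup A (u * x + v * y) <= ennreal u * gauge_sup A x + ennreal v * gauge_sup A y"
proof (rule gauge_sup_leI)
 fix c d assume *: "(c, d) \<in> A"
 have d: "0 <= d" using A * by (auto simp: gauge_lines_def)
 then have "c * (u * x + v * y) - d <= u * (c * x - d) + v * (c * y - d)"
  using mult_right_mono[OF u(3) d] by (simp add: algebra_simps)
 also have "... <= u * max 0 (c * x - d) + v * max 0 (c * y - d)"
  using u by (intro add_mono mult_left_mono) auto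
 finally have "ennreal (c * (u * x + v * y) - d) <= ennreal (u * max 0 (c * x - d) + v * max 0 (c * y - d))"
  by (rule ennreal_leI)
 also have "... = ennreal u * ennreal (c * x - d) + ennreal v * ennreal (c * y - d)"
  using u by (simp add: ennreal_plus ennreal_mult ennreal_max_0)
 also have "... <= ennreal u * gauge_sup A x + ennreal v * gauge_sup A y"
  using gauge_sup_ge[OF *] by (intro add_mono mult_left_mono) auto
 finally show "ennreal (c * (u * x + v * y) - d) <= ennreal u * gauge_sup A x + ennreal v * gauge_sup A y" .
qed

lemma gauge_sup_scale:
 assumes A: "gauge_lines A" and u: "0 <= u" "u <= 1"
 shows "gauge_sup A (u * x) <= ennreal u * gauge_sup A x"
 using gauge_sup_convex[OF A u(1) order_refl, of x 0] u by simp

lemma gauge_sup_0: "gauge_lines A ==> gauge_sup A 0 = 0"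
 by (rule antisym[OF gauge_sup_leI]) (auto simp: gauge_lines_def ennreal_neg subset_iff)

lemma gauge_sup_small:
 assumes A: "gauge_lines A" and K: "0 <= K"
 shows "\<exists>e>0. gauge_sup A e * ennreal K <= 1"
proof -
 obtain x where x: "x > 0" "gauge_sup A x < \<infinity>" using A by (auto simp: gauge_lines_def)
 obtain g where g: "gauge_sup A x = ennreal g" "0 <= g" using x(2) by (cases "gauge_sup A x") auto
 define u where "u = 1 / (1 + g * K)"
 have gk: "0 <= g * K" using g K by simp
 have u: "0 < u" "u <= 1" using gk by (auto simp: u_def)
 have "gauge_sup A (u * x) * ennreal K <= (ennreal u * gauge_sup A x) * ennreal K"
  using gauge_sup_scale[OF A, of u x] u by (intro mult_right_mono) auto
 also have "... = ennreal (u * g * K)" using g u K by (simp add: ennreal_mult)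
 also have "... <= 1" using gk by (simp add: u_def divide_simps)
 finally show ?thesis using x u by (intro exI[of _ "u * x"]) auto
qed

lemma gauge_sup_lsc:
 assumes "X \<longlonglongrightarrow> x"
 shows "gauge_sup A x <= liminf (%n. gauge_sup A (X n))"
proof (rule gauge_sup_leI)
 fix c d assume *: "(c, d) \<in> A"
 have "(%n. ennreal (c * X n - d)) \<longlonglongrightarrow> ennreal (c * x - d)"
  by (intro tendsto_intros tendsto_ennrealI assms)
 then have "ennreal (c * x - d) = liminf (%n. ennreal (c * X n - d))"
  by (simp add: lim_imp_Liminf)
 also have "... <= liminf (%n. gauge_sup A (X n))"
  by (intro Liminf_mono always_eventually allI gauge_sup_ge[OF *])
 finally show "ennreal (c * x - d) <= liminf (%n. gauge_sup A (X n))" .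
qed

text \<open>Each line \<open>c x - d\<close> has \<open>d \<ge> 0\<close>, so it can be integrated against a kernel of
mass at most 1, and the result is below the integral of the supremum.\<close>

lemma gauge_sup_Jensen:
 assumes A: "gauge_lines A" and k[measurable]: "k \<in> borel_measurable M" and k1: "(\<integral>\<^sup>+y. k y \<partial>M) <= 1"
  and f[measurable]: "f \<in> borel_measurable M"
  and h: "ennreal h <= (\<integral>\<^sup>+y. k y * ennreal \<bar>f y\<bar> \<partial>M)" "0 <= h"
 shows "gauge_sup A h <= (\<integral>\<^sup>+y. k y * gauge_sup A \<bar>f y\<bar> \<partial>M)"
proof (rule gauge_sup_leI)
 note [measurable] = gauge_sup_measurable[OF A]
 fix c d assume *: "(c, d) \<in> A"
 have c: "0 <= c" and d: "0 <= d" using A * by (auto simp: gauge_lines_def)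
 have "ennreal (c * h) <= ennreal c * (\<integral>\<^sup>+y. k y * ennreal \<bar>f y\<bar> \<partial>M)"
  using c h by (simp add: ennreal_mult mult_left_mono)
 also have "... = (\<integral>\<^sup>+y. ennreal c * (k y * ennreal \<bar>f y\<bar>) \<partial>M)" by (simp add: nn_integral_cmult)
 also have "... = (\<integral>\<^sup>+y. k y * ennreal (c * \<bar>f y\<bar>) \<partial>M)"
  by (intro nn_integral_cong) (simp add: ennreal_mult' c ac_simps)
 also have "... <= (\<integral>\<^sup>+y. k y * gauge_sup A \<bar>f y\<bar> + k y * ennreal d \<partial>M)"
 proof (intro nn_integral_mono)
  fix y
  have "ennreal (c * \<bar>f y\<bar>) <= ennreal (max 0 (c * \<bar>f y\<bar> - d) + d)" by (intro ennreal_leI) auto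
  also have "... = ennreal (c * \<bar>f y\<bar> - d) + ennreal d" using d by (simp add: ennreal_plus ennreal_max_0)
  also have "... <= gauge_sup A \<bar>f y\<bar> + ennreal d" by (intro add_right_mono gauge_sup_ge[OF *])
  finally show "k y * ennreal (c * \<bar>f y\<bar>) <= k y * gauge_sup A \<bar>f y\<bar> + k y * ennreal d"
   by (metis distrib_left mult_left_mono zero_le)
 qed
 also have "... = (\<integral>\<^sup>+y. k y * gauge_sup A \<bar>f y\<bar> \<partial>M) + (\<integral>\<^sup>+y. k y \<partial>M) * ennreal d"
  by (simp add: nn_integral_add nn_integral_multc)
 also have "... <= (\<integral>\<^sup>+y. k y * gauge_sup A \<bar>f y\<bar> \<partial>M) + 1 * ennreal d"
  by (intro add_left_mono mult_right_mono k1) auto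
 finally have "ennreal (c * h) <= (\<integral>\<^sup>+y. k y * gauge_sup A \<bar>f y\<bar> \<partial>M) + ennreal d" by simp
 then show "ennreal (c * h - d) <= (\<integral>\<^sup>+y. k y * gauge_sup A \<bar>f y\<bar> \<partial>M)"
  using d by (metis ennreal_minus ennreal_minus_le_iff add.commute ennreal_neq_top)
qed

text \<open>Jensen's inequality in the second variable, then Fubini; the symmetry of the kernel bounds its mass in the
other variable.\<close>

lemma gauge_sup_kernel:
 assumes A: "gauge_lines A" and M: "sigma_finite_measure M"
  and k[measurable]: "case_prod k \<in> borel_measurable (M \<Otimes>\<^sub>M M)"
  and sym: "!!x y. k x y = k y x"
  and k1: "!!x. x \<in> space M ==> (\<integral>\<^sup>+y. k x y \<partial>M) <= 1"
  and f[measurable]: "f \<in> borel_measurable M"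
  and h: "AE x in M. ennreal \<bar>h x\<bar> <= (\<integral>\<^sup>+y. k x y * ennreal \<bar>f y\<bar> \<partial>M)"
 shows "(\<integral>\<^sup>+x. gauge_sup A \<bar>h x\<bar> \<partial>M) <= (\<integral>\<^sup>+y. gauge_sup A \<bar>f y\<bar> \<partial>M)"
proof -
 interpret M: sigma_finite_measure M by fact
 interpret P: pair_sigma_finite M M ..
 note [measurable] = gauge_sup_measurable[OF A]
 have "(\<integral>\<^sup>+x. gauge_sup A \<bar>h x\<bar> \<partial>M) <= (\<integral>\<^sup>+x. (\<integral>\<^sup>+y. k x y * gauge_sup A \<bar>f y\<bar> \<partial>M) \<partial>M)"
 proof (rule nn_integral_mono_AE)
  show "AE x in M. gauge_sup A \<bar>h x\<bar> <= (\<integral>\<^sup>+y. k x y * gauge_sup A \<bar>f y\<bar> \<partial>M)"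
   using h AE_space
  proof eventually_elim
   case (elim x)
   note x = elim(2)
   have [measurable]: "(%y. k x y) \<in> borel_measurable M" using x by measurable
   show ?case by (rule gauge_sup_Jensen[OF A _ k1[OF x] f]) (use elim in auto)
  qed
 qed
 also have "... = (\<integral>\<^sup>+y. (\<integral>\<^sup>+x. k x y * gauge_sup A \<bar>f y\<bar> \<partial>M) \<partial>M)"
  by (rule P.Fubini'[symmetric]) measurable
 also have "... = (\<integral>\<^sup>+y. (\<integral>\<^sup>+x. k y x \<partial>M) * gauge_sup A \<bar>f y\<bar> \<partial>M)"
 proof (intro nn_integral_cong)
  fix y assume y: "y \<in> space M"
  have "(%x. k x y) \<in> borel_measurable M" using y by measurable
  then show "(\<integral>\<^sup>+x. k x y * gauge_sup A \<bar>f y\<bar> \<partial>M) = (\<integral>\<^sup>+x. k y x \<partial>M) * gauge_sup A \<bar>f y\<bar>"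
   by (simp add: nn_integral_multc sym[of y])
 qed
 also have "... <= (\<integral>\<^sup>+y. 1 * gauge_sup A \<bar>f y\<bar> \<partial>M)"
  by (intro nn_integral_mono mult_right_mono k1) auto
 finally show ?thesis by simp
qed

subsection \<open>Luxemburg norms of convex gauges\<close>

definition lux :: "'a measure => (real \<times> real) set => ('a => real) => ennreal" where
 "lux M A f = Inf {ennreal a | a. a > 0 \<and> (\<integral>\<^sup>+x. gauge_sup A (\<bar>f x\<bar> / a) \<partial>M) <= 1}"

lemma lux_leI: "a > 0 ==> (\<integral>\<^sup>+x. gauge_sup A (\<bar>f x\<bar> / a) \<partial>M) <= 1 ==> lux M A f <= ennreal a"
 unfolding lux_def by (rule Inf_lower) auto

lemma lux_lessD:
 assumes A: "gauge_lines A" and l: "lux M A f < ennreal a"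
 shows "a > 0 \<and> (\<integral>\<^sup>+x. gauge_sup A (\<bar>f x\<bar> / a) \<partial>M) <= 1"
proof -
 obtain b where b: "b > 0" "(\<integral>\<^sup>+x. gauge_sup A (\<bar>f x\<bar> / b) \<partial>M) <= 1" "ennreal b < ennreal a"
  using l unfolding lux_def Inf_less_iff by auto
 have ba: "b < a" using b by (simp add: ennreal_less_iff)
 have "(\<integral>\<^sup>+x. gauge_sup A (\<bar>f x\<bar> / a) \<partial>M) <= (\<integral>\<^sup>+x. gauge_sup A (\<bar>f x\<bar> / b) \<partial>M)"
  using ba b by (intro nn_integral_mono gauge_sup_mono[OF A] divide_left_mono) auto
 with b ba show ?thesis by auto
qed

lemma ennreal_le_of_real_bounds:
 assumes "!!a. 0 < a ==> x < ennreal a ==> y <= ennreal a" shows "y <= (x::ennreal)"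
proof (cases x)
 case (real r)
 show ?thesis unfolding real
 proof (rule ennreal_le_epsilon)
  fix e :: real assume "0 < e"
  then have "y <= ennreal (r + e)" using real by (intro assms) (auto simp: ennreal_less_iff)
  then show "y <= ennreal r + ennreal e" using real \<open>0 < e\<close> by simp
 qed
qed simp

text \<open>The kernel property is inherited from the gauge, since the modular of the image is at most the modular of
\<open>f\<close>. The bound by \<open>L\<^sub>1\<close> comes from one line of positive slope.\<close>

lemma function_norm_lux:
 assumes M: "finite_measure M" and A: "gauge_lines A"
 shows "function_norm M (lux M A)"
proof -
 interpret finite_measure M by fact
 note [measurable] = gauge_sup_measurable[OF A]
 have mono: "lux M A f <= lux M A g"
  if "f \<in> borel_measurable M" "g \<in> borel_measurable M" "AE x in M. \<bar>f x\<bar> <= \<bar>g x\<bar>" for f g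
 proof (rule ennreal_le_of_real_bounds)
  fix a assume "0 < a" "lux M A g < ennreal a"
  note a = lux_lessD[OF A this(2)]
  have "(\<integral>\<^sup>+x. gauge_sup A (\<bar>f x\<bar> / a) \<partial>M) <= (\<integral>\<^sup>+x. gauge_sup A (\<bar>g x\<bar> / a) \<partial>M)"
   using that(3) a by (intro nn_integral_mono_AE) (auto elim!: eventually_mono intro!: gauge_sup_mono[OF A] divide_right_mono)
  with a show "lux M A f <= ennreal a" by (intro lux_leI) auto
 qed
 show ?thesis
 proof (unfold_locales, goal_cases)
  case (1 f c)
  show ?case
  proof (rule ennreal_le_of_real_bounds)
   fix a :: real assume a: "0 < a" "ennreal \<bar>c\<bar> * lux M A f < ennreal a"
   show "lux M A (%x. c * f x) <= ennreal a"
   proof (cases "c = 0")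
    case True
    then show ?thesis using a by (intro lux_leI) (auto simp: gauge_sup_0[OF A])
   next
    case False
    have "lux M A f < ennreal (a / \<bar>c\<bar>)"
    proof (rule ccontr)
     assume "\<not> ?thesis"
     then have "ennreal \<bar>c\<bar> * ennreal (a / \<bar>c\<bar>) <= ennreal \<bar>c\<bar> * lux M A f"
      by (intro mult_left_mono) auto
     with a False show False by (simp flip: ennreal_mult)
    qed
    from lux_lessD[OF A this] have "(\<integral>\<^sup>+x. gauge_sup A (\<bar>f x\<bar> / (a / \<bar>c\<bar>)) \<partial>M) <= 1" by simp
    then show ?thesis using a by (intro lux_leI) (auto simp: abs_mult mult.commute)
   qed
  qed
 next
  case (2 f g)
  note [measurable] = 2
  show ?case
  proof (cases "lux M A f = top \<or> lux M A g = top")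
   case False
   then obtain p q where pq: "lux M A f = ennreal p" "lux M A g = ennreal q" "0 <= p" "0 <= q"
    by (metis ennreal_cases)
   show ?thesis
   proof (rule ennreal_le_epsilon)
    fix e :: real assume e: "0 < e"
    define a b where "a = p + e/2" and "b = q + e/2"
    have "lux M A f < ennreal a" "lux M A g < ennreal b"
     using pq e by (auto simp: ennreal_less_iff a_def b_def)
    note ab = lux_lessD[OF A this(1)] lux_lessD[OF A this(2)]
    have "(\<integral>\<^sup>+x. gauge_sup A (\<bar>f x + g x\<bar> / (a + b)) \<partial>M) \<le>
     (\<integral>\<^sup>+x. ennreal (a / (a+b)) * gauge_sup A (\<bar>f x\<bar> / a) + ennreal (b / (a+b)) * gauge_sup A (\<bar>g x\<bar> / b) \<partial>M)"
    proof (intro nn_integral_mono)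
     fix x
     have "\<bar>f x + g x\<bar> / (a + b) <= (a/(a+b)) * (\<bar>f x\<bar> / a) + (b/(a+b)) * (\<bar>g x\<bar> / b)"
      using ab by (simp add: divide_simps abs_triangle_ineq)
     then have "gauge_sup A (\<bar>f x + g x\<bar> / (a + b)) <= gauge_sup A ((a/(a+b)) * (\<bar>f x\<bar> / a) + (b/(a+b)) * (\<bar>g x\<bar> / b))"
      by (rule gauge_sup_mono[OF A])
     also have "... <= ennreal (a / (a+b)) * gauge_sup A (\<bar>f x\<bar> / a) + ennreal (b / (a+b)) * gauge_sup A (\<bar>g x\<bar> / b)"
      using ab by (intro gauge_sup_convex[OF A]) (auto simp: divide_simps)
     finally show "gauge_sup A (\<bar>f x + g x\<bar> / (a + b)) <= ..." .
    qed
    also have "... = ennreal (a / (a+b)) * (\<integral>\<^sup>+x. gauge_sup A (\<bar>f x\<bar> / a) \<partial>M) + ennreal (b / (a+b)) * (\<integral>\<^sup>+x. gauge_sup A (\<bar>g x\<bar> / b) \<partial>M)"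
     by (simp add: nn_integral_add nn_integral_cmult)
    also have "... <= ennreal (a / (a+b)) * 1 + ennreal (b / (a+b)) * 1"
     using ab by (intro add_mono mult_left_mono) auto
    also have "... = ennreal (a / (a+b) + b / (a+b))" using ab by (simp add: ennreal_plus)
    also have "... = 1" using ab by (simp add: add_divide_distrib[symmetric])
    finally have "lux M A (%x. f x + g x) <= ennreal (a + b)" using ab by (intro lux_leI) auto
    also have "... = lux M A f + lux M A g + ennreal e"
     unfolding pq a_def b_def using pq e by (simp flip: ennreal_plus)
    finally show "lux M A (%x. f x + g x) <= lux M A f + lux M A g + ennreal e" .
   qed
  qed auto
 next
  case (3 f g)
  then show ?case by (rule mono)
 next
  case 4
  obtain e where e: "e > 0" "gauge_sup A e * ennreal (measure M (space M)) <= 1"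
   using gauge_sup_small[OF A, of "measure M (space M)"] by auto
  have "lux M A (%_. 1) <= ennreal (1 / e)"
   using e by (intro lux_leI) (auto simp: emeasure_eq_measure)
  then show ?case by (rule le_less_trans) simp
 next
  case 5
  obtain c d where cd: "(c, d) \<in> A" "c > 0" "0 <= d" using A by (auto simp: gauge_lines_def)
  define C where "C = (1 + d * measure M (space M)) / c"
  have C: "0 <= C" using cd by (auto simp: C_def)
  have "(\<integral>\<^sup>+x. ennreal \<bar>f x\<bar> \<partial>M) <= ennreal C * lux M A f" if [measurable]: "f \<in> borel_measurable M" for f
  proof -
   have *: "(\<integral>\<^sup>+x. ennreal \<bar>f x\<bar> \<partial>M) <= ennreal C * ennreal a" if "a > 0" "lux M A f < ennreal a" for a
   proof -
    note a = lux_lessD[OF A that(2)]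
    have "(\<integral>\<^sup>+x. ennreal \<bar>f x\<bar> \<partial>M) <= (\<integral>\<^sup>+x. ennreal (a/c) * (gauge_sup A (\<bar>f x\<bar> / a) + ennreal d) \<partial>M)"
    proof (intro nn_integral_mono)
     fix x
     have "\<bar>f x\<bar> <= (a/c) * (max 0 (c * (\<bar>f x\<bar> / a) - d) + d)"
      using a cd by (auto simp: field_simps max_def)
     then have "ennreal \<bar>f x\<bar> <= ennreal ((a/c) * (max 0 (c * (\<bar>f x\<bar> / a) - d) + d))" by (rule ennreal_leI)
     also have "... = ennreal (a/c) * (ennreal (c * (\<bar>f x\<bar> / a) - d) + ennreal d)"
      using a cd by (simp add: ennreal_mult ennreal_plus ennreal_max_0 del: times_divide_eq_right times_divide_eq_left)
     also have "... <= ennreal (a/c) * (gauge_sup A (\<bar>f x\<bar> / a) + ennreal d)"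
      by (intro mult_left_mono add_right_mono gauge_sup_ge[OF cd(1)]) auto
     finally show "ennreal \<bar>f x\<bar> <= ..." .
    qed
    also have "... = ennreal (a/c) * ((\<integral>\<^sup>+x. gauge_sup A (\<bar>f x\<bar> / a) \<partial>M) + ennreal d * emeasure M (space M))"
     by (simp add: nn_integral_cmult nn_integral_add)
    also have "... <= ennreal (a/c) * (1 + ennreal d * emeasure M (space M))"
     using a by (intro mult_left_mono add_right_mono) auto
    also have "... = ennreal C * ennreal a"
     using a cd by (simp add: C_def emeasure_eq_measure flip: ennreal_mult ennreal_plus ennreal_1)
    finally show ?thesis .
   qed
   show ?thesis
   proof (cases "lux M A f")
    case (real r)
    have ee: "(\<integral>\<^sup>+x. ennreal \<bar>f x\<bar> \<partial>M) <= ennreal (C * r) + ennreal e" if e: "e > 0" for e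
    proof -
     have "(\<integral>\<^sup>+x. ennreal \<bar>f x\<bar> \<partial>M) <= ennreal C * ennreal (r + e / (C+1))"
      using e C real by (intro *) (auto simp: ennreal_less_iff intro!: add_nonneg_pos divide_pos_pos)
     also have "... = ennreal (C * (r + e / (C+1)))" using C e real by (intro ennreal_mult[symmetric]) auto
     also have "... <= ennreal (C * r + e)"
      using C e real by (intro ennreal_leI) (auto simp: field_simps)
     finally show ?thesis using C e real by simp
    qed
    have "(\<integral>\<^sup>+x. ennreal \<bar>f x\<bar> \<partial>M) <= ennreal (C * r)" by (rule ennreal_le_epsilon[OF ee])
    then show ?thesis using real C by (simp add: ennreal_mult)
   next
    case top
    have "C > 0" using cd by (auto simp: C_def intro!: divide_pos_pos add_pos_nonneg)
    then show ?thesis using top by (simp add: ennreal_mult_top)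
   qed
  qed
  then show ?case using C by blast
 next
  case (6 k f h)
  show ?case
  proof (rule ennreal_le_of_real_bounds)
   fix a assume "0 < a" "lux M A f < ennreal a"
   note a = lux_lessD[OF A this(2)]
   note [measurable] = 6(1,4,5)
   have "(\<integral>\<^sup>+x. gauge_sup A \<bar>h x / a\<bar> \<partial>M) <= (\<integral>\<^sup>+x. gauge_sup A \<bar>f x / a\<bar> \<partial>M)"
   proof (rule gauge_sup_kernel[OF A sigma_finite_measure_axioms 6(1,2,3)])
    show "AE x in M. ennreal \<bar>h x / a\<bar> <= (\<integral>\<^sup>+y. k x y * ennreal \<bar>f y / a\<bar> \<partial>M)"
     using 6(6) AE_space
    proof eventually_elim
     case (elim x)
     have km: "(%y. k x y) \<in> borel_measurable M" using elim(2) 6(1) by measurable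
     have "ennreal \<bar>h x / a\<bar> = ennreal \<bar>h x\<bar> * ennreal (1/a)" using a by (simp flip: ennreal_mult)
     also have "... <= (\<integral>\<^sup>+y. k x y * ennreal \<bar>f y\<bar> \<partial>M) * ennreal (1/a)" by (intro mult_right_mono elim) auto
     also have "... = (\<integral>\<^sup>+y. k x y * ennreal \<bar>f y\<bar> * ennreal (1/a) \<partial>M)"
      using km by (subst nn_integral_multc) auto
     also have "... = (\<integral>\<^sup>+y. k x y * ennreal \<bar>f y / a\<bar> \<partial>M)"
      using a by (intro nn_integral_cong) (simp add: mult.assoc flip: ennreal_mult)
     finally show ?case .
    qed
   qed (auto simp: 6)
   also have "... <= 1" using a by simp
   finally show "lux M A h <= ennreal a" using a by (intro lux_leI) auto
  qed
 next
  case (7 f g u)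
  note [measurable] = 7(1,2)
  show ?case
  proof (rule ennreal_le_of_real_bounds)
   fix a assume a: "0 < a" "u < ennreal a"
   have 1: "(\<integral>\<^sup>+x. gauge_sup A (\<bar>f n x\<bar> / a) \<partial>M) <= 1" for n
    using lux_lessD[OF A le_less_trans[OF 7(4)[of n] a(2)]] by simp
   have "(\<integral>\<^sup>+x. gauge_sup A (\<bar>g x\<bar> / a) \<partial>M) <= (\<integral>\<^sup>+x. liminf (%n. gauge_sup A (\<bar>f n x\<bar> / a)) \<partial>M)"
   proof (rule nn_integral_mono_AE)
    show "AE x in M. gauge_sup A (\<bar>g x\<bar> / a) <= liminf (%n. gauge_sup A (\<bar>f n x\<bar> / a))"
     using 7(3) by eventually_elim (use a in \<open>intro gauge_sup_lsc tendsto_intros, auto\<close>)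
   qed
   also have "... <= liminf (%n. \<integral>\<^sup>+x. gauge_sup A (\<bar>f n x\<bar> / a) \<partial>M)"
    by (rule nn_integral_liminf) measurable
   also have "... <= 1" by (rule Liminf_le) (auto simp: 1)
   finally show "lux M A g <= ennreal a" using a by (intro lux_leI) auto
  qed
 qed
qed

subsection \<open>Orlicz norms of convex gauges\<close>

definition orl :: "'a measure => (real \<times> real) set => ('a => real) => ennreal" where
 "orl M A f = Sup {(\<integral>\<^sup>+x. ennreal \<bar>f x * g x\<bar> \<partial>M) | g.
      g \<in> borel_measurable M \<and> (\<integral>\<^sup>+x. gauge_sup A \<bar>g x\<bar> \<partial>M) <= 1}"

lemma orl_leI:
 "(!!g. g \<in> borel_measurable M ==> (\<integral>\<^sup>+x. gauge_sup A \<bar>g x\<bar> \<partial>M) <= 1 ==> (\<integral>\<^sup>+x. ennreal \<bar>f x * g x\<bar> \<partial>M) <= u) ==>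
  orl M A f <= u"
 unfolding orl_def by (rule Sup_least) auto

lemma orl_ge:
 "g \<in> borel_measurable M ==> (\<integral>\<^sup>+x. gauge_sup A \<bar>g x\<bar> \<partial>M) <= 1 ==> (\<integral>\<^sup>+x. ennreal \<bar>f x * g x\<bar> \<partial>M) <= orl M A f"
 unfolding orl_def by (rule Sup_upper) auto

text \<open>The kernel acts on the test function instead: by symmetry \<open>\<integral> (K f) g = \<integral> f (K
g)\<close>, and \<open>K g\<close> is again an admissible test function.\<close>

lemma function_norm_orl:
 assumes M: "finite_measure M" and A: "gauge_lines A"
 shows "function_norm M (orl M A)"
proof -
 interpret finite_measure M by fact
 interpret P: pair_sigma_finite M M ..
 note [measurable] = gauge_sup_measurable[OF A]
 show ?thesis
 proof (unfold_locales, goal_cases)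
  case (1 f c)
  note [measurable] = 1
  show ?case
  proof (rule orl_leI)
   fix g assume [measurable]: "g \<in> borel_measurable M" and g: "(\<integral>\<^sup>+x. gauge_sup A \<bar>g x\<bar> \<partial>M) <= 1"
   have "(\<integral>\<^sup>+x. ennreal \<bar>c * f x * g x\<bar> \<partial>M) = (\<integral>\<^sup>+x. ennreal \<bar>c\<bar> * ennreal \<bar>f x * g x\<bar> \<partial>M)"
    by (intro nn_integral_cong) (simp add: abs_mult ac_simps flip: ennreal_mult)
   also have "... = ennreal \<bar>c\<bar> * (\<integral>\<^sup>+x. ennreal \<bar>f x * g x\<bar> \<partial>M)"
    by (simp add: nn_integral_cmult)
   also have "... <= ennreal \<bar>c\<bar> * orl M A f" by (intro mult_left_mono orl_ge) (auto simp: g)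
   finally show "(\<integral>\<^sup>+x. ennreal \<bar>c * f x * g x\<bar> \<partial>M) <= ..." .
  qed
 next
  case (2 f f')
  note [measurable] = 2
  show ?case
  proof (rule orl_leI)
   fix g assume [measurable]: "g \<in> borel_measurable M" and g: "(\<integral>\<^sup>+x. gauge_sup A \<bar>g x\<bar> \<partial>M) <= 1"
   have "(\<integral>\<^sup>+x. ennreal \<bar>(f x + f' x) * g x\<bar> \<partial>M) <= (\<integral>\<^sup>+x. ennreal \<bar>f x * g x\<bar> + ennreal \<bar>f' x * g x\<bar> \<partial>M)"
    by (intro nn_integral_mono) (auto simp: distrib_right simp flip: ennreal_plus intro!: ennreal_leI)
   also have "... = (\<integral>\<^sup>+x. ennreal \<bar>f x * g x\<bar> \<partial>M) + (\<integral>\<^sup>+x. ennreal \<bar>f' x * g x\<bar> \<partial>M)"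
    by (rule nn_integral_add) auto
   also have "... <= orl M A f + orl M A f'" by (intro add_mono orl_ge) (auto simp: g)
   finally show "(\<integral>\<^sup>+x. ennreal \<bar>(f x + f' x) * g x\<bar> \<partial>M) <= ..." .
  qed
 next
  case (3 f f')
  note [measurable] = 3(1,2)
  show ?case
  proof (rule orl_leI)
   fix g assume [measurable]: "g \<in> borel_measurable M" and g: "(\<integral>\<^sup>+x. gauge_sup A \<bar>g x\<bar> \<partial>M) <= 1"
   have "(\<integral>\<^sup>+x. ennreal \<bar>f x * g x\<bar> \<partial>M) <= (\<integral>\<^sup>+x. ennreal \<bar>f' x * g x\<bar> \<partial>M)"
    using 3(3) by (intro nn_integral_mono_AE) (auto elim!: eventually_mono simp: abs_mult intro!: ennreal_leI mult_right_mono)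
   also have "... <= orl M A f'" by (intro orl_ge) (auto simp: g)
   finally show "(\<integral>\<^sup>+x. ennreal \<bar>f x * g x\<bar> \<partial>M) <= ..." .
  qed
 next
  case 4
  obtain c d where cd: "(c, d) \<in> A" "c > 0" "0 <= d" using A by (auto simp: gauge_lines_def)
  have "orl M A (%_. 1) <= ennreal (1/c) * (1 + ennreal d * emeasure M (space M))"
  proof (rule orl_leI)
   fix g assume [measurable]: "g \<in> borel_measurable M" and g: "(\<integral>\<^sup>+x. gauge_sup A \<bar>g x\<bar> \<partial>M) <= 1"
   have "(\<integral>\<^sup>+x. ennreal \<bar>1 * g x\<bar> \<partial>M) <= (\<integral>\<^sup>+x. ennreal (1/c) * (gauge_sup A \<bar>g x\<bar> + ennreal d) \<partial>M)"
   proof (intro nn_integral_mono)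
    fix x
    have "\<bar>1 * g x\<bar> <= (1/c) * (max 0 (c * \<bar>g x\<bar> - d) + d)"
     using cd by (auto simp: field_simps max_def)
    then have "ennreal \<bar>1 * g x\<bar> <= ennreal ((1/c) * (max 0 (c * \<bar>g x\<bar> - d) + d))" by (rule ennreal_leI)
    also have "... = ennreal (1/c) * (ennreal (c * \<bar>g x\<bar> - d) + ennreal d)"
     using cd by (simp add: ennreal_mult ennreal_plus ennreal_max_0 del: times_divide_eq_right times_divide_eq_left)
    also have "... <= ennreal (1/c) * (gauge_sup A \<bar>g x\<bar> + ennreal d)"
     by (intro mult_left_mono add_right_mono gauge_sup_ge[OF cd(1)]) auto
    finally show "ennreal \<bar>1 * g x\<bar> <= ..." .
   qed
   also have "... = ennreal (1/c) * ((\<integral>\<^sup>+x. gauge_sup A \<bar>g x\<bar> \<partial>M) + ennreal d * emeasure M (space M))"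
    by (simp add: nn_integral_cmult nn_integral_add)
   also have "... <= ennreal (1/c) * (1 + ennreal d * emeasure M (space M))"
    using g by (intro mult_left_mono add_right_mono) auto
   finally show "(\<integral>\<^sup>+x. ennreal \<bar>1 * g x\<bar> \<partial>M) <= ..." .
  qed
  also have "... < \<infinity>" by (simp add: ennreal_mult_less_top emeasure_eq_measure)
  finally show ?case .
 next
  case 5
  obtain e where e: "e > 0" "gauge_sup A e * ennreal (measure M (space M)) <= 1"
   using gauge_sup_small[OF A, of "measure M (space M)"] by auto
  have "(\<integral>\<^sup>+x. ennreal \<bar>f x\<bar> \<partial>M) <= ennreal (1/e) * orl M A f" if [measurable]: "f \<in> borel_measurable M" for f
  proof -
   have "(\<integral>\<^sup>+x. ennreal \<bar>f x\<bar> \<partial>M) = (\<integral>\<^sup>+x. ennreal (1/e) * ennreal \<bar>f x * e\<bar> \<partial>M)"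
    using e by (intro nn_integral_cong) (simp add: abs_mult flip: ennreal_mult)
   also have "... = ennreal (1/e) * (\<integral>\<^sup>+x. ennreal \<bar>f x * e\<bar> \<partial>M)" by (simp add: nn_integral_cmult)
   also have "... <= ennreal (1/e) * orl M A f"
    using e by (intro mult_left_mono orl_ge) (auto simp: emeasure_eq_measure)
   finally show ?thesis .
  qed
  then show ?case using e by (intro exI[of _ "1/e"]) auto
 next
  case (6 k f h)
  note [measurable] = 6(1,4,5)
  show ?case
  proof (rule orl_leI)
   fix g assume [measurable]: "g \<in> borel_measurable M" and g: "(\<integral>\<^sup>+x. gauge_sup A \<bar>g x\<bar> \<partial>M) <= 1"
   define G where "G y = (\<integral>\<^sup>+x. k y x * ennreal \<bar>g x\<bar> \<partial>M)" for y
   have Gm[measurable]: "G \<in> borel_measurable M" unfolding G_def by measurable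
   have "(\<integral>\<^sup>+x. ennreal \<bar>h x * g x\<bar> \<partial>M) <= (\<integral>\<^sup>+x. (\<integral>\<^sup>+y. k x y * ennreal \<bar>f y\<bar> * ennreal \<bar>g x\<bar> \<partial>M) \<partial>M)"
   proof (rule nn_integral_mono_AE)
    show "AE x in M. ennreal \<bar>h x * g x\<bar> <= (\<integral>\<^sup>+y. k x y * ennreal \<bar>f y\<bar> * ennreal \<bar>g x\<bar> \<partial>M)"
     using 6(6) AE_space
    proof eventually_elim
     case (elim x)
     have km: "(%y. k x y) \<in> borel_measurable M" using elim(2) 6(1) by measurable
     have "ennreal \<bar>h x * g x\<bar> <= (\<integral>\<^sup>+y. k x y * ennreal \<bar>f y\<bar> \<partial>M) * ennreal \<bar>g x\<bar>"
      using elim(1) by (simp add: abs_mult ennreal_mult mult_right_mono)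
     then show ?case using km by (subst nn_integral_multc) auto
    qed
   qed
   also have "... = (\<integral>\<^sup>+y. (\<integral>\<^sup>+x. k x y * ennreal \<bar>f y\<bar> * ennreal \<bar>g x\<bar> \<partial>M) \<partial>M)"
    by (rule P.Fubini'[symmetric]) measurable
   also have "... = (\<integral>\<^sup>+y. ennreal \<bar>f y\<bar> * G y \<partial>M)"
   proof (intro nn_integral_cong)
    fix y assume y: "y \<in> space M"
    have km: "(%x. k y x) \<in> borel_measurable M" using y 6(1) by measurable
    have "(\<integral>\<^sup>+x. k x y * ennreal \<bar>f y\<bar> * ennreal \<bar>g x\<bar> \<partial>M) = (\<integral>\<^sup>+x. ennreal \<bar>f y\<bar> * (k y x * ennreal \<bar>g x\<bar>) \<partial>M)"
     by (intro nn_integral_cong) (simp add: 6(2)[of y] ac_simps)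
    also have "... = ennreal \<bar>f y\<bar> * G y" unfolding G_def using km by (subst nn_integral_cmult) auto
    finally show "(\<integral>\<^sup>+x. k x y * ennreal \<bar>f y\<bar> * ennreal \<bar>g x\<bar> \<partial>M) = ennreal \<bar>f y\<bar> * G y" .
   qed
   also have "... <= orl M A f"
   proof -
    (* G may be infinite, so it is tested against f through the truncations min n G. *)
    define Gn where "Gn n y = enn2real (min (of_nat n) (G y))" for n :: nat and y
    have Gn: "ennreal (Gn n y) = min (of_nat n) (G y)" for n y
     unfolding Gn_def by (rule ennreal_enn2real) (simp add: min_less_iff_disj ennreal_of_nat_eq_real_of_nat)
    have Gn0: "0 <= Gn n y" for n y by (simp add: Gn_def)
    have [measurable]: "Gn n \<in> borel_measurable M" for n unfolding Gn_def by measurable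
    have G1: "(\<integral>\<^sup>+y. gauge_sup A \<bar>Gn n y\<bar> \<partial>M) <= 1" for n
    proof -
     have "(\<integral>\<^sup>+y. gauge_sup A \<bar>Gn n y\<bar> \<partial>M) <= (\<integral>\<^sup>+x. gauge_sup A \<bar>g x\<bar> \<partial>M)"
      by (rule gauge_sup_kernel[OF A sigma_finite_measure_axioms 6(1,2,3)]) (auto simp: Gn Gn0 G_def)
     then show ?thesis using g by (rule order_trans)
    qed
    have "(\<integral>\<^sup>+y. ennreal \<bar>f y\<bar> * G y \<partial>M) = (\<integral>\<^sup>+y. (SUP n. ennreal \<bar>f y\<bar> * ennreal (Gn n y)) \<partial>M)"
    proof (intro nn_integral_cong)
     fix y
     have "(SUP n. ennreal (Gn n y)) = G y"
      unfolding Gn by (simp add: inf_min[symmetric] SUP_inf[symmetric] ennreal_SUP_of_nat_eq_top)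
     then show "ennreal \<bar>f y\<bar> * G y = (SUP n. ennreal \<bar>f y\<bar> * ennreal (Gn n y))"
      by (simp add: SUP_mult_left_ennreal[symmetric])
    qed
    also have "... = (SUP n. \<integral>\<^sup>+y. ennreal \<bar>f y\<bar> * ennreal (Gn n y) \<partial>M)"
    proof (rule nn_integral_monotone_convergence_SUP)
     show "incseq (%n y. ennreal \<bar>f y\<bar> * ennreal (Gn n y))"
      unfolding Gn by (intro incseq_SucI le_funI mult_left_mono min.mono order_refl of_nat_mono) auto
    qed measurable
    also have "... <= orl M A f"
    proof (rule SUP_least)
     fix n
     have "(\<integral>\<^sup>+y. ennreal \<bar>f y\<bar> * ennreal (Gn n y) \<partial>M) = (\<integral>\<^sup>+y. ennreal \<bar>f y * Gn n y\<bar> \<partial>M)"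
      by (intro nn_integral_cong) (simp add: abs_mult Gn0 ennreal_mult)
     also have "... <= orl M A f" by (rule orl_ge) (auto simp: G1)
     finally show "(\<integral>\<^sup>+y. ennreal \<bar>f y\<bar> * ennreal (Gn n y) \<partial>M) <= orl M A f" .
    qed
    finally show ?thesis .
   qed
   finally show "(\<integral>\<^sup>+x. ennreal \<bar>h x * g x\<bar> \<partial>M) <= orl M A f" .
  qed
 next
  case (7 f f' u)
  note [measurable] = 7(1,2)
  show ?case
  proof (rule orl_leI)
   fix g assume [measurable]: "g \<in> borel_measurable M" and g: "(\<integral>\<^sup>+x. gauge_sup A \<bar>g x\<bar> \<partial>M) <= 1"
   have "(\<integral>\<^sup>+x. ennreal \<bar>f' x * g x\<bar> \<partial>M) = (\<integral>\<^sup>+x. liminf (%n. ennreal \<bar>f n x * g x\<bar>) \<partial>M)"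
   proof (rule nn_integral_cong_AE)
    show "AE x in M. ennreal \<bar>f' x * g x\<bar> = liminf (%n. ennreal \<bar>f n x * g x\<bar>)"
     using 7(3) by eventually_elim
      (rule lim_imp_Liminf[symmetric], auto intro!: tendsto_intros tendsto_ennrealI)
   qed
   also have "... <= liminf (%n. \<integral>\<^sup>+x. ennreal \<bar>f n x * g x\<bar> \<partial>M)"
    by (rule nn_integral_liminf) measurable
   also have "... <= u"
    by (rule Liminf_le) (auto intro!: always_eventually order_trans[OF orl_ge 7(4)] simp: g)
   finally show "(\<integral>\<^sup>+x. ennreal \<bar>f' x * g x\<bar> \<partial>M) <= u" .
  qed
 qed
qed

subsection \<open>Lebesgue and Orlicz spaces\<close>

definition young_lines :: "(real => real) => (real \<times> real) set" where
 "young_lines \<Phi> = {(c, d). 0 <= c \<and> 0 <= d \<and> (\<forall>y\<ge>0. c * y - d <= \<Phi> y)}"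

lemma young_fun_nonneg: "young_fun \<Phi> ==> 0 <= x ==> 0 <= \<Phi> x"
 using mono_onD[of "{0..}" \<Phi> 0 x] by (auto simp: young_fun_def)

text \<open>A finite convex function has a supporting line at every interior point, so it is the supremum of its
minorising lines.\<close>

lemma young_fun_support_line:
 assumes \<Phi>: "young_fun \<Phi>" and x: "0 < x"
 shows "\<exists>c d. (c, d) \<in> young_lines \<Phi> \<and> \<Phi> x = c * x - d"
proof -
 define c where "c = Inf ((%t. (\<Phi> x - \<Phi> t) / (x - t)) ` ({x<..} \<inter> {0..}))"
 have *: "\<Phi> y >= \<Phi> x + c * (y - x)" if "y >= 0" for y
  unfolding c_def by (rule convex_le_Inf_differential) (use \<Phi> x that in \<open>auto simp: young_fun_def interior_Ici\<close>)
 have d: "0 <= c * x - \<Phi> x" using *[of 0] \<Phi> by (simp add: young_fun_def)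
 then have "0 <= c * x" using young_fun_nonneg[OF \<Phi>, of x] x by linarith
 then have "0 <= c" using x by (simp add: zero_le_mult_iff)
 with d * show ?thesis by (intro exI[of _ c] exI[of _ "c * x - \<Phi> x"]) (auto simp: young_lines_def algebra_simps)
qed

lemma gauge_sup_young_lines:
 assumes \<Phi>: "young_fun \<Phi>" and x: "0 <= x"
 shows "gauge_sup (young_lines \<Phi>) x = ennreal (\<Phi> x)"
proof (rule antisym)
 show "gauge_sup (young_lines \<Phi>) x <= ennreal (\<Phi> x)"
  using x by (intro gauge_sup_leI ennreal_leI) (auto simp: young_lines_def)
 show "ennreal (\<Phi> x) <= gauge_sup (young_lines \<Phi>) x"
 proof (cases "x = 0")
  case True then show ?thesis using \<Phi> by (simp add: young_fun_def)
 next
  case False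
  then obtain c d where "(c, d) \<in> young_lines \<Phi>" "\<Phi> x = c * x - d"
   using young_fun_support_line[OF \<Phi>, of x] x by auto
  then show ?thesis using gauge_sup_ge[of c d "young_lines \<Phi>" x] by simp
 qed
qed

lemma young_lines_slope:
 assumes \<Phi>: "young_fun \<Phi>" shows "\<exists>(c, d)\<in>young_lines \<Phi>. c > 0"
proof -
 obtain x where x: "x > 0" "\<Phi> x > 0" using \<Phi> by (auto simp: young_fun_def)
 obtain c d where cd: "(c, d) \<in> young_lines \<Phi>" "\<Phi> x = c * x - d"
  using young_fun_support_line[OF \<Phi> x(1)] by auto
 then have "0 < c * x" using x by (auto simp: young_lines_def)
 then show ?thesis using cd x by (auto simp: zero_less_mult_iff)
qed

lemma gauge_lines_young: "young_fun \<Phi> ==> gauge_lines (young_lines \<Phi>)"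
 unfolding gauge_lines_def using young_lines_slope[of \<Phi>] gauge_sup_young_lines[of \<Phi> 1]
 by (intro conjI exI[of _ "1::real"]) (auto simp: young_lines_def)

lemma norm_Luxemburg_eq_lux:
 assumes "young_fun \<Phi>" shows "norm_Luxemburg M \<Phi> = lux M (young_lines \<Phi>)"
proof
 fix f :: "'a => real"
 have "(\<integral>\<^sup>+x. gauge_sup (young_lines \<Phi>) (\<bar>f x\<bar> / a) \<partial>M) = (\<integral>\<^sup>+x. ennreal (\<Phi> (\<bar>f x\<bar> / a)) \<partial>M)" if "a > 0" for a
  using that by (intro nn_integral_cong) (simp add: gauge_sup_young_lines[OF assms])
 then show "norm_Luxemburg M \<Phi> f = lux M (young_lines \<Phi>) f"
  unfolding norm_Luxemburg_def lux_def by (intro arg_cong[where f=Inf]) auto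
qed

lemma complementary_eq_gauge: "complementary \<Phi> = gauge_sup ((%x. (x, \<Phi> x)) ` {0..})"
 by (auto simp: fun_eq_iff complementary_def gauge_sup_def image_image)

lemma gauge_lines_complementary:
 assumes \<Phi>: "young_fun \<Phi>"
 shows "gauge_lines ((%x. (x, \<Phi> x)) ` {0..})" (is "gauge_lines ?A")
proof -
 obtain c d where cd: "(c, d) \<in> young_lines \<Phi>" "c > 0" using young_lines_slope[OF \<Phi>] by auto
 have "gauge_sup ?A c <= ennreal d"
  using cd by (intro gauge_sup_leI ennreal_leI) (auto simp: young_lines_def algebra_simps)
 then have "gauge_sup ?A c < \<infinity>" by (rule le_less_trans) simp
 then show ?thesis unfolding gauge_lines_def using cd young_fun_nonneg[OF \<Phi>]
  by (intro conjI exI[of _ c]) (auto intro: bexI[of _ "1::real"])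
qed

lemma norm_Orlicz_eq_orl: "norm_Orlicz M \<Phi> = orl M ((%x. (x, \<Phi> x)) ` {0..})"
 by (intro ext) (simp add: norm_Orlicz_def orl_def complementary_eq_gauge)

lemma young_fun_powr:
 fixes p :: real assumes p: "1 <= p" shows "young_fun (%x. x powr p)"
proof -
 have "convex_on {0..} (%x::real. x powr p)"
 proof (rule convex_on_linorderI)
  fix t x y :: real assume t: "0 < t" "t < 1" and xy: "x \<in> {0..}" "y \<in> {0..}" "x < y"
  show "((1 - t) *\<^sub>R x + t *\<^sub>R y) powr p <= (1 - t) * x powr p + t * y powr p"
  proof (cases "x = 0")
   case True
   have "t powr p <= t powr 1" using t p by (intro powr_mono') auto
   then show ?thesis using True t xy p by (simp add: powr_mult mult_right_mono)
  next
   case False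
   then show ?thesis using convex_onD[OF powr_convex[OF p], of t x y] t xy by auto
  qed
 qed simp
 moreover have "mono_on {0..} (%x::real. x powr p)" using p by (auto intro!: mono_onI powr_mono2)
 ultimately show ?thesis using p by (auto simp: young_fun_def intro!: exI[of _ 1])
qed

text \<open>For \<open>\<Phi> x = x powr p\<close> the modular is homogeneous in \<open>a\<close>, so the infimum is
attained at the \<open>p\<close>-norm.\<close>

lemma norm_L_eq_Luxemburg:
 fixes p :: real assumes p: "1 <= p" and f[measurable]: "f \<in> borel_measurable M"
 shows "norm_L M p f = norm_Luxemburg M (%x. x powr p) f"
proof -
 let ?I = "\<integral>\<^sup>+x. ennreal (\<bar>f x\<bar> powr p) \<partial>M"
 have eq: "(\<integral>\<^sup>+x. ennreal ((\<bar>f x\<bar> / a) powr p) \<partial>M) <= 1 \<longleftrightarrow> ?I <= ennreal (a powr p)" if a: "a > 0" for a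
 proof -
  have "(\<integral>\<^sup>+x. ennreal ((\<bar>f x\<bar> / a) powr p) \<partial>M) = (\<integral>\<^sup>+x. ennreal (\<bar>f x\<bar> powr p) * ennreal (1 / a powr p) \<partial>M)"
   using a by (intro nn_integral_cong) (simp add: powr_divide flip: ennreal_mult)
  also have "... = ?I * ennreal (1 / a powr p)" by (rule nn_integral_multc) auto
  finally have 1: "(\<integral>\<^sup>+x. ennreal ((\<bar>f x\<bar> / a) powr p) \<partial>M) = ?I * ennreal (1 / a powr p)" .
  show ?thesis
  proof (cases ?I)
   case (real r)
   then show ?thesis unfolding 1 using a by (simp add: divide_simps flip: ennreal_mult)
  next
   case top
   then show ?thesis unfolding 1 using a by (simp add: ennreal_top_mult top_unique)
  qed
 qed
 show ?thesis
 proof (cases ?I)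
  case top
  then have "{ennreal a | a. a > 0 \<and> (\<integral>\<^sup>+x. ennreal ((\<bar>f x\<bar> / a) powr p) \<partial>M) <= 1} = {}"
   using eq by (auto simp: top_unique)
  then show ?thesis unfolding norm_L_def norm_Luxemburg_def using top by (simp only: Inf_empty Let_def) simp
 next
  case (real r)
  have le: "?I <= ennreal (a powr p) \<longleftrightarrow> r powr (1/p) <= a" if "a > 0" for a
  proof -
   have "r <= a powr p ==> r powr (1/p) <= (a powr p) powr (1/p)"
    using real p by (intro powr_mono2) auto
   moreover have "r powr (1/p) <= a ==> (r powr (1/p)) powr p <= a powr p"
    using real p by (intro powr_mono2) auto
   moreover have "(a powr p) powr (1/p) = a" "(r powr (1/p)) powr p = r"
    using real that p by (simp_all add: powr_powr)
   ultimately show ?thesis using real that by auto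
  qed
  have "norm_Luxemburg M (%x. x powr p) f = Inf {ennreal a | a. a > 0 \<and> r powr (1/p) <= a}"
   unfolding norm_Luxemburg_def by (rule arg_cong[where f=Inf]) (auto simp: eq le)
  also have "... = ennreal (r powr (1/p))"
  proof (rule antisym)
   show "ennreal (r powr (1/p)) <= Inf {ennreal a | a. a > 0 \<and> r powr (1/p) <= a}"
    by (rule Inf_greatest) (auto intro: ennreal_leI)
   show "Inf {ennreal a | a. a > 0 \<and> r powr (1/p) <= a} <= ennreal (r powr (1/p))"
   proof (rule ennreal_le_epsilon)
    fix e :: real assume e: "0 < e"
    have "Inf {ennreal a | a. a > 0 \<and> r powr (1/p) <= a} <= ennreal (r powr (1/p) + e)"
     using e by (intro Inf_lower CollectI exI[of _ "r powr (1/p) + e"]) (auto intro: add_nonneg_pos)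
    then show "Inf {ennreal a | a. a > 0 \<and> r powr (1/p) <= a} <= ennreal (r powr (1/p)) + ennreal e"
     using e by simp
   qed
  qed
  finally show ?thesis using real by (simp add: norm_L_def)
 qed
qed

text \<open>With the lines \<open>c x - c\<close> the gauge vanishes on \<open>[0, 1]\<close> and is infinite beyond, so
that the modular condition says \<open>\<bar>f\<bar> \<le> a\<close> almost everywhere.\<close>

lemma norm_Linf_eq_lux:
 assumes f[measurable]: "f \<in> borel_measurable M"
 shows "norm_Linf M f = lux M ((%c. (c, c)) ` {0..}) f" (is "_ = lux M ?A f")
proof -
 have g: "gauge_sup ?A x = (if x <= 1 then 0 else top)" for x
 proof (cases "x <= 1")
  case True
  have "gauge_sup ?A x <= 0"
   using True by (intro gauge_sup_leI) (auto simp: ennreal_neg mult_left_le)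
  then show ?thesis using True by simp
 next
  case False
  have "gauge_sup ?A x = top"
  proof (rule ccontr)
   assume "gauge_sup ?A x ~= top"
   then obtain r where r: "gauge_sup ?A x = ennreal r" "0 <= r" by (cases "gauge_sup ?A x") auto
   define c where "c = (r + 1) / (x - 1)"
   have c: "0 <= c" using False r by (simp add: c_def)
   then have "ennreal (c * x - c) <= ennreal r" using gauge_sup_ge[of c c ?A x] r by auto
   moreover have "c * x - c = r + 1" using False by (simp add: c_def divide_simps) (simp add: algebra_simps)
   ultimately show False using r by simp
  qed
  with False show ?thesis by simp
 qed
 have eq: "(\<integral>\<^sup>+x. gauge_sup ?A (\<bar>f x\<bar> / a) \<partial>M) <= 1 \<longleftrightarrow> (AE x in M. ennreal \<bar>f x\<bar> <= ennreal a)" if a: "a > 0" for a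
 proof -
  have "(\<integral>\<^sup>+x. gauge_sup ?A (\<bar>f x\<bar> / a) \<partial>M) = (\<integral>\<^sup>+x. top * indicator {x\<in>space M. \<bar>f x\<bar> > a} x \<partial>M)"
   using a by (intro nn_integral_cong) (auto simp: g divide_simps indicator_def)
  also have "... = top * emeasure M {x\<in>space M. \<bar>f x\<bar> > a}" by (rule nn_integral_cmult_indicator) simp
  finally have 1: "(\<integral>\<^sup>+x. gauge_sup ?A (\<bar>f x\<bar> / a) \<partial>M) = top * emeasure M {x\<in>space M. \<bar>f x\<bar> > a}" .
  have "(AE x in M. ennreal \<bar>f x\<bar> <= ennreal a) \<longleftrightarrow> emeasure M {x\<in>space M. \<bar>f x\<bar> > a} = 0"
   using a by (subst AE_iff_measurable[OF _ refl]) (auto simp: not_le)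
  then show ?thesis unfolding 1 by (cases "emeasure M {x\<in>space M. \<bar>f x\<bar> > a} = 0") (auto simp: ennreal_top_mult top_unique)
 qed
 show ?thesis
 proof (rule antisym)
  show "norm_Linf M f <= lux M ?A f"
   unfolding lux_def norm_Linf_def by (rule Inf_superset_mono) (auto simp: eq)
  show "lux M ?A f <= norm_Linf M f"
   unfolding norm_Linf_def
  proof (rule Inf_greatest)
   fix u assume "u \<in> {a. AE x in M. ennreal \<bar>f x\<bar> <= a}"
   then have u: "AE x in M. ennreal \<bar>f x\<bar> <= u" by simp
   show "lux M ?A f <= u"
   proof (rule ennreal_le_of_real_bounds)
    fix a :: real assume a: "0 < a" "u < ennreal a"
    have "AE x in M. ennreal \<bar>f x\<bar> <= ennreal a" using u by eventually_elim (rule order_trans[OF _ less_imp_le[OF a(2)]])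
    then show "lux M ?A f <= ennreal a" using a eq by (intro lux_leI) auto
   qed
  qed
 qed
qed

lemma gauge_lines_Linf: "gauge_lines ((%c. (c, c)) ` {0..})"
proof -
 have "gauge_sup ((%c. (c, c)) ` {0..}) 1 <= 0" by (intro gauge_sup_leI) auto
 then show ?thesis by (auto simp: gauge_lines_def intro!: exI[of _ 1] bexI[of _ "1::real"])
qed

lemma function_norm_cong:
 assumes "function_norm M N'" "!!f. f \<in> borel_measurable M ==> N f = N' f"
 shows "function_norm M N"
proof -
 interpret function_norm M N' by fact
 show ?thesis
 proof (unfold_locales, goal_cases)
  case (1 f c) then show ?case using norm_cmult[of f c] by (simp add: assms(2))
 next
  case (2 f g) then show ?case using norm_triangle[of f g] by (simp add: assms(2))
 next
  case (3 f g) then show ?case using norm_mono[OF 3] by (simp only: assms(2))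
 next
  case 4 show ?case using norm_one by (simp add: assms(2))
 next
  case 5 show ?case using norm_L1 by (metis assms(2))
 next
  case (6 k f h) then show ?case using norm_kernel[OF 6] by (simp only: assms(2))
 next
  case (7 f g a)
  have "N' (f n) <= a" for n using 7(1,4)[of n] by (simp add: assms(2))
  from norm_fatou[of f, OF 7(1,2,3) this] show ?case using 7(2) by (simp only: assms(2))
 qed
qed

theorem function_norm_Lp_or_Orlicz:
 assumes "finite_measure M" "Lp_or_Orlicz_norm M N"
 shows "function_norm M N"
 using assms(2) unfolding Lp_or_Orlicz_norm_def
proof (elim disjE exE conjE)
 fix p assume p: "1 <= p" "N = norm_L M p"
 show ?thesis
  by (rule function_norm_cong[OF function_norm_lux[OF assms(1) gauge_lines_young[OF young_fun_powr[OF p(1)]]]])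
    (simp add: p norm_L_eq_Luxemburg norm_Luxemburg_eq_lux young_fun_powr)
next
 assume "N = norm_Linf M"
 then show ?thesis
  by (intro function_norm_cong[OF function_norm_lux[OF assms(1) gauge_lines_Linf]]) (simp add: norm_Linf_eq_lux)
next
 fix \<Phi> assume \<Phi>: "young_fun \<Phi>"
 show ?thesis if "N = norm_Luxemburg M \<Phi>"
  unfolding that norm_Luxemburg_eq_lux[OF \<Phi>] by (rule function_norm_lux[OF assms(1) gauge_lines_young[OF \<Phi>]])
 show ?thesis if "N = norm_Orlicz M \<Phi>"
  unfolding that norm_Orlicz_eq_orl by (rule function_norm_orl[OF assms(1) gauge_lines_complementary[OF \<Phi>]])
qed

section \<open>Dirichlet integrals\<close>

lemma Beta_real_pos: "0 < a ==> 0 < b ==> 0 < Beta a (b::real)"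
 unfolding Beta_def by (intro divide_pos_pos mult_pos_pos Gamma_real_pos) auto

lemma nn_integral_Beta_scaled:
 fixes a b c :: real assumes a: "a > -1" and b: "b > -1" and c: "0 <= c"
 shows "(\<integral>\<^sup>+y. ennreal (indicator {0..c} y * (y powr a * (c - y) powr b)) \<partial>lborel) =
  ennreal (c powr (a + b + 1) * Beta (a + 1) (b + 1))"
proof (cases "c = 0")
 case True
 have "(\<integral>\<^sup>+y. ennreal (indicator {0..c} y * (y powr a * (c - y) powr b)) \<partial>lborel) = (\<integral>\<^sup>+(y::real). 0 \<partial>lborel)"
  by (intro nn_integral_cong) (auto simp: True indicator_def)
 then show ?thesis using True by simp
next
 case False
 then have c: "0 < c" using c by simp
 have "((%t. t powr a * (1 - t) powr b) has_integral Beta (a + 1) (b + 1)) {0..1}"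
  using has_integral_Beta_real[of "a+1" "b+1"] a b by simp
 from nn_integral_has_integral_lebesgue[OF _ this]
 have 1: "(\<integral>\<^sup>+t. ennreal (indicator {0..1} t * (t powr a * (1 - t) powr b)) \<partial>lborel) = ennreal (Beta (a + 1) (b + 1))"
  by simp
 have "(\<integral>\<^sup>+y. ennreal (indicator {0..c} y * (y powr a * (c - y) powr b)) \<partial>lborel) =
  ennreal \<bar>c\<bar> * (\<integral>\<^sup>+t. ennreal (indicator {0..c} (0 + c * t) * ((0 + c * t) powr a * (c - (0 + c * t)) powr b)) \<partial>lborel)"
  using c by (intro nn_integral_real_affine) auto
 also have "... = ennreal c * (\<integral>\<^sup>+t. ennreal (c powr (a + b)) * ennreal (indicator {0..1} t * (t powr a * (1 - t) powr b)) \<partial>lborel)"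
 proof -
  have "indicator {0..c} (0 + c * t) * ((0 + c * t) powr a * (c - (0 + c * t)) powr b) =
   c powr (a + b) * (indicator {0..1} t * (t powr a * (1 - t) powr b))" for t
  proof (cases "t \<in> {0..1}")
   case True
   have "c - c * t = c * (1 - t)" by (simp add: algebra_simps)
   then show ?thesis using True c by (simp add: powr_mult powr_add mult_left_le)
  next
   case False
   then show ?thesis using c by (auto simp: indicator_def zero_le_mult_iff)
  qed
  then show ?thesis using c by (simp add: ennreal_mult)
 qed
 also have "... = ennreal c * (ennreal (c powr (a + b)) * ennreal (Beta (a + 1) (b + 1)))"
  by (subst nn_integral_cmult) (auto simp: 1)
 also have "... = ennreal (c powr (a + b + 1) * Beta (a + 1) (b + 1))"
 proof -
  have "0 <= Beta (a + 1) (b + 1)" by (intro less_imp_le Beta_real_pos) (use a b in auto)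
  then show ?thesis using c by (simp add: powr_add mult_ac flip: ennreal_mult)
 qed
 finally show ?thesis .
qed

text \<open>Induction on \<open>I\<close>: the innermost integral is a scaled Beta integral and raises the exponent of the
remaining slack \<open>c - sum x I\<close>.\<close>

lemma Dirichlet_integral_PiM:
 fixes a :: "'a => real" and b c :: real
 assumes "finite I" "!!i. i \<in> I ==> a i > -1" and b: "b > -1" and "0 <= c"
 shows "(\<integral>\<^sup>+x. ennreal (of_bool ((\<forall>i\<in>I. 0 <= x i) \<and> sum x I <= c) * ((\<Prod>i\<in>I. x i powr a i) * (c - sum x I) powr b)) \<partial>Pi\<^sub>M I (%_. lborel))
   = ennreal (c powr ((\<Sum>i\<in>I. a i + 1) + b) * ((\<Prod>i\<in>I. Gamma (a i + 1)) * Gamma (b + 1) / Gamma ((\<Sum>i\<in>I. a i + 1) + b + 1)))"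
 using assms(1,2,4)
proof (induction arbitrary: c rule: finite_induct)
 case (empty c)
 have "Gamma (b + 1) ~= 0" by (rule less_imp_neq[OF Gamma_real_pos, symmetric]) (use b in simp)
 then show ?case using empty by (simp add: PiM_empty nn_integral_count_space_finite)
next
 case (insert j I c)
 interpret product_sigma_finite "%_. lborel :: real measure" by standard
 define s where "s = (\<Sum>i\<in>I. a i + 1) + b"
 define K where "K = (\<Prod>i\<in>I. Gamma (a i + 1)) * Gamma (b + 1) / Gamma (s + 1)"
 have "0 <= (\<Sum>i\<in>I. a i + 1)" using insert.prems by (intro sum_nonneg) (force simp: less_imp_le)
 then have s: "s > -1" using b by (simp add: s_def)
 have "a i + 1 > 0" if "i \<in> I" for i using insert.prems(1)[of i] that by simp
 then have K: "0 <= K" unfolding K_def using b s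
  by (intro divide_nonneg_nonneg mult_nonneg_nonneg prod_nonneg ballI less_imp_le[OF Gamma_real_pos]) auto
 let ?f = "%I c x. ennreal (of_bool ((\<forall>i\<in>I. 0 <= x i) \<and> sum x I <= c) * ((\<Prod>i\<in>I. x i powr a i) * (c - sum x I) powr b))"
 have meas: "?f J c \<in> borel_measurable (Pi\<^sub>M J (%_. lborel))" if [simp]: "finite J" for J c
  by measurable
 have "(\<integral>\<^sup>+x. ?f (insert j I) c x \<partial>Pi\<^sub>M (insert j I) (%_. lborel)) =
   (\<integral>\<^sup>+y. (\<integral>\<^sup>+x. ?f (insert j I) c (x(j := y)) \<partial>Pi\<^sub>M I (%_. lborel)) \<partial>lborel)"
  using insert.hyps by (intro product_nn_integral_insert_rev meas) auto
 also have "... = (\<integral>\<^sup>+y. ennreal (indicator {0..c} y * y powr a j) * (\<integral>\<^sup>+x. ?f I (c - y) x \<partial>Pi\<^sub>M I (%_. lborel)) \<partial>lborel)"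
 proof (intro nn_integral_cong)
  fix y :: real
  have "?f (insert j I) c (x(j := y)) = ennreal (indicator {0..c} y * y powr a j) * ?f I (c - y) x" for x
  proof -
   have e1: "(\<forall>i\<in>insert j I. 0 <= (x(j := y)) i) \<longleftrightarrow> 0 <= y \<and> (\<forall>i\<in>I. 0 <= x i)"
    using insert.hyps by auto
   have e2: "sum (x(j := y)) (insert j I) = y + sum x I"
    using insert.hyps by (simp add: sum.insert) (intro sum.cong, auto)
   have e3: "(\<Prod>i\<in>insert j I. (x(j := y)) i powr a i) = y powr a j * (\<Prod>i\<in>I. x i powr a i)"
    using insert.hyps by (simp add: prod.insert) (intro disjI2 prod.cong, auto)
   have p: "(\<forall>i\<in>I. 0 <= x i) ==> 0 <= sum x I" by (simp add: sum_nonneg)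
   have "of_bool ((0 <= y \<and> (\<forall>i\<in>I. 0 <= x i)) \<and> y + sum x I <= c) =
    indicator {0..c} y * (of_bool ((\<forall>i\<in>I. 0 <= x i) \<and> sum x I <= c - y) :: real)"
    using p by (auto simp: indicator_def)
   then show ?thesis
    unfolding e1 e2 e3 by (simp add: mult_ac diff_diff_eq flip: ennreal_mult')
  qed
  then have "(\<integral>\<^sup>+x. ?f (insert j I) c (x(j := y)) \<partial>Pi\<^sub>M I (%_. lborel)) =
   (\<integral>\<^sup>+x. ennreal (indicator {0..c} y * y powr a j) * ?f I (c - y) x \<partial>Pi\<^sub>M I (%_. lborel))" by simp
  also have "... = ennreal (indicator {0..c} y * y powr a j) * (\<integral>\<^sup>+x. ?f I (c - y) x \<partial>Pi\<^sub>M I (%_. lborel))"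
   by (rule nn_integral_cmult[OF meas[OF insert.hyps(1)]])
  finally show "(\<integral>\<^sup>+x. ?f (insert j I) c (x(j := y)) \<partial>Pi\<^sub>M I (%_. lborel)) = ..." .
 qed
 also have "... = (\<integral>\<^sup>+y. ennreal K * ennreal (indicator {0..c} y * (y powr a j * (c - y) powr s)) \<partial>lborel)"
 proof (intro nn_integral_cong)
  fix y :: real
  show "ennreal (indicator {0..c} y * y powr a j) * (\<integral>\<^sup>+x. ?f I (c - y) x \<partial>Pi\<^sub>M I (%_. lborel)) =
   ennreal K * ennreal (indicator {0..c} y * (y powr a j * (c - y) powr s))"
  proof (cases "y \<in> {0..c}")
   case True
   then have "(\<integral>\<^sup>+x. ?f I (c - y) x \<partial>Pi\<^sub>M I (%_. lborel)) = ennreal ((c - y) powr s * K)"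
    unfolding s_def K_def using insert.prems by (intro insert.IH) auto
   then show ?thesis using K True by (simp add: mult_ac flip: ennreal_mult)
  qed simp
 qed
 also have "... = ennreal K * ennreal (c powr (a j + s + 1) * Beta (a j + 1) (s + 1))"
  using insert.prems s by (simp add: nn_integral_cmult nn_integral_Beta_scaled)
 also have "... = ennreal (c powr (a j + 1 + s) * (Gamma (a j + 1) * ((\<Prod>i\<in>I. Gamma (a i + 1)) * Gamma (b + 1)) / Gamma (a j + 1 + s + 1)))"
 proof -
  have "Gamma (s + 1) ~= 0" by (rule less_imp_neq[OF Gamma_real_pos, symmetric]) (use s in simp)
  moreover have "0 <= Beta (a j + 1) (s + 1)"
   by (intro less_imp_le Beta_real_pos) (use insert.prems(1)[of j] s in auto)
  ultimately have "ennreal K * ennreal (c powr (a j + s + 1) * Beta (a j + 1) (s + 1)) =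
    ennreal (K * (c powr (a j + s + 1) * Beta (a j + 1) (s + 1)))"
   using K by (intro ennreal_mult[symmetric]) auto
  then show ?thesis using \<open>Gamma (s + 1) ~= 0\<close> by (simp add: K_def Beta_def field_simps)
 qed
 finally show ?case using insert.hyps by (simp add: s_def add_ac mult_ac)
qed

subsection \<open>Moments of the Jacobi weight\<close>

text \<open>The monomials in the barycentric coordinates. They treat all vertices of the simplex alike, unlike the
monomials in \<open>x $ i\<close>.\<close>

definition hmon :: "('d::finite option => nat) => real^'d => real" where
 "hmon b x = (\<Prod>i\<in>UNIV. coord x i ^ b i)"

text \<open>The Dirichlet integral of \<open>hmon b\<close> against the Jacobi weight.\<close>

definition moment :: "('d::finite option => real) => ('d option => nat) => real" where
 "moment \<alpha> b = (\<Prod>i\<in>UNIV. Gamma (b i + \<alpha> i + 1)) / Gamma (\<Sum>i\<in>UNIV. b i + \<alpha> i + 1)"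

lemma UNIV_option: "(UNIV :: 'd option set) = insert None (range Some)"
 by (rule UNIV_option_conv)

lemma prod_UNIV_option: "(\<Prod>i\<in>UNIV. f i) = f None * (\<Prod>i\<in>(UNIV::'d::finite set). (f (Some i) :: 'a :: comm_monoid_mult))"
 unfolding UNIV_option by (subst prod.insert) (auto simp: prod.reindex)

lemma sum_UNIV_option: "(\<Sum>i\<in>UNIV. f i) = f None + (\<Sum>i\<in>(UNIV::'d::finite set). (f (Some i) :: 'a :: comm_monoid_add))"
 unfolding UNIV_option by (subst sum.insert) (auto simp: sum.reindex)

lemma all_option: "(\<forall>i. P i) \<longleftrightarrow> P None \<and> (\<forall>i. P (Some i))"
 by (metis option.exhaust)

lemma sum_coord [simp]: "(\<Sum>i\<in>UNIV. coord x i) = 1"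
 by (simp add: sum_UNIV_option)

lemma coord_continuous [continuous_intros]: "continuous_on A (%x. coord x i)"
 by (cases i) (auto intro!: continuous_intros)

lemma coord_measurable [measurable]: "(%x. coord x i) \<in> borel_measurable borel"
 by (rule borel_measurable_continuous_onI[OF coord_continuous])

lemma hmon_continuous [continuous_intros]: "continuous_on A (hmon b)"
 unfolding hmon_def by (intro continuous_intros)

lemma hmon_measurable [measurable]: "hmon b \<in> borel_measurable borel"
 by (rule borel_measurable_continuous_onI[OF hmon_continuous])

lemma simplex_S_closed: "closed simplex_S"
proof -
 have *: "simplex_S = (\<Inter>i. {x. 0 <= coord x i})" by (auto simp: simplex_S_def)
 show ?thesis unfolding * by (intro closed_INT ballI closed_Collect_le continuous_intros)
qed

lemma simplex_S_sets [measurable]: "simplex_S \<in> sets borel"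
 by (rule borel_closed[OF simplex_S_closed])

lemma sets_jacobi [simp, measurable_cong]: "sets (jacobi_measure \<alpha>) = sets borel"
 by (simp add: jacobi_measure_def)

lemma space_jacobi [simp]: "space (jacobi_measure \<alpha>) = UNIV"
 by (simp add: jacobi_measure_def)

lemma jacobi_weight_measurable [measurable]: "jacobi_weight \<alpha> \<in> borel_measurable borel"
 unfolding jacobi_weight_def by measurable

lemma jacobi_weight_nonneg: "0 <= jacobi_weight \<alpha> x"
 unfolding jacobi_weight_def by (intro prod_nonneg) auto

lemma AE_jacobi: "AE x in jacobi_measure \<alpha>. x \<in> simplex_S"
 unfolding jacobi_measure_def by (subst AE_density) (auto simp: indicator_def)

lemma nn_integral_hmon:
 fixes \<alpha> :: "'d::finite option => real"
 assumes \<alpha>: "!!i. \<alpha> i > -1"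
 shows "(\<integral>\<^sup>+x. ennreal (hmon \<beta> x) \<partial>jacobi_measure \<alpha>) = ennreal (moment \<alpha> \<beta>)"
proof -
 define B where "B = (Basis :: (real^'d) set)"
 define idx where "idx = inv_into UNIV (%i::'d. axis i (1::real))"
 define a where "a i = real (\<beta> i) + \<alpha> i" for i
 have a: "a i > -1" for i using \<alpha>[of i] by (simp add: a_def)
 have inj: "inj (%i::'d. axis i (1::real))" by (auto simp: inj_on_def axis_eq_axis)
 have B: "B = range (%i::'d. axis i (1::real))" by (auto simp: B_def Basis_vec_def)
 have idx: "idx (axis i 1) = i" for i unfolding idx_def by (rule inv_into_f_f[OF inj]) simp
 have w: "(\<Prod>i\<in>UNIV. coord x i powr a i) = jacobi_weight \<alpha> x * hmon \<beta> x" if "x \<in> simplex_S" for x :: "real^'d"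
 proof -
  have "y powr (real n + r) = y powr r * y ^ n" if "0 <= y" for y r :: real and n
   using that by (cases "y = 0"; cases "n = 0") (auto simp: powr_add powr_realpow)
  then show ?thesis using that
   by (simp add: jacobi_weight_def hmon_def prod.distrib[symmetric] a_def simplex_S_def)
 qed
 define g where "g x = ennreal (of_bool ((\<forall>i\<in>B. 0 <= x i) \<and> sum x B <= 1) *
   ((\<Prod>i\<in>B. x i powr a (Some (idx i))) * (1 - sum x B) powr a None))" for x :: "real^'d => real"
 have "(\<integral>\<^sup>+x. ennreal (hmon \<beta> x) \<partial>jacobi_measure \<alpha>) =
   (\<integral>\<^sup>+x. ennreal (indicator simplex_S x * jacobi_weight \<alpha> x) * ennreal (hmon \<beta> x) \<partial>lborel)"
  unfolding jacobi_measure_def by (rule nn_integral_density) auto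
 also have "... = (\<integral>\<^sup>+x. ennreal (indicator simplex_S x * (\<Prod>i\<in>UNIV. coord x i powr a i)) \<partial>lborel)"
  by (intro nn_integral_cong) (auto simp: indicator_def w ennreal_mult' jacobi_weight_nonneg)
 also have "... = (\<integral>\<^sup>+x. ennreal (indicator simplex_S x * (\<Prod>i\<in>UNIV. coord x i powr a i))
   \<partial>distr (Pi\<^sub>M B (%_. lborel)) borel (%f. \<Sum>b\<in>B. f b *\<^sub>R b))"
  unfolding B_def by (subst lborel_eq) simp
 also have "... = (\<integral>\<^sup>+f. ennreal (indicator simplex_S (\<Sum>b\<in>B. f b *\<^sub>R b) * (\<Prod>i\<in>UNIV. coord (\<Sum>b\<in>B. f b *\<^sub>R b) i powr a i)) \<partial>Pi\<^sub>M B (%_. lborel))"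
  by (rule nn_integral_distr) (auto simp: B_def)
 also have "... = (\<integral>\<^sup>+f. g f \<partial>Pi\<^sub>M B (%_. lborel))"
 proof (intro nn_integral_cong)
  fix f :: "real^'d => real"
  let ?x = "\<Sum>b\<in>B. f b *\<^sub>R b"
  have c: "coord ?x (Some i) = f (axis i 1)" for i
  proof -
   have "coord ?x (Some i) = ?x \<bullet> axis i 1" by (simp add: inner_axis)
   also have "... = f (axis i 1)"
    unfolding B_def by (rule inner_sum_left_Basis) auto
   finally show ?thesis .
  qed
  have s: "sum h B = (\<Sum>i\<in>UNIV. h (axis i 1))" for h :: "real^'d => real"
   unfolding B by (subst sum.reindex[OF inj]) simp
  have p: "prod h B = (\<Prod>i\<in>UNIV. h (axis i 1))" for h :: "real^'d => real"
   unfolding B by (subst prod.reindex[OF inj]) simp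
  have c0: "coord ?x None = 1 - sum f B"
   using c by (simp add: s)
  have "?x \<in> simplex_S \<longleftrightarrow> (\<forall>i\<in>B. 0 <= f i) \<and> sum f B <= 1"
   unfolding simplex_S_def mem_Collect_eq all_option c c0 by (auto simp: B simp del: coord.simps)
  then show "ennreal (indicator simplex_S ?x * (\<Prod>i\<in>UNIV. coord ?x i powr a i)) = g f"
   unfolding g_def prod_UNIV_option c c0 p idx by (simp add: indicator_def mult_ac)
 qed
 also have "... = ennreal (1 powr ((\<Sum>i\<in>B. a (Some (idx i)) + 1) + a None) *
   ((\<Prod>i\<in>B. Gamma (a (Some (idx i)) + 1)) * Gamma (a None + 1) / Gamma ((\<Sum>i\<in>B. a (Some (idx i)) + 1) + a None + 1)))"
  unfolding g_def by (rule Dirichlet_integral_PiM) (auto simp: a B_def)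
 also have "... = ennreal (moment \<alpha> \<beta>)"
  unfolding B sum.reindex[OF inj] prod.reindex[OF inj]
  by (simp add: moment_def prod_UNIV_option sum_UNIV_option idx a_def add_ac mult_ac)
 finally show ?thesis .
qed

section \<open>Polynomials on the simplex\<close>

definition xmon :: "('d::finite => nat) => real^'d => real" where
 "xmon m x = (\<Prod>i\<in>UNIV. (x $ i) ^ m i)"

lemma Poly_deg_alt: "Poly_deg k = {p. \<exists>c. p = (%x. \<Sum>m | (\<Sum>i\<in>UNIV. m i) <= k. c m * xmon m x)}"
 by (simp add: Poly_deg_def xmon_def)

lemma finite_degree_le: "finite {m :: 'a::finite => nat. (\<Sum>i\<in>UNIV. m i) <= k}"
proof (rule finite_subset)
 show "{m :: 'a => nat. (\<Sum>i\<in>UNIV. m i) <= k} \<subseteq> (UNIV \<rightarrow>\<^sub>E {..k})"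
 proof
  fix m :: "'a => nat" assume "m \<in> {m. (\<Sum>i\<in>UNIV. m i) <= k}"
  then have "m i <= k" for i using member_le_sum[of i UNIV m] by simp
  then show "m \<in> UNIV \<rightarrow>\<^sub>E {..k}" by auto
 qed
qed (auto intro: finite_PiE)

lemma finite_degree_eq: "finite {m :: 'a::finite => nat. (\<Sum>i\<in>UNIV. m i) = k}"
 by (rule finite_subset[OF _ finite_degree_le[of k]]) auto

lemma Poly_deg_add: "p \<in> Poly_deg k ==> q \<in> Poly_deg k ==> (%x. p x + q x) \<in> Poly_deg k"
proof -
 assume "p \<in> Poly_deg k" "q \<in> Poly_deg k"
 then obtain c d where "p = (%x. \<Sum>m | (\<Sum>i\<in>UNIV. m i) <= k. c m * xmon m x)"
  "q = (%x. \<Sum>m | (\<Sum>i\<in>UNIV. m i) <= k. d m * xmon m x)" by (auto simp: Poly_deg_alt)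
 then show ?thesis unfolding Poly_deg_alt
  by (intro CollectI exI[of _ "%m. c m + d m"]) (simp add: sum.distrib algebra_simps)
qed

lemma Poly_deg_scale: "p \<in> Poly_deg k ==> (%x. a * p x) \<in> Poly_deg k"
proof -
 assume "p \<in> Poly_deg k"
 then obtain c where "p = (%x. \<Sum>m | (\<Sum>i\<in>UNIV. m i) <= k. c m * xmon m x)"
  by (auto simp: Poly_deg_alt)
 then show ?thesis unfolding Poly_deg_alt
  by (intro CollectI exI[of _ "%m. a * c m"]) (simp add: sum_distrib_left mult.assoc)
qed

lemma Poly_deg_zero: "(%x. 0) \<in> Poly_deg k"
 unfolding Poly_deg_alt by (intro CollectI exI[of _ "%m. 0"]) simp

lemma Poly_deg_xmon: "(\<Sum>i\<in>UNIV. m i) <= k ==> xmon m \<in> Poly_deg k"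
proof -
 assume "(\<Sum>i\<in>UNIV. m i) <= k"
 then have "(\<Sum>m' | (\<Sum>i\<in>UNIV. m' i) <= k. of_bool (m' = m) * xmon m' x) = xmon m x" for x
  by (subst sum.remove[of _ m]) (auto simp: finite_degree_le intro!: sum.neutral)
 then show ?thesis unfolding Poly_deg_alt by (auto intro!: exI[of _ "%m'. of_bool (m' = m)"])
qed

lemma Poly_deg_diff: "p \<in> Poly_deg k ==> q \<in> Poly_deg k ==> (%x. p x - q x) \<in> Poly_deg k"
 using Poly_deg_add[OF _ Poly_deg_scale[of q k "-1"], of p] by simp

lemma Poly_deg_sum: "(!!i. i \<in> A ==> p i \<in> Poly_deg k) ==> (%x. \<Sum>i\<in>A. p i x) \<in> Poly_deg k"
proof (induction A rule: infinite_finite_induct)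
 case (insert x F)
 then show ?case using Poly_deg_add[of "p x" k "%y. \<Sum>i\<in>F. p i y"] by simp
qed (simp_all add: Poly_deg_zero)

lemma Poly_deg_induct [consumes 1, case_names mon zero add scale]:
 assumes "p \<in> Poly_deg k" and "!!m. (\<Sum>i\<in>UNIV. m i) <= k ==> Q (xmon m)" and "Q (%x. 0)"
  and "!!p q. Q p ==> Q q ==> Q (%x. p x + q x)" and "!!p a. Q p ==> Q (%x. a * p x)"
 shows "Q p"
proof -
 obtain c where p: "p = (%x. \<Sum>m | (\<Sum>i\<in>UNIV. m i) <= k. c m * xmon m x)"
  using assms(1) by (auto simp: Poly_deg_alt)
 have "Q (%x. \<Sum>m\<in>A. c m * xmon m x)" if "finite A" "A \<subseteq> {m. (\<Sum>i\<in>UNIV. m i) <= k}" for A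
  using that
 proof (induction A rule: finite_induct)
  case (insert m A)
  then have "Q (%x. c m * xmon m x)" by (intro assms(5)[of "xmon m"] assms(2)) auto
  with insert show ?case using assms(4)[of "%x. c m * xmon m x"] by simp
 qed (simp add: assms(3))
 from this[OF finite_degree_le subset_refl] show ?thesis by (simp add: p)
qed

lemma Poly_deg_mono: "p \<in> Poly_deg k ==> k <= l ==> p \<in> Poly_deg l"
proof (induction rule: Poly_deg_induct)
 case (mon m) then show ?case by (intro Poly_deg_xmon) simp
qed (simp_all add: Poly_deg_zero Poly_deg_add Poly_deg_scale)

lemma xmon_mult: "xmon m x * xmon m' x = xmon (%i. m i + m' i) x"
 by (simp add: xmon_def prod.distrib power_add)

lemma Poly_deg_mult:
 assumes "p \<in> Poly_deg k" "q \<in> Poly_deg l" shows "(%x. p x * q x) \<in> Poly_deg (k + l)"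
 using assms(1)
proof (induction rule: Poly_deg_induct)
 case (mon m)
 show ?case using assms(2)
 proof (induction rule: Poly_deg_induct)
  case (mon m')
  then have "xmon (%i. m i + m' i) \<in> Poly_deg (k + l)"
   using \<open>sum m UNIV <= k\<close> by (intro Poly_deg_xmon) (simp add: sum.distrib)
  then show ?case by (simp add: xmon_mult)
 next
  case zero then show ?case by (simp add: Poly_deg_zero)
 next
  case (add p q) from Poly_deg_add[OF this] show ?case by (simp add: distrib_left)
 next
  case (scale p a) from Poly_deg_scale[OF this, of a] show ?case by (simp add: mult.left_commute)
 qed
next
 case zero then show ?case by (simp add: Poly_deg_zero)
next
 case (add p q) from Poly_deg_add[OF this] show ?case by (simp add: distrib_right)
next
 case (scale p a) from Poly_deg_scale[OF this, of a] show ?case by (simp add: mult.assoc)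
qed

lemma xmon_0: "xmon (%_. 0) = (%x. 1)"
 by (simp add: xmon_def fun_eq_iff)

lemma Poly_deg_const: "(%x. c) \<in> Poly_deg k"
 using Poly_deg_scale[OF Poly_deg_xmon[of "%_. 0" k], of c] by (simp add: xmon_0)

lemma Poly_deg_nth: "(%x. x $ i) \<in> Poly_deg 1"
proof -
 have "xmon (%j. if j = i then 1 else 0) x = x $ i" for x :: "real^'a"
 proof -
  have "(\<Prod>j\<in>UNIV. (x $ j) ^ (if j = i then 1 else 0)) = (\<Prod>j\<in>UNIV. if j = i then x $ j else 1)"
   by (intro prod.cong) auto
  then show ?thesis by (simp add: xmon_def)
 qed
 then have "(%x. x $ i) = xmon (%j. if j = i then 1 else 0)" by auto
 then show ?thesis using Poly_deg_xmon[of "%j. if j = i then 1 else 0" 1] by simp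
qed

lemma Poly_deg_coord: "(%x. coord x i) \<in> Poly_deg 1"
proof (cases i)
 case None
 then show ?thesis using Poly_deg_diff[OF Poly_deg_const[of 1] Poly_deg_sum[of UNIV "%i x. x $ i", OF Poly_deg_nth]]
  by simp
qed (simp add: Poly_deg_nth[simplified])

lemma Poly_deg_power: "p \<in> Poly_deg k ==> (%x. p x ^ n) \<in> Poly_deg (k * n)"
proof (induction n)
 case (Suc n)
 then show ?case using Poly_deg_mult[of p k "%x. p x ^ n" "k * n"] by simp
qed (simp add: Poly_deg_const)

lemma Poly_deg_prod:
 "finite A ==> (!!i. i \<in> A ==> p i \<in> Poly_deg (k i)) ==> (%x. \<Prod>i\<in>A. p i x) \<in> Poly_deg (\<Sum>i\<in>A. k i)"
proof (induction A rule: finite_induct)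
 case (insert i A)
 then show ?case using Poly_deg_mult[of "p i" "k i" "%x. \<Prod>i\<in>A. p i x"] by simp
qed (simp add: Poly_deg_const)

lemma Poly_deg_hmon: "hmon b \<in> Poly_deg (\<Sum>i\<in>UNIV. b i)"
proof -
 have "(%x. coord x i ^ n) \<in> Poly_deg n" for i n
  using Poly_deg_power[OF Poly_deg_coord, of i n] by (simp del: coord.simps)
 then show ?thesis unfolding hmon_def[abs_def] by (intro Poly_deg_prod) simp_all
qed

lemma xmon_eq_hmon: "xmon m = hmon (case_option 0 m)"
 by (simp add: fun_eq_iff xmon_def hmon_def prod_UNIV_option)

lemma Poly_deg_continuous: "p \<in> Poly_deg k ==> continuous_on A p"
proof (induction rule: Poly_deg_induct)
 case (mon m) show ?case unfolding xmon_eq_hmon by (rule hmon_continuous)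
next
 case (add p q) then show ?case by (rule continuous_on_add)
next
 case (scale p a) then show ?case by (intro continuous_on_mult continuous_on_const)
qed simp

lemma Poly_deg_measurable: "p \<in> Poly_deg k ==> p \<in> borel_measurable borel"
 by (rule borel_measurable_continuous_onI[OF Poly_deg_continuous])

subsection \<open>A polynomial vanishing on an open set is zero\<close>

lemma Poly_deg_on_line:
 assumes "p \<in> Poly_deg k" shows "\<exists>q :: real poly. \<forall>t. p (x + t *\<^sub>R v) = poly q t"
 using assms
proof (induction rule: Poly_deg_induct)
 case (mon m)
 show ?case
  by (intro exI[of _ "\<Prod>i\<in>UNIV. [:x $ i, v $ i:] ^ m i"]) (simp add: xmon_def poly_prod mult.commute)
next
 case zero show ?case by (intro exI[of _ 0]) simp
next
 case (add p q) then show ?case by (metis poly_add)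
next
 case (scale p a) then show ?case by (metis poly_smult)
qed

text \<open>A polynomial vanishing near \<open>x\<close> vanishes on every line through \<open>x\<close>, because a
univariate polynomial has finitely many zeros.\<close>

lemma Poly_deg_zero_on_open:
 assumes p: "p \<in> Poly_deg k" and U: "open U" "U ~= {}" and z: "!!x. x \<in> U ==> p x = 0"
 shows "p y = 0"
proof -
 obtain x where x: "x \<in> U" using U by auto
 obtain q :: "real poly" where q: "p (x + t *\<^sub>R (y - x)) = poly q t" for t
  using Poly_deg_on_line[OF p, of x "y - x"] by auto
 have "open ((%t. x + t *\<^sub>R (y - x)) -` U)"
  by (intro open_vimage U continuous_intros)
 moreover have "0 \<in> (%t. x + t *\<^sub>R (y - x)) -` U" using x by simp
 ultimately have "infinite ((%t::real. x + t *\<^sub>R (y - x)) -` U)"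
  by (metis empty_iff finite_imp_not_open)
 moreover have "(%t. x + t *\<^sub>R (y - x)) -` U \<subseteq> {t. poly q t = 0}" using z q by (auto simp flip: q)
 ultimately have "q = 0" using poly_roots_finite[of q] infinite_super by blast
 then show ?thesis using q[of 1] by simp
qed

section \<open>The edges of the simplex\<close>

definition vert :: "'d::finite option => real^'d" where
 "vert k = (case k of None => 0 | Some i => axis i 1)"

lemma coord_vert: "coord (vert k) l = (if k = l then 1 else 0)"
proof (cases l)
 case None
 show ?thesis
 proof (cases k)
  case (Some i)
  have "(\<Sum>j\<in>UNIV. axis i (1::real) $ j) = (\<Sum>j\<in>UNIV. if j = i then 1 else 0)"
   by (intro sum.cong) (auto simp: axis_def)
  then show ?thesis using None Some by (simp add: vert_def)
 qed (use None in \<open>simp add: vert_def\<close>)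
qed (auto simp: vert_def axis_def split: option.splits)

lemma coord_add_diff: "coord (x + t *\<^sub>R (y - z)) l = coord x l + t * (coord y l - coord z l)"
proof (cases l)
 case None
 then show ?thesis
  by (simp add: sum.distrib sum_subtractf right_diff_distrib flip: sum_distrib_left)
qed simp

lemma inj_vert: "inj vert"
 by (rule injI) (metis coord_vert zero_neq_one)

lemma vert_expansion: "(\<Sum>k\<in>UNIV. coord x k *\<^sub>R vert k) = x"
proof -
 have "(\<Sum>i\<in>UNIV. x $ i *\<^sub>R axis i 1) = x"
  using basis_expansion[of x] by (simp add: scalar_mult_eq_scaleR)
 then show ?thesis by (simp add: sum_UNIV_option vert_def)
qed

lemma simplex_S_hull: "(simplex_S :: (real^'a::finite) set) = convex hull (range vert)"
proof (rule antisym)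
 show "(simplex_S :: (real^'a) set) \<subseteq> convex hull (range vert)"
 proof
  fix x :: "real^'a" assume "x \<in> simplex_S"
  then have "(\<Sum>k\<in>UNIV. coord x k *\<^sub>R vert k) \<in> convex hull (range vert)"
   by (intro convex_sum) (auto simp: simplex_S_def intro: hull_inc simp del: coord.simps)
  then show "x \<in> convex hull (range vert)" by (simp only: vert_expansion)
 qed
 have "convex (simplex_S :: (real^'a) set)"
 proof (rule convexI)
  fix x y :: "real^'a" and u v :: real
  assume *: "x \<in> simplex_S" "y \<in> simplex_S" "0 <= u" "0 <= v" "u + v = 1"
  have u: "u = 1 - v" using * by simp
  have e: "u *\<^sub>R x + v *\<^sub>R y = x + v *\<^sub>R (y - x)"
   unfolding u by (simp add: algebra_simps)
  have "coord (u *\<^sub>R x + v *\<^sub>R y) l = u * coord x l + v * coord y l" for l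
   unfolding e coord_add_diff by (simp add: u algebra_simps del: coord.simps)
  then show "u *\<^sub>R x + v *\<^sub>R y \<in> simplex_S" using * by (simp add: simplex_S_def)
 qed
 then show "convex hull (range vert) \<subseteq> (simplex_S :: (real^'a) set)"
  by (intro hull_minimal) (auto simp: simplex_S_def coord_vert)
qed

lemma affine_independent_vert: "\<not> affine_dependent (range (vert :: 'd::finite option => _))"
proof
 assume "affine_dependent (range (vert :: 'd option => _))"
 then obtain U where U: "sum U (range (vert :: 'd option => _)) = 0" "\<exists>v\<in>range vert. U v ~= 0"
  "(\<Sum>v\<in>range (vert :: 'd option => _). U v *\<^sub>R v) = 0"
  by (subst (asm) affine_dependent_explicit_finite) auto
 have s: "(\<Sum>k\<in>UNIV. U (vert k :: real^'d)) = 0" "(\<Sum>k\<in>UNIV. U (vert k :: real^'d) *\<^sub>R vert k) = 0"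
  using U by (simp_all add: sum.reindex[OF inj_vert])
 have "U (vert (Some i)) = 0" for i :: 'd
 proof -
  have "(\<Sum>k\<in>UNIV. U (vert k :: real^'d) *\<^sub>R vert k) $ i = 0" using s by simp
  then have "(\<Sum>k\<in>UNIV. U (vert k) * coord (vert k) (Some i)) = 0" by simp
  then show ?thesis by (simp only: coord_vert) (simp add: if_distrib cong: if_cong)
 qed
 moreover from this have "U (vert (None :: 'd option)) = 0" using s by (simp add: sum_UNIV_option)
 ultimately have "U (vert k) = 0" for k :: "'d option" by (cases k) auto
 then show False using U by auto
qed

text \<open>The vertices are affinely independent, so the faces of the hull are the hulls of their subsets and the edges
join two vertices.\<close>

lemma edges_simplex_S:
 "{e. e edge_of simplex_S} = {convex hull {vert i, vert j :: real^'d::finite} | i j. i ~= j}"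
proof (rule antisym; safe)
 fix e :: "(real^'d) set" assume e: "e edge_of simplex_S"
 then obtain c where c: "c \<subseteq> range vert" "e = convex hull c"
  unfolding edge_of_def simplex_S_hull face_of_convex_hull_affine_independent[OF affine_independent_vert] by auto
 then have "\<not> affine_dependent c" using affine_dependent_subset affine_independent_vert by metis
 then have "int (card c) = 2"
  using e c by (simp add: edge_of_def aff_dim_convex_hull aff_dim_affine_independent)
 then obtain v w where "c = {v, w}" "v ~= w" by (metis card_2_iff of_nat_eq_iff of_nat_numeral)
 then show "\<exists>i j. e = convex hull {vert i, vert j} \<and> i ~= j" using c by auto
next
 fix i j :: "'d option" assume ij: "i ~= j"
 have sub: "{vert i, vert j} \<subseteq> range (vert :: 'd option => real^'d)" by auto
 have "\<not> affine_dependent {vert i, vert j :: real^'d}" using affine_dependent_subset affine_independent_vert sub by metis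
 moreover have "vert i ~= (vert j :: real^'d)" using ij inj_vert by (auto simp: inj_on_def)
 ultimately have "aff_dim {vert i, vert j :: real^'d} = 1"
  using aff_dim_affine_independent[of "{vert i, vert j :: real^'d}"] by simp
 then show "convex hull {vert i, vert j} edge_of (simplex_S :: (real^'d) set)"
  unfolding edge_of_def simplex_S_hull face_of_convex_hull_affine_independent[OF affine_independent_vert]
  using sub by (intro conjI exI[of _ "{vert i, vert j}"]) (auto simp: aff_dim_convex_hull)
qed

definition edge_vec :: "'d::finite option => 'd option => real^'d" where
 "edge_vec i j = edge_direction (convex hull {vert i, vert j})"

lemma edge_vec_form:
 assumes "i ~= (j :: 'd::finite option)"
 shows "\<exists>\<kappa>. \<kappa> ~= 0 \<and> edge_vec i j = \<kappa> *\<^sub>R (vert i - vert j) \<and> norm (edge_vec i j) = 1"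
proof -
 let ?e = "convex hull {vert i, vert j :: real^'d}"
 have v: "vert i ~= (vert j :: real^'d)" using assms inj_vert by (auto simp: inj_on_def)
 have "\<exists>\<xi>. \<exists>a\<in>?e. \<exists>b\<in>?e. a ~= b \<and> \<xi> = (b - a) /\<^sub>R norm (b - a)"
  using v by (intro exI bexI conjI refl) (auto intro: hull_inc)
 from someI_ex[OF this] obtain a b
  where ab: "a \<in> ?e" "b \<in> ?e" "a ~= b" "edge_vec i j = (b - a) /\<^sub>R norm (b - a)"
  unfolding edge_vec_def edge_direction_def by blast
 have "\<exists>s. c = vert j + s *\<^sub>R (vert i - vert j)" if c: "c \<in> ?e" for c
 proof -
  obtain u v where uv: "c = u *\<^sub>R vert i + v *\<^sub>R vert j" "u + v = 1"
   using c unfolding convex_hull_2 by auto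
  then have "v = 1 - u" by simp
  with uv(1) show ?thesis by (intro exI[of _ u]) (simp add: algebra_simps)
 qed
 then obtain s t where st: "a = vert j + s *\<^sub>R (vert i - vert j)" "b = vert j + t *\<^sub>R (vert i - vert j)"
  using ab(1,2) by blast
 have ba: "b - a = (t - s) *\<^sub>R (vert i - vert j)" unfolding st by (simp add: algebra_simps)
 show ?thesis
 proof (intro exI[of _ "(t - s) / norm (b - a)"] conjI)
  show "(t - s) / norm (b - a) ~= 0" using ab(3) ba by auto
  show "edge_vec i j = ((t - s) / norm (b - a)) *\<^sub>R (vert i - vert j)"
   unfolding ab(4) by (subst (1) ba) (simp add: divide_inverse_commute)
  show "norm (edge_vec i j) = 1" unfolding ab(4) using ab(3) by simp
 qed
qed

lemma edge_vec_commute: "edge_vec i j = edge_vec j i"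
 by (simp add: edge_vec_def insert_commute)

lemma edge_directions_eq: "edge_directions = (%(i, j). edge_vec i j) ` {(i, j). i ~= (j :: 'd::finite option)}"
 unfolding edge_directions_def edges_simplex_S edge_vec_def by (auto simp: image_iff)

lemma edge_vec_inj:
 assumes "i ~= (j :: 'd::finite option)" "k ~= l" "edge_vec i j = edge_vec k l"
 shows "(k, l) = (i, j) \<or> (k, l) = (j, i)"
proof -
 obtain u where u: "u ~= 0" "edge_vec i j = u *\<^sub>R (vert i - vert j)" using edge_vec_form[OF assms(1)] by auto
 obtain v where v: "v ~= 0" "edge_vec k l = v *\<^sub>R (vert k - vert l)" using edge_vec_form[OF assms(2)] by auto
 have "coord (0 + u *\<^sub>R (vert i - vert j)) p = coord (0 + v *\<^sub>R (vert k - vert l)) p" for p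
  using u v assms by simp
 then have eq: "u * (of_bool (i = p) - of_bool (j = p)) = v * (of_bool (k = p) - of_bool (l = p))" for p
  unfolding coord_add_diff coord_vert by (auto simp: of_bool_def)
 have "k = i \<or> l = i" by (rule ccontr) (use eq[of i] u assms(1) in simp)
 moreover have "k = j \<or> l = j" by (rule ccontr) (use eq[of j] u assms(1) in simp)
 ultimately show ?thesis using assms(1,2) by auto
qed

text \<open>Each unordered edge is counted twice among the ordered pairs of vertices.\<close>

lemma sum_edge_directions:
 fixes g :: "real^'d::finite => real"
 assumes h: "!!i j. i ~= j ==> g (edge_vec i j) = h i j + h j i"
 shows "(\<Sum>\<xi>\<in>edge_directions. g \<xi>) = (\<Sum>(i, j) | i ~= j. h i j)"
proof -
 let ?O = "{(i, j). i ~= (j :: 'd option)}"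
 let ?G = "%(i, j). edge_vec i j :: real^'d"
 have "(\<Sum>p\<in>?O. g (?G p)) = (\<Sum>\<xi>\<in>?G ` ?O. \<Sum>p\<in>{p\<in>?O. ?G p = \<xi>}. g (?G p))"
  by (rule sum.image_gen) simp
 also have "... = (\<Sum>\<xi>\<in>?G ` ?O. 2 * g \<xi>)"
 proof (rule sum.cong[OF refl])
  fix \<xi> assume "\<xi> \<in> ?G ` ?O"
  then obtain i j where ij: "i ~= j" "\<xi> = edge_vec i j" by auto
  have "{p\<in>?O. ?G p = \<xi>} = {(i, j), (j, i)}"
   using ij edge_vec_inj[OF ij(1)] edge_vec_commute[of i j] by fastforce
  then show "(\<Sum>p\<in>{p\<in>?O. ?G p = \<xi>}. g (?G p)) = 2 * g \<xi>"
   using ij by (simp add: edge_vec_commute[of j i])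
 qed
 finally have 1: "(\<Sum>p\<in>?O. g (?G p)) = 2 * (\<Sum>\<xi>\<in>edge_directions. g \<xi>)"
  unfolding edge_directions_eq by (simp add: sum_distrib_left)
 have "(\<Sum>p\<in>?O. g (?G p)) = (\<Sum>(i, j)\<in>?O. h i j + h j i)" by (intro sum.cong) (auto simp: h)
 also have "... = (\<Sum>(i, j)\<in>?O. h i j) + (\<Sum>(i, j)\<in>?O. h j i)"
  by (simp add: case_prod_unfold sum.distrib)
 also have "(\<Sum>(i, j)\<in>?O. h j i) = (\<Sum>(i, j)\<in>?O. h i j)"
  by (rule sum.reindex_bij_witness[of _ "%(i,j). (j,i)" "%(i,j). (j,i)"]) auto
 finally show ?thesis using 1 by simp
qed

lemma SUP_dist_along:
 fixes \<xi> x :: "real^'d::finite"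
 assumes n: "norm \<xi> = 1" and S: "{c. 0 <= c \<and> x + c *\<^sub>R \<xi> \<in> simplex_S} = {0..L}" and L: "0 <= L"
 shows "(SUP c\<in>{c. 0 <= c \<and> x + c *\<^sub>R \<xi> \<in> simplex_S}. dist x (x + c *\<^sub>R \<xi>)) = L"
proof -
 have "(SUP c\<in>{0..L}. dist x (x + c *\<^sub>R \<xi>)) = (SUP c\<in>{0..L}. c)"
  by (intro SUP_cong) (auto simp: dist_norm n)
 also have "... = L" using L by simp
 finally show ?thesis unfolding S .
qed

lemma exit_times:
 assumes x: "x \<in> simplex_S" and k: "\<kappa> > 0" and ij: "i ~= j"
 shows "{c. 0 <= c \<and> x + c *\<^sub>R (\<kappa> *\<^sub>R (vert i - vert j)) \<in> simplex_S} = {0..coord x j / \<kappa>}"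
proof (intro set_eqI iffI)
 fix c assume c: "c \<in> {c. 0 <= c \<and> x + c *\<^sub>R (\<kappa> *\<^sub>R (vert i - vert j)) \<in> simplex_S}"
 then have "0 <= coord (x + (c * \<kappa>) *\<^sub>R (vert i - vert j)) j" by (auto simp: simplex_S_def)
 then show "c \<in> {0..coord x j / \<kappa>}" using c k ij by (simp add: coord_add_diff coord_vert pos_le_divide_eq)
next
 fix c assume c: "c \<in> {0..coord x j / \<kappa>}"
 then have "c * \<kappa> <= coord x j" using k by (simp add: pos_le_divide_eq)
 then have "0 <= coord (x + (c * \<kappa>) *\<^sub>R (vert i - vert j)) l" for l
  using c k x ij unfolding coord_add_diff coord_vert by (auto simp: simplex_S_def)
 then show "c \<in> {c. 0 <= c \<and> x + c *\<^sub>R (\<kappa> *\<^sub>R (vert i - vert j)) \<in> simplex_S}"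
  using c by (auto simp: simplex_S_def)
qed

lemma dtilde_edge_pos:
 assumes x: "x \<in> simplex_S" and k: "\<kappa> > 0" and ij: "i ~= j" and n: "norm (\<kappa> *\<^sub>R (vert i - vert j)) = 1"
 shows "dtilde (\<kappa> *\<^sub>R (vert i - vert j)) x = coord x i * coord x j / \<kappa>\<^sup>2"
proof -
 have 0: "0 <= coord x i / \<kappa>" "0 <= coord x j / \<kappa>" using x k by (auto simp: simplex_S_def)
 have n': "norm (\<kappa> *\<^sub>R (vert j - vert i)) = 1" using n by (simp add: norm_minus_commute)
 have minus: "x - c *\<^sub>R (\<kappa> *\<^sub>R (vert i - vert j)) = x + c *\<^sub>R (\<kappa> *\<^sub>R (vert j - vert i))" for c
  by (simp add: algebra_simps)
 show ?thesis
  unfolding dtilde_def minus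
  using SUP_dist_along[OF n exit_times[OF x k ij] 0(2)] SUP_dist_along[OF n' exit_times[OF x k ij[symmetric]] 0(1)]
  by (simp add: power2_eq_square)
qed

text \<open>From \<open>x\<close> one can move along an edge until one of the two coordinates that change becomes zero, so
the product of the two distances is a product of two coordinates.\<close>

lemma dtilde_edge:
 assumes x: "x \<in> simplex_S" and k: "\<kappa> ~= 0" and ij: "i ~= j" and n: "norm (\<kappa> *\<^sub>R (vert i - vert j)) = 1"
 shows "dtilde (\<kappa> *\<^sub>R (vert i - vert j)) x = coord x i * coord x j / \<kappa>\<^sup>2"
proof (cases "\<kappa> > 0")
 case True then show ?thesis using assms by (intro dtilde_edge_pos)
next
 case False
 have e: "\<kappa> *\<^sub>R (vert i - vert j) = (-\<kappa>) *\<^sub>R (vert j - vert i)" by (simp add: algebra_simps)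
 show ?thesis using False assms unfolding e by (subst dtilde_edge_pos) auto
qed

section \<open>The operator on polynomials\<close>

text \<open>The eigenvalues are \<open>l (l + sig \<alpha>)\<close>.\<close>

definition sig :: "('d::finite option => real) => real" where
 "sig \<alpha> = real CARD('d) + (\<Sum>i\<in>UNIV. \<alpha> i)"

lemma eigenval_sig: "eigenval \<alpha> l = real l * (real l + sig \<alpha>)"
 by (simp add: eigenval_def sig_def)

lemma interior_simplex_S: "(x :: real^'a::finite) \<in> interior simplex_S ==> 0 < coord x i"
proof -
 assume x: "x \<in> interior simplex_S"
 then obtain e where e: "e > 0" "ball x e \<subseteq> simplex_S" by (auto simp: mem_interior)
 obtain j where j: "j ~= i" by (metis option.distinct(1))
 define v :: "real^'a" where "v = vert j - vert i"
 have "v ~= 0" using j inj_vert by (auto simp: v_def inj_on_def)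
 define t where "t = e / (2 * norm v)"
 have t: "t > 0" using e \<open>v ~= 0\<close> by (simp add: t_def)
 have "norm (t *\<^sub>R v) < e" using e \<open>v ~= 0\<close> t by (simp add: t_def)
 then have "x + t *\<^sub>R v \<in> simplex_S" using e by (auto simp: dist_norm subset_iff)
 then have "0 <= coord (x + t *\<^sub>R v) i" by (auto simp: simplex_S_def)
 then show ?thesis using t j unfolding v_def coord_add_diff coord_vert by simp
qed

lemma coord_along: "coord (x + t *\<^sub>R (\<kappa> *\<^sub>R (vert i - vert j))) l =
  coord x l + t * \<kappa> * ((if i = l then 1 else 0) - (if j = l then 1 else 0))"
 unfolding scaleR_scaleR coord_add_diff coord_vert by (rule refl)

lemma prod_split2:
 fixes f :: "'a::finite => 'b::comm_monoid_mult"
 assumes "i ~= j" shows "prod f UNIV = f i * (f j * prod f (UNIV - {i, j}))"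
proof -
 have "prod f UNIV = f i * prod f (UNIV - {i})" by (rule prod.remove) auto
 also have "prod f (UNIV - {i}) = f j * prod f (UNIV - {i} - {j})" using assms by (intro prod.remove) auto
 also have "UNIV - {i} - {j} = UNIV - {i, j}" by auto
 finally show ?thesis .
qed

lemma hmon_split:
 assumes "i ~= j"
 shows "hmon b x = coord x i ^ b i * (coord x j ^ b j * (\<Prod>l\<in>UNIV - {i, j}. coord x l ^ b l))"
 unfolding hmon_def by (rule prod_split2[OF assms, where f="%l. coord x l ^ b l"])

lemma hmon_along_deriv:
 assumes ij: "i ~= j"
 shows "((%t. hmon b (y + t *\<^sub>R (\<kappa> *\<^sub>R (vert i - vert j)))) has_real_derivative
  \<kappa> * (real (b i) * hmon (b(i := b i - 1)) y - real (b j) * hmon (b(j := b j - 1)) y)) (at 0)"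
proof -
 define R where "R = (\<Prod>l\<in>UNIV - {i, j}. coord y l ^ b l)"
 have "hmon b (y + t *\<^sub>R (\<kappa> *\<^sub>R (vert i - vert j))) = (coord y i + t * \<kappa>) ^ b i * ((coord y j - t * \<kappa>) ^ b j * R)" for t
  unfolding hmon_split[OF ij] coord_along R_def using ij
  by (intro arg_cong2[where f="(*)"] prod.cong) auto
 moreover have "hmon (b(i := b i - 1)) y = coord y i ^ (b i - 1) * (coord y j ^ b j * R)"
  unfolding hmon_split[OF ij] R_def using ij by (intro arg_cong2[where f="(*)"] prod.cong) auto
 moreover have "hmon (b(j := b j - 1)) y = coord y i ^ b i * (coord y j ^ (b j - 1) * R)"
  unfolding hmon_split[OF ij] R_def using ij by (intro arg_cong2[where f="(*)"] prod.cong) auto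
 moreover have "((%t. (coord y i + t * \<kappa>) ^ b i * ((coord y j - t * \<kappa>) ^ b j * R)) has_real_derivative
  \<kappa> * (real (b i) * (coord y i ^ (b i - 1) * (coord y j ^ b j * R)) -
   real (b j) * (coord y i ^ b i * (coord y j ^ (b j - 1) * R)))) (at 0)"
  by (rule derivative_eq_intros refl | simp)+ (simp add: algebra_simps)
 ultimately show ?thesis by (simp del: coord.simps)
qed

lemma hmon_lower:
 assumes "coord x i ~= 0"
 shows "real (\<beta> i) * hmon (\<beta>(i := \<beta> i - 1)) x = real (\<beta> i) * hmon \<beta> x / coord x i"
proof -
 have "hmon b x = coord x i ^ b i * (\<Prod>l\<in>UNIV - {i}. coord x l ^ b l)" for b
  unfolding hmon_def by (rule prod.remove) auto
 moreover have "(\<Prod>l\<in>UNIV - {i}. coord x l ^ (\<beta>(i := \<beta> i - 1)) l) = (\<Prod>l\<in>UNIV - {i}. coord x l ^ \<beta> l)"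
  by (intro prod.cong) auto
 ultimately show ?thesis using assms by (cases "\<beta> i") (simp_all del: coord.simps)
qed

definition edge_flux :: "('d::finite option => real) => real^'d => (real^'d => real) => real^'d => real" where
 "edge_flux \<alpha> \<xi> \<phi>' y = dtilde \<xi> y * jacobi_weight \<alpha> y * \<phi>' y"

lemma hmon_flux_deriv:
 fixes \<alpha> :: "'d::finite option => real" and b :: "'d option => nat"
 assumes ij: "i ~= j" and k: "\<kappa> ~= 0" and n: "norm (\<kappa> *\<^sub>R (vert i - vert j)) = 1"
  and x: "x \<in> interior simplex_S"
 defines "\<xi> \<equiv> \<kappa> *\<^sub>R (vert i - vert j :: real^'d)"
 defines "g \<equiv> %l. real (b l) + \<alpha> l"
 shows "((%t. edge_flux \<alpha> \<xi>
   (%y. \<kappa> * (real (b i) * hmon (b(i := b i - 1)) y - real (b j) * hmon (b(j := b j - 1)) y)) (x + t *\<^sub>R \<xi>))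
  has_real_derivative jacobi_weight \<alpha> x * (hmon b x *
   (- real (b i) - real (b j) + (real (b i) * coord x j - real (b j) * coord x i) * (g i / coord x i - g j / coord x j)))) (at 0)"
proof -
 define X Y where "X = coord x i" and "Y = coord x j"
 have XY: "0 < X" "0 < Y" using interior_simplex_S[OF x] by (auto simp: X_def Y_def)
 define C where "C = (\<Prod>l\<in>UNIV - {i, j}. coord x l powr g l)"
 define F where "F t = (1/\<kappa>) * ((real (b i) * (Y - t * \<kappa>) - real (b j) * (X + t * \<kappa>)) *
   ((X + t * \<kappa>) powr g i * ((Y - t * \<kappa>) powr g j * C)))" for t
 have wh: "jacobi_weight \<alpha> z * hmon b z = (\<Prod>l\<in>UNIV. coord z l powr g l)" if "z \<in> interior simplex_S" for z
 proof -
  have "coord z l powr \<alpha> l * coord z l ^ b l = coord z l powr g l" for l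
   using interior_simplex_S[OF that, of l] by (simp add: g_def powr_add powr_realpow mult.commute del: coord.simps)
  then show ?thesis by (simp add: jacobi_weight_def hmon_def prod.distrib[symmetric] del: coord.simps)
 qed
 define T where "T = (%t. x + t *\<^sub>R \<xi>) -` interior simplex_S"
 have T: "open T" "0 \<in> T" unfolding T_def using x by (auto intro!: open_vimage continuous_intros)
 have eq: "F t = edge_flux \<alpha> \<xi>
   (%y. \<kappa> * (real (b i) * hmon (b(i := b i - 1)) y - real (b j) * hmon (b(j := b j - 1)) y)) (x + t *\<^sub>R \<xi>)"
  if t: "t \<in> T" for t
 proof -
  define z where "z = x + t *\<^sub>R \<xi>"
  have z: "z \<in> interior simplex_S" using t by (simp add: T_def z_def)
  then have zS: "z \<in> simplex_S" using interior_subset by blast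
  have zi: "coord z i = X + t * \<kappa>" "coord z j = Y - t * \<kappa>"
   using ij unfolding z_def \<xi>_def coord_along X_def Y_def by auto
  have z0: "0 < X + t * \<kappa>" "0 < Y - t * \<kappa>" using interior_simplex_S[OF z] zi by metis+
  have "(\<Prod>l\<in>UNIV. coord z l powr g l) = (X + t * \<kappa>) powr g i * ((Y - t * \<kappa>) powr g j * C)"
  proof -
   have "(\<Prod>l\<in>UNIV - {i, j}. coord z l powr g l) = C"
    unfolding C_def z_def \<xi>_def coord_along by (intro prod.cong) auto
   then show ?thesis unfolding prod_split2[OF ij] zi by simp
  qed
  then have wz: "jacobi_weight \<alpha> z * hmon b z = (X + t * \<kappa>) powr g i * ((Y - t * \<kappa>) powr g j * C)"
   using wh[OF z] by simp
  have dt: "dtilde \<xi> z = (X + t * \<kappa>) * (Y - t * \<kappa>) / \<kappa>\<^sup>2"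
   unfolding \<xi>_def using dtilde_edge[OF zS k ij n] zi by simp
  have hl: "real (b i) * hmon (b(i := b i - 1)) z = real (b i) * hmon b z / (X + t * \<kappa>)"
   "real (b j) * hmon (b(j := b j - 1)) z = real (b j) * hmon b z / (Y - t * \<kappa>)"
   using z0 zi hmon_lower[of z i b] hmon_lower[of z j b] by simp_all
  have "edge_flux \<alpha> \<xi> (%y. \<kappa> * (real (b i) * hmon (b(i := b i - 1)) y - real (b j) * hmon (b(j := b j - 1)) y)) z
    = (1/\<kappa>) * ((real (b i) * (Y - t * \<kappa>) - real (b j) * (X + t * \<kappa>)) * (jacobi_weight \<alpha> z * hmon b z))"
   unfolding edge_flux_def dt hl using z0 k by (simp add: power2_eq_square divide_simps) (simp add: algebra_simps)
  then show ?thesis unfolding z_def[symmetric] F_def wz[symmetric] by (rule sym)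
 qed
 have "(F has_real_derivative (1/\<kappa>) * ((- real (b i) * \<kappa> - real (b j) * \<kappa>) * (X powr g i * (Y powr g j * C)) +
   (real (b i) * Y - real (b j) * X) * (g i * X powr (g i - 1) * \<kappa> * (Y powr g j * C) +
    X powr g i * (g j * Y powr (g j - 1) * (- \<kappa>) * C)))) (at 0)"
 proof -
  have p1: "((%t. (X + t * \<kappa>) powr g i) has_real_derivative g i * X powr (g i - 1) * \<kappa>) (at 0)"
   using DERIV_fun_powr[of "%t. X + t * \<kappa>" \<kappa> 0 "g i"] XY by (auto intro!: derivative_eq_intros)
  have p2: "((%t. (Y - t * \<kappa>) powr g j) has_real_derivative g j * Y powr (g j - 1) * (- \<kappa>)) (at 0)"
   using DERIV_fun_powr[of "%t. Y - t * \<kappa>" "- \<kappa>" 0 "g j"] XY by (auto intro!: derivative_eq_intros)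
  show ?thesis unfolding F_def[abs_def]
   by (rule derivative_eq_intros p1 p2 refl)+ (simp add: algebra_simps)
 qed
 also have "(1/\<kappa>) * ((- real (b i) * \<kappa> - real (b j) * \<kappa>) * (X powr g i * (Y powr g j * C)) +
   (real (b i) * Y - real (b j) * X) * (g i * X powr (g i - 1) * \<kappa> * (Y powr g j * C) +
    X powr g i * (g j * Y powr (g j - 1) * (- \<kappa>) * C))) =
   (X powr g i * (Y powr g j * C)) * (- real (b i) - real (b j) + (real (b i) * Y - real (b j) * X) * (g i / X - g j / Y))"
  using k XY by (simp add: powr_diff field_simps)
 also have "X powr g i * (Y powr g j * C) = jacobi_weight \<alpha> x * hmon b x"
  unfolding wh[OF x] prod_split2[OF ij] X_def Y_def C_def ..
 finally have "(F has_real_derivative jacobi_weight \<alpha> x * (hmon b x *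
   (- real (b i) - real (b j) + (real (b i) * Y - real (b j) * X) * (g i / X - g j / Y)))) (at 0)"
  by (simp add: mult.assoc)
 from has_field_derivative_transform_within_open[OF this T(1) T(2) eq] show ?thesis
  by (simp add: X_def Y_def del: coord.simps)
qed

definition edge_smooth :: "('d::finite option => real) => (real^'d => real) => bool" where
 "edge_smooth \<alpha> \<phi> \<longleftrightarrow> (\<forall>\<xi>\<in>edge_directions. \<exists>\<phi>'.
   (\<forall>y. ((%t. \<phi> (y + t *\<^sub>R \<xi>)) has_real_derivative \<phi>' y) (at 0)) \<and>
   (\<forall>x\<in>interior simplex_S. \<exists>D. ((%t. edge_flux \<alpha> \<xi> \<phi>' (x + t *\<^sub>R \<xi>)) has_real_derivative D) (at 0)))"

definition edge_term :: "('d::finite option => real) => (real^'d => real) => real^'d => real^'d => real" where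
 "edge_term \<alpha> \<phi> \<xi> x = dir_deriv \<xi> (%y. dtilde \<xi> y * jacobi_weight \<alpha> y * dir_deriv \<xi> \<phi> y) x"

lemma edge_term_eqI:
 assumes "!!y. ((%t. \<phi> (y + t *\<^sub>R \<xi>)) has_real_derivative \<phi>' y) (at 0)"
  and "((%t. edge_flux \<alpha> \<xi> \<phi>' (x + t *\<^sub>R \<xi>)) has_real_derivative D) (at 0)"
 shows "edge_term \<alpha> \<phi> \<xi> x = D"
proof -
 have "dir_deriv \<xi> \<phi> = \<phi>'" unfolding dir_deriv_def by (intro ext DERIV_imp_deriv assms)
 then show ?thesis using DERIV_imp_deriv[OF assms(2)] by (simp add: edge_term_def dir_deriv_def edge_flux_def)
qed

lemma P_op_edge_term: "P_op \<alpha> \<phi> x = - (\<Sum>\<xi>\<in>edge_directions. inverse (jacobi_weight \<alpha> x) * edge_term \<alpha> \<phi> \<xi> x)"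
 by (simp add: P_op_def edge_term_def)

lemma edge_smooth_add:
 assumes "edge_smooth \<alpha> \<phi>" "edge_smooth \<alpha> \<psi>"
 shows "edge_smooth \<alpha> (%x. \<phi> x + \<psi> x) \<and>
  (\<forall>x\<in>interior simplex_S. P_op \<alpha> (%x. \<phi> x + \<psi> x) x = P_op \<alpha> \<phi> x + P_op \<alpha> \<psi> x)"
proof -
 have *: "\<exists>\<theta>'. (\<forall>y. ((%t. \<phi> (y + t *\<^sub>R \<xi>) + \<psi> (y + t *\<^sub>R \<xi>)) has_real_derivative \<theta>' y) (at 0)) \<and>
   (\<forall>x\<in>interior simplex_S. ((%t. edge_flux \<alpha> \<xi> \<theta>' (x + t *\<^sub>R \<xi>)) has_real_derivative
    edge_term \<alpha> \<phi> \<xi> x + edge_term \<alpha> \<psi> \<xi> x) (at 0))" if \<xi>: "\<xi> \<in> edge_directions" for \<xi>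
 proof -
  obtain \<phi>' where p: "!!y. ((%t. \<phi> (y + t *\<^sub>R \<xi>)) has_real_derivative \<phi>' y) (at 0)"
   "!!x. x\<in>interior simplex_S ==> \<exists>D. ((%t. edge_flux \<alpha> \<xi> \<phi>' (x + t *\<^sub>R \<xi>)) has_real_derivative D) (at 0)"
   using assms(1) \<xi> unfolding edge_smooth_def by blast
  obtain \<psi>' where q: "!!y. ((%t. \<psi> (y + t *\<^sub>R \<xi>)) has_real_derivative \<psi>' y) (at 0)"
   "!!x. x\<in>interior simplex_S ==> \<exists>D. ((%t. edge_flux \<alpha> \<xi> \<psi>' (x + t *\<^sub>R \<xi>)) has_real_derivative D) (at 0)"
   using assms(2) \<xi> unfolding edge_smooth_def by blast
  show ?thesis
  proof (intro exI[of _ "%y. \<phi>' y + \<psi>' y"] conjI allI ballI)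
   fix x :: "real^'a" assume x: "x \<in> interior simplex_S"
   obtain D where D: "((%t. edge_flux \<alpha> \<xi> \<phi>' (x + t *\<^sub>R \<xi>)) has_real_derivative D) (at 0)" using p(2)[OF x] by auto
   obtain E where E: "((%t. edge_flux \<alpha> \<xi> \<psi>' (x + t *\<^sub>R \<xi>)) has_real_derivative E) (at 0)" using q(2)[OF x] by auto
   show "((%t. edge_flux \<alpha> \<xi> (%y. \<phi>' y + \<psi>' y) (x + t *\<^sub>R \<xi>)) has_real_derivative
    edge_term \<alpha> \<phi> \<xi> x + edge_term \<alpha> \<psi> \<xi> x) (at 0)"
    unfolding edge_term_eqI[OF p(1) D] edge_term_eqI[OF q(1) E]
    using DERIV_add[OF D E] by (simp add: edge_flux_def distrib_left)
  qed (intro DERIV_add p q)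
 qed
 then have "edge_smooth \<alpha> (%x. \<phi> x + \<psi> x)" unfolding edge_smooth_def by meson
 moreover have "edge_term \<alpha> (%x. \<phi> x + \<psi> x) \<xi> x = edge_term \<alpha> \<phi> \<xi> x + edge_term \<alpha> \<psi> \<xi> x"
  if "\<xi> \<in> edge_directions" "x \<in> interior simplex_S" for \<xi> x
  using *[OF that(1)] that(2) edge_term_eqI[of "%x. \<phi> x + \<psi> x"] by blast
 ultimately show ?thesis by (simp add: P_op_edge_term distrib_left sum.distrib)
qed

lemma edge_smooth_scale:
 assumes "edge_smooth \<alpha> \<phi>"
 shows "edge_smooth \<alpha> (%x. a * \<phi> x) \<and> (\<forall>x\<in>interior simplex_S. P_op \<alpha> (%x. a * \<phi> x) x = a * P_op \<alpha> \<phi> x)"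
proof -
 have *: "\<exists>\<theta>'. (\<forall>y. ((%t. a * \<phi> (y + t *\<^sub>R \<xi>)) has_real_derivative \<theta>' y) (at 0)) \<and>
   (\<forall>x\<in>interior simplex_S. ((%t. edge_flux \<alpha> \<xi> \<theta>' (x + t *\<^sub>R \<xi>)) has_real_derivative
    a * edge_term \<alpha> \<phi> \<xi> x) (at 0))" if \<xi>: "\<xi> \<in> edge_directions" for \<xi>
 proof -
  obtain \<phi>' where p: "!!y. ((%t. \<phi> (y + t *\<^sub>R \<xi>)) has_real_derivative \<phi>' y) (at 0)"
   "!!x. x\<in>interior simplex_S ==> \<exists>D. ((%t. edge_flux \<alpha> \<xi> \<phi>' (x + t *\<^sub>R \<xi>)) has_real_derivative D) (at 0)"
   using assms(1) \<xi> unfolding edge_smooth_def by blast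
  show ?thesis
  proof (intro exI[of _ "%y. a * \<phi>' y"] conjI allI ballI)
   fix x :: "real^'a" assume x: "x \<in> interior simplex_S"
   obtain D where D: "((%t. edge_flux \<alpha> \<xi> \<phi>' (x + t *\<^sub>R \<xi>)) has_real_derivative D) (at 0)" using p(2)[OF x] by auto
   show "((%t. edge_flux \<alpha> \<xi> (%y. a * \<phi>' y) (x + t *\<^sub>R \<xi>)) has_real_derivative a * edge_term \<alpha> \<phi> \<xi> x) (at 0)"
    unfolding edge_term_eqI[OF p(1) D]
    using DERIV_cmult[OF D, of a] by (simp add: edge_flux_def mult_ac)
  qed (intro DERIV_cmult p)
 qed
 then have "edge_smooth \<alpha> (%x. a * \<phi> x)" unfolding edge_smooth_def by meson
 moreover have "edge_term \<alpha> (%x. a * \<phi> x) \<xi> x = a * edge_term \<alpha> \<phi> \<xi> x"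
  if "\<xi> \<in> edge_directions" "x \<in> interior simplex_S" for \<xi> x
  using *[OF that(1)] that(2) edge_term_eqI[of "%x. a * \<phi> x"] by blast
 ultimately show ?thesis by (simp add: P_op_edge_term sum_distrib_left mult_ac)
qed

lemma edge_term_hmon:
 fixes \<alpha> :: "'d::finite option => real" and b :: "'d option => nat"
 assumes ij: "i ~= j"
 defines "g \<equiv> %l. real (b l) + \<alpha> l"
 shows "\<exists>\<phi>'. (\<forall>y. ((%t. hmon b (y + t *\<^sub>R edge_vec i j)) has_real_derivative \<phi>' y) (at 0)) \<and>
  (\<forall>x\<in>interior simplex_S. ((%t. edge_flux \<alpha> (edge_vec i j) \<phi>' (x + t *\<^sub>R edge_vec i j)) has_real_derivative
   jacobi_weight \<alpha> x * (hmon b x * (- real (b i) - real (b j) +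
    (real (b i) * coord x j - real (b j) * coord x i) * (g i / coord x i - g j / coord x j)))) (at 0))"
proof -
 obtain \<kappa> where k: "\<kappa> ~= 0" "edge_vec i j = \<kappa> *\<^sub>R (vert i - vert j)" "norm (edge_vec i j) = 1"
  using edge_vec_form[OF ij] by auto
 show ?thesis unfolding k(2) g_def
  by (intro exI[of _ "%y. \<kappa> * (real (b i) * hmon (b(i := b i - 1)) y - real (b j) * hmon (b(j := b j - 1)) y)"] conjI allI ballI
    hmon_along_deriv[OF ij] hmon_flux_deriv[OF ij k(1) k(3)[unfolded k(2)]])
qed

lemma edge_smooth_hmon:
 fixes \<alpha> :: "'d::finite option => real" shows "edge_smooth \<alpha> (hmon b)"
 unfolding edge_smooth_def
proof
 fix \<xi> :: "real^'d" assume "\<xi> \<in> edge_directions"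
 then obtain i j where "i ~= j" "\<xi> = edge_vec i j" unfolding edge_directions_eq by auto
 with edge_term_hmon[OF this(1), of b \<alpha>]
 show "\<exists>\<phi>'. (\<forall>y. ((%t. hmon b (y + t *\<^sub>R \<xi>)) has_real_derivative \<phi>' y) (at 0)) \<and>
   (\<forall>x\<in>interior simplex_S. \<exists>D. ((%t. edge_flux \<alpha> \<xi> \<phi>' (x + t *\<^sub>R \<xi>)) has_real_derivative D) (at 0))" by blast
qed

text \<open>Along the edge from vertex \<open>j\<close> to vertex \<open>i\<close> only two coordinates change and
\<open>dtilde\<close> is their product, so each edge contributes a one-dimensional Jacobi operator in closed
form. Summing over the edges gives an operator that lowers the degree up to a multiple of the identity.\<close>

lemma P_op_hmon:
 fixes \<alpha> :: "'d::finite option => real" and \<beta> :: "'d option => nat"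
 assumes x: "x \<in> interior simplex_S"
 defines "n \<equiv> real (\<Sum>i\<in>UNIV. \<beta> i)"
 shows "P_op \<alpha> (hmon \<beta>) x = n * (n + sig \<alpha>) * hmon \<beta> x -
  (\<Sum>i\<in>UNIV. real (\<beta> i) * (real (\<beta> i) + \<alpha> i) * hmon (\<beta>(i := \<beta> i - 1)) x)"
proof -
 define g where "g l = real (\<beta> l) + \<alpha> l" for l
 define b where "b l = real (\<beta> l)" for l
 have xp: "0 < coord x i" for i by (rule interior_simplex_S[OF x])
 have w: "jacobi_weight \<alpha> x ~= 0" unfolding jacobi_weight_def using xp by (simp add: less_imp_neq[symmetric] del: coord.simps)
 define h where "h i j = hmon \<beta> x * (b i * g i * coord x j / coord x i - b i * (g j + 1))" for i j
 have "inverse (jacobi_weight \<alpha> x) * edge_term \<alpha> (hmon \<beta>) (edge_vec i j) x = h i j + h j i" if ij: "i ~= j" for i j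
 proof -
  obtain \<phi>' where "!!y. ((%t. hmon \<beta> (y + t *\<^sub>R edge_vec i j)) has_real_derivative \<phi>' y) (at 0)"
   "((%t. edge_flux \<alpha> (edge_vec i j) \<phi>' (x + t *\<^sub>R edge_vec i j)) has_real_derivative
   jacobi_weight \<alpha> x * (hmon \<beta> x * (- real (\<beta> i) - real (\<beta> j) +
    (real (\<beta> i) * coord x j - real (\<beta> j) * coord x i) * (g i / coord x i - g j / coord x j)))) (at 0)"
   using edge_term_hmon[OF ij, of \<beta> \<alpha>] x unfolding g_def by blast
  from edge_term_eqI[OF this] show ?thesis
   using w xp[of i] xp[of j] by (simp add: h_def b_def field_simps del: coord.simps)
 qed
 from sum_edge_directions[of "%\<xi>. inverse (jacobi_weight \<alpha> x) * edge_term \<alpha> (hmon \<beta>) \<xi> x" h, OF this]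
 have "P_op \<alpha> (hmon \<beta>) x = - (\<Sum>(i, j) | i ~= j. h i j)" by (simp add: P_op_edge_term)
 also have "(\<Sum>(i, j) | i ~= j. h i j) = (\<Sum>i\<in>UNIV. \<Sum>j\<in>UNIV - {i}. h i j)"
  by (subst sum.Sigma) (auto intro!: sum.cong)
 also have "... = (\<Sum>i\<in>UNIV. hmon \<beta> x * (b i * g i / coord x i) - hmon \<beta> x * b i * (n + sig \<alpha>))"
 proof (rule sum.cong[OF refl])
  fix i
  have "(\<Sum>j\<in>UNIV - {i}. h i j) = hmon \<beta> x * (b i * g i / coord x i * (\<Sum>j\<in>UNIV - {i}. coord x j) - b i * (\<Sum>j\<in>UNIV - {i}. g j + 1))"
   by (simp add: h_def sum_distrib_left sum_divide_distrib sum_subtractf right_diff_distrib mult_ac del: coord.simps)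
  also have "(\<Sum>j\<in>UNIV - {i}. coord x j) = 1 - coord x i"
   by (subst sum_diff1) (auto simp del: coord.simps)
  also have "(\<Sum>j\<in>UNIV - {i}. g j + 1) = n + sig \<alpha> - g i"
   by (subst sum_diff1) (auto simp: g_def n_def sig_def sum.distrib)
  finally show "(\<Sum>j\<in>UNIV - {i}. h i j) = hmon \<beta> x * (b i * g i / coord x i) - hmon \<beta> x * b i * (n + sig \<alpha>)"
   using xp[of i] by (simp add: field_simps del: coord.simps)
 qed
 also have "... = (\<Sum>i\<in>UNIV. b i * g i * hmon (\<beta>(i := \<beta> i - 1)) x) - n * (n + sig \<alpha>) * hmon \<beta> x"
 proof -
  have "hmon \<beta> x * (b i * g i / coord x i) = b i * g i * hmon (\<beta>(i := \<beta> i - 1)) x" for i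
   using hmon_lower[of x i \<beta>] xp[of i] by (auto simp: b_def field_simps simp del: coord.simps)
  moreover have "(\<Sum>i\<in>UNIV. hmon \<beta> x * b i * (n + sig \<alpha>)) = n * (n + sig \<alpha>) * hmon \<beta> x"
   by (simp add: n_def b_def sum_distrib_left sum_distrib_right mult_ac)
  ultimately show ?thesis by (simp add: sum_subtractf)
 qed
 finally show ?thesis by (simp add: b_def g_def)
qed

section \<open>Multi-indices\<close>

definition degs :: "nat => ('i::finite => nat) set" where
 "degs n = {b. (\<Sum>i\<in>UNIV. b i) = n}"

abbreviation incr :: "('i => nat) => 'i => 'i => nat" where
 "incr b i \<equiv> b(i := Suc (b i))"

abbreviation decr :: "('i => nat) => 'i => 'i => nat" where
 "decr b i \<equiv> b(i := b i - 1)"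

lemma finite_degs: "finite (degs n)"
 unfolding degs_def by (rule finite_degree_eq)

lemma sum_incr: "(\<Sum>j\<in>UNIV. incr b i j) = Suc (\<Sum>j\<in>UNIV. b (j :: 'i::finite))"
 by (subst (1 2) sum.remove[of _ i]) auto

lemma incr_in_degs: "incr b i \<in> degs (Suc n) \<longleftrightarrow> b \<in> degs n"
 unfolding degs_def mem_Collect_eq sum_incr by simp

lemma prod_incr:
 fixes F :: "'i::finite => nat => 'b::comm_semiring_1"
 assumes "F i (Suc (b i)) = c * F i (b i)"
 shows "(\<Prod>j\<in>UNIV. F j (incr b i j)) = c * (\<Prod>j\<in>UNIV. F j (b j))"
proof -
 have "(\<Prod>j\<in>UNIV. F j (incr b i j)) = F i (Suc (b i)) * (\<Prod>j\<in>UNIV - {i}. F j (incr b i j))"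
  by (subst prod.remove[of _ i]) auto
 also have "(\<Prod>j\<in>UNIV - {i}. F j (incr b i j)) = (\<Prod>j\<in>UNIV - {i}. F j (b j))"
  by (intro prod.cong) auto
 also have "F i (Suc (b i)) * (\<Prod>j\<in>UNIV - {i}. F j (b j)) = c * (\<Prod>j\<in>UNIV. F j (b j))"
  unfolding assms by (subst (2) prod.remove[of _ i]) (auto simp: mult.assoc)
 finally show ?thesis .
qed

lemma sum_degs_shift:
 fixes F :: "('i::finite => nat) => real"
 shows "(\<Sum>b\<in>degs (Suc n). real (b i) * F b) = (\<Sum>b\<in>degs n. real (Suc (b i)) * F (incr b i))"
proof -
 have "(\<Sum>b\<in>degs (Suc n). real (b i) * F b) = (\<Sum>b\<in>{b\<in>degs (Suc n). b i > 0}. real (b i) * F b)"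
  by (rule sum.mono_neutral_right) (auto simp: finite_degs)
 also have "... = (\<Sum>b\<in>degs n. real (Suc (b i)) * F (incr b i))"
 proof (rule sum.reindex_bij_witness[of _ "%b. incr b i" "%b. decr b i"])
  fix b :: "'i => nat" assume b: "b \<in> {b\<in>degs (Suc n). b i > 0}"
  show 1: "incr (decr b i) i = b" using b by auto
  then show "decr b i \<in> degs n" using b incr_in_degs[of "decr b i" i n] by simp
  show "real (Suc (decr b i i)) * F (incr (decr b i) i) = real (b i) * F b" unfolding 1 using b by auto
 next
  fix b :: "'i => nat" assume b: "b \<in> degs n"
  show "decr (incr b i) i = b" by auto
  show "incr b i \<in> {b\<in>degs (Suc n). b i > 0}" using b by (simp add: incr_in_degs)
 qed
 finally show ?thesis .
qed

lemma degs_0: "degs 0 = {%_. 0}"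
 by (auto simp: degs_def fun_eq_iff)

definition mfact :: "('i::finite => nat) => real" where
 "mfact b = (\<Prod>i\<in>UNIV. fact (b i))"

lemma mfact_pos: "0 < mfact b"
 unfolding mfact_def by (intro prod_pos) auto

lemma mfact_incr: "mfact (incr b i) = real (Suc (b i)) * mfact b"
 unfolding mfact_def by (rule prod_incr) simp

lemma monomial_incr: "(\<Prod>j\<in>UNIV. a j ^ (incr b i j)) = (a i :: real) * (\<Prod>j\<in>UNIV. a (j :: 'i::finite) ^ b j)"
 by (rule prod_incr) simp

text \<open>By induction: multiplying by one more factor \<open>\<Sum>i. a i\<close> shifts the index set \<open>degs
n\<close>.\<close>

theorem multinomial:
 fixes a :: "'i::finite => real"
 shows "(\<Sum>b\<in>degs n. fact n / mfact b * (\<Prod>i\<in>UNIV. a i ^ b i)) = (\<Sum>i\<in>UNIV. a i) ^ n"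
proof (induction n)
 case 0 then show ?case by (simp add: degs_0 mfact_def)
next
 case (Suc n)
 let ?A = "%n. (\<Sum>b\<in>degs n. fact n / mfact b * (\<Prod>i\<in>UNIV. a i ^ b i))"
 have "real (Suc n) * ?A (Suc n) =
  (\<Sum>b\<in>degs (Suc n). real (\<Sum>i\<in>UNIV. b i) * (fact (Suc n) / mfact b * (\<Prod>i\<in>UNIV. a i ^ b i)))"
  unfolding sum_distrib_left by (intro sum.cong) (auto simp: degs_def)
 also have "... = (\<Sum>b\<in>degs (Suc n). \<Sum>i\<in>UNIV. real (b i) * (fact (Suc n) / mfact b * (\<Prod>i\<in>UNIV. a i ^ b i)))"
  by (simp only: of_nat_sum sum_distrib_right)
 also have "... = (\<Sum>i\<in>UNIV. \<Sum>b\<in>degs (Suc n). real (b i) * (fact (Suc n) / mfact b * (\<Prod>i\<in>UNIV. a i ^ b i)))"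
  by (rule sum.swap)
 also have "... = (\<Sum>i\<in>UNIV. \<Sum>b\<in>degs n. real (Suc (b i)) * (fact (Suc n) / mfact (incr b i) * (\<Prod>j\<in>UNIV. a j ^ incr b i j)))"
  by (simp only: sum_degs_shift)
 also have "... = (\<Sum>i\<in>UNIV. \<Sum>b\<in>degs n. real (Suc n) * a i * (fact n / mfact b * (\<Prod>j\<in>UNIV. a j ^ b j)))"
 proof (intro sum.cong refl)
  fix i and b :: "'i => nat"
  have "real (Suc (b i)) * (fact (Suc n) / mfact (incr b i) * (\<Prod>j\<in>UNIV. a j ^ incr b i j)) =
   real (Suc (b i)) * (fact (Suc n) / (real (Suc (b i)) * mfact b) * (a i * (\<Prod>j\<in>UNIV. a j ^ b j)))"
   by (simp only: mfact_incr monomial_incr)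
  then show "real (Suc (b i)) * (fact (Suc n) / mfact (incr b i) * (\<Prod>j\<in>UNIV. a j ^ incr b i j)) =
   real (Suc n) * a i * (fact n / mfact b * (\<Prod>j\<in>UNIV. a j ^ b j))"
   using mfact_pos[of b] by (simp add: field_simps del: of_nat_Suc)
 qed
 also have "... = real (Suc n) * ((\<Sum>i\<in>UNIV. a i) * ?A n)"
  by (simp only: mult.assoc sum_distrib_left[symmetric] sum_distrib_right[symmetric])
 finally show ?case using Suc by simp
qed

section \<open>Spectral decomposition of polynomials\<close>

definition Hom :: "nat => (real^'d::finite => real) set" where
 "Hom n = {p. \<exists>c. p = (%x. \<Sum>b\<in>degs n. c b * hmon b x)}"

lemma Hom_add: "p \<in> Hom n ==> q \<in> Hom n ==> (%x. p x + q x) \<in> Hom n"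
proof -
 assume "p \<in> Hom n" "q \<in> Hom n"
 then obtain c d where "p = (%x. \<Sum>b\<in>degs n. c b * hmon b x)" "q = (%x. \<Sum>b\<in>degs n. d b * hmon b x)"
  by (auto simp: Hom_def)
 then show ?thesis unfolding Hom_def
  by (intro CollectI exI[of _ "%m. c m + d m"]) (simp add: sum.distrib algebra_simps)
qed

lemma Hom_scale: "p \<in> Hom n ==> (%x. a * p x) \<in> Hom n"
proof -
 assume "p \<in> Hom n"
 then obtain c where "p = (%x. \<Sum>b\<in>degs n. c b * hmon b x)" by (auto simp: Hom_def)
 then show ?thesis unfolding Hom_def
  by (intro CollectI exI[of _ "%m. a * c m"]) (simp add: sum_distrib_left mult.assoc)
qed

lemma Hom_zero: "(%x. 0) \<in> Hom n"
 unfolding Hom_def by (intro CollectI exI[of _ "%m. 0"]) simp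

lemma Hom_sum: "(!!i. i \<in> A ==> p i \<in> Hom n) ==> (%x. \<Sum>i\<in>A. p i x) \<in> Hom n"
proof (induction A rule: infinite_finite_induct)
 case (insert x F)
 then show ?case using Hom_add[of "p x" n "%y. \<Sum>i\<in>F. p i y"] by simp
qed (simp_all add: Hom_zero)

lemma hmon_in_Hom: "\<beta> \<in> degs n ==> hmon \<beta> \<in> Hom n"
proof -
 assume b: "\<beta> \<in> degs n"
 then have "(\<Sum>b\<in>degs n. of_bool (b = \<beta>) * hmon b x) = hmon \<beta> x" for x
  by (subst sum.remove[of _ \<beta>]) (auto simp: finite_degs intro!: sum.neutral)
 then show ?thesis unfolding Hom_def by (auto intro!: exI[of _ "%b. of_bool (b = \<beta>)"])
qed

lemma hmon_incr: "hmon (incr b i) x = coord x i * hmon b x"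
 unfolding hmon_def by (rule monomial_incr)

lemma hmon_add: "hmon b x * hmon \<gamma> x = hmon (%i. b i + \<gamma> i) x"
 by (simp add: hmon_def prod.distrib power_add)

lemma hmon_homogenize: "hmon b x = (\<Sum>i\<in>UNIV. hmon (incr b i) x)"
 unfolding hmon_incr sum_distrib_right[symmetric] by simp

lemma Hom_Suc: "p \<in> Hom n ==> p \<in> Hom (Suc n)"
proof -
 assume "p \<in> Hom n"
 then obtain c where p: "p = (%x. \<Sum>b\<in>degs n. c b * hmon b x)" by (auto simp: Hom_def)
 have "hmon b \<in> Hom (Suc n)" if "b \<in> degs n" for b :: "'a option => nat"
 proof -
  have "(%x. \<Sum>i\<in>UNIV. hmon (incr b i) x) \<in> Hom (Suc n)"
   using that by (intro Hom_sum hmon_in_Hom) (simp add: incr_in_degs)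
  then show ?thesis by (simp add: hmon_homogenize[symmetric])
 qed
 then show ?thesis unfolding p by (intro Hom_sum Hom_scale)
qed

lemma Hom_mono: "p \<in> Hom n ==> n <= k ==> p \<in> Hom k"
 by (induction k rule: nat_induct) (auto simp: le_Suc_eq intro: Hom_Suc)

text \<open>The barycentric coordinates sum to 1, so every monomial of lower degree can be multiplied up to degree exactly
\<open>n\<close>.\<close>

lemma Poly_deg_eq_Hom: "Poly_deg n = Hom n"
proof (intro equalityI subsetI)
 fix p :: "real^'a => real" assume "p \<in> Poly_deg n"
 then show "p \<in> Hom n"
 proof (induction rule: Poly_deg_induct)
  case (mon m)
  have "case_option 0 m \<in> degs (\<Sum>i\<in>UNIV. m i)" by (simp add: degs_def sum_UNIV_option)
  from Hom_mono[OF hmon_in_Hom[OF this] mon] show ?case by (simp add: xmon_eq_hmon)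
 qed (simp_all add: Hom_zero Hom_add Hom_scale)
next
 fix p :: "real^'a => real" assume "p \<in> Hom n"
 then obtain c where p: "p = (%x. \<Sum>b\<in>degs n. c b * hmon b x)" by (auto simp: Hom_def)
 have "hmon b \<in> Poly_deg n" if "b \<in> degs n" for b :: "'a option => nat"
  using Poly_deg_hmon[of b] that by (simp add: degs_def)
 then show "p \<in> Poly_deg n" unfolding p by (intro Poly_deg_sum Poly_deg_scale)
qed

lemma interior_simplex_nonempty: "interior (simplex_S :: (real^'d::finite) set) ~= {}"
proof -
 define U where "U = (\<Inter>i. {x :: real^'d. 0 < coord x i})"
 have "open U" unfolding U_def by (intro open_INT finite_class.finite_UNIV ballI open_Collect_less continuous_intros)
 moreover have "U \<subseteq> simplex_S" by (auto simp: U_def simplex_S_def less_imp_le)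
 ultimately have "U \<subseteq> interior simplex_S" by (rule interior_maximal[rotated])
 moreover have "(\<chi> i. 1 / (real CARD('d) + 1)) \<in> U"
  unfolding U_def
 proof (intro INT_I CollectI)
  fix i :: "'d option"
  show "0 < coord (\<chi> i. 1 / (real CARD('d) + 1)) i" by (cases i) (auto simp: field_simps)
 qed
 ultimately show ?thesis by auto
qed

lemma Poly_deg_eqI:
 assumes "p \<in> Poly_deg k" "q \<in> Poly_deg l" "!!x. x \<in> interior simplex_S ==> p x = q x"
 shows "p = q"
proof
 fix y
 have "(%x. p x - q x) \<in> Poly_deg (max k l)"
  by (intro Poly_deg_diff Poly_deg_mono[OF assms(1)] Poly_deg_mono[OF assms(2)]) auto
 from Poly_deg_zero_on_open[OF this open_interior interior_simplex_nonempty] assms(3)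
 have "p y - q y = 0" by simp
 then show "p y = q y" by simp
qed

text \<open>The polynomial that agrees with \<open>P_op \<alpha> (hmon b)\<close> in the interior of the simplex.\<close>

definition Phmon :: "('d::finite option => real) => ('d option => nat) => real^'d => real" where
 "Phmon \<alpha> b x = real (\<Sum>i\<in>UNIV. b i) * (real (\<Sum>i\<in>UNIV. b i) + sig \<alpha>) * hmon b x -
  (\<Sum>i\<in>UNIV. real (b i) * ((real (b i) + \<alpha> i) * hmon (decr b i) x))"

lemma P_op_hmon_sum:
 fixes \<alpha> :: "'d::finite option => real"
 assumes "finite A"
 shows "edge_smooth \<alpha> (%x. \<Sum>b\<in>A. c b * hmon b x) \<and>
  (\<forall>x\<in>interior simplex_S. P_op \<alpha> (%x. \<Sum>b\<in>A. c b * hmon b x) x = (\<Sum>b\<in>A. c b * Phmon \<alpha> b x))"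
 using assms
proof (induction A rule: finite_induct)
 case empty
 have "edge_smooth \<alpha> (%x. 0 * hmon (%_. 0) x) \<and> (\<forall>x\<in>interior simplex_S. P_op \<alpha> (%x. 0 * hmon (%_. 0) x) x = 0 * P_op \<alpha> (hmon (%_. 0)) x)"
  by (rule edge_smooth_scale[OF edge_smooth_hmon])
 then show ?case by simp
next
 case (insert b A)
 have 1: "edge_smooth \<alpha> (%x. c b * hmon b x) \<and> (\<forall>x\<in>interior simplex_S. P_op \<alpha> (%x. c b * hmon b x) x = c b * Phmon \<alpha> b x)"
  using edge_smooth_scale[OF edge_smooth_hmon, of \<alpha> "c b" b] P_op_hmon[of _ \<alpha> b] by (simp add: Phmon_def mult.assoc)
 from edge_smooth_add[OF conjunct1[OF 1] conjunct1[OF insert.IH]] 1 insert show ?case by simp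
qed

lemma P_op_Hom:
 assumes "x \<in> interior simplex_S"
 shows "P_op \<alpha> (%x. \<Sum>b\<in>degs n. c b * hmon b x) x = (\<Sum>b\<in>degs n. c b * Phmon \<alpha> b x)"
 using P_op_hmon_sum[OF finite_degs, of \<alpha> c] assms by blast

lemma edge_smooth_Poly: "p \<in> Poly_deg k ==> edge_smooth \<alpha> p"
 using P_op_hmon_sum[OF finite_degs, of \<alpha>] unfolding Poly_deg_eq_Hom Hom_def by blast

lemma P_op_add: "p \<in> Poly_deg k ==> q \<in> Poly_deg l ==> x \<in> interior simplex_S ==>
  P_op \<alpha> (%x. p x + q x) x = P_op \<alpha> p x + P_op \<alpha> q x"
 using edge_smooth_add[OF edge_smooth_Poly edge_smooth_Poly] by blast

lemma P_op_scale: "p \<in> Poly_deg k ==> x \<in> interior simplex_S ==> P_op \<alpha> (%x. a * p x) x = a * P_op \<alpha> p x"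
 using edge_smooth_scale[OF edge_smooth_Poly] by blast

lemma H_spaceI: "h \<in> Poly_deg l ==> (!!x. x \<in> interior simplex_S ==> P_op \<alpha> h x = eigenval \<alpha> l * h x) ==> h \<in> H_space \<alpha> l"
 by (simp add: H_space_def)

lemma H_space_Poly: "h \<in> H_space \<alpha> l ==> h \<in> Poly_deg l"
 by (simp add: H_space_def)

lemma H_space_add: "h \<in> H_space \<alpha> l ==> g \<in> H_space \<alpha> l ==> (%x. h x + g x) \<in> H_space \<alpha> l"
 unfolding H_space_def using P_op_add[of h l g l] Poly_deg_add by (auto simp: distrib_left)

lemma H_space_scale: "h \<in> H_space \<alpha> l ==> (%x. a * h x) \<in> H_space \<alpha> l"
 unfolding H_space_def using P_op_scale[of h l] Poly_deg_scale by auto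

lemma H_space_zero: "(%x. 0) \<in> H_space \<alpha> l"
proof (rule H_spaceI)
 fix x :: "real^'a" assume "x \<in> interior simplex_S"
 from P_op_scale[OF Poly_deg_zero this, where \<alpha>=\<alpha> and a=0] show "P_op \<alpha> (%x. 0) x = eigenval \<alpha> l * 0" by simp
qed (rule Poly_deg_zero)

lemma H_space_diff: "h \<in> H_space \<alpha> l ==> g \<in> H_space \<alpha> l ==> (%x. h x - g x) \<in> H_space \<alpha> l"
 using H_space_add[OF _ H_space_scale[of g \<alpha> l "-1"], of h] by simp

definition Poly_lt :: "nat => (real^'d::finite => real) set" where
 "Poly_lt k = (if k = 0 then {%x. 0} else Poly_deg (k - 1))"

lemma Poly_lt_add: "p \<in> Poly_lt k ==> q \<in> Poly_lt k ==> (%x. p x + q x) \<in> Poly_lt k"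
 by (auto simp: Poly_lt_def Poly_deg_add split: if_splits)

lemma Poly_lt_scale: "p \<in> Poly_lt k ==> (%x. a * p x) \<in> Poly_lt k"
 by (auto simp: Poly_lt_def Poly_deg_scale split: if_splits)

lemma Poly_lt_zero: "(%x. 0) \<in> Poly_lt k"
 by (auto simp: Poly_lt_def Poly_deg_zero)

lemma Poly_deg_Poly_lt: "p \<in> Poly_deg j ==> j < k ==> p \<in> Poly_lt k"
 unfolding Poly_lt_def using Poly_deg_mono[of p j "k - 1"] by auto

text \<open>The operator is triangular with respect to the degree, with diagonal entries \<open>eigenval \<alpha>
k\<close>.\<close>

lemma P_op_triangular:
 assumes "p \<in> Poly_deg k"
 shows "\<exists>q\<in>Poly_lt k. \<forall>x\<in>interior simplex_S. P_op \<alpha> p x = eigenval \<alpha> k * p x + q x"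
proof -
 have "p \<in> Poly_deg k \<and> ?thesis" using assms
 proof (induction rule: Poly_deg_induct)
  case (mon m)
  define b where "b = case_option 0 m"
  define n where "n = (\<Sum>i\<in>UNIV. m i)"
  have bn: "(\<Sum>i\<in>UNIV. b i) = n" by (simp add: b_def n_def sum_UNIV_option)
  have n: "n <= k" using mon by (simp add: n_def)
  have low: "(%x. real (b i) * ((real (b i) + \<alpha> i) * hmon (decr b i) x)) \<in> Poly_lt k" for i
  proof (cases "b i = 0")
   case True then show ?thesis by (simp add: Poly_lt_zero)
  next
   case False
   then have "incr (decr b i) i = b" by auto
   then have "Suc (\<Sum>j\<in>UNIV. decr b i j) = n" using sum_incr[of "decr b i" i] bn by simp
   then have "hmon (decr b i) \<in> Poly_lt k" using n by (intro Poly_deg_Poly_lt[OF Poly_deg_hmon]) simp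
   then show ?thesis by (intro Poly_lt_scale)
  qed
  have "(%x. \<Sum>i\<in>A. real (b i) * ((real (b i) + \<alpha> i) * hmon (decr b i) x)) \<in> Poly_lt k" if "finite A" for A
   using that
  proof (induction A rule: finite_induct)
   case (insert i A)
   show ?case unfolding sum.insert[OF insert.hyps] by (rule Poly_lt_add[OF low[of i] insert.IH])
  qed (simp add: Poly_lt_zero)
  from this[of UNIV] have s: "(%x. \<Sum>i\<in>UNIV. real (b i) * ((real (b i) + \<alpha> i) * hmon (decr b i) x)) \<in> Poly_lt k" by simp
  have t: "(%x. (eigenval \<alpha> n - eigenval \<alpha> k) * hmon b x) \<in> Poly_lt k"
  proof (cases "n = k")
   case False
   then show ?thesis using n bn Poly_deg_hmon[of b] by (intro Poly_lt_scale Poly_deg_Poly_lt[of _ n]) auto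
  qed (simp add: Poly_lt_zero)
  have "P_op \<alpha> (hmon b) x = eigenval \<alpha> k * hmon b x + ((eigenval \<alpha> n - eigenval \<alpha> k) * hmon b x +
   (-1) * (\<Sum>i\<in>UNIV. real (b i) * ((real (b i) + \<alpha> i) * hmon (decr b i) x)))" if "x \<in> interior simplex_S" for x
   unfolding P_op_hmon[OF that] bn by (simp add: eigenval_sig algebra_simps)
  with Poly_lt_add[OF t Poly_lt_scale[OF s, of "-1"]]
  show ?case unfolding xmon_eq_hmon b_def[symmetric]
   using Poly_deg_mono[OF Poly_deg_hmon[of b], of k] n bn by auto
 next
  case zero
  show ?case using Poly_deg_zero H_space_zero[of \<alpha> k] Poly_lt_zero[of k] by (auto simp: H_space_def intro!: bexI[of _ "%x. 0"])
 next
  case (add p q)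
  then obtain p' q' where "p' \<in> Poly_lt k" "q' \<in> Poly_lt k"
   "!!x. x\<in>interior simplex_S ==> P_op \<alpha> p x = eigenval \<alpha> k * p x + p' x"
   "!!x. x\<in>interior simplex_S ==> P_op \<alpha> q x = eigenval \<alpha> k * q x + q' x" by blast
  then show ?case using add P_op_add[of p k q k] Poly_deg_add[of p k q]
   by (auto intro!: bexI[OF _ Poly_lt_add[of p' k q']] simp: algebra_simps)
 next
  case (scale p a)
  then obtain p' where "p' \<in> Poly_lt k"
   "!!x. x\<in>interior simplex_S ==> P_op \<alpha> p x = eigenval \<alpha> k * p x + p' x" by blast
  then show ?case using scale P_op_scale[of p k] Poly_deg_scale[of p k]
   by (auto intro!: bexI[OF _ Poly_lt_scale[of p' k a]] simp: algebra_simps)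
 qed
 then show ?thesis by simp
qed

lemma simplex_S_compact: "compact (simplex_S :: (real^'d::finite) set)"
 unfolding simplex_S_hull by (intro finite_imp_compact_convex_hull) auto

lemma bounded_on_simplex:
 assumes "p \<in> Poly_deg k" shows "\<exists>C. \<forall>x\<in>simplex_S. \<bar>p x\<bar> <= C"
proof -
 have "bounded (p ` simplex_S)"
  by (intro compact_imp_bounded compact_continuous_image Poly_deg_continuous[OF assms] simplex_S_compact)
 then show ?thesis by (auto simp: bounded_iff)
qed

locale jacobi =
 fixes \<alpha> :: "'d::finite option => real"
 assumes alpha: "!!i. \<alpha> i > - 1 / 2"
begin

abbreviation "mu \<equiv> jacobi_measure \<alpha>"
abbreviation "\<sigma> \<equiv> sig \<alpha>"
abbreviation "lam \<equiv> eigenval \<alpha>"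

lemma alpha1: "\<alpha> i > -1" "0 < \<alpha> i + 1"
 using alpha[of i] by auto

lemma sigma_pos: "0 < \<sigma>"
proof -
 have "(\<Sum>i\<in>(UNIV :: 'd option set). - (1 / 2)) < (\<Sum>i\<in>UNIV. \<alpha> i)"
  by (intro sum_strict_mono) (use alpha in auto)
 then have "- ((real CARD('d) + 1) / 2) < (\<Sum>i\<in>UNIV. \<alpha> i)" by (simp add: field_simps)
 moreover have "1 <= real CARD('d)"
  by (metis One_nat_def Suc_leI of_nat_1 of_nat_mono zero_less_card_finite)
 moreover have "- ((c + 1) / 2) < s ==> 1 <= c ==> 0 < c + s" for c s :: real
  by (simp add: field_simps)
 ultimately show ?thesis unfolding sig_def by blast
qed

lemma lam_alt: "lam l = real l * (real l + \<sigma>)"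
 by (rule eigenval_sig)

lemma lam_0 [simp]: "lam 0 = 0"
 by (simp add: lam_alt)

lemma lam_strict_mono: "l < k ==> lam l < lam k"
 unfolding lam_alt using sigma_pos by (intro mult_strict_mono) auto

lemma lam_pos: "l > 0 ==> 0 < lam l"
 using lam_strict_mono[of 0 l] by simp

lemma lam_nonneg: "0 <= lam l"
 using lam_pos[of l] by (cases "l = 0") auto

lemma lam_eq_iff: "lam l = lam k \<longleftrightarrow> l = k"
 using lam_strict_mono[of l k] lam_strict_mono[of k l] by (cases l k rule: linorder_cases) auto

section \<open>Orthogonal decomposition\<close>

text \<open>The eigenvalues are distinct, so a triangular operator is diagonalised by eliminating lower degrees one by
one.\<close>

lemma decomposition_exists:
 "p \<in> Poly_deg k ==> \<exists>h. (\<forall>l. h l \<in> H_space \<alpha> l) \<and> p = (%x. \<Sum>l\<le>k. h l x)"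
proof (induction k arbitrary: p)
 case 0
 obtain q where "q \<in> Poly_lt 0" "\<forall>x\<in>interior simplex_S. P_op \<alpha> p x = eigenval \<alpha> 0 * p x + q x"
  using P_op_triangular[OF 0] by blast
 then have "p \<in> H_space \<alpha> 0" using 0 by (intro H_spaceI) (auto simp: Poly_lt_def)
 then show ?case by (intro exI[of _ "%l. if l = 0 then p else (%x. 0)"]) (auto simp: H_space_zero)
next
 case (Suc k)
 obtain q where q: "q \<in> Poly_lt (Suc k)" "!!x. x\<in>interior simplex_S ==> P_op \<alpha> p x = lam (Suc k) * p x + q x"
  using P_op_triangular[OF Suc.prems] by blast
 have "q \<in> Poly_deg k" using q(1) by (simp add: Poly_lt_def)
 then obtain h where h: "!!l. h l \<in> H_space \<alpha> l" "q = (%x. \<Sum>l\<le>k. h l x)" using Suc.IH by blast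
 define c where "c l = 1 / (lam l - lam (Suc k))" for l
 define s where "s A x = (\<Sum>l\<in>A. c l * h l x)" for A x
 have s: "s A \<in> Poly_deg k \<and> (\<forall>x\<in>interior simplex_S. P_op \<alpha> (s A) x = (\<Sum>l\<in>A. c l * (lam l * h l x)))"
  if "finite A" "A \<subseteq> {..k}" for A
  using that
 proof (induction A rule: finite_induct)
  case empty
  show ?case using Poly_deg_zero H_space_zero[of \<alpha> 0] by (simp add: s_def[abs_def] H_space_def)
 next
  case (insert l A)
  have e: "s (insert l A) = (%x. c l * h l x + s A x)" using insert.hyps by (simp add: s_def[abs_def])
  have hl: "h l \<in> Poly_deg k" using Poly_deg_mono[OF H_space_Poly[OF h(1)]] insert.prems by simp
  have hP: "P_op \<alpha> (h l) x = lam l * h l x" if "x \<in> interior simplex_S" for x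
   using h(1)[of l] that by (simp add: H_space_def)
  show ?case unfolding e using insert Poly_deg_add[OF Poly_deg_scale[OF hl]]
   P_op_add[OF Poly_deg_scale[OF hl], of "s A" k] P_op_scale[OF hl] by (auto simp: hP)
 qed
 have sk: "s {..k} \<in> Poly_deg (Suc k)" using s[of "{..k}"] Poly_deg_mono[of "s {..k}" k "Suc k"] by auto
 define g where "g x = p x + (-1) * s {..k} x" for x
 have "g \<in> H_space \<alpha> (Suc k)"
 proof (rule H_spaceI)
  show "g \<in> Poly_deg (Suc k)" unfolding g_def[abs_def] using Suc.prems sk by (intro Poly_deg_add Poly_deg_scale)
  fix x :: "real^'d" assume x: "x \<in> interior simplex_S"
  have "P_op \<alpha> g x = P_op \<alpha> p x + (-1) * P_op \<alpha> (s {..k}) x"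
   unfolding g_def[abs_def] using P_op_add[OF Suc.prems Poly_deg_scale[OF sk] x, of \<alpha> "-1"] P_op_scale[OF sk x, of \<alpha> "-1"] by simp
  also have "P_op \<alpha> (s {..k}) x = (\<Sum>l\<le>k. c l * (lam l * h l x))" using s[of "{..k}"] x by simp
  also have "P_op \<alpha> p x = lam (Suc k) * p x + (\<Sum>l\<le>k. h l x)" using q(2)[OF x] h(2) by simp
  finally have "P_op \<alpha> g x = lam (Suc k) * p x + (\<Sum>l\<le>k. h l x - c l * (lam l * h l x))"
   by (simp add: sum_subtractf)
  also have "(\<Sum>l\<le>k. h l x - c l * (lam l * h l x)) = (\<Sum>l\<le>k. - lam (Suc k) * (c l * h l x))"
  proof (rule sum.cong[OF refl])
   fix l assume "l \<in> {..k}"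
   then have "lam l - lam (Suc k) ~= 0" using lam_eq_iff[of l "Suc k"] by simp
   then show "h l x - c l * (lam l * h l x) = - lam (Suc k) * (c l * h l x)"
    by (simp add: c_def field_simps)
  qed
  also have "... = - lam (Suc k) * s {..k} x" by (simp add: s_def sum_distrib_left)
  finally show "P_op \<alpha> g x = lam (Suc k) * g x" by (simp only: g_def[of x]) (simp add: right_diff_distrib)
 qed
 moreover have "p = (%x. (\<Sum>l\<le>k. c l * h l x) + g x)" by (simp add: g_def s_def)
 ultimately show ?case
  by (intro exI[of _ "%l. if l <= k then (%x. c l * h l x) else if l = Suc k then g else (%x. 0)"])
    (auto simp: H_space_zero H_space_scale h(1) fun_eq_iff intro!: sum.cong)
qed

lemma sum_alpha: "(\<Sum>i\<in>UNIV. real (b i) + \<alpha> i + 1) = real (\<Sum>i\<in>UNIV. b i) + \<sigma> + 1"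
 by (simp add: sum.distrib sig_def)

lemma moment_pos: "0 < moment \<alpha> b"
proof -
 have "0 < real (b i) + \<alpha> i + 1" for i using alpha1(2)[of i] by simp
 moreover have "0 < real (\<Sum>i\<in>UNIV. b i) + \<sigma> + 1" using sigma_pos of_nat_0_le_iff[of "\<Sum>i\<in>UNIV. b i"] by linarith
 ultimately show ?thesis unfolding moment_def sum_alpha by (intro divide_pos_pos prod_pos Gamma_real_pos ballI)
qed

lemma moment_incr:
 "moment \<alpha> (incr b i) = moment \<alpha> b * (real (b i) + \<alpha> i + 1) / (real (\<Sum>i\<in>UNIV. b i) + \<sigma> + 1)"
proof -
 have Gp: "Gamma (x + 1) = x * Gamma x" if "0 < x" for x :: real
  using that nonpos_Ints_nonpos[of x] by (intro Gamma_plus1) auto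
 have "real (b i) + \<alpha> i + 1 > 0" using alpha1(2)[of i] by simp
 from Gp[OF this] have 1: "Gamma (real (Suc (b i)) + \<alpha> i + 1) = (real (b i) + \<alpha> i + 1) * Gamma (real (b i) + \<alpha> i + 1)"
  by (simp add: add_ac)
 have n: "real (\<Sum>i\<in>UNIV. b i) + \<sigma> + 1 > 0" using sigma_pos of_nat_0_le_iff[of "\<Sum>i\<in>UNIV. b i"] by linarith
 from Gp[OF this] have 2: "Gamma (real (\<Sum>j\<in>UNIV. incr b i j) + \<sigma> + 1) =
   (real (\<Sum>i\<in>UNIV. b i) + \<sigma> + 1) * Gamma (real (\<Sum>i\<in>UNIV. b i) + \<sigma> + 1)"
  unfolding sum_incr by (simp add: add_ac)
 have "(\<Prod>j\<in>UNIV. Gamma (real (incr b i j) + \<alpha> j + 1)) =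
   (real (b i) + \<alpha> i + 1) * (\<Prod>j\<in>UNIV. Gamma (real (b j) + \<alpha> j + 1))"
  using prod_incr[of "%j n. Gamma (real n + \<alpha> j + 1)" i b, OF 1] .
 then show ?thesis unfolding moment_def sum_alpha 2 by (simp add: mult_ac)
qed

lemma has_moment: "has_bochner_integral mu (hmon b) (moment \<alpha> b)"
proof -
 have "AE x in mu. 0 <= hmon b x"
  using AE_jacobi[of \<alpha>] by eventually_elim (auto simp: hmon_def simplex_S_def intro!: prod_nonneg simp del: coord.simps)
 then show ?thesis
  using nn_integral_hmon[of \<alpha> b, OF alpha1(1)] moment_pos[of b] by (intro has_bochner_integral_nn_integral) auto
qed

lemma finite_measure_jacobi: "finite_measure mu"
proof
 have "emeasure mu (space mu) = (\<integral>\<^sup>+x. ennreal (hmon (%_. 0) x) \<partial>mu)" by (simp add: hmon_def)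
 then show "emeasure mu (space mu) ~= \<infinity>" using nn_integral_hmon[of \<alpha> "%_. 0", OF alpha1(1)] by simp
qed

sublocale finite_measure mu by (rule finite_measure_jacobi)

sublocale pair_sigma_finite mu mu ..

lemma integrable_Poly_mult:
 assumes f: "integrable mu f" and p: "p \<in> Poly_deg k"
 shows "integrable mu (%x. f x * p x)"
proof -
 obtain C where C: "!!x. x\<in>simplex_S ==> \<bar>p x\<bar> <= C" using bounded_on_simplex[OF p] by auto
 have [measurable]: "p \<in> borel_measurable borel" by (rule Poly_deg_measurable[OF p])
 have [measurable]: "f \<in> borel_measurable mu" using f by auto
 have ae: "AE x in mu. norm (f x * p x) <= norm (C * f x)"
  using AE_jacobi[of \<alpha>]
 proof eventually_elim
  case (elim x)
  then have "\<bar>p x\<bar> <= \<bar>C\<bar>" using C[of x] by linarith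
  then have "\<bar>f x\<bar> * \<bar>p x\<bar> <= \<bar>f x\<bar> * \<bar>C\<bar>" by (intro mult_left_mono) auto
  then show ?case by (simp add: abs_mult mult.commute)
 qed
 show ?thesis by (rule Bochner_Integration.integrable_bound[OF integrable_mult_right[OF f, of C] _ ae]) measurable
qed

lemma integrable_Poly: "p \<in> Poly_deg k ==> integrable mu p"
 using integrable_Poly_mult[of "%_. 1" p k] by simp

lemma integrable_hmon: "integrable mu (hmon b)"
 using has_moment by (rule integrable.intros)

lemma integral_hmon: "(LINT x|mu. hmon b x) = moment \<alpha> b"
 using has_moment by (rule has_bochner_integral_integral_eq)

text \<open>Symmetry of the operator on monomials. Both sides are explicit because the moments obey the recursion of the
Gamma function; no boundary terms arise.\<close>

lemma integral_Phmon:
 assumes "\<beta> \<in> degs n" "\<gamma> \<in> degs n"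
 shows "(LINT x|mu. Phmon \<alpha> \<beta> x * hmon \<gamma> x) = (LINT x|mu. hmon \<beta> x * Phmon \<alpha> \<gamma> x)"
proof -
 have gen: "(LINT x|mu. Phmon \<alpha> \<beta> x * hmon \<gamma> x) =
   real n * (real n + \<sigma>) * moment \<alpha> (%i. \<beta> i + \<gamma> i) -
   moment \<alpha> (%i. \<beta> i + \<gamma> i) * (2 * real n + \<sigma>) * (\<Sum>i\<in>UNIV. real (\<beta> i) * (real (\<beta> i) + \<alpha> i) / (real (\<beta> i + \<gamma> i) + \<alpha> i))"
  if b: "\<beta> \<in> degs n" and c: "\<gamma> \<in> degs n" for \<beta> \<gamma> :: "'d option => nat"
 proof -
  let ?d = "%i. \<beta> i + \<gamma> i"
  have trm: "real (\<beta> i) * ((real (\<beta> i) + \<alpha> i) * moment \<alpha> (%j. decr \<beta> i j + \<gamma> j)) =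
   moment \<alpha> ?d * (2 * real n + \<sigma>) * (real (\<beta> i) * (real (\<beta> i) + \<alpha> i) / (real (\<beta> i + \<gamma> i) + \<alpha> i))" for i
  proof (cases "\<beta> i = 0")
   case False
   define e where "e = (%j. decr \<beta> i j + \<gamma> j)"
   have d: "incr e i = ?d" using False by (auto simp: e_def fun_eq_iff)
   have "Suc (\<Sum>j\<in>UNIV. e j) = 2 * n" using sum_incr[of e i] b c unfolding d by (simp add: degs_def sum.distrib)
   then have s: "real (\<Sum>j\<in>UNIV. e j) + 1 = 2 * real n" by linarith
   have e: "real (e i) + 1 = real (\<beta> i + \<gamma> i)" using False by (simp add: e_def)
   have p: "0 < real (\<beta> i + \<gamma> i) + \<alpha> i" using False alpha[of i] by (cases "\<beta> i") auto
   have "moment \<alpha> ?d = moment \<alpha> e * (real (e i) + \<alpha> i + 1) / (real (\<Sum>j\<in>UNIV. e j) + \<sigma> + 1)"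
    using moment_incr[of e i] unfolding d .
   also have "real (e i) + \<alpha> i + 1 = real (\<beta> i + \<gamma> i) + \<alpha> i" using e by simp
   also have "real (\<Sum>j\<in>UNIV. e j) + \<sigma> + 1 = 2 * real n + \<sigma>" using s by simp
   finally have m: "moment \<alpha> ?d = moment \<alpha> e * (real (\<beta> i + \<gamma> i) + \<alpha> i) / (2 * real n + \<sigma>)" .
   have n: "2 * real n + \<sigma> ~= 0" using sigma_pos of_nat_0_le_iff[of n] by linarith
   have "moment \<alpha> e * (real (\<beta> i + \<gamma> i) + \<alpha> i) / (2 * real n + \<sigma>) * (2 * real n + \<sigma>) =
    moment \<alpha> e * (real (\<beta> i + \<gamma> i) + \<alpha> i)" using n by simp
   then show ?thesis unfolding e_def[symmetric] m using p by simp
  qed simp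
  have int: "integrable mu (%x. real (\<beta> i) * ((real (\<beta> i) + \<alpha> i) * hmon (%j. decr \<beta> i j + \<gamma> j) x))" for i
   by (intro integrable_mult_right integrable_hmon)
  have "(LINT x|mu. Phmon \<alpha> \<beta> x * hmon \<gamma> x) = (LINT x|mu. real n * (real n + \<sigma>) * hmon ?d x -
   (\<Sum>i\<in>UNIV. real (\<beta> i) * ((real (\<beta> i) + \<alpha> i) * hmon (%j. decr \<beta> i j + \<gamma> j) x)))"
  proof (intro Bochner_Integration.integral_cong refl)
   fix x
   have "(\<Sum>i\<in>UNIV. real (\<beta> i) * ((real (\<beta> i) + \<alpha> i) * hmon (decr \<beta> i) x)) * hmon \<gamma> x =
    (\<Sum>i\<in>UNIV. real (\<beta> i) * ((real (\<beta> i) + \<alpha> i) * hmon (%j. decr \<beta> i j + \<gamma> j) x))"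
    by (simp only: sum_distrib_right mult.assoc hmon_add)
   then show "Phmon \<alpha> \<beta> x * hmon \<gamma> x = real n * (real n + \<sigma>) * hmon ?d x -
   (\<Sum>i\<in>UNIV. real (\<beta> i) * ((real (\<beta> i) + \<alpha> i) * hmon (%j. decr \<beta> i j + \<gamma> j) x))"
    using b by (simp only: Phmon_def left_diff_distrib mult.assoc hmon_add) (simp add: degs_def)
  qed
  also have "... = real n * (real n + \<sigma>) * moment \<alpha> ?d -
   (\<Sum>i\<in>UNIV. real (\<beta> i) * ((real (\<beta> i) + \<alpha> i) * moment \<alpha> (%j. decr \<beta> i j + \<gamma> j)))"
   using int integrable_hmon
   by (simp add: integral_hmon Bochner_Integration.integral_sum Bochner_Integration.integral_diff)
  also have "... = real n * (real n + \<sigma>) * moment \<alpha> ?d - moment \<alpha> ?d * (2 * real n + \<sigma>) *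
   (\<Sum>i\<in>UNIV. real (\<beta> i) * (real (\<beta> i) + \<alpha> i) / (real (\<beta> i + \<gamma> i) + \<alpha> i))"
   by (simp only: trm sum_distrib_left)
  finally show ?thesis .
 qed
 have com: "(%i. \<gamma> i + \<beta> i) = (%i. \<beta> i + \<gamma> i)" by (simp add: add.commute)
 have eq: "(\<Sum>i\<in>UNIV. real (\<beta> i) * (real (\<beta> i) + \<alpha> i) / (real (\<beta> i + \<gamma> i) + \<alpha> i)) =
  (\<Sum>i\<in>UNIV. real (\<gamma> i) * (real (\<gamma> i) + \<alpha> i) / (real (\<gamma> i + \<beta> i) + \<alpha> i))"
 proof -
  have "real (\<beta> i) * (real (\<beta> i) + \<alpha> i) / (real (\<beta> i + \<gamma> i) + \<alpha> i) -
   real (\<gamma> i) * (real (\<gamma> i) + \<alpha> i) / (real (\<gamma> i + \<beta> i) + \<alpha> i) = real (\<beta> i) - real (\<gamma> i)" for i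
  proof (cases "\<beta> i + \<gamma> i = 0")
   case False
   then have "1 <= real (\<beta> i + \<gamma> i)" by (metis One_nat_def Suc_leI of_nat_1 of_nat_mono neq0_conv)
   then have P: "real (\<beta> i + \<gamma> i) + \<alpha> i ~= 0" using alpha[of i] by linarith
   have "real (\<beta> i) * (real (\<beta> i) + \<alpha> i) - real (\<gamma> i) * (real (\<gamma> i) + \<alpha> i) =
    (real (\<beta> i) - real (\<gamma> i)) * (real (\<beta> i + \<gamma> i) + \<alpha> i)" by (simp add: algebra_simps)
   then show ?thesis
    unfolding add.commute[of "\<gamma> i"] diff_divide_distrib[symmetric] using P by simp
  qed simp
  then have "(\<Sum>i\<in>UNIV. real (\<beta> i) * (real (\<beta> i) + \<alpha> i) / (real (\<beta> i + \<gamma> i) + \<alpha> i)) -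
   (\<Sum>i\<in>UNIV. real (\<gamma> i) * (real (\<gamma> i) + \<alpha> i) / (real (\<gamma> i + \<beta> i) + \<alpha> i)) = (\<Sum>i\<in>UNIV. real (\<beta> i) - real (\<gamma> i))"
   by (simp only: sum_subtractf[symmetric])
  also have "... = real (\<Sum>i\<in>UNIV. \<beta> i) - real (\<Sum>i\<in>UNIV. \<gamma> i)" by (simp add: sum_subtractf)
  also have "... = 0" using assms by (simp add: degs_def)
  finally show ?thesis by simp
 qed
 show ?thesis using gen[OF assms] gen[OF assms(2,1)] unfolding com eq by (simp only: mult.commute[of "hmon \<beta> _"])
qed

lemma Phmon_Poly: "Phmon \<alpha> b \<in> Poly_deg (\<Sum>i\<in>UNIV. b i)"
proof -
 obtain q where q: "q \<in> Poly_lt (\<Sum>i\<in>UNIV. b i)" "!!x. x\<in>interior simplex_S ==>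
   P_op \<alpha> (hmon b) x = lam (\<Sum>i\<in>UNIV. b i) * hmon b x + q x"
  using P_op_triangular[OF Poly_deg_hmon, of b \<alpha>] by blast
 have "(%x. \<Sum>i\<in>UNIV. real (b i) * ((real (b i) + \<alpha> i) * hmon (decr b i) x)) \<in> Poly_deg (\<Sum>i\<in>UNIV. b i)"
 proof (intro Poly_deg_sum Poly_deg_scale)
  fix i
  have "(\<Sum>j\<in>UNIV. decr b i j) <= (\<Sum>j\<in>UNIV. b j)" by (intro sum_mono) auto
  then show "hmon (decr b i) \<in> Poly_deg (\<Sum>i\<in>UNIV. b i)" by (rule Poly_deg_mono[OF Poly_deg_hmon])
 qed
 then show ?thesis unfolding Phmon_def[abs_def] by (intro Poly_deg_diff Poly_deg_scale Poly_deg_hmon)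
qed

lemma H_space_coeffs:
 assumes h: "h \<in> H_space \<alpha> l" and n: "l <= n"
 obtains c where "!!x. h x = (\<Sum>b\<in>degs n. c b * hmon b x)" "!!x. lam l * h x = (\<Sum>b\<in>degs n. c b * Phmon \<alpha> b x)"
proof -
 have "h \<in> Hom n" using Poly_deg_mono[OF H_space_Poly[OF h] n] by (simp add: Poly_deg_eq_Hom)
 then obtain c where c: "h = (%x. \<Sum>b\<in>degs n. c b * hmon b x)" by (auto simp: Hom_def)
 have "(%x. lam l * h x) = (%x. \<Sum>b\<in>degs n. c b * Phmon \<alpha> b x)"
 proof (rule Poly_deg_eqI)
  show "(%x. lam l * h x) \<in> Poly_deg l" by (rule Poly_deg_scale[OF H_space_Poly[OF h]])
  have "Phmon \<alpha> b \<in> Poly_deg n" if "b \<in> degs n" for b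
   using Phmon_Poly[of b] that by (simp add: degs_def)
  then show "(%x. \<Sum>b\<in>degs n. c b * Phmon \<alpha> b x) \<in> Poly_deg n" by (intro Poly_deg_sum Poly_deg_scale)
  fix x :: "real^'d" assume x: "x \<in> interior simplex_S"
  have "lam l * h x = P_op \<alpha> h x" using h x by (simp add: H_space_def)
  also have "... = (\<Sum>b\<in>degs n. c b * Phmon \<alpha> b x)" unfolding c by (rule P_op_Hom[OF x])
  finally show "lam l * h x = (\<Sum>b\<in>degs n. c b * Phmon \<alpha> b x)" .
 qed
 then have "!!x. lam l * h x = (\<Sum>b\<in>degs n. c b * Phmon \<alpha> b x)" by (simp add: fun_eq_iff)
 then show ?thesis using that[of c] c by simp
qed

lemma integrable_hmon_Phmon: "integrable mu (%x. hmon b x * Phmon \<alpha> \<gamma> x)" "integrable mu (%x. Phmon \<alpha> \<gamma> x * hmon b x)"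
 using integrable_Poly_mult[OF integrable_hmon Phmon_Poly] by (auto simp: mult.commute)

lemma integral_Phmon_H_space:
 assumes h: "h \<in> H_space \<alpha> l" and b: "\<beta> \<in> degs n"
 shows "(LINT x|mu. Phmon \<alpha> \<beta> x * h x) = lam l * (LINT x|mu. hmon \<beta> x * h x)"
proof (cases "l <= n")
 case True
 obtain c where c: "!!x. h x = (\<Sum>\<gamma>\<in>degs n. c \<gamma> * hmon \<gamma> x)" "!!x. lam l * h x = (\<Sum>\<gamma>\<in>degs n. c \<gamma> * Phmon \<alpha> \<gamma> x)"
  using H_space_coeffs[OF h True] by blast
 have "(LINT x|mu. Phmon \<alpha> \<beta> x * h x) = (LINT x|mu. (\<Sum>\<gamma>\<in>degs n. c \<gamma> * (Phmon \<alpha> \<beta> x * hmon \<gamma> x)))"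
  by (simp only: c(1) sum_distrib_left mult.left_commute)
 also have "... = (\<Sum>\<gamma>\<in>degs n. c \<gamma> * (LINT x|mu. Phmon \<alpha> \<beta> x * hmon \<gamma> x))"
  using integrable_hmon_Phmon by (simp add: Bochner_Integration.integral_sum)
 also have "... = (\<Sum>\<gamma>\<in>degs n. c \<gamma> * (LINT x|mu. hmon \<beta> x * Phmon \<alpha> \<gamma> x))"
  using integral_Phmon[OF b] by (intro sum.cong) auto
 also have "... = (LINT x|mu. (\<Sum>\<gamma>\<in>degs n. c \<gamma> * (hmon \<beta> x * Phmon \<alpha> \<gamma> x)))"
  using integrable_hmon_Phmon by (simp add: Bochner_Integration.integral_sum)
 also have "... = (LINT x|mu. lam l * (hmon \<beta> x * h x))"
 proof -
  have "(\<Sum>\<gamma>\<in>degs n. c \<gamma> * (hmon \<beta> x * Phmon \<alpha> \<gamma> x)) = hmon \<beta> x * (lam l * h x)" for x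
   unfolding c(2) by (simp add: sum_distrib_left mult.left_commute)
  then show ?thesis by (simp add: mult.left_commute)
 qed
 finally show ?thesis by simp
next
 case False
 (* Both sides are computed in the homogeneous polynomials of degree l. *)
 then have nl: "n <= l" by simp
 have "hmon \<beta> \<in> Hom l" by (rule Hom_mono[OF hmon_in_Hom[OF b] nl])
 then obtain e where e: "hmon \<beta> = (%x. \<Sum>\<gamma>\<in>degs l. e \<gamma> * hmon \<gamma> x)" by (auto simp: Hom_def)
 have e': "Phmon \<alpha> \<beta> = (%x. \<Sum>\<gamma>\<in>degs l. e \<gamma> * Phmon \<alpha> \<gamma> x)"
 proof (rule Poly_deg_eqI[OF Phmon_Poly])
  have "Phmon \<alpha> \<gamma> \<in> Poly_deg l" if "\<gamma> \<in> degs l" for \<gamma>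
   using Phmon_Poly[of \<gamma>] that by (simp add: degs_def)
  then show "(%x. \<Sum>\<gamma>\<in>degs l. e \<gamma> * Phmon \<alpha> \<gamma> x) \<in> Poly_deg l" by (intro Poly_deg_sum Poly_deg_scale)
  fix x :: "real^'d" assume x: "x \<in> interior simplex_S"
  have "Phmon \<alpha> \<beta> x = P_op \<alpha> (hmon \<beta>) x" using P_op_hmon[OF x] by (simp add: Phmon_def mult.assoc)
  also have "... = (\<Sum>\<gamma>\<in>degs l. e \<gamma> * Phmon \<alpha> \<gamma> x)" unfolding e by (rule P_op_Hom[OF x])
  finally show "Phmon \<alpha> \<beta> x = ..." .
 qed
 obtain c where c: "!!x. h x = (\<Sum>\<gamma>\<in>degs l. c \<gamma> * hmon \<gamma> x)" "!!x. lam l * h x = (\<Sum>\<gamma>\<in>degs l. c \<gamma> * Phmon \<alpha> \<gamma> x)"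
  using H_space_coeffs[OF h order_refl] by blast
 have "(LINT x|mu. Phmon \<alpha> \<beta> x * h x) = (LINT x|mu. (\<Sum>\<gamma>\<in>degs l. \<Sum>\<delta>\<in>degs l. e \<gamma> * (c \<delta> * (Phmon \<alpha> \<gamma> x * hmon \<delta> x))))"
  unfolding e' c(1) sum_product by (simp only: mult_ac)
 also have "... = (\<Sum>\<gamma>\<in>degs l. \<Sum>\<delta>\<in>degs l. e \<gamma> * (c \<delta> * (LINT x|mu. Phmon \<alpha> \<gamma> x * hmon \<delta> x)))"
  using integrable_hmon_Phmon by (simp add: Bochner_Integration.integral_sum)
 also have "... = (\<Sum>\<gamma>\<in>degs l. \<Sum>\<delta>\<in>degs l. e \<gamma> * (c \<delta> * (LINT x|mu. hmon \<gamma> x * Phmon \<alpha> \<delta> x)))"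
  using integral_Phmon by (intro sum.cong) auto
 also have "... = (LINT x|mu. (\<Sum>\<gamma>\<in>degs l. \<Sum>\<delta>\<in>degs l. e \<gamma> * (c \<delta> * (hmon \<gamma> x * Phmon \<alpha> \<delta> x))))"
  using integrable_hmon_Phmon by (simp add: Bochner_Integration.integral_sum)
 also have "... = (LINT x|mu. lam l * (hmon \<beta> x * h x))"
 proof -
  have eq: "lam l * (hmon \<beta> x * h x) = hmon \<beta> x * (lam l * h x)" for x by (simp add: mult_ac)
  show ?thesis unfolding eq unfolding c(2) unfolding e sum_product by (simp only: mult_ac)
 qed
 finally show ?thesis by simp
qed

text \<open>Eigenfunctions of a symmetric operator with different eigenvalues.\<close>

lemma H_space_orthogonal:
 assumes h: "h \<in> H_space \<alpha> l" and g: "g \<in> H_space \<alpha> k" and lk: "l ~= k"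
 shows "(LINT x|mu. h x * g x) = 0"
proof -
 obtain c where c: "!!x. h x = (\<Sum>\<gamma>\<in>degs l. c \<gamma> * hmon \<gamma> x)" "!!x. lam l * h x = (\<Sum>\<gamma>\<in>degs l. c \<gamma> * Phmon \<alpha> \<gamma> x)"
  using H_space_coeffs[OF h order_refl] by blast
 have i1: "integrable mu (%x. Phmon \<alpha> \<gamma> x * g x)" "integrable mu (%x. hmon \<gamma> x * g x)" for \<gamma>
  using integrable_Poly_mult[OF integrable_Poly[OF Phmon_Poly] H_space_Poly[OF g]]
   integrable_Poly_mult[OF integrable_hmon H_space_Poly[OF g]] by auto
 have "lam l * (LINT x|mu. h x * g x) = (LINT x|mu. (lam l * h x) * g x)" by (simp add: mult.assoc)
 also have "... = (LINT x|mu. (\<Sum>\<gamma>\<in>degs l. c \<gamma> * (Phmon \<alpha> \<gamma> x * g x)))"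
  by (simp only: c(2) sum_distrib_right mult.assoc)
 also have "... = (\<Sum>\<gamma>\<in>degs l. c \<gamma> * (LINT x|mu. Phmon \<alpha> \<gamma> x * g x))"
  using i1 by (simp add: Bochner_Integration.integral_sum)
 also have "... = (\<Sum>\<gamma>\<in>degs l. lam k * (c \<gamma> * (LINT x|mu. hmon \<gamma> x * g x)))"
  using integral_Phmon_H_space[OF g] by (intro sum.cong) auto
 also have "... = lam k * (LINT x|mu. (\<Sum>\<gamma>\<in>degs l. c \<gamma> * (hmon \<gamma> x * g x)))"
  using i1 by (simp add: Bochner_Integration.integral_sum sum_distrib_left)
 also have "... = lam k * (LINT x|mu. h x * g x)"
  by (simp only: c(1) sum_distrib_right mult.assoc)
 finally show ?thesis using lam_eq_iff[of l k] lk by auto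
qed

end

context jacobi
begin

section \<open>Bernstein--Durrmeyer operators\<close>

text \<open>Normalised so that the kernel \<open>Kn\<close> has total mass 1 in each variable.\<close>

definition kap :: "('d option => nat) => real" where
 "kap b = fact (\<Sum>i\<in>UNIV. b i) / mfact b / moment \<alpha> b"

definition Kn :: "nat => real^'d => real^'d => real" where
 "Kn n x y = (\<Sum>b\<in>degs n. kap b * (hmon b x * hmon b y))"

text \<open>The Bernstein--Durrmeyer operator for the Jacobi weight: the integral operator with the positive symmetric
kernel \<open>Kn n\<close>. These operators commute with the differential operator, and all positive kernels
below are combinations of them.\<close>

definition BD :: "nat => (real^'d => real) => real^'d => real" where
 "BD n f x = (\<Sum>b\<in>degs n. kap b * (LINT y|mu. f y * hmon b y) * hmon b x)"

lemma kap_pos: "0 < kap b"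
 unfolding kap_def by (intro divide_pos_pos mfact_pos moment_pos) simp

lemma kap_incr:
 assumes "\<beta> \<in> degs k"
 shows "real (Suc (\<beta> i)) * (kap (incr \<beta> i) * (real (Suc (\<beta> i)) + \<alpha> i)) = real (Suc k) * (real (Suc k) + \<sigma>) * kap \<beta>"
proof -
 have k: "(\<Sum>j\<in>UNIV. \<beta> j) = k" using assms by (simp add: degs_def)
 define b where "b = real (Suc (\<beta> i))"
 have b: "b ~= 0" "b + \<alpha> i ~= 0" using alpha[of i] by (simp_all add: b_def)
 have s: "real k + \<sigma> + 1 ~= 0" using sigma_pos of_nat_0_le_iff[of k] by linarith
 have "kap (incr \<beta> i) = fact (Suc k) / (b * mfact \<beta>) / (moment \<alpha> \<beta> * (b + \<alpha> i) / (real k + \<sigma> + 1))"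
  unfolding kap_def mfact_incr moment_incr sum_incr k b_def by (simp add: add_ac)
 also have "b * (... * (b + \<alpha> i)) = fact (Suc k) * (real k + \<sigma> + 1) / (mfact \<beta> * moment \<alpha> \<beta>)"
 proof -
  have gg: "b * (X / (b * Y) / (Z * v / w) * v) = X * w / (Y * Z)" if "v ~= 0" "Y ~= 0" "Z ~= 0" "w ~= 0" for X Y Z v w :: real
   using that b(1) by (simp add: field_simps)
  show ?thesis
   by (rule gg[OF b(2) _ _ s]) (use mfact_pos[of \<beta>] moment_pos[of \<beta>] in auto)
 qed
 also have "... = real (Suc k) * (real (Suc k) + \<sigma>) * kap \<beta>"
  unfolding kap_def k by (simp add: mult_ac add_ac)
 finally show ?thesis unfolding b_def .
qed

lemma Kn_commute: "Kn n x y = Kn n y x"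
 by (simp add: Kn_def mult.commute[of "hmon _ x"])

lemma hmon_nonneg: "x \<in> simplex_S ==> 0 <= hmon b x"
 by (auto simp: hmon_def simplex_S_def intro!: prod_nonneg simp del: coord.simps)

lemma Kn_nonneg: "x \<in> simplex_S ==> y \<in> simplex_S ==> 0 <= Kn n x y"
 unfolding Kn_def using kap_pos hmon_nonneg by (intro sum_nonneg mult_nonneg_nonneg) (auto simp: less_imp_le)

text \<open>The differential operator maps \<open>Kn (Suc k)\<close> to a multiple of the difference of two consecutive
kernels. This is the source of all formulas for resolvents and for the Green function.\<close>

lemma Phmon_kernel:
 "(\<Sum>b\<in>degs (Suc k). kap b * (Phmon \<alpha> b x * hmon b y)) =
  real (Suc k) * (real (Suc k) + \<sigma>) * (Kn (Suc k) x y - Kn k x y)"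
proof -
 let ?N = "real (Suc k) * (real (Suc k) + \<sigma>)"
 have "(\<Sum>b\<in>degs (Suc k). kap b * (Phmon \<alpha> b x * hmon b y)) =
  (\<Sum>b\<in>degs (Suc k). ?N * (kap b * (hmon b x * hmon b y)) -
   (\<Sum>i\<in>UNIV. real (b i) * (kap b * (real (b i) + \<alpha> i) * hmon (decr b i) x * hmon b y)))"
 proof (rule sum.cong[OF refl])
  fix b :: "'d option => nat" assume "b \<in> degs (Suc k)"
  then have s: "(\<Sum>j\<in>UNIV. b j) = Suc k" by (simp add: degs_def)
  have "kap b * ((\<Sum>i\<in>UNIV. real (b i) * ((real (b i) + \<alpha> i) * hmon (decr b i) x)) * hmon b y) =
   (\<Sum>i\<in>UNIV. real (b i) * (kap b * (real (b i) + \<alpha> i) * hmon (decr b i) x * hmon b y))"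
   unfolding sum_distrib_left sum_distrib_right by (intro sum.cong refl) (simp only: mult_ac)
  then show "kap b * (Phmon \<alpha> b x * hmon b y) = ?N * (kap b * (hmon b x * hmon b y)) -
   (\<Sum>i\<in>UNIV. real (b i) * (kap b * (real (b i) + \<alpha> i) * hmon (decr b i) x * hmon b y))"
   unfolding Phmon_def s left_diff_distrib right_diff_distrib by (simp only: mult_ac)
 qed
 also have "... = ?N * Kn (Suc k) x y -
  (\<Sum>i\<in>UNIV. \<Sum>b\<in>degs (Suc k). real (b i) * (kap b * (real (b i) + \<alpha> i) * hmon (decr b i) x * hmon b y))"
  unfolding sum_subtractf Kn_def sum_distrib_left[symmetric] by (subst sum.swap) (rule refl)
 also have "(\<Sum>i\<in>UNIV. \<Sum>b\<in>degs (Suc k). real (b i) * (kap b * (real (b i) + \<alpha> i) * hmon (decr b i) x * hmon b y)) =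
  (\<Sum>i\<in>UNIV. \<Sum>b\<in>degs k. coord y i * (?N * (kap b * (hmon b x * hmon b y))))"
 proof (rule sum.cong[OF refl])
  fix i
  have "(\<Sum>b\<in>degs (Suc k). real (b i) * (kap b * (real (b i) + \<alpha> i) * hmon (decr b i) x * hmon b y)) =
   (\<Sum>b\<in>degs k. real (Suc (b i)) * (kap (incr b i) * (real (incr b i i) + \<alpha> i) * hmon (decr (incr b i) i) x * hmon (incr b i) y))"
   by (rule sum_degs_shift)
  also have "... = (\<Sum>b\<in>degs k. coord y i * (?N * (kap b * (hmon b x * hmon b y))))"
  proof (intro sum.cong refl)
   fix b :: "'d option => nat" assume b: "b \<in> degs k"
   have d: "decr (incr b i) i = b" by auto
   have "real (Suc (b i)) * (kap (incr b i) * (real (incr b i i) + \<alpha> i) * hmon (decr (incr b i) i) x * hmon (incr b i) y) =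
    (real (Suc (b i)) * (kap (incr b i) * (real (Suc (b i)) + \<alpha> i))) * hmon b x * (coord y i * hmon b y)"
    unfolding d hmon_incr by (simp only: fun_upd_same mult_ac)
   also have "... = coord y i * (?N * (kap b * (hmon b x * hmon b y)))"
    unfolding kap_incr[OF b] by (simp only: mult_ac)
   finally show "real (Suc (b i)) * (kap (incr b i) * (real (incr b i i) + \<alpha> i) * hmon (decr (incr b i) i) x * hmon (incr b i) y) = ..." .
  qed
  finally show "(\<Sum>b\<in>degs (Suc k). real (b i) * (kap b * (real (b i) + \<alpha> i) * hmon (decr b i) x * hmon b y)) = ..." .
 qed
 also have "... = ?N * Kn k x y"
  unfolding Kn_def sum_distrib_left[symmetric] sum_distrib_right[symmetric] sum_coord by simp
 finally show ?thesis by (simp only: right_diff_distrib)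
qed

lemma BD_Poly: "BD n f \<in> Poly_deg n"
 unfolding BD_def[abs_def]
proof (intro Poly_deg_sum Poly_deg_scale)
 fix b :: "'d option => nat" assume "b \<in> degs n"
 then show "hmon b \<in> Poly_deg n" using Poly_deg_hmon[of b] by (simp add: degs_def)
qed

lemma integrable_mult_hmon: "integrable mu f ==> integrable mu (%y. f y * hmon b y)"
 by (rule integrable_Poly_mult[OF _ Poly_deg_hmon])

lemma BD_integral:
 assumes f: "integrable mu f"
 shows "BD n f x = (LINT y|mu. Kn n x y * f y)" "integrable mu (%y. Kn n x y * f y)"
proof -
 have e: "Kn n x y * f y = (\<Sum>b\<in>degs n. kap b * hmon b x * (f y * hmon b y))" for y
  unfolding Kn_def sum_distrib_right by (intro sum.cong refl) (simp only: mult_ac)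
 show "integrable mu (%y. Kn n x y * f y)"
  unfolding e using integrable_mult_hmon[OF f] by auto
 show "BD n f x = (LINT y|mu. Kn n x y * f y)"
 proof -
  have "(LINT y|mu. Kn n x y * f y) = (\<Sum>b\<in>degs n. kap b * hmon b x * (LINT y|mu. f y * hmon b y))"
   unfolding e using integrable_mult_hmon[OF f] by (simp add: Bochner_Integration.integral_sum)
  then show ?thesis unfolding BD_def by (simp add: mult_ac)
 qed
qed

lemma BD_adjoint:
 assumes f: "integrable mu f" and p: "p \<in> Poly_deg k"
 shows "(LINT x|mu. BD n f x * p x) = (LINT x|mu. f x * BD n p x)"
proof -
 have i: "integrable mu (%x. p x * hmon b x)" for b by (rule integrable_mult_hmon[OF integrable_Poly[OF p]])
 have "(LINT x|mu. BD n f x * p x) = (LINT x|mu. (\<Sum>b\<in>degs n. kap b * (LINT y|mu. f y * hmon b y) * (p x * hmon b x)))"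
  unfolding BD_def sum_distrib_right by (simp only: mult_ac)
 also have "... = (\<Sum>b\<in>degs n. kap b * (LINT y|mu. f y * hmon b y) * (LINT x|mu. p x * hmon b x))"
  using i by (simp add: Bochner_Integration.integral_sum)
 also have "... = (\<Sum>b\<in>degs n. kap b * (LINT y|mu. p y * hmon b y) * (LINT x|mu. f x * hmon b x))"
  by (simp only: mult_ac)
 also have "... = (LINT x|mu. (\<Sum>b\<in>degs n. kap b * (LINT y|mu. p y * hmon b y) * (f x * hmon b x)))"
  using integrable_mult_hmon[OF f] by (simp add: Bochner_Integration.integral_sum)
 also have "... = (LINT x|mu. f x * BD n p x)"
  unfolding BD_def sum_distrib_left by (simp only: mult_ac)
 finally show ?thesis .
qed

text \<open>On an eigenfunction the previous identity determines \<open>BD (Suc k) h\<close> from \<open>BD k h\<close>,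
except at \<open>k + 1 = l\<close>, where the factor vanishes.\<close>

lemma BD_recursion:
 assumes h: "h \<in> H_space \<alpha> l"
 shows "(real (Suc k) * (real (Suc k) + \<sigma>) - lam l) * BD (Suc k) h x = real (Suc k) * (real (Suc k) + \<sigma>) * BD k h x"
proof -
 let ?N = "real (Suc k) * (real (Suc k) + \<sigma>)"
 have hi: "integrable mu h" by (rule integrable_Poly[OF H_space_Poly[OF h]])
 have "lam l * BD (Suc k) h x = (\<Sum>b\<in>degs (Suc k). kap b * (lam l * (LINT y|mu. hmon b y * h y)) * hmon b x)"
  unfolding BD_def sum_distrib_left by (simp only: mult_ac)
 also have "... = (\<Sum>b\<in>degs (Suc k). kap b * hmon b x * (LINT y|mu. Phmon \<alpha> b y * h y))"
  using integral_Phmon_H_space[OF h] by (intro sum.cong) (auto simp: mult_ac)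
 also have "... = (LINT y|mu. (\<Sum>b\<in>degs (Suc k). kap b * hmon b x * (Phmon \<alpha> b y * h y)))"
  using integrable_Poly_mult[OF integrable_Poly[OF Phmon_Poly] H_space_Poly[OF h]]
  by (simp add: Bochner_Integration.integral_sum)
 also have "... = (LINT y|mu. (\<Sum>b\<in>degs (Suc k). kap b * (Phmon \<alpha> b y * hmon b x)) * h y)"
  unfolding sum_distrib_right by (simp only: mult_ac)
 also have "... = (LINT y|mu. ?N * (Kn (Suc k) x y * h y - Kn k x y * h y))"
  unfolding Phmon_kernel by (simp only: Kn_commute[of _ _ x] left_diff_distrib mult.assoc)
 also have "... = ?N * (BD (Suc k) h x - BD k h x)"
  using BD_integral[OF hi] by simp
 finally show ?thesis by (simp add: algebra_simps)
qed

lemma kap_moment: "b \<in> degs n ==> kap b * moment \<alpha> b = fact n / mfact b"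
 using moment_pos[of b] by (simp add: kap_def degs_def)

lemma BD_add:
 assumes "integrable mu f" "integrable mu g"
 shows "BD n (%y. f y + g y) x = BD n f x + BD n g x"
 unfolding BD_def using integrable_mult_hmon[OF assms(1)] integrable_mult_hmon[OF assms(2)]
 by (simp add: distrib_right distrib_left sum.distrib)

lemma BD_scale: "BD n (%y. c * f y) x = c * BD n f x"
 unfolding BD_def by (simp add: sum_distrib_left mult_ac)

lemma BD_one: "BD n (%_. 1) x = 1"
proof -
 have "BD n (%_. 1) x = (\<Sum>b\<in>degs n. fact n / mfact b * hmon b x)"
  unfolding BD_def by (intro sum.cong refl) (simp add: integral_hmon kap_moment)
 then show ?thesis by (simp only: hmon_def multinomial sum_coord power_one)
qed

lemma Kn_integral: "(LINT y|mu. Kn n x y) = 1" "integrable mu (%y. Kn n x y)"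
 using BD_integral[of "%_. 1" n x] BD_one[of n x] by simp_all

lemma multinomial_total:
 fixes x :: "real^'d" shows "(\<Sum>b\<in>degs n. fact n / mfact b * hmon b x) = 1"
 by (simp only: hmon_def multinomial sum_coord power_one)

lemma multinomial_mean:
 fixes x :: "real^'d" shows "(\<Sum>b\<in>degs n. real (b i) * (fact n / mfact b * hmon b x)) = real n * coord x i"
proof (cases n)
 case 0 then show ?thesis by (simp add: degs_0)
next
 case (Suc k)
 have "(\<Sum>b\<in>degs (Suc k). real (b i) * (fact (Suc k) / mfact b * hmon b x)) =
  (\<Sum>b\<in>degs k. real (Suc (b i)) * (fact (Suc k) / mfact (incr b i) * hmon (incr b i) x))"
  by (rule sum_degs_shift)
 also have "... = (\<Sum>b\<in>degs k. real (Suc k) * coord x i * (fact k / mfact b * hmon b x))"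
  unfolding mfact_incr hmon_incr by (intro sum.cong refl) (simp add: field_simps del: of_nat_Suc)
 also have "... = real (Suc k) * coord x i"
  unfolding sum_distrib_left[symmetric] hmon_def multinomial by simp
 finally show ?thesis using Suc by simp
qed

lemma multinomial_second:
 fixes x :: "real^'d" shows "(\<Sum>b\<in>degs n. real (b i) * ((real (b i) - 1) * (fact n / mfact b * hmon b x))) = real n * (real n - 1) * (coord x i)\<^sup>2"
proof (cases n)
 case 0 then show ?thesis by (simp add: degs_0)
next
 case (Suc k)
 have "(\<Sum>b\<in>degs (Suc k). real (b i) * ((real (b i) - 1) * (fact (Suc k) / mfact b * hmon b x))) =
  (\<Sum>b\<in>degs k. real (Suc (b i)) * ((real (incr b i i) - 1) * (fact (Suc k) / mfact (incr b i) * hmon (incr b i) x)))"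
  by (rule sum_degs_shift)
 also have "... = (\<Sum>b\<in>degs k. real (Suc k) * coord x i * (real (b i) * (fact k / mfact b * hmon b x)))"
 proof (intro sum.cong refl)
  fix b :: "'d option => nat"
  have "real (Suc (b i)) * ((real (incr b i i) - 1) * (fact (Suc k) / mfact (incr b i) * hmon (incr b i) x)) =
   real (Suc (b i)) * (real (b i) * (fact (Suc k) / (real (Suc (b i)) * mfact b) * (coord x i * hmon b x)))"
   unfolding mfact_incr hmon_incr by simp
  then show "real (Suc (b i)) * ((real (incr b i i) - 1) * (fact (Suc k) / mfact (incr b i) * hmon (incr b i) x)) =
   real (Suc k) * coord x i * (real (b i) * (fact k / mfact b * hmon b x))"
   using mfact_pos[of b] by (simp add: field_simps del: of_nat_Suc)
 qed
 also have "... = real (Suc k) * real k * (coord x i)\<^sup>2"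
  unfolding sum_distrib_left[symmetric] multinomial_mean by (simp add: power2_eq_square)
 finally show ?thesis using Suc by simp
qed

lemma BD_coord: "BD n (%y. coord y i) x = (real n * coord x i + (\<alpha> i + 1)) / (real n + \<sigma> + 1)"
proof -
 have 1: "(LINT y|mu. coord y i * hmon b y) = moment \<alpha> (incr b i)" for b
  by (simp only: hmon_incr[symmetric] integral_hmon)
 have "BD n (%y. coord y i) x = (\<Sum>b\<in>degs n. (real (b i) * (fact n / mfact b * hmon b x) + (\<alpha> i + 1) * (fact n / mfact b * hmon b x)) / (real n + \<sigma> + 1))"
  unfolding BD_def 1
 proof (intro sum.cong refl)
  fix b :: "'d option => nat" assume b: "b \<in> degs n"
  then have s: "(\<Sum>j\<in>UNIV. b j) = n" by (simp add: degs_def)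
  have gen: "Q * (r + a + 1) * h / D = (r * (Q * h) + (a + 1) * (Q * h)) / D" for Q r a h D :: real
   by (simp add: algebra_simps)
  have m: "kap b * moment \<alpha> (incr b i) * hmon b x = (kap b * moment \<alpha> b) * (real (b i) + \<alpha> i + 1) * hmon b x / (real n + \<sigma> + 1)"
   unfolding moment_incr s by (simp add: mult_ac)
  show "kap b * moment \<alpha> (incr b i) * hmon b x = (real (b i) * (fact n / mfact b * hmon b x) + (\<alpha> i + 1) * (fact n / mfact b * hmon b x)) / (real n + \<sigma> + 1)"
   unfolding m kap_moment[OF b] by (rule gen)
 qed
 also have "... = (real n * coord x i + (\<alpha> i + 1)) / (real n + \<sigma> + 1)"
  unfolding sum_divide_distrib[symmetric] sum.distrib multinomial_mean sum_distrib_left[symmetric] multinomial_total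
  by simp
 finally show ?thesis .
qed

lemma BD_coord_square: "BD n (%y. (coord y i)\<^sup>2) x =
 (real n * (real n - 1) * (coord x i)\<^sup>2 + (2 * \<alpha> i + 4) * (real n * coord x i) + (\<alpha> i + 1) * (\<alpha> i + 2)) / ((real n + \<sigma> + 1) * (real n + \<sigma> + 2))"
proof -
 have 1: "(LINT y|mu. (coord y i)\<^sup>2 * hmon \<beta> y) = moment \<alpha> (incr (incr \<beta> i) i)" for \<beta>
  by (simp only: power2_eq_square mult.assoc hmon_incr[symmetric] integral_hmon)
 let ?b = "%\<beta>. fact n / mfact \<beta> * hmon \<beta> x"
 have "BD n (%y. (coord y i)\<^sup>2) x = (\<Sum>\<beta>\<in>degs n. (real (\<beta> i) * ((real (\<beta> i) - 1) * ?b \<beta>) + (2 * \<alpha> i + 4) * (real (\<beta> i) * ?b \<beta>)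
   + (\<alpha> i + 1) * (\<alpha> i + 2) * ?b \<beta>) / ((real n + \<sigma> + 1) * (real n + \<sigma> + 2)))"
  unfolding BD_def 1
 proof (intro sum.cong refl)
  fix \<beta> :: "'d option => nat" assume b: "\<beta> \<in> degs n"
  then have s: "(\<Sum>j\<in>UNIV. \<beta> j) = n" by (simp add: degs_def)
  have "moment \<alpha> (incr (incr \<beta> i) i) = moment \<alpha> \<beta> * (real (\<beta> i) + \<alpha> i + 1) / (real n + \<sigma> + 1) * (real (\<beta> i) + \<alpha> i + 2) / (real n + \<sigma> + 2)"
   using moment_incr[of "incr \<beta> i" i] unfolding moment_incr[of \<beta> i] sum_incr s by (simp add: add_ac)
  then have m: "kap \<beta> * moment \<alpha> (incr (incr \<beta> i) i) * hmon \<beta> x =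
    (kap \<beta> * moment \<alpha> \<beta>) * ((real (\<beta> i) + \<alpha> i + 1) * (real (\<beta> i) + \<alpha> i + 2)) * hmon \<beta> x / ((real n + \<sigma> + 1) * (real n + \<sigma> + 2))"
   by simp
  have gen: "Q * ((r + a + 1) * (r + a + 2)) * h / D =
    (r * ((r - 1) * (Q * h)) + (2 * a + 4) * (r * (Q * h)) + (a + 1) * (a + 2) * (Q * h)) / D" for Q r a h D :: real
   by (simp add: algebra_simps)
  show "kap \<beta> * moment \<alpha> (incr (incr \<beta> i) i) * hmon \<beta> x = (real (\<beta> i) * ((real (\<beta> i) - 1) * ?b \<beta>) + (2 * \<alpha> i + 4) * (real (\<beta> i) * ?b \<beta>)
   + (\<alpha> i + 1) * (\<alpha> i + 2) * ?b \<beta>) / ((real n + \<sigma> + 1) * (real n + \<sigma> + 2))"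
   unfolding m kap_moment[OF b] by (rule gen)
 qed
 also have "... = (real n * (real n - 1) * (coord x i)\<^sup>2 + (2 * \<alpha> i + 4) * (real n * coord x i) + (\<alpha> i + 1) * (\<alpha> i + 2)) / ((real n + \<sigma> + 1) * (real n + \<sigma> + 2))"
  unfolding sum_divide_distrib[symmetric] sum.distrib multinomial_mean multinomial_second sum_distrib_left[symmetric] multinomial_total
  by simp
 finally show ?thesis .
qed

lemma tendsto_ratio:
 fixes a b :: real shows "(%n. (real n + a) / (real n + b)) \<longlonglongrightarrow> 1"
 by real_asymp

lemma tendsto_reciprocal:
 fixes b :: real shows "(%n. 1 / (real n + b)) \<longlonglongrightarrow> 0"
 by real_asymp

text \<open>The first two moments of the kernel are explicit and make the variance vanish in the limit.\<close>

lemma BD_variance_tendsto: "(%n. BD n (%y. (coord y i - coord x i)\<^sup>2) x) \<longlonglongrightarrow> 0"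
proof -
 define c where "c = coord x i"
 have i: "integrable mu (%y. coord y i)" "integrable mu (%y. (coord y i)\<^sup>2)"
  using integrable_Poly[OF Poly_deg_coord] integrable_Poly[OF Poly_deg_power[OF Poly_deg_coord]] by auto
 have "BD n (%y. (coord y i - coord x i)\<^sup>2) x = BD n (%y. (coord y i)\<^sup>2) x - 2 * c * BD n (%y. coord y i) x + c\<^sup>2 * BD n (%_. 1) x" for n
 proof -
  have e: "(coord y i - coord x i)\<^sup>2 = (coord y i)\<^sup>2 + (- 2 * c) * coord y i + c\<^sup>2 * 1" for y
   by (simp add: c_def power2_eq_square algebra_simps del: coord.simps)
  have j: "integrable mu (%y. (- 2 * c) * coord y i)" "integrable mu (%y. (coord y i)\<^sup>2 + (- 2 * c) * coord y i)"
   using i by (auto simp del: coord.simps)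
  have "BD n (%y. (coord y i)\<^sup>2 + (- 2 * c) * coord y i + c\<^sup>2 * 1) x =
   BD n (%y. (coord y i)\<^sup>2) x + (- 2 * c) * BD n (%y. coord y i) x + c\<^sup>2 * BD n (%_. 1) x"
   using BD_add[OF j(2), of "%_. c\<^sup>2 * 1" n x] BD_add[OF i(2) j(1), of n x]
    BD_scale[of n "- 2 * c" "%y. coord y i" x] BD_scale[of n "c\<^sup>2" "%_. 1" x] by simp
  then show ?thesis unfolding e by simp
 qed
 then have e: "BD n (%y. (coord y i - coord x i)\<^sup>2) x =
  (real n * (real n - 1) * c\<^sup>2 + (2 * \<alpha> i + 4) * (real n * c) + (\<alpha> i + 1) * (\<alpha> i + 2)) / ((real n + \<sigma> + 1) * (real n + \<sigma> + 2)) -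
  2 * c * ((real n * c + (\<alpha> i + 1)) / (real n + \<sigma> + 1)) + c\<^sup>2" for n
  unfolding BD_coord BD_coord_square BD_one by (simp add: c_def)
 have l1: "(%n. (real n * c + (\<alpha> i + 1)) / (real n + \<sigma> + 1)) \<longlonglongrightarrow> c"
 proof -
  have "(%n. c * ((real n + 0) / (real n + (\<sigma> + 1))) + (\<alpha> i + 1) * (1 / (real n + (\<sigma> + 1)))) \<longlonglongrightarrow> c * 1 + (\<alpha> i + 1) * 0"
   by (intro tendsto_add tendsto_mult tendsto_const tendsto_ratio tendsto_reciprocal)
  then show ?thesis by (simp add: add_divide_distrib mult_ac add_ac)
 qed
 have l2: "(%n. (real n * (real n - 1) * c\<^sup>2 + (2 * \<alpha> i + 4) * (real n * c) + (\<alpha> i + 1) * (\<alpha> i + 2)) / ((real n + \<sigma> + 1) * (real n + \<sigma> + 2))) \<longlonglongrightarrow> c\<^sup>2"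
 proof -
  have "(%n. c\<^sup>2 * (((real n + 0) / (real n + (\<sigma> + 1))) * ((real n + (-1)) / (real n + (\<sigma> + 2)))) +
    (2 * \<alpha> i + 4) * c * (((real n + 0) / (real n + (\<sigma> + 1))) * (1 / (real n + (\<sigma> + 2)))) +
    (\<alpha> i + 1) * (\<alpha> i + 2) * ((1 / (real n + (\<sigma> + 1))) * (1 / (real n + (\<sigma> + 2))))) \<longlonglongrightarrow>
    c\<^sup>2 * (1 * 1) + (2 * \<alpha> i + 4) * c * (1 * 0) + (\<alpha> i + 1) * (\<alpha> i + 2) * (0 * 0)"
   by (intro tendsto_add tendsto_mult tendsto_const tendsto_ratio tendsto_reciprocal)
  moreover have "c\<^sup>2 * ((N + 0) / A * ((N + (-1)) / B)) + p * c * ((N + 0) / A * (1 / B)) + q * r * (1 / A * (1 / B)) =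
    (N * (N - 1) * c\<^sup>2 + p * (N * c) + q * r) / (A * B)" for A B N p q r :: real
   by (simp add: add_divide_distrib mult_ac)
  ultimately show ?thesis by (simp only: add.assoc mult_1_right mult_zero_right add_0_right)
 qed
 have "(%n. BD n (%y. (coord y i - coord x i)\<^sup>2) x) \<longlonglongrightarrow> c\<^sup>2 - 2 * c * c + c\<^sup>2"
  unfolding e by (intro tendsto_add tendsto_diff tendsto_mult l1 l2 tendsto_const)
 then show ?thesis by (simp add: power2_eq_square)
qed

text \<open>Korovkin's argument: a positive kernel of mass 1 and vanishing variance reproduces continuous functions.\<close>

lemma BD_tendsto:
 assumes x: "x \<in> simplex_S" and g: "continuous_on UNIV g"
 shows "(%n. BD n g x) \<longlonglongrightarrow> g x"
proof (rule LIMSEQ_I)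
 fix r :: real assume r: "0 < r"
 have gm[measurable]: "g \<in> borel_measurable borel" by (rule borel_measurable_continuous_onI[OF g])
 have gS: "continuous_on simplex_S g" by (rule continuous_on_subset[OF g]) simp
 obtain B where B: "!!y. y \<in> simplex_S ==> \<bar>g y\<bar> <= B"
  using compact_imp_bounded[OF compact_continuous_image[OF gS simplex_S_compact]] by (auto simp: bounded_iff)
 have B0: "0 <= B" using B[OF x] by linarith
 have gi: "integrable mu g"
  by (rule integrable_const_bound[where B=B]) (use AE_jacobi[of \<alpha>] B in \<open>auto elim!: eventually_mono\<close>)
 obtain d where d: "d > 0" "!!y. y \<in> simplex_S ==> dist y x < d ==> dist (g y) (g x) < r / 2"
  using gS x r unfolding continuous_on_iff by (metis half_gt_zero)
 define V where "V n = (\<Sum>i\<in>UNIV. BD n (%y. (coord y (Some i) - coord x (Some i))\<^sup>2) x)" for n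
 have "V \<longlonglongrightarrow> (\<Sum>i\<in>(UNIV :: 'd set). 0)" unfolding V_def by (intro tendsto_sum BD_variance_tendsto)
 then have "V \<longlonglongrightarrow> 0" by simp
 moreover have "0 < r / 2 / (2 * B / d\<^sup>2 + 1)" using r d B0 by (intro divide_pos_pos add_nonneg_pos) auto
 ultimately obtain n0 where n0: "!!n. n >= n0 ==> \<bar>V n\<bar> < r / 2 / (2 * B / d\<^sup>2 + 1)"
  by (metis LIMSEQ_D real_norm_def diff_zero)
 have "\<bar>BD n g x - g x\<bar> < r" if n: "n >= n0" for n
 proof -
  have vi: "integrable mu (%y. (coord y i - coord x i)\<^sup>2)" for i
   by (rule integrable_Poly[OF Poly_deg_power[OF Poly_deg_diff[OF Poly_deg_coord Poly_deg_const]]])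
  let ?Q = "%y. r / 2 + 2 * B / d\<^sup>2 * (\<Sum>i\<in>UNIV. (coord y (Some i) - coord x (Some i))\<^sup>2)"
  have pt: "\<bar>g y - g x\<bar> <= ?Q y" if y: "y \<in> simplex_S" for y
  proof (cases "dist y x < d")
   case True
   have "0 <= 2 * B / d\<^sup>2 * (\<Sum>i\<in>UNIV. (coord y (Some i) - coord x (Some i))\<^sup>2)"
    using B0 by (intro mult_nonneg_nonneg sum_nonneg) auto
   then show ?thesis using d(2)[OF y True] by (simp add: dist_real_def del: coord.simps)
  next
   case False
   have "(dist y x)\<^sup>2 = (\<Sum>i\<in>UNIV. (coord y (Some i) - coord x (Some i))\<^sup>2)"
    by (simp add: dist_vec_def L2_set_def dist_real_def sum_nonneg)
   moreover have "d\<^sup>2 <= (dist y x)\<^sup>2" using False d by (intro power_mono) auto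
   ultimately have "1 <= (\<Sum>i\<in>UNIV. (coord y (Some i) - coord x (Some i))\<^sup>2) / d\<^sup>2" using d by (simp add: divide_simps)
   then have "2 * B * 1 <= 2 * B * ((\<Sum>i\<in>UNIV. (coord y (Some i) - coord x (Some i))\<^sup>2) / d\<^sup>2)"
    using B0 by (intro mult_left_mono) auto
   moreover have "\<bar>g y - g x\<bar> <= 2 * B" using B[OF y] B[OF x] by linarith
   ultimately show ?thesis using r by simp
  qed
  have i1: "integrable mu (%y. g y - g x)" using gi by simp
  have i2: "integrable mu (%y. \<Sum>i\<in>UNIV. (coord y (Some i) - coord x (Some i))\<^sup>2)"
   using vi by (intro Bochner_Integration.integrable_sum) (auto simp del: coord.simps)
  have i3: "integrable mu ?Q" using i2 by (intro Bochner_Integration.integrable_add integrable_mult_right integrable_const)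
  have "BD n g x - g x = BD n (%y. g y - g x) x"
   using BD_add[OF gi, of "%_. - g x * 1" n x] BD_scale[of n "- g x" "%_. 1" x] BD_one[of n x] by simp
  also have "... = (LINT y|mu. Kn n x y * (g y - g x))" by (rule BD_integral[OF i1])
  finally have e: "BD n g x - g x = (LINT y|mu. Kn n x y * (g y - g x))" .
  have "\<bar>LINT y|mu. Kn n x y * (g y - g x)\<bar> <= (LINT y|mu. \<bar>Kn n x y * (g y - g x)\<bar>)"
   by (rule integral_abs_bound)
  also have "... <= (LINT y|mu. Kn n x y * ?Q y)"
  proof (rule integral_mono_AE)
   show "integrable mu (%y. \<bar>Kn n x y * (g y - g x)\<bar>)" using BD_integral(2)[OF i1] by (rule integrable_abs)
   show "integrable mu (%y. Kn n x y * ?Q y)" by (rule BD_integral(2)[OF i3])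
   show "AE y in mu. \<bar>Kn n x y * (g y - g x)\<bar> <= Kn n x y * ?Q y"
    using AE_jacobi[of \<alpha>]
    by eventually_elim (use Kn_nonneg[OF x] pt in \<open>auto simp: abs_mult intro!: mult_left_mono simp del: coord.simps\<close>)
  qed
  also have "... = BD n ?Q x" using BD_integral(1)[OF i3] by simp
  also have "... = r / 2 + 2 * B / d\<^sup>2 * V n"
  proof -
   have s: "BD n (%y. \<Sum>i\<in>A. (coord y (Some i) - coord x (Some i))\<^sup>2) x = (\<Sum>i\<in>A. BD n (%y. (coord y (Some i) - coord x (Some i))\<^sup>2) x)"
    if "finite A" for A
    using that
   proof (induction A rule: finite_induct)
    case empty
    then show ?case using BD_scale[of n 0 "%_. 1" x] by simp
   next
    case (insert i A)
    have "integrable mu (%y. \<Sum>i\<in>A. (coord y (Some i) - coord x (Some i))\<^sup>2)"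
     using vi by (intro Bochner_Integration.integrable_sum) (auto simp del: coord.simps)
    from BD_add[OF vi[of "Some i"] this, of n x] show ?case using insert by (simp del: coord.simps)
   qed
   have "BD n ?Q x = BD n (%y. r / 2 * 1) x + BD n (%y. 2 * B / d\<^sup>2 * (\<Sum>i\<in>UNIV. (coord y (Some i) - coord x (Some i))\<^sup>2)) x"
    using BD_add[OF integrable_const[of "r / 2 * 1"] integrable_mult_right[OF i2, of "2 * B / d\<^sup>2"], of n x]
    by (simp del: coord.simps)
   also have "... = r / 2 + 2 * B / d\<^sup>2 * V n" unfolding BD_scale BD_one s[OF finite_class.finite_UNIV] V_def by simp
   finally show ?thesis .
  qed
  also have "... < r"
  proof -
   have "2 * B / d\<^sup>2 * V n <= (2 * B / d\<^sup>2 + 1) * \<bar>V n\<bar>"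
   proof -
    have "2 * B / d\<^sup>2 * V n <= 2 * B / d\<^sup>2 * \<bar>V n\<bar>" using B0 by (intro mult_left_mono) auto
    then show ?thesis by (simp add: distrib_right)
   qed
   also have "... < r / 2"
   proof -
    have "0 < 2 * B / d\<^sup>2 + 1" using B0 by (intro add_nonneg_pos) auto
    then have "\<bar>V n\<bar> * (2 * B / d\<^sup>2 + 1) < r / 2" using n0[OF n] by (simp only: pos_less_divide_eq)
    then show ?thesis by (simp only: mult.commute)
   qed
   finally show ?thesis by simp
  qed
  finally show ?thesis unfolding e .
 qed
 then show "\<exists>no. \<forall>n\<ge>no. norm (BD n g x - g x) < r" by auto
qed

end

context jacobi
begin

section \<open>Eigenvalues of the Bernstein--Durrmeyer operators\<close>

text \<open>The eigenvalue of \<open>BD n\<close> on \<open>H_space \<alpha> l\<close>.\<close>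

definition mm :: "nat => nat => real" where
 "mm n l = (\<Prod>j<l. (real n - real j) / (real n + \<sigma> + 1 + real j))"

lemma sigma_nat_pos: "0 < real n + \<sigma>" "0 < real n + \<sigma> + 1 + real j"
 using sigma_pos of_nat_0_le_iff[of n] of_nat_0_le_iff[of j] by linarith+

lemma mm_0 [simp]: "mm n 0 = 1"
 by (simp add: mm_def)

lemma mm_eq_0: "n < l ==> mm n l = 0"
 unfolding mm_def by (rule prod_zero) (auto intro!: bexI[of _ n])

lemma mm_pos: "l <= n ==> 0 < mm n l"
 unfolding mm_def using sigma_nat_pos(2) by (intro prod_pos) (auto intro!: divide_pos_pos)

lemma mm_tendsto: "(%n. mm n l) \<longlonglongrightarrow> 1"
proof -
 have "(%n. mm n l) \<longlonglongrightarrow> (\<Prod>j<l. 1)"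
  unfolding mm_def
 proof (intro tendsto_prod)
  fix j
  show "(%n. (real n - real j) / (real n + \<sigma> + 1 + real j)) \<longlonglongrightarrow> 1"
   using tendsto_ratio[of "- real j" "\<sigma> + 1 + real j"] by (simp add: add_ac)
 qed
 then show ?thesis by simp
qed

lemma lam_diff: "real n * (real n + \<sigma>) - lam l = (real n - real l) * (real n + \<sigma> + real l)"
 by (simp add: lam_alt algebra_simps)

lemma mm_recursion: "real (Suc k) * (real (Suc k) + \<sigma>) * mm k l = (real (Suc k) * (real (Suc k) + \<sigma>) - lam l) * mm (Suc k) l"
proof -
 define N where "N = real (Suc k)"
 have N: "0 < N + \<sigma> + real j" for j using sigma_nat_pos(2)[of k j] by (simp add: N_def add_ac)
 have "N * (N + \<sigma>) * mm k l = (N - real l) * (N + \<sigma> + real l) * mm (Suc k) l"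
 proof (induction l)
  case (Suc l)
  have k: "mm k (Suc l) = mm k l * ((N - 1 - real l) / (N + \<sigma> + real l))"
   by (simp add: mm_def N_def add_ac)
  have S: "mm (Suc k) (Suc l) = mm (Suc k) l * ((N - real l) / (N + \<sigma> + real (Suc l)))"
   by (simp add: mm_def N_def add_ac)
  have "N * (N + \<sigma>) * mm k (Suc l) = (N - real l) * (N + \<sigma> + real l) * mm (Suc k) l * ((N - 1 - real l) / (N + \<sigma> + real l))"
   unfolding k using Suc by (simp only: mult.assoc[symmetric])
  also have "... = (N - real l) * mm (Suc k) l * (N - real (Suc l))"
   using N[of l] by simp
  also have "... = (N - real (Suc l)) * (N + \<sigma> + real (Suc l)) * mm (Suc k) (Suc l)"
   unfolding S using N[of "Suc l"] by (simp del: of_nat_Suc)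
  finally show ?case .
 qed simp
 then show ?thesis unfolding N_def lam_diff .
qed

lemma mm_step: "mm (Suc k) l - mm k l = lam l * mm (Suc k) l / (real (Suc k) * (real (Suc k) + \<sigma>))"
proof -
 define D where "D = real (Suc k) * (real (Suc k) + \<sigma>)"
 have "D ~= 0" unfolding D_def using sigma_nat_pos(1)[of "Suc k"] by simp
 moreover have "(mm (Suc k) l - mm k l) * D = lam l * mm (Suc k) l"
  using mm_recursion[of k l] unfolding D_def[symmetric] by (simp add: algebra_simps)
 ultimately show ?thesis unfolding D_def[symmetric] by (metis nonzero_eq_divide_eq)
qed

text \<open>The recursion makes \<open>BD n h\<close> zero for \<open>n < l\<close> and proportional to \<open>BD l
h\<close> for \<open>n \<ge> l\<close>. Convergence \<open>BD n h \<longlonglongrightarrow> h\<close>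
identifies the factor.\<close>

lemma BD_eigen:
 assumes h: "h \<in> H_space \<alpha> l"
 shows "BD n h x = mm n l * h x"
proof -
 have low: "BD n h y = 0" if "n < l" for n y
  using that
 proof (induction "l - n" arbitrary: n)
  case (Suc d)
  then have "Suc n <= l" by simp
  have N: "0 < real (Suc n) * (real (Suc n) + \<sigma>)" using sigma_nat_pos(1)[of "Suc n"] by (intro mult_pos_pos) auto
  have "(real (Suc n) * (real (Suc n) + \<sigma>) - lam l) * BD (Suc n) h y = 0"
  proof (cases "Suc n = l")
   case True then show ?thesis by (simp add: lam_alt[of l])
  next
   case False then show ?thesis using Suc by simp
  qed
  then show ?case using BD_recursion[OF h, of n y] N by auto
 qed simp
 have high: "BD n h y = mm n l * (BD l h y / mm l l)" if "l <= n" for n y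
  using that
 proof (induction n rule: dec_induct)
  case base then show ?case using mm_pos[of l l] by simp
 next
  case (step n)
  have c: "real (Suc n) * (real (Suc n) + \<sigma>) - lam l ~= 0"
   unfolding lam_diff using step(1) sigma_nat_pos(1)[of "Suc n"] of_nat_0_le_iff[of l]
   by (simp del: of_nat_Suc)
  have "(real (Suc n) * (real (Suc n) + \<sigma>) - lam l) * BD (Suc n) h y =
   (real (Suc n) * (real (Suc n) + \<sigma>) * mm n l) * (BD l h y / mm l l)"
   unfolding BD_recursion[OF h] step.IH by (simp only: mult.assoc)
  also have "... = (real (Suc n) * (real (Suc n) + \<sigma>) - lam l) * (mm (Suc n) l * (BD l h y / mm l l))"
   unfolding mm_recursion by (simp only: mult.assoc)
  finally show ?case unfolding mult_left_cancel[OF c] .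
 qed
 have S: "h y = BD l h y / mm l l" if y: "y \<in> simplex_S" for y
 proof -
  have "(%n. BD n h y) \<longlonglongrightarrow> h y" by (rule BD_tendsto[OF y Poly_deg_continuous[OF H_space_Poly[OF h]]])
  moreover have "(%n. BD n h y) \<longlonglongrightarrow> 1 * (BD l h y / mm l l)"
  proof (rule Lim_transform_eventually)
   show "(%n. mm n l * (BD l h y / mm l l)) \<longlonglongrightarrow> 1 * (BD l h y / mm l l)"
    by (intro tendsto_mult mm_tendsto tendsto_const)
   show "\<forall>\<^sub>F n in sequentially. mm n l * (BD l h y / mm l l) = BD n h y"
    using eventually_ge_at_top[of l] by eventually_elim (rule high[symmetric])
  qed
  ultimately show ?thesis using LIMSEQ_unique by fastforce
 qed
 have "h = (%y. (1 / mm l l) * BD l h y)"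
  by (rule Poly_deg_eqI[OF H_space_Poly[OF h] Poly_deg_scale[OF BD_Poly]])
    (use S interior_subset in \<open>auto simp: mult.commute\<close>)
 from fun_cong[OF this, of x] have hx: "BD l h x / mm l l = h x" by simp
 show ?thesis
 proof (cases "n < l")
  case True then show ?thesis by (simp add: low mm_eq_0)
 next
  case False then show ?thesis using high[of n x] unfolding hx by simp
 qed
qed

section \<open>Projections\<close>

text \<open>The weight is positive inside, so the polynomial vanishes almost everywhere on an open set.\<close>

lemma Poly_square_integral_zero:
 assumes p: "p \<in> Poly_deg k" and z: "(LINT x|mu. p x * p x) = 0"
 shows "p = (%x. 0)"
proof (rule Poly_deg_eqI[OF p Poly_deg_zero])
 fix x :: "real^'d" assume x: "x \<in> interior simplex_S"
 have pm[measurable]: "p \<in> borel_measurable borel" by (rule Poly_deg_measurable[OF p])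
 have "AE x in mu. p x * p x = 0"
  using integral_nonneg_eq_0_iff_AE[of mu "%x. p x * p x"] integrable_Poly_mult[OF integrable_Poly[OF p] p] z by simp
 then have "AE x in mu. p x = 0" by eventually_elim simp
 then have ae: "AE x in lborel. 0 < ennreal (indicator simplex_S x * jacobi_weight \<alpha> x) --> p x = 0"
  unfolding jacobi_measure_def by (subst (asm) AE_density) auto
 define U where "U = {y \<in> interior simplex_S. p y ~= 0}"
 have "open U"
 proof -
  have "open (p -` (- {0}))" by (intro open_vimage Poly_deg_continuous[OF p]) auto
  then have "open (interior simplex_S \<inter> p -` (- {0}))" by blast
  then show ?thesis by (simp add: U_def vimage_def Int_def)
 qed
 have "AE x in lborel. x \<notin> U"
  using ae
 proof eventually_elim
  case (elim y)
  have "0 < indicator simplex_S y * jacobi_weight \<alpha> y" if "y \<in> interior simplex_S"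
  proof -
   have "coord y i ~= 0" for i using interior_simplex_S[OF that, of i] by linarith
   then have "0 < jacobi_weight \<alpha> y" unfolding jacobi_weight_def by (intro prod_pos) auto
   then show ?thesis using that interior_subset by (auto simp: indicator_def)
  qed
  then show ?case using elim by (auto simp: U_def)
 qed
 then have "emeasure lborel U = 0"
  using \<open>open U\<close> by (subst (asm) AE_iff_measurable[of U]) auto
 then have "negligible U" using \<open>open U\<close> by (simp add: negligible_iff_null_sets null_sets_def)
 then have "U = {}" using \<open>open U\<close> open_not_negligible by blast
 then show "p x = 0" using x by (auto simp: U_def)
qed

lemma integral_H_sum:
 assumes h: "!!j. h j \<in> H_space \<alpha> j" and g: "g \<in> H_space \<alpha> l" and l: "l <= k"
 shows "(LINT x|mu. (\<Sum>j\<le>k. h j x) * g x) = (LINT x|mu. h l x * g x)"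
proof -
 have i: "integrable mu (%x. h j x * g x)" for j
  by (rule integrable_Poly_mult[OF integrable_Poly[OF H_space_Poly[OF h]] H_space_Poly[OF g]])
 have "(LINT x|mu. (\<Sum>j\<le>k. h j x) * g x) = (\<Sum>j\<le>k. LINT x|mu. h j x * g x)"
  unfolding sum_distrib_right using i by (intro Bochner_Integration.integral_sum) auto
 also have "... = (\<Sum>j\<le>k. if j = l then LINT x|mu. h l x * g x else 0)"
  using H_space_orthogonal[OF h g] by (intro sum.cong) auto
 finally show ?thesis using l by simp
qed

text \<open>The component in \<open>H_space \<alpha> l\<close> of the polynomial \<open>BD l f\<close>, divided by the
nonzero eigenvalue, is the projection of \<open>f\<close>. In this way no basis is needed, and
\<open>f\<close> need only be integrable.\<close>

lemma H_proj_exists: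
 assumes f: "integrable mu f"
 shows "\<exists>h\<in>H_space \<alpha> l. \<forall>\<phi>\<in>H_space \<alpha> l. (LINT x|mu. (f x - h x) * \<phi> x) = 0"
proof -
 obtain h where h: "!!j. h j \<in> H_space \<alpha> j" "BD l f = (%x. \<Sum>j\<le>l. h j x)"
  using decomposition_exists[OF BD_Poly] by blast
 have ml: "mm l l ~= 0" using mm_pos[of l l] by simp
 show ?thesis
 proof (intro bexI[of _ "%x. (1 / mm l l) * h l x"] ballI H_space_scale h)
  fix \<phi> assume \<phi>: "\<phi> \<in> H_space \<alpha> l"
  have hi: "integrable mu (%x. h l x * \<phi> x)"
   by (rule integrable_Poly_mult[OF integrable_Poly[OF H_space_Poly[OF h(1)]] H_space_Poly[OF \<phi>]])
  have "(LINT x|mu. h l x * \<phi> x) = (LINT x|mu. BD l f x * \<phi> x)"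
   unfolding h(2) using integral_H_sum[of h, OF h(1) \<phi>] by simp
  also have "... = mm l l * (LINT x|mu. f x * \<phi> x)"
   unfolding BD_adjoint[OF f H_space_Poly[OF \<phi>]] BD_eigen[OF \<phi>]
   by (simp only: mult.left_commute[of "f _" "mm l l"] integral_mult_right_zero)
  finally have e: "(LINT x|mu. h l x * \<phi> x) = mm l l * (LINT x|mu. f x * \<phi> x)" .
  have "(LINT x|mu. (f x - (1 / mm l l) * h l x) * \<phi> x) = (LINT x|mu. f x * \<phi> x - (1 / mm l l) * (h l x * \<phi> x))"
   by (simp add: left_diff_distrib)
  also have "... = (LINT x|mu. f x * \<phi> x) - (1 / mm l l) * (LINT x|mu. h l x * \<phi> x)"
   using integrable_Poly_mult[OF f H_space_Poly[OF \<phi>]] hi by simp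
  finally show "(LINT x|mu. (f x - (1 / mm l l) * h l x) * \<phi> x) = 0" using e ml by simp
 qed
qed

lemma H_proj_eqI:
 assumes f: "integrable mu f" and h: "h \<in> H_space \<alpha> l"
  and o: "!!\<phi>. \<phi> \<in> H_space \<alpha> l ==> (LINT x|mu. f x * \<phi> x) = (LINT x|mu. h x * \<phi> x)"
 shows "H_proj \<alpha> l f = h"
 unfolding H_proj_def
proof (rule the_equality)
 have i: "integrable mu (%x. g x * \<phi> x)" if "g \<in> H_space \<alpha> l" "\<phi> \<in> H_space \<alpha> l" for g \<phi>
  by (rule integrable_Poly_mult[OF integrable_Poly[OF H_space_Poly[OF that(1)]] H_space_Poly[OF that(2)]])
 have fi: "integrable mu (%x. f x * \<phi> x)" if "\<phi> \<in> H_space \<alpha> l" for \<phi>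
  by (rule integrable_Poly_mult[OF f H_space_Poly[OF that]])
 show "h \<in> H_space \<alpha> l \<and> (\<forall>\<phi>\<in>H_space \<alpha> l. (LINT x|mu. (f x - h x) * \<phi> x) = 0)"
  using h o i[OF h] fi by (simp add: left_diff_distrib)
 fix g assume g: "g \<in> H_space \<alpha> l \<and> (\<forall>\<phi>\<in>H_space \<alpha> l. (LINT x|mu. (f x - g x) * \<phi> x) = 0)"
 have d: "(%x. g x - h x) \<in> H_space \<alpha> l" using g h by (intro H_space_diff) auto
 have "(LINT x|mu. (g x - h x) * (g x - h x)) = (LINT x|mu. g x * (g x - h x)) - (LINT x|mu. h x * (g x - h x))"
  using i[OF _ d, of g] i[OF h d] g by (simp add: left_diff_distrib[of _ _ "g _ - h _"])
 also have "(LINT x|mu. g x * (g x - h x)) = (LINT x|mu. f x * (g x - h x))"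
 proof -
  have "(LINT x|mu. (f x - g x) * (g x - h x)) = 0" using g d by auto
  then show ?thesis using fi[OF d] i[OF _ d, of g] g by (simp add: left_diff_distrib[of _ _ "g _ - h _"])
 qed
 finally have "(LINT x|mu. (g x - h x) * (g x - h x)) = 0" using o[OF d] by simp
 from Poly_square_integral_zero[OF H_space_Poly[OF d] this] show "g = h" by (simp add: fun_eq_iff)
qed

lemma H_proj_in_orth:
 assumes f: "integrable mu f"
 shows "H_proj \<alpha> l f \<in> H_space \<alpha> l" "\<phi> \<in> H_space \<alpha> l ==> (LINT x|mu. f x * \<phi> x) = (LINT x|mu. H_proj \<alpha> l f x * \<phi> x)"
proof -
 obtain h where h: "h \<in> H_space \<alpha> l" "!!\<phi>. \<phi>\<in>H_space \<alpha> l ==> (LINT x|mu. (f x - h x) * \<phi> x) = 0"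
  using H_proj_exists[OF f] by blast
 have e: "(LINT x|mu. f x * \<phi> x) = (LINT x|mu. h x * \<phi> x)" if p: "\<phi> \<in> H_space \<alpha> l" for \<phi>
  using h(2)[OF p] integrable_Poly_mult[OF f H_space_Poly[OF p]]
   integrable_Poly_mult[OF integrable_Poly[OF H_space_Poly[OF h(1)]] H_space_Poly[OF p]] by (simp add: left_diff_distrib)
 have "H_proj \<alpha> l f = h" by (rule H_proj_eqI[OF f h(1) e])
 then show "H_proj \<alpha> l f \<in> H_space \<alpha> l" "\<phi> \<in> H_space \<alpha> l ==> (LINT x|mu. f x * \<phi> x) = (LINT x|mu. H_proj \<alpha> l f x * \<phi> x)"
  using h(1) e by auto
qed

lemma H_proj_Poly: "integrable mu f ==> H_proj \<alpha> l f \<in> Poly_deg l"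
 by (rule H_space_Poly[OF H_proj_in_orth(1)])

lemma integrable_proj_mult:
 "integrable mu f ==> \<phi> \<in> H_space \<alpha> l ==> integrable mu (%x. H_proj \<alpha> l f x * \<phi> x)"
 by (rule integrable_Poly_mult[OF integrable_Poly[OF H_proj_Poly] H_space_Poly])

lemma H_proj_add:
 assumes f: "integrable mu f" and g: "integrable mu g"
 shows "H_proj \<alpha> l (%x. f x + g x) = (%x. H_proj \<alpha> l f x + H_proj \<alpha> l g x)"
proof (rule H_proj_eqI[OF _ H_space_add[OF H_proj_in_orth(1)[OF f] H_proj_in_orth(1)[OF g]]])
 fix \<phi> assume p: "\<phi> \<in> H_space \<alpha> l"
 show "(LINT x|mu. (f x + g x) * \<phi> x) = (LINT x|mu. (H_proj \<alpha> l f x + H_proj \<alpha> l g x) * \<phi> x)"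
  using integrable_Poly_mult[OF f H_space_Poly[OF p]] integrable_Poly_mult[OF g H_space_Poly[OF p]]
   integrable_proj_mult[OF f p] integrable_proj_mult[OF g p] H_proj_in_orth(2)[OF f p] H_proj_in_orth(2)[OF g p]
  by (simp add: distrib_right)
qed (use f g in simp)

lemma H_proj_scale:
 assumes f: "integrable mu f"
 shows "H_proj \<alpha> l (%x. c * f x) = (%x. c * H_proj \<alpha> l f x)"
proof (rule H_proj_eqI[OF _ H_space_scale[OF H_proj_in_orth(1)[OF f]]])
 fix \<phi> assume p: "\<phi> \<in> H_space \<alpha> l"
 show "(LINT x|mu. c * f x * \<phi> x) = (LINT x|mu. c * H_proj \<alpha> l f x * \<phi> x)"
  using H_proj_in_orth(2)[OF f p] by (simp add: mult.assoc)
qed (use f in simp)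

lemma H_proj_zero: "H_proj \<alpha> l (%x. 0) = (%x. 0)"
 by (rule H_proj_eqI) (auto intro: H_space_zero)

lemma H_proj_sum:
 "(!!i. i \<in> A ==> integrable mu (f i)) ==> H_proj \<alpha> l (%x. \<Sum>i\<in>A. f i x) = (%x. \<Sum>i\<in>A. H_proj \<alpha> l (f i) x)"
proof (induction A rule: infinite_finite_induct)
 case (insert i A)
 have "integrable mu (%x. \<Sum>i\<in>A. f i x)" using insert.prems by (intro Bochner_Integration.integrable_sum) auto
 from H_proj_add[OF insert.prems[of i] this] insert show ?case by simp
qed (simp_all add: H_proj_zero)

lemma H_proj_H_space:
 assumes h: "h \<in> H_space \<alpha> j"
 shows "H_proj \<alpha> l h = (if l = j then h else (%x. 0))"
proof (rule H_proj_eqI[OF integrable_Poly[OF H_space_Poly[OF h]]])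
 show "(if l = j then h else (%x. 0)) \<in> H_space \<alpha> l" using h by (auto intro: H_space_zero)
 fix \<phi> assume p: "\<phi> \<in> H_space \<alpha> l"
 show "(LINT x|mu. h x * \<phi> x) = (LINT x|mu. (if l = j then h else (%x. 0)) x * \<phi> x)"
  using H_space_orthogonal[OF h p] by auto
qed

lemma Poly_expansion:
 assumes p: "p \<in> Poly_deg k"
 shows "p = (%x. \<Sum>l\<le>k. H_proj \<alpha> l p x)" "k < l ==> H_proj \<alpha> l p = (%x. 0)"
proof -
 obtain h where h: "!!j. h j \<in> H_space \<alpha> j" "p = (%x. \<Sum>j\<le>k. h j x)"
  using decomposition_exists[OF p] by blast
 have "H_proj \<alpha> l p x = (if l <= k then h l x else 0)" for l x
 proof -
  have "H_proj \<alpha> l p x = (\<Sum>j\<le>k. H_proj \<alpha> l (h j) x)"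
   unfolding h(2) using integrable_Poly[OF H_space_Poly[OF h(1)]] by (subst H_proj_sum) auto
  also have "... = (\<Sum>j\<le>k. if l = j then h l x else 0)"
   using H_proj_H_space[OF h(1)] by (intro sum.cong) auto
  finally show ?thesis by simp
 qed
 then show "p = (%x. \<Sum>l\<le>k. H_proj \<alpha> l p x)" "k < l ==> H_proj \<alpha> l p = (%x. 0)"
  by (auto simp: h(2) fun_eq_iff)
qed

lemma H_proj_BD:
 assumes f: "integrable mu f"
 shows "H_proj \<alpha> l (BD n f) = (%x. mm n l * H_proj \<alpha> l f x)"
proof (rule H_proj_eqI[OF integrable_Poly[OF BD_Poly] H_space_scale[OF H_proj_in_orth(1)[OF f]]])
 fix \<phi> assume p: "\<phi> \<in> H_space \<alpha> l"
 show "(LINT x|mu. BD n f x * \<phi> x) = (LINT x|mu. mm n l * H_proj \<alpha> l f x * \<phi> x)"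
  unfolding BD_adjoint[OF f H_space_Poly[OF p]] BD_eigen[OF p]
  using H_proj_in_orth(2)[OF f p]
  by (simp only: mult.assoc mult.left_commute[of "f _" "mm n l"] integral_mult_right_zero)
qed

lemma BD_expansion:
 assumes f: "integrable mu f"
 shows "BD n f x = (\<Sum>l\<le>n. mm n l * H_proj \<alpha> l f x)"
 using Poly_expansion(1)[OF BD_Poly, of n f] unfolding H_proj_BD[OF f] by (simp add: fun_eq_iff)

section \<open>Kernel operators on function norms\<close>

text \<open>The majorant, divided by its mass, is a symmetric Markov kernel, so the contraction property of the norm
applies.\<close>

lemma kernel_norm_bound:
 assumes N: "function_norm mu N"
  and c: "0 < (\<Sum>k\<le>n. b k)"
  and dom: "!!x y. x \<in> simplex_S ==> y \<in> simplex_S ==> \<bar>\<Sum>k\<le>n. a k * Kn k x y\<bar> <= (\<Sum>k\<le>n. b k * Kn k x y)"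
  and f: "integrable mu f"
 shows "N (%x. \<Sum>k\<le>n. a k * BD k f x) <= ennreal (\<Sum>k\<le>n. b k) * N f"
proof -
 interpret N: function_norm mu N by fact
 define c where "c = (\<Sum>k\<le>n. b k)"
 define B where "B x y = (\<Sum>k\<le>n. b k * Kn k x y)" for x y
 define h where "h x = (\<Sum>k\<le>n. a k * BD k f x)" for x
 define k where "k x y = ennreal (indicator simplex_S x * indicator simplex_S y * B x y / c)" for x y
 have [measurable]: "f \<in> borel_measurable mu" using f by auto
 have Km[measurable]: "case_prod (Kn k) \<in> borel_measurable (mu \<Otimes>\<^sub>M mu)" for k
  unfolding Kn_def by measurable
 have hm[measurable]: "h \<in> borel_measurable mu"
  unfolding h_def[abs_def] using Poly_deg_measurable[OF BD_Poly] by measurable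
 have Bi: "integrable mu (B x)" "(LINT y|mu. B x y) = c" for x
  unfolding B_def[abs_def] c_def using Kn_integral by (auto simp: Bochner_Integration.integral_sum)
 have B0: "0 <= B x y" if "x \<in> simplex_S" "y \<in> simplex_S" for x y
  using dom[OF that] unfolding B_def by linarith
 have "N (%x. (1 / c) * h x) <= N f"
 proof (rule N.norm_kernel[of k])
  show "case_prod k \<in> borel_measurable (mu \<Otimes>\<^sub>M mu)" unfolding k_def[abs_def] B_def by measurable
  show "k x y = k y x" for x y
   unfolding k_def B_def by (simp add: Kn_commute[of _ x] mult.commute[of "indicator simplex_S x"])
  show "(\<integral>\<^sup>+y. k x y \<partial>mu) <= 1" for x
  proof (cases "x \<in> simplex_S")
   case True
   have "(\<integral>\<^sup>+y. k x y \<partial>mu) = (\<integral>\<^sup>+y. ennreal (B x y / c) \<partial>mu)"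
    using AE_jacobi[of \<alpha>] by (intro nn_integral_cong_AE) (auto simp: k_def True elim!: eventually_mono)
   also have "... = ennreal (LINT y|mu. B x y / c)"
    using AE_jacobi[of \<alpha>] Bi assms(2) B0[OF True]
    by (intro nn_integral_eq_integral) (auto simp: c_def elim!: eventually_mono)
   also have "... = 1" using Bi(2) assms(2) by (simp add: c_def)
   finally show ?thesis by simp
  qed (simp add: k_def)
  show "AE x in mu. ennreal \<bar>(1 / c) * h x\<bar> <= (\<integral>\<^sup>+y. k x y * ennreal \<bar>f y\<bar> \<partial>mu)"
   using AE_jacobi[of \<alpha>]
  proof eventually_elim
   case (elim x)
   have i: "integrable mu (%y. (\<Sum>k\<le>n. a k * Kn k x y) * f y)"
    unfolding sum_distrib_right mult.assoc using BD_integral(2)[OF f]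
    by (intro Bochner_Integration.integrable_sum integrable_mult_right)
   have "h x = (LINT y|mu. (\<Sum>k\<le>n. a k * Kn k x y) * f y)"
    unfolding h_def sum_distrib_right mult.assoc using BD_integral[OF f]
    by (simp add: Bochner_Integration.integral_sum)
   then have "\<bar>h x\<bar> <= (LINT y|mu. \<bar>(\<Sum>k\<le>n. a k * Kn k x y) * f y\<bar>)" by simp
   then have "ennreal \<bar>(1 / c) * h x\<bar> <= ennreal ((1 / c) * (LINT y|mu. \<bar>(\<Sum>k\<le>n. a k * Kn k x y) * f y\<bar>))"
    using assms(2) by (intro ennreal_leI) (simp add: abs_mult c_def divide_right_mono)
   also have "... = ennreal (LINT y|mu. (1 / c) * \<bar>(\<Sum>k\<le>n. a k * Kn k x y) * f y\<bar>)" by simp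
   also have "... = (\<integral>\<^sup>+y. ennreal ((1 / c) * \<bar>(\<Sum>k\<le>n. a k * Kn k x y) * f y\<bar>) \<partial>mu)"
    using i assms(2) by (intro nn_integral_eq_integral[symmetric]) (auto simp: c_def)
   also have "... <= (\<integral>\<^sup>+y. k x y * ennreal \<bar>f y\<bar> \<partial>mu)"
   proof (rule nn_integral_mono_AE)
    show "AE y in mu. ennreal ((1 / c) * \<bar>(\<Sum>k\<le>n. a k * Kn k x y) * f y\<bar>) <= k x y * ennreal \<bar>f y\<bar>"
     using AE_jacobi[of \<alpha>]
    proof eventually_elim
     case (elim y)
     have "(1 / c) * \<bar>(\<Sum>k\<le>n. a k * Kn k x y) * f y\<bar> <= (B x y / c) * \<bar>f y\<bar>"
      using dom[OF \<open>x \<in> simplex_S\<close> elim] assms(2)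
      by (simp add: abs_mult B_def c_def divide_right_mono mult_right_mono)
     then have "ennreal ((1 / c) * \<bar>(\<Sum>k\<le>n. a k * Kn k x y) * f y\<bar>) <= ennreal ((B x y / c) * \<bar>f y\<bar>)"
      by (rule ennreal_leI)
     also have "... = k x y * ennreal \<bar>f y\<bar>"
      using B0[OF \<open>x \<in> simplex_S\<close> elim] assms(2) elim \<open>x \<in> simplex_S\<close>
      by (simp add: k_def c_def flip: ennreal_mult)
     finally show ?case .
    qed
   qed
   finally show ?case .
  qed
 qed auto
 then have "ennreal c * N (%x. (1 / c) * h x) <= ennreal c * N f" by (intro mult_left_mono) auto
 moreover have "N h <= ennreal c * N (%x. (1 / c) * h x)"
  using N.norm_cmult[of "%x. (1 / c) * h x" c] assms(2) by (simp add: c_def)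
 ultimately show ?thesis unfolding c_def h_def[abs_def] by (rule order_trans[rotated])
qed

lemma BD_norm_contraction:
 assumes N: "function_norm mu N" and f: "integrable mu f"
 shows "N (BD n f) <= N f"
proof -
 have s: "(\<Sum>k\<le>n. of_bool (k = n) * g k) = g n" for g :: "nat => real"
  by (subst sum.remove[of _ n]) (auto intro!: sum.neutral)
 have s1: "(\<Sum>k\<le>n. of_bool (k = n)) = (1::real)" using s[of "%_. 1"] by simp
 have "N (%x. \<Sum>k\<le>n. of_bool (k = n) * BD k f x) <= ennreal (\<Sum>k\<le>n. of_bool (k = n)) * N f"
  by (rule kernel_norm_bound[OF N _ _ f]) (use Kn_nonneg in \<open>simp_all only: s s1, auto\<close>)
 then show ?thesis by (simp only: s s1) simp
qed

section \<open>Convergence in the mean\<close>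

lemma continuous_dense_indicator:
 fixes A :: "(real^'d) set" and e :: real
 assumes A: "A \<in> sets borel" and e: "0 < e"
 shows "\<exists>g :: real^'d => real. continuous_on UNIV g \<and> integrable mu g \<and> (LINT x|mu. \<bar>indicator A x - g x\<bar>) <= e"
proof -
 have fin: "emeasure mu (space mu) ~= \<infinity>" by simp
 have AM: "emeasure mu A = ennreal (measure mu A)" by (simp add: emeasure_eq_measure)
 have "\<exists>K. K \<subseteq> A \<and> compact K \<and> measure mu A - e / 2 < measure mu K"
 proof (cases "measure mu A - e / 2 < 0")
  case True
  then have "measure mu A - e / 2 < measure mu {}" by simp
  then show ?thesis by (intro exI[of _ "{}"]) auto
 next
  case False
  have "ennreal (measure mu A - e / 2) < (SUP K\<in>{K. K \<subseteq> A \<and> compact K}. emeasure mu K)"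
   unfolding inner_regular[OF sets_jacobi fin A, symmetric] AM using e False by (simp add: ennreal_less_iff)
  then obtain K where "K \<subseteq> A" "compact K" "ennreal (measure mu A - e / 2) < emeasure mu K"
   by (auto simp: less_SUP_iff)
  then show ?thesis using False by (auto simp: emeasure_eq_measure ennreal_less_iff)
 qed
 then obtain K where K: "K \<subseteq> A" "compact K" "measure mu A - e / 2 < measure mu K" by blast
 have "(INF U\<in>{U. A \<subseteq> U \<and> open U}. emeasure mu U) < ennreal (measure mu A + e / 2)"
  unfolding outer_regular[OF sets_jacobi fin A, symmetric] AM using e by (intro ennreal_lessI) (auto intro: add_nonneg_pos)
 then obtain U where U: "A \<subseteq> U" "open U" "emeasure mu U < ennreal (measure mu A + e / 2)"
  by (auto simp: INF_less_iff)
 have Um: "measure mu U < measure mu A + e / 2"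
  using U(3) unfolding emeasure_eq_measure by (subst (asm) ennreal_less_iff) auto
 obtain g :: "real^'d => real" where g: "continuous_on UNIV g" "!!x. g x \<in> closed_segment 1 0" "!!x. x \<in> K ==> g x = 1" "!!x. x \<in> - U ==> g x = 0"
  using Urysohn[of K "- U" "1::real" 0] K U compact_imp_closed[OF K(2)] by auto
 have gb: "0 <= g x \<and> g x <= 1" for x using g(2)[of x] by (auto simp: closed_segment_eq_real_ivl)
 have [measurable]: "g \<in> borel_measurable borel" by (rule borel_measurable_continuous_onI[OF g(1)])
 have gi: "integrable mu g" by (rule integrable_const_bound[where B=1]) (use gb in auto)
 have [measurable]: "A \<in> sets borel" "U \<in> sets borel" "K \<in> sets borel"
  using A U K by (auto intro: borel_compact)
 have "(LINT x|mu. \<bar>indicator A x - g x\<bar>) <= (LINT x|mu. indicator (U - K) x)"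
 proof (rule integral_mono)
  show "integrable mu (%x. \<bar>indicator A x - g x\<bar>)"
   using gi by (intro integrable_abs Bochner_Integration.integrable_diff integrable_real_indicator) (auto simp: less_top[symmetric])
  show "integrable mu (indicator (U - K) :: _ => real)" by (intro integrable_real_indicator) (auto simp: less_top[symmetric])
  fix x
  show "\<bar>indicator A x - g x\<bar> <= indicator (U - K) x"
   using gb[of x] g(3,4)[of x] K(1) U(1) by (auto simp: indicator_def)
 qed
 also have "... = measure mu U - measure mu K"
  using K U by (simp add: finite_measure_Diff)
 also have "... <= e" using K Um by simp
 finally show ?thesis using g gi by blast
qed

text \<open>Regularity of finite Borel measures and Urysohn functions give the case of indicators; the rest is the
standard induction over integrable functions.\<close>

lemma continuous_dense_L1:
 fixes f :: "real^'d => real"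
 assumes "integrable mu f"
 shows "\<forall>e>0::real. \<exists>g :: real^'d => real. continuous_on UNIV g \<and> integrable mu g \<and> (LINT x|mu. \<bar>f x - g x\<bar>) <= e"
 using assms
proof (induction rule: integrable_induct)
 case (base A c)
 show ?case
 proof (intro allI impI)
  fix e :: real assume e: "0 < e"
  then have "0 < e / (\<bar>c\<bar> + 1)" by simp
  then obtain g where g: "continuous_on UNIV g" "integrable mu g" "(LINT x|mu. \<bar>indicator A x - g x\<bar>) <= e / (\<bar>c\<bar> + 1)"
   using continuous_dense_indicator[of A] base by auto
  have "(LINT x|mu. \<bar>indicator A x *\<^sub>R c - c * g x\<bar>) = (LINT x|mu. \<bar>c\<bar> * \<bar>indicator A x - g x\<bar>)"
   by (intro Bochner_Integration.integral_cong refl) (simp add: abs_mult[symmetric] algebra_simps)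
  also have "... <= \<bar>c\<bar> * (e / (\<bar>c\<bar> + 1))" using g(3) by (simp add: mult_left_mono del: times_divide_eq_right)
  also have "... <= e" using e by (simp add: divide_simps algebra_simps)
  finally show "\<exists>g. continuous_on UNIV g \<and> integrable mu g \<and> (LINT x|mu. \<bar>indicator A x *\<^sub>R c - g x\<bar>) <= e"
   using g by (intro exI[of _ "%x. c * g x"]) (auto intro!: continuous_intros)
 qed
next
 case (add f1 f2)
 show ?case
 proof (intro allI impI)
  fix e :: real assume e: "0 < e"
  then have e2: "0 < e / 2" by simp
  obtain g1 where g1: "continuous_on UNIV g1" "integrable mu g1" "(LINT x|mu. \<bar>f1 x - g1 x\<bar>) <= e / 2" using add e2 by blast
  obtain g2 where g2: "continuous_on UNIV g2" "integrable mu g2" "(LINT x|mu. \<bar>f2 x - g2 x\<bar>) <= e / 2" using add e2 by blast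
  have "(LINT x|mu. \<bar>f1 x + f2 x - (g1 x + g2 x)\<bar>) <= (LINT x|mu. \<bar>f1 x - g1 x\<bar> + \<bar>f2 x - g2 x\<bar>)"
   using add g1 g2 by (intro integral_mono) auto
  also have "... <= e" using add g1 g2 by (subst Bochner_Integration.integral_add) auto
  finally show "\<exists>g. continuous_on UNIV g \<and> integrable mu g \<and> (LINT x|mu. \<bar>f1 x + f2 x - g x\<bar>) <= e"
   using g1 g2 by (intro exI[of _ "%x. g1 x + g2 x"]) (auto intro!: continuous_intros)
 qed
next
 case (lim f s)
 show ?case
 proof (intro allI impI)
  fix e :: real assume e: "0 < e"
  have "(%i. LINT x|mu. \<bar>s i x - f x\<bar>) \<longlonglongrightarrow> (LINT x|mu. 0)"
  proof (rule integral_dominated_convergence[where w="%x. 3 * \<bar>f x\<bar>"])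
   show "AE x in mu. (%i. \<bar>s i x - f x\<bar>) \<longlonglongrightarrow> 0"
   proof (intro AE_I2 tendsto_rabs_zero)
    fix x assume "x \<in> space mu"
    then have "(%i. s i x) \<longlonglongrightarrow> f x" by (rule lim.hyps(2))
    then show "(%i. s i x - f x) \<longlonglongrightarrow> 0" by (simp only: LIM_zero_iff)
   qed
   show "AE x in mu. norm \<bar>s i x - f x\<bar> <= 3 * \<bar>f x\<bar>" for i
   proof (intro AE_I2)
    fix x assume "x \<in> space mu"
    then have "\<bar>s i x\<bar> <= 2 * \<bar>f x\<bar>" using lim.hyps(3)[of x i] by simp
    then show "norm \<bar>s i x - f x\<bar> <= 3 * \<bar>f x\<bar>" by simp
   qed
  qed (use lim.hyps in auto)
  from LIMSEQ_D[OF this, of "e / 2"] e obtain i where i: "\<bar>LINT x|mu. \<bar>s i x - f x\<bar>\<bar> < e / 2"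
   by auto
  obtain g where g: "continuous_on UNIV g" "integrable mu g" "(LINT x|mu. \<bar>s i x - g x\<bar>) <= e / 2"
   using lim.IH[of i] e by (metis half_gt_zero)
  have "(LINT x|mu. \<bar>f x - g x\<bar>) <= (LINT x|mu. \<bar>s i x - f x\<bar> + \<bar>s i x - g x\<bar>)"
   using lim.hyps g by (intro integral_mono) auto
  also have "... = (LINT x|mu. \<bar>s i x - f x\<bar>) + (LINT x|mu. \<bar>s i x - g x\<bar>)"
   using lim.hyps g by (intro Bochner_Integration.integral_add) auto
  also have "... <= e" using i g(3) by linarith
  finally show "\<exists>g. continuous_on UNIV g \<and> integrable mu g \<and> (LINT x|mu. \<bar>f x - g x\<bar>) <= e" using g by blast
 qed
qed

lemma BD_L1_contraction:
 assumes f: "integrable mu f"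
 shows "(LINT x|mu. \<bar>BD n f x\<bar>) <= (LINT x|mu. \<bar>f x\<bar>)"
proof -
 have e: "norm_L mu 1 g = ennreal (LINT x|mu. \<bar>g x\<bar>)" if g: "integrable mu g" for g
 proof -
  have "(\<integral>\<^sup>+x. ennreal (\<bar>g x\<bar> powr 1) \<partial>mu) = ennreal (LINT x|mu. \<bar>g x\<bar>)"
   using g by (subst powr_one) (auto intro!: nn_integral_eq_integral)
  then show ?thesis by (simp add: norm_L_def)
 qed
 have "function_norm mu (norm_L mu 1)"
  by (rule function_norm_Lp_or_Orlicz[OF finite_measure_jacobi]) (auto simp: Lp_or_Orlicz_norm_def)
 from BD_norm_contraction[OF this f, of n] show ?thesis
  unfolding e[OF f] e[OF integrable_Poly[OF BD_Poly]] by (simp add: ennreal_le_iff)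
qed

text \<open>The operators are contractions in the mean and converge on continuous functions, which are dense.\<close>

lemma BD_L1_tendsto:
 assumes f: "integrable mu f"
 shows "(%n. LINT x|mu. \<bar>BD n f x - f x\<bar>) \<longlonglongrightarrow> 0"
proof (rule LIMSEQ_I)
 fix r :: real assume r: "0 < r"
 then have "0 < r / 4" by simp
 then obtain g where g: "continuous_on UNIV g" "integrable mu g" "(LINT x|mu. \<bar>f x - g x\<bar>) <= r / 4"
  using continuous_dense_L1[OF f] by blast
 have [measurable]: "g \<in> borel_measurable borel" by (rule borel_measurable_continuous_onI[OF g(1)])
 have [measurable]: "BD n g \<in> borel_measurable borel" for n by (rule Poly_deg_measurable[OF BD_Poly])
 obtain B where B: "!!y. y \<in> simplex_S ==> \<bar>g y\<bar> <= B"
  using compact_imp_bounded[OF compact_continuous_image[OF continuous_on_subset[OF g(1) subset_UNIV] simplex_S_compact]]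
  by (auto simp: bounded_iff)
 have "(%n. LINT x|mu. \<bar>BD n g x - g x\<bar>) \<longlonglongrightarrow> (LINT x|mu. 0)"
 proof (rule integral_dominated_convergence[where w="%x. 2 * B"])
  show "AE x in mu. (%n. \<bar>BD n g x - g x\<bar>) \<longlonglongrightarrow> 0"
   using AE_jacobi[of \<alpha>]
  proof eventually_elim
   case (elim x)
   have "(%n. BD n g x - g x) \<longlonglongrightarrow> 0" using BD_tendsto[OF elim g(1)] by (simp add: LIM_zero_iff)
   then show ?case by (rule tendsto_rabs_zero)
  qed
  show "AE x in mu. norm \<bar>BD n g x - g x\<bar> <= 2 * B" for n
   using AE_jacobi[of \<alpha>]
  proof eventually_elim
   case (elim x)
   have "\<bar>BD n g x\<bar> <= (LINT y|mu. \<bar>Kn n x y * g y\<bar>)" unfolding BD_integral(1)[OF g(2)] by simp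
   also have "... <= (LINT y|mu. Kn n x y * B)"
   proof (rule integral_mono_AE)
    show "integrable mu (%y. \<bar>Kn n x y * g y\<bar>)" using BD_integral(2)[OF g(2)] by (rule integrable_abs)
    show "integrable mu (%y. Kn n x y * B)" using Kn_integral(2) by (rule integrable_mult_left)
    show "AE y in mu. \<bar>Kn n x y * g y\<bar> <= Kn n x y * B"
     using AE_jacobi[of \<alpha>]
     by eventually_elim (use Kn_nonneg[OF elim] B in \<open>auto simp: abs_mult intro!: mult_left_mono\<close>)
   qed
   also have "... = B" using Kn_integral by simp
   finally show ?case using B[OF elim] by simp
  qed
 qed (use g in auto)
 from LIMSEQ_D[OF this, of "r / 4"] r
 obtain n0 where n0: "!!n. n >= n0 ==> \<bar>LINT x|mu. \<bar>BD n g x - g x\<bar>\<bar> < r / 4" by auto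
 have "\<bar>LINT x|mu. \<bar>BD n f x - f x\<bar>\<bar> < r" if n: "n >= n0" for n
 proof -
  have fg: "integrable mu (%x. f x - g x)" using f g by simp
  have d: "BD n f x = BD n (%x. f x - g x) x + BD n g x" for x
   using BD_add[OF fg g(2), of n x] by simp
  note ii = integrable_Poly[OF BD_Poly]
  have "(LINT x|mu. \<bar>BD n f x - f x\<bar>) <= (LINT x|mu. \<bar>BD n (%x. f x - g x) x\<bar> + \<bar>BD n g x - g x\<bar> + \<bar>f x - g x\<bar>)"
  proof (rule integral_mono)
   show "integrable mu (%x. \<bar>BD n f x - f x\<bar>)" using ii f by auto
   show "integrable mu (%x. \<bar>BD n (%x. f x - g x) x\<bar> + \<bar>BD n g x - g x\<bar> + \<bar>f x - g x\<bar>)" using ii f g by auto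
   show "\<bar>BD n f x - f x\<bar> <= \<bar>BD n (%x. f x - g x) x\<bar> + \<bar>BD n g x - g x\<bar> + \<bar>f x - g x\<bar>" for x
    unfolding d by linarith
  qed
  also have "... = (LINT x|mu. \<bar>BD n (%x. f x - g x) x\<bar>) + (LINT x|mu. \<bar>BD n g x - g x\<bar>) + (LINT x|mu. \<bar>f x - g x\<bar>)"
   using ii f g by (simp add: Bochner_Integration.integral_add)
  also have "... < r" using BD_L1_contraction[OF fg, of n] g(3) n0[OF n] r by linarith
  finally show ?thesis by simp
 qed
 then show "\<exists>no. \<forall>n\<ge>no. norm ((LINT x|mu. \<bar>BD n f x - f x\<bar>) - 0) < r" by auto
qed

lemma BD_AE_subseq:
 assumes f: "integrable mu f"
 shows "\<exists>r. strict_mono r \<and> (AE x in mu. (%n. BD (r n) f x) \<longlonglongrightarrow> f x)"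
proof -
 have "\<exists>r. strict_mono r \<and> (AE x in mu. (%n. BD (r n) f x - f x) \<longlonglongrightarrow> 0)"
  using BD_L1_tendsto[OF f] integrable_Poly[OF BD_Poly] f by (intro tendsto_L1_AE_subseq) auto
 then show ?thesis by (simp add: LIM_zero_iff)
qed

text \<open>Equal projections give equal images under every \<open>BD n\<close>, and these converge to the functions.\<close>

lemma AE_eq_if_H_proj_eq:
 assumes f: "integrable mu f" and g: "integrable mu g" and e: "!!l. H_proj \<alpha> l f = H_proj \<alpha> l g"
 shows "AE x in mu. f x = g x"
proof -
 have eq: "BD n f = BD n g" for n
  using BD_expansion[OF f] BD_expansion[OF g] e by (auto simp: fun_eq_iff)
 have fg: "integrable mu (%x. f x - g x)" using f g by simp
 have "BD n (%x. f x - g x) x = 0" for n x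
  using BD_add[OF fg g, of n x] eq[of n] by simp
 then have "(%n. LINT x|mu. \<bar>f x - g x\<bar>) \<longlonglongrightarrow> 0"
  using BD_L1_tendsto[OF fg] by (simp add: abs_minus_commute)
 then have "(LINT x|mu. \<bar>f x - g x\<bar>) = 0" by (simp add: LIMSEQ_const_iff)
 then have "AE x in mu. \<bar>f x - g x\<bar> = 0"
  using integral_nonneg_eq_0_iff_AE[of mu "%x. \<bar>f x - g x\<bar>"] fg by simp
 then show ?thesis by eventually_elim simp
qed

end

section \<open>Positive kernels from even power moments\<close>

text \<open>A signed square root, cut off at 1 so that it is bounded everywhere. Under \<open>sym_beta a\<close> it is
distributed with density proportional to \<open>(1 - t\<^sup>2) powr (a - 1/2)\<close> on \<open>[-1,
1]\<close>; this measure is finite only for \<open>a > -1/2\<close>, which is where the restriction on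
\<open>\<alpha>\<close> enters.\<close>

definition sroot :: "real => real" where
 "sroot u = sgn u * sqrt (min 1 \<bar>u\<bar>)"

definition sym_beta :: "real => real measure" where
 "sym_beta a = density lborel (%u. ennreal (indicator {-1..1} u * (\<bar>u\<bar> powr (-1/2) * (1 - \<bar>u\<bar>) powr (a - 1/2))))"

lemma sroot_bound: "\<bar>sroot u\<bar> <= 1"
 by (auto simp: sroot_def abs_mult sgn_if)

lemma sroot_measurable [measurable]: "sroot \<in> borel_measurable borel"
 unfolding sroot_def by measurable

lemma sroot_minus: "sroot (- u) = - sroot u"
 by (simp add: sroot_def sgn_minus)

lemma sym_beta_sets [simp, measurable_cong]: "sets (sym_beta a) = sets borel" "space (sym_beta a) = UNIV"
 by (auto simp: sym_beta_def)

lemma sroot_even_power: "\<bar>u\<bar> <= 1 ==> u ~= 0 ==> sroot u ^ (2 * k) = \<bar>u\<bar> powr real k"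
 by (simp add: sroot_def power_mult power_mult_distrib powr_realpow sgn_if)

lemma nn_integral_sym_beta:
 assumes a: "a > -1/2"
 shows "(\<integral>\<^sup>+u. ennreal (sroot u ^ (2 * k)) \<partial>sym_beta a) = ennreal (2 * Beta (real k + 1/2) (a + 1/2))"
proof -
 define f where "f u = indicator {0..1} u * (u powr (real k - 1/2) * (1 - u) powr (a - 1/2))" for u :: real
 have fI: "(\<integral>\<^sup>+u. ennreal (f u) \<partial>lborel) = ennreal (Beta (real k + 1/2) (a + 1/2))"
  using nn_integral_Beta_scaled[of "real k - 1/2" "a - 1/2" 1] a unfolding f_def
  by (simp add: add.commute)
 have [measurable]: "f \<in> borel_measurable borel" unfolding f_def by measurable
 have f0: "0 <= f u" for u by (simp add: f_def)
 have fm: "(\<integral>\<^sup>+u. ennreal (f (- u)) \<partial>lborel) = (\<integral>\<^sup>+u. ennreal (f u) \<partial>lborel)"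
  using nn_integral_real_affine[of "%u. ennreal (f u)" "-1" 0] by simp
 have "(\<integral>\<^sup>+u. ennreal (sroot u ^ (2 * k)) \<partial>sym_beta a) =
  (\<integral>\<^sup>+u. ennreal (indicator {-1..1} u * (\<bar>u\<bar> powr (-1/2) * (1 - \<bar>u\<bar>) powr (a - 1/2))) * ennreal (sroot u ^ (2 * k)) \<partial>lborel)"
  unfolding sym_beta_def by (subst nn_integral_density) auto
 also have "... = (\<integral>\<^sup>+u. ennreal (f u) + ennreal (f (- u)) \<partial>lborel)"
 proof (intro nn_integral_cong)
  fix u :: real
  have "indicator {-1..1} u * (\<bar>u\<bar> powr (-1/2) * (1 - \<bar>u\<bar>) powr (a - 1/2)) * sroot u ^ (2 * k) = f u + f (- u)"
  proof (cases "u = 0 \<or> \<bar>u\<bar> > 1")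
   case True then show ?thesis by (auto simp: f_def indicator_def)
  next
   case False
   then have u: "u ~= 0" "\<bar>u\<bar> <= 1" by auto
   have "\<bar>u\<bar> powr (-1/2) * \<bar>u\<bar> powr real k = \<bar>u\<bar> powr (real k - 1/2)"
    by (simp add: powr_add[symmetric] add.commute)
   then have "indicator {-1..1} u * (\<bar>u\<bar> powr (-1/2) * (1 - \<bar>u\<bar>) powr (a - 1/2)) * sroot u ^ (2 * k) =
     \<bar>u\<bar> powr (real k - 1/2) * (1 - \<bar>u\<bar>) powr (a - 1/2)"
    using u by (subst sroot_even_power[OF u(2,1)]) (simp add: abs_le_iff mult_ac)
   then show ?thesis using u by (cases "u > 0") (auto simp: f_def)
  qed
  then show "ennreal (indicator {-1..1} u * (\<bar>u\<bar> powr (-1/2) * (1 - \<bar>u\<bar>) powr (a - 1/2))) * ennreal (sroot u ^ (2 * k)) =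
    ennreal (f u) + ennreal (f (- u))"
   using f0[of u] f0[of "- u"] by (simp add: ennreal_mult'[symmetric] ennreal_plus[symmetric] power_mult del: ennreal_plus)
 qed
 also have "... = ennreal (Beta (real k + 1/2) (a + 1/2)) + ennreal (Beta (real k + 1/2) (a + 1/2))"
  by (subst nn_integral_add) (auto simp: fI fm)
 also have "... = ennreal (2 * Beta (real k + 1/2) (a + 1/2))"
  using Beta_real_pos[of "real k + 1/2" "a + 1/2"] a by (simp flip: ennreal_plus)
 finally show ?thesis .
qed

lemma finite_measure_sym_beta: "a > -1/2 ==> finite_measure (sym_beta a)"
 using nn_integral_sym_beta[of a 0] by (intro finite_measureI) (simp add: top_unique)

lemma integrable_sroot: "a > -1/2 ==> integrable (sym_beta a) (%u. sroot u ^ n)"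
proof -
 assume a: "a > -1/2"
 interpret finite_measure "sym_beta a" by (rule finite_measure_sym_beta[OF a])
 show ?thesis
  by (rule integrable_const_bound[where B=1]) (auto simp: power_abs sroot_bound power_le_one)
qed

lemma integral_sroot:
 assumes a: "a > -1/2"
 shows "(LINT u|sym_beta a. sroot u ^ (2 * k)) = 2 * Beta (real k + 1/2) (a + 1/2)"
  and "odd n ==> (LINT u|sym_beta a. sroot u ^ n) = 0"
proof -
 show "(LINT u|sym_beta a. sroot u ^ (2 * k)) = 2 * Beta (real k + 1/2) (a + 1/2)"
  using nn_integral_sym_beta[OF a, of k] Beta_real_pos[of "real k + 1/2" "a + 1/2"] a
  by (subst integral_eq_nn_integral) (auto simp: power_mult)
 assume n: "odd n"
 let ?g = "%u. indicator {-1..1} u * (\<bar>u\<bar> powr (-1/2) * (1 - \<bar>u\<bar>) powr (a - 1/2)) * sroot u ^ n"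
 have "(LINT u|sym_beta a. sroot u ^ n) = (LINT u|lborel. ?g u)"
  unfolding sym_beta_def by (subst integral_density) auto
 moreover have "(LINT u|lborel. ?g u) = - (LINT u|lborel. ?g u)"
  using n by (subst lborel_integral_real_affine[where c="-1" and t=0])
   (auto simp: sroot_minus indicator_def simp flip: Bochner_Integration.integral_minus intro!: Bochner_Integration.integral_cong)
 ultimately show "(LINT u|sym_beta a. sroot u ^ n) = 0" by linarith
qed

lemma Gamma_half_fact: "Gamma (real b + 1/2) / fact (2 * b) = sqrt pi / (4 ^ b * fact b)"
proof -
 have "pochhammer (1/2 :: real) b = Gamma (1/2 + real b) / Gamma (1/2)"
  by (rule pochhammer_Gamma) (auto elim!: nonpos_Ints_cases)
 then have "Gamma (real b + 1/2) = sqrt pi * pochhammer (1/2) b"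
  by (simp add: Gamma_one_half_real add.commute)
 moreover have "pochhammer (1/2 :: real) b ~= 0"
  using pochhammer_pos[of "1/2 :: real" b] by simp
 ultimately show ?thesis by (simp add: fact_double power_mult)
qed

text \<open>Multi-indices with an odd entry drop out, as odd moments of a symmetric distribution vanish.\<close>

lemma sum_degs_even:
 fixes F :: "('i::finite => nat) => real"
 assumes z: "!!\<gamma> i. odd (\<gamma> i) ==> F \<gamma> = 0"
 shows "(\<Sum>\<gamma>\<in>degs (2 * k). F \<gamma>) = (\<Sum>b\<in>degs k. F (%i. 2 * b i))"
proof -
 let ?d = "%b i. 2 * b i :: nat"
 have "(\<Sum>b\<in>degs k. F (?d b)) = (\<Sum>\<gamma>\<in>?d ` degs k. F \<gamma>)"
  by (subst sum.reindex) (auto simp: inj_on_def fun_eq_iff)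
 also have "... = (\<Sum>\<gamma>\<in>degs (2 * k). F \<gamma>)"
 proof (rule sum.mono_neutral_left[OF finite_degs])
  show "?d ` degs k \<subseteq> degs (2 * k)" by (auto simp: degs_def sum_distrib_left[symmetric])
  show "\<forall>\<gamma>\<in>degs (2 * k) - ?d ` degs k. F \<gamma> = 0"
  proof (intro ballI, rule ccontr)
   fix \<gamma> :: "'i => nat" assume g: "\<gamma> \<in> degs (2 * k) - ?d ` degs k" "F \<gamma> ~= 0"
   then have "even (\<gamma> i)" for i using z[of \<gamma> i] by auto
   then have e: "\<gamma> = ?d (%i. \<gamma> i div 2)" by (auto simp: fun_eq_iff)
   have "(%i. \<gamma> i div 2) \<in> degs k"
   proof -
    have "2 * (\<Sum>i\<in>UNIV. \<gamma> i div 2) = (\<Sum>i\<in>UNIV. \<gamma> i)"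
     unfolding sum_distrib_left using \<open>!!i. even (\<gamma> i)\<close> by (intro sum.cong) auto
    then show ?thesis using g(1) by (simp add: degs_def)
   qed
   then have "?d (%i. \<gamma> i div 2) \<in> ?d ` degs k" by (rule imageI)
   then show False using g(1) unfolding e[symmetric] by blast
  qed
 qed
 finally show ?thesis ..
qed

context jacobi
begin

text \<open>The \<open>k\<close>-th moment of \<open>nu\<close> below, with the quotient of rising factorials as closed
form.\<close>

definition ww :: "nat => real" where
 "ww k = pochhammer (1/2) k / pochhammer (\<sigma> + 1) k"

lemma ww_0 [simp]: "ww 0 = 1"
 by (simp add: ww_def)

lemma ww_Suc: "ww (Suc k) * (real k + \<sigma> + 1) = ww k * (real k + 1/2)"
proof -
 have "pochhammer (\<sigma> + 1) k > 0" using sigma_pos by (intro pochhammer_pos) auto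
 moreover have "real k + \<sigma> + 1 > 0" using sigma_pos of_nat_0_le_iff[of k] by linarith
 moreover have "p / (q * v) * v = p / q" if "0 < v" for p q v :: real using that by simp
 moreover have "pochhammer (\<sigma> + 1) (Suc k) = pochhammer (\<sigma> + 1) k * (real k + \<sigma> + 1)"
  by (simp add: pochhammer_Suc add_ac)
 ultimately show ?thesis unfolding ww_def by (simp only: pochhammer_Suc[of "1/2"]) (simp add: add.commute)
qed

lemma ww_pos: "0 < ww k"
 unfolding ww_def using sigma_pos by (intro divide_pos_pos pochhammer_pos) auto

lemma ww_kap:
 assumes b: "b \<in> degs k"
 shows "(\<Prod>i\<in>UNIV. 2 * Beta (real (b i) + 1/2) (\<alpha> i + 1/2)) * (fact (2 * k) / mfact (%i. 2 * b i)) =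
  (\<Prod>i\<in>UNIV. 2 * sqrt pi * Gamma (\<alpha> i + 1/2)) / Gamma (\<sigma> + 1) * (ww k * kap b)"
proof -
 have k: "(\<Sum>i\<in>UNIV. b i) = k" using b by (simp add: degs_def)
 have k4: "(\<Prod>i\<in>UNIV. 4 ^ b i) = (4::real) ^ k" unfolding k[symmetric] by (simp add: power_sum)
 have s: "(\<Sum>i\<in>UNIV. real (b i) + \<alpha> i + 1) = real k + \<sigma> + 1"
  unfolding k[symmetric] by (simp add: sum.distrib sig_def card_UNIV_option)
 define A where "A = (\<Prod>i\<in>UNIV. Gamma (real (b i) + \<alpha> i + 1))"
 define S where "S = (\<Prod>i\<in>UNIV. 2 * sqrt pi * Gamma (\<alpha> i + 1/2))"
 have A0: "A > 0" unfolding A_def using alpha1 by (intro prod_pos Gamma_real_pos) (auto intro: add_nonneg_pos simp: add.assoc)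
 have "(\<Prod>i\<in>UNIV. 2 * Beta (real (b i) + 1/2) (\<alpha> i + 1/2)) * (fact (2 * k) / mfact (%i. 2 * b i)) =
  fact (2 * k) * (\<Prod>i\<in>UNIV. 2 * Beta (real (b i) + 1/2) (\<alpha> i + 1/2) / fact (2 * b i))"
  by (simp add: mfact_def prod_dividef)
 also have "(\<Prod>i\<in>UNIV. 2 * Beta (real (b i) + 1/2) (\<alpha> i + 1/2) / fact (2 * b i)) =
  (\<Prod>i\<in>UNIV. 2 * sqrt pi * Gamma (\<alpha> i + 1/2) / (4 ^ b i * fact (b i) * Gamma (real (b i) + \<alpha> i + 1)))"
 proof (intro prod.cong refl)
  fix i
  have "2 * Beta (real (b i) + 1/2) (\<alpha> i + 1/2) / fact (2 * b i) =
   2 * Gamma (\<alpha> i + 1/2) / Gamma (real (b i) + \<alpha> i + 1) * (Gamma (real (b i) + 1/2) / fact (2 * b i))"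
   by (simp add: Beta_def add_ac)
  also have "... = 2 * sqrt pi * Gamma (\<alpha> i + 1/2) / (4 ^ b i * fact (b i) * Gamma (real (b i) + \<alpha> i + 1))"
   unfolding Gamma_half_fact by (simp add: mult_ac)
  finally show "2 * Beta (real (b i) + 1/2) (\<alpha> i + 1/2) / fact (2 * b i) = ..." .
 qed
 also have "... = S / (4 ^ k * mfact b * A)"
  by (simp only: prod_dividef prod.distrib k4 S_def A_def mfact_def)
 finally have L: "(\<Prod>i\<in>UNIV. 2 * Beta (real (b i) + 1/2) (\<alpha> i + 1/2)) * (fact (2 * k) / mfact (%i. 2 * b i)) =
  fact (2 * k) * (S / (4 ^ k * mfact b * A))" .
 have g: "Gamma (real k + \<sigma> + 1) > 0" "Gamma (\<sigma> + 1) > 0" using sigma_pos of_nat_0_le_iff[of k] by (auto intro!: Gamma_real_pos)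
 have p: "pochhammer (\<sigma> + 1) k = Gamma (real k + \<sigma> + 1) / Gamma (\<sigma> + 1)"
 proof -
  have "\<sigma> + 1 \<notin> \<int>\<^sub>\<le>\<^sub>0" using sigma_pos nonpos_Ints_nonpos[of "\<sigma> + 1"] by auto
  then show ?thesis using pochhammer_Gamma[of "\<sigma> + 1" k] by (simp add: add_ac)
 qed
 have "ww k * kap b = pochhammer (1/2) k * fact k * Gamma (\<sigma> + 1) / (mfact b * A)"
  unfolding ww_def kap_def moment_def k s p A_def[symmetric] using g by simp
 also have "pochhammer (1/2) k * fact k = (fact (2 * k) / 4 ^ k :: real)"
  by (simp add: fact_double power_mult)
 finally have R: "ww k * kap b = fact (2 * k) / 4 ^ k * Gamma (\<sigma> + 1) / (mfact b * A)" .
 show ?thesis unfolding L R S_def[symmetric] using g(2) by (simp add: mult_ac)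
qed

text \<open>With independent variables \<open>t i\<close> distributed as above, \<open>ww k * Kn k x y\<close> is a
constant multiple of the expectation of \<open>(\<Sum>i. sqrt (x i * y i) * t i) ^ (2 * k)\<close>, by the
multinomial formula. The base is at most 1 in modulus by the inequality of arithmetic and geometric means, so
a polynomial that is nonnegative on \<open>[0, 1]\<close> yields a nonnegative kernel.\<close>

lemma Kn_positive:
 assumes p: "!!u. 0 <= u ==> u <= 1 ==> 0 <= (\<Sum>k\<le>n. a k * u ^ k)"
  and x: "x \<in> simplex_S" and y: "y \<in> simplex_S"
 shows "0 <= (\<Sum>k\<le>n. a k * ww k * Kn k x y)"
proof -
 define c where "c i = sqrt (coord x i * coord y i)" for i
 have x0: "0 <= coord x i" and y0: "0 <= coord y i" for i using x y by (auto simp: simplex_S_def simp del: coord.simps)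
 have c0: "0 <= c i" for i using x0 y0 by (simp add: c_def del: coord.simps)
 have c1: "(\<Sum>i\<in>UNIV. c i) <= 1"
 proof -
  have "(\<Sum>i\<in>UNIV. c i) <= (\<Sum>i\<in>UNIV. (coord x i + coord y i) / 2)"
   unfolding c_def by (intro sum_mono arith_geo_mean_sqrt x0 y0)
  also have "... = 1" by (simp only: sum_divide_distrib[symmetric] sum.distrib sum_coord) simp
  finally show ?thesis .
 qed
 define M where "M i = sym_beta (\<alpha> i)" for i
 have al: "\<alpha> i > -1/2" for i using alpha[of i] by simp
 have al2: "0 < \<alpha> i + 1/2" for i using al[of i] by linarith
 interpret Mf: finite_measure "M i" for i unfolding M_def by (rule finite_measure_sym_beta[OF al])
 interpret P: product_sigma_finite M by unfold_locales
 let ?P = "Pi\<^sub>M UNIV M"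
 define t where "t u = (\<Sum>i\<in>UNIV. c i * sroot (u i))" for u :: "'d option => real"
 define D where "D = (\<Prod>i\<in>UNIV. 2 * sqrt pi * Gamma (\<alpha> i + 1/2)) / Gamma (\<sigma> + 1)"
 have D: "D > 0" unfolding D_def using al sigma_pos
  by (intro divide_pos_pos prod_pos Gamma_real_pos mult_pos_pos) (auto intro: al2)
 have texp: "t u ^ n = (\<Sum>\<gamma>\<in>degs n. (fact n / mfact \<gamma> * (\<Prod>i\<in>UNIV. c i ^ \<gamma> i)) * (\<Prod>i\<in>UNIV. sroot (u i) ^ \<gamma> i))" for u n
  unfolding t_def multinomial[symmetric] by (simp add: power_mult_distrib prod.distrib mult_ac)
 have pi: "integrable ?P (%u. \<Prod>i\<in>UNIV. sroot (u i) ^ \<gamma> i)" for \<gamma>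
  by (rule P.product_integrable_prod) (auto simp: M_def intro: integrable_sroot[OF al])
 have pe: "(LINT u|?P. (\<Prod>i\<in>UNIV. sroot (u i) ^ \<gamma> i)) = (\<Prod>i\<in>UNIV. LINT u|M i. sroot u ^ \<gamma> i)" for \<gamma>
  by (rule P.product_integral_prod) (auto simp: M_def intro: integrable_sroot[OF al])
 have ti: "integrable ?P (%u. t u ^ n)" for n
  unfolding texp using pi by auto
 have tE: "(LINT u|?P. t u ^ (2 * k)) = D * (ww k * Kn k x y)" for k
 proof -
  have "(LINT u|?P. t u ^ (2 * k)) = (\<Sum>\<gamma>\<in>degs (2 * k). (fact (2 * k) / mfact \<gamma> * (\<Prod>i\<in>UNIV. c i ^ \<gamma> i)) * (\<Prod>i\<in>UNIV. LINT u|M i. sroot u ^ \<gamma> i))"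
   unfolding texp using pi by (simp add: Bochner_Integration.integral_sum pe)
  also have "... = (\<Sum>b\<in>degs k. (fact (2 * k) / mfact (%i. 2 * b i) * (\<Prod>i\<in>UNIV. c i ^ (2 * b i))) * (\<Prod>i\<in>UNIV. LINT u|M i. sroot u ^ (2 * b i)))"
  proof (rule sum_degs_even)
   fix \<gamma> :: "'d option => nat" and i assume "odd (\<gamma> i)"
   then have "(LINT u|M i. sroot u ^ \<gamma> i) = 0" unfolding M_def by (rule integral_sroot(2)[OF al])
   then have "(\<Prod>i\<in>UNIV. LINT u|M i. sroot u ^ \<gamma> i) = 0" by (intro prod_zero) auto
   then show "(fact (2 * k) / mfact \<gamma> * (\<Prod>i\<in>UNIV. c i ^ \<gamma> i)) * (\<Prod>i\<in>UNIV. LINT u|M i. sroot u ^ \<gamma> i) = 0" by simp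
  qed
  also have "... = (\<Sum>b\<in>degs k. D * (ww k * (kap b * (hmon b x * hmon b y))))"
  proof (rule sum.cong[OF refl])
   fix b :: "'d option => nat" assume b: "b \<in> degs k"
   have "(\<Prod>i\<in>UNIV. c i ^ (2 * b i)) = hmon b x * hmon b y"
    unfolding hmon_def prod.distrib[symmetric] using x0 y0
    by (intro prod.cong refl) (simp add: c_def power_mult power_mult_distrib del: coord.simps)
   moreover have "(\<Prod>i\<in>UNIV. LINT u|M i. sroot u ^ (2 * b i)) = (\<Prod>i\<in>UNIV. 2 * Beta (real (b i) + 1/2) (\<alpha> i + 1/2))"
    unfolding M_def by (intro prod.cong refl integral_sroot(1)[OF al])
   ultimately have "(fact (2 * k) / mfact (%i. 2 * b i) * (\<Prod>i\<in>UNIV. c i ^ (2 * b i))) * (\<Prod>i\<in>UNIV. LINT u|M i. sroot u ^ (2 * b i)) =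
    ((\<Prod>i\<in>UNIV. 2 * Beta (real (b i) + 1/2) (\<alpha> i + 1/2)) * (fact (2 * k) / mfact (%i. 2 * b i))) * (hmon b x * hmon b y)"
    by (simp only: mult_ac)
   then show "(fact (2 * k) / mfact (%i. 2 * b i) * (\<Prod>i\<in>UNIV. c i ^ (2 * b i))) * (\<Prod>i\<in>UNIV. LINT u|M i. sroot u ^ (2 * b i)) =
    D * (ww k * (kap b * (hmon b x * hmon b y)))"
    unfolding ww_kap[OF b] D_def[symmetric] by (simp only: mult_ac)
  qed
  also have "... = D * (ww k * Kn k x y)" by (simp only: Kn_def sum_distrib_left)
  finally show ?thesis .
 qed
 have "0 <= (LINT u|?P. (\<Sum>k\<le>n. a k * t u ^ (2 * k)))"
 proof (intro Bochner_Integration.integral_nonneg)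
  fix u
  have "\<bar>t u\<bar> <= (\<Sum>i\<in>UNIV. c i * \<bar>sroot (u i)\<bar>)"
   unfolding t_def using sum_abs[of "%i. c i * sroot (u i)" UNIV] c0 by (simp add: abs_mult)
  also have "... <= (\<Sum>i\<in>UNIV. c i)" using c0 sroot_bound by (intro sum_mono) (simp add: mult_left_le)
  finally have "\<bar>t u\<bar> <= 1" using c1 by simp
  then have "(t u)\<^sup>2 <= 1" by (simp add: abs_square_le_1)
  then show "0 <= (\<Sum>k\<le>n. a k * t u ^ (2 * k))" using p[of "(t u)\<^sup>2"] by (simp add: power_mult)
 qed
 also have "... = D * (\<Sum>k\<le>n. a k * ww k * Kn k x y)"
 proof -
  have "(LINT u|?P. (\<Sum>k\<le>n. a k * t u ^ (2 * k))) = (\<Sum>k\<le>n. a k * (D * (ww k * Kn k x y)))"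
   unfolding tE[symmetric] using ti by (simp add: Bochner_Integration.integral_sum)
  then show ?thesis by (simp only: sum_distrib_left mult_ac)
 qed
 finally show ?thesis using D by (simp add: zero_le_mult_iff)
qed

end

section \<open>One-dimensional estimates\<close>

lemma increment_le_nn_integral_derivative:
 fixes F f :: "real => real"
 assumes ab: "a <= b" and F: "continuous_on {a..b} F"
  and d: "!!x. a < x ==> x < b ==> (F has_real_derivative f x) (at x)"
  and f[measurable]: "f \<in> borel_measurable borel"
 shows "ennreal \<bar>F b - F a\<bar> <= (\<integral>\<^sup>+x. indicator {a..b} x * ennreal \<bar>f x\<bar> \<partial>lborel)"
proof (cases "(\<integral>\<^sup>+x. indicator {a..b} x * ennreal \<bar>f x\<bar> \<partial>lborel) < \<infinity>")
 case True
 have e: "ennreal (norm (indicator {a..b} x *\<^sub>R f x)) = indicator {a..b} x * ennreal \<bar>f x\<bar>" for x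
  by (auto simp: indicator_def)
 have i: "set_integrable lborel {a..b} f"
  unfolding set_integrable_def using True by (intro integrableI_bounded) (auto simp only: e, measurable)
 have "(f has_integral (F b - F a)) {a..b}"
  by (rule fundamental_theorem_of_calculus_interior[OF ab F])
    (use d in \<open>auto simp: has_real_derivative_iff_has_vector_derivative[symmetric]\<close>)
 then have "F b - F a = (LINT x:{a..b}|lborel. f x)"
  using set_borel_integral_eq_integral(2)[OF i] by (simp add: integral_unique)
 then have "ennreal \<bar>F b - F a\<bar> <= (\<integral>\<^sup>+x. ennreal (norm (indicator {a..b} x *\<^sub>R f x)) \<partial>lborel)"
  using integral_norm_bound_ennreal[OF i[unfolded set_integrable_def]] by (simp add: set_lebesgue_integral_def)
 then show ?thesis by (simp only: e)
qed (simp add: less_top[symmetric] not_less top_unique)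

context jacobi
begin

text \<open>The density of the probability measure \<open>nu\<close> on \<open>[0, 1]\<close>, the one-dimensional model
to which estimates of kernels are reduced.\<close>

definition nud :: "real => real" where
 "nud u = indicator {0..1} u * (u powr (-1/2) * (1 - u) powr (\<sigma> - 1/2)) / Beta (1/2) (\<sigma> + 1/2)"

definition nu :: "real measure" where
 "nu = density lborel (%u. ennreal (nud u))"

lemma Beta_sigma: "0 < Beta (1/2) (\<sigma> + 1/2)"
 using sigma_pos by (intro Beta_real_pos) auto

lemma nud_nonneg: "0 <= nud u"
 using Beta_sigma by (simp add: nud_def)

lemma nud_measurable [measurable]: "nud \<in> borel_measurable borel"
 unfolding nud_def by measurable

lemma nu_sets [simp, measurable_cong]: "sets nu = sets borel" "space nu = UNIV"
 by (auto simp: nu_def)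

lemma nud_outside: "u <= 0 \<or> 1 < u ==> nud u = 0"
 by (auto simp: nud_def indicator_def)

lemma AE_nu: "AE u in nu. 0 < u \<and> u <= 1"
proof -
 have "0 < u \<and> u <= 1" if "0 < nud u" for u using nud_outside[of u] that by linarith
 then show ?thesis unfolding nu_def by (subst AE_density) auto
qed

lemma nn_integral_nu: "f \<in> borel_measurable borel ==> (\<integral>\<^sup>+u. f u \<partial>nu) = (\<integral>\<^sup>+u. ennreal (nud u) * f u \<partial>lborel)"
 unfolding nu_def by (subst nn_integral_density) auto

lemma ww_Beta: "ww k = Beta (real k + 1/2) (\<sigma> + 1/2) / Beta (1/2) (\<sigma> + 1/2)"
proof (induction k)
 case 0 show ?case using Beta_sigma by simp
next
 case (Suc k)
 have p: "real k + \<sigma> + 1 > 0" using sigma_pos of_nat_0_le_iff[of k] by linarith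
 have "(real k + 1/2 + (\<sigma> + 1/2)) * Beta (real k + 1/2 + 1) (\<sigma> + 1/2) = (real k + 1/2) * Beta (real k + 1/2) (\<sigma> + 1/2)"
 proof (rule Beta_plus1_left)
  show "real k + 1/2 \<notin> \<int>\<^sub>\<le>\<^sub>0" using nonpos_Ints_nonpos[of "real k + 1/2"] by auto
 qed
 then have "Beta (real (Suc k) + 1/2) (\<sigma> + 1/2) * (real k + \<sigma> + 1) = (real k + 1/2) * Beta (real k + 1/2) (\<sigma> + 1/2)"
  by (simp add: algebra_simps)
 then have "ww (Suc k) * (real k + \<sigma> + 1) = Beta (real (Suc k) + 1/2) (\<sigma> + 1/2) / Beta (1/2) (\<sigma> + 1/2) * (real k + \<sigma> + 1)"
  unfolding ww_Suc Suc by (simp add: mult_ac)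
 then show ?case using p by (simp only: mult_cancel_right) simp
qed

lemma nn_integral_nu_power: "(\<integral>\<^sup>+u. ennreal (u ^ k) \<partial>nu) = ennreal (ww k)"
proof -
 let ?f = "%u::real. indicator {0..1} u * (u powr (real k - 1/2) * (1 - u) powr (\<sigma> - 1/2))"
 have "(\<integral>\<^sup>+u. ennreal (u ^ k) \<partial>nu) = (\<integral>\<^sup>+u. ennreal (1 / Beta (1/2) (\<sigma> + 1/2)) * ennreal (?f u) \<partial>lborel)"
  unfolding nn_integral_nu[of "%u. ennreal (u ^ k)", simplified]
 proof (intro nn_integral_cong)
  fix u :: real
  have "nud u * u ^ k = 1 / Beta (1/2) (\<sigma> + 1/2) * ?f u"
  proof (cases "0 < u \<and> u <= 1")
   case True
   then have "u ^ k * u powr (- 1/2) = u powr (real k - 1/2)"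
    by (simp add: powr_realpow[symmetric] powr_add[symmetric])
   then show ?thesis using True by (simp add: nud_def mult_ac)
  next
   case False then show ?thesis by (auto simp: nud_def indicator_def)
  qed
  then show "ennreal (nud u) * ennreal (u ^ k) = ennreal (1 / Beta (1/2) (\<sigma> + 1/2)) * ennreal (?f u)"
   using nud_nonneg[of u] Beta_sigma by (simp only: ennreal_mult'[symmetric] ennreal_mult''[symmetric]) (simp add: ennreal_mult'[symmetric])
 qed
 also have "... = ennreal (1 / Beta (1/2) (\<sigma> + 1/2)) * ennreal (Beta (real k + 1/2) (\<sigma> + 1/2))"
  using nn_integral_Beta_scaled[of "real k - 1/2" "\<sigma> - 1/2" 1] sigma_pos by (subst nn_integral_cmult) (auto simp: add.commute)
 also have "... = ennreal (ww k)"
  unfolding ww_Beta using Beta_sigma by (subst ennreal_mult'[symmetric]) (auto simp: Beta_real_pos less_imp_le)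
 finally show ?thesis .
qed

lemma finite_measure_nu: "finite_measure nu"
 using nn_integral_nu_power[of 0] by (intro finite_measureI) (simp)

lemma integrable_nu_power: "integrable nu (%u. u ^ k)"
proof -
 interpret finite_measure nu by (rule finite_measure_nu)
 show ?thesis
 proof (rule integrable_const_bound[where B=1])
  show "AE u in nu. norm (u ^ k) <= 1"
   using AE_nu by eventually_elim (simp add: power_le_one)
 qed simp
qed

lemma integral_nu_power: "(LINT u|nu. u ^ k) = ww k"
proof -
 have "(LINT u|nu. u ^ k) = enn2real (\<integral>\<^sup>+u. ennreal (u ^ k) \<partial>nu)"
  by (intro integral_eq_nn_integral) (use AE_nu in \<open>auto elim!: eventually_mono\<close>)
 then show ?thesis unfolding nn_integral_nu_power using ww_pos[of k] by simp
qed

lemma nn_integral_nu_poly: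
 assumes "!!u. 0 <= u ==> u <= 1 ==> 0 <= (\<Sum>k\<in>A. a k * u ^ k)"
 shows "(\<integral>\<^sup>+u. ennreal (\<Sum>k\<in>A. a k * u ^ k) \<partial>nu) = ennreal (\<Sum>k\<in>A. a k * ww k)" "0 <= (\<Sum>k\<in>A. a k * ww k)"
proof -
 have ae: "AE u in nu. 0 <= (\<Sum>k\<in>A. a k * u ^ k)"
  using AE_nu by eventually_elim (use assms in auto)
 have i: "integrable nu (%u. \<Sum>k\<in>A. a k * u ^ k)" using integrable_nu_power by auto
 have e: "(LINT u|nu. (\<Sum>k\<in>A. a k * u ^ k)) = (\<Sum>k\<in>A. a k * ww k)"
  using integrable_nu_power by (simp add: Bochner_Integration.integral_sum integral_nu_power)
 show "(\<integral>\<^sup>+u. ennreal (\<Sum>k\<in>A. a k * u ^ k) \<partial>nu) = ennreal (\<Sum>k\<in>A. a k * ww k)"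
  using nn_integral_eq_integral[OF i ae] e by simp
 show "0 <= (\<Sum>k\<in>A. a k * ww k)" unfolding e[symmetric] using ae by (rule integral_nonneg_AE)
qed

lemma nn_integral_power_tail:
 fixes b c :: real assumes b: "b > -1" and c: "0 <= c"
 shows "(\<integral>\<^sup>+y. ennreal (indicator {0..c} y * y powr b) \<partial>lborel) = ennreal (c powr (b + 1) * Beta (b + 1) 1)"
proof -
 have "(\<integral>\<^sup>+y. ennreal (indicator {0..c} y * y powr b) \<partial>lborel) =
  (\<integral>\<^sup>+y. ennreal (indicator {0..c} y * (y powr b * (c - y) powr 0)) \<partial>lborel)"
 proof (rule nn_integral_cong_AE)
  show "AE y in lborel. ennreal (indicator {0..c} y * y powr b) = ennreal (indicator {0..c} y * (y powr b * (c - y) powr 0))"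
   using AE_lborel_singleton[of c] by eventually_elim (simp add: indicator_def)
 qed
 then show ?thesis using nn_integral_Beta_scaled[of b 0 c] b c by simp
qed

text \<open>Near 1 the density behaves like \<open>(1 - u) powr (\<sigma> - 1/2)\<close>; the bound for small
\<open>u\<close> is trivial.\<close>

lemma nu_tail: "\<exists>C\<ge>0. \<forall>u. 0 <= u --> u <= 1 -->
 (\<integral>\<^sup>+v. ennreal (nud v) * indicator {u..} v \<partial>lborel) <= ennreal (C * (1 - u) powr (\<sigma> + 1/2))"
proof -
 let ?B = "Beta (1/2) (\<sigma> + 1/2)"
 define C1 where "C1 = 2 / ?B * Beta (\<sigma> + 1/2) 1"
 define C2 where "C2 = (3/4) powr (-(\<sigma> + 1/2))"
 have C0: "0 <= C1" "0 <= C2" unfolding C1_def C2_def using Beta_sigma Beta_real_pos[of "\<sigma> + 1/2" 1] sigma_pos by auto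
 have "(\<integral>\<^sup>+v. ennreal (nud v) * indicator {u..} v \<partial>lborel) <= ennreal ((C1 + C2) * (1 - u) powr (\<sigma> + 1/2))"
  if u: "0 <= u" "u <= 1" for u
 proof (cases "u >= 1/4")
  case True
  have "(\<integral>\<^sup>+v. ennreal (nud v) * indicator {u..} v \<partial>lborel) \<le>
   (\<integral>\<^sup>+v. ennreal (2 / ?B) * ennreal (indicator {0..1-u} (1 - v) * (1 - v) powr (\<sigma> - 1/2)) \<partial>lborel)"
  proof (intro nn_integral_mono)
   fix v :: real
   show "ennreal (nud v) * indicator {u..} v <= ennreal (2 / ?B) * ennreal (indicator {0..1-u} (1 - v) * (1 - v) powr (\<sigma> - 1/2))"
   proof (cases "u <= v \<and> v <= 1")
    case v: True
    have "v powr (-1/2) <= (1/4) powr (-1/2)" using v True by (intro powr_mono2') auto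
    also have "(1/4::real) powr (-1/2) = 2"
     by (simp add: powr_minus powr_half_sqrt real_sqrt_divide)
    finally have "nud v <= (2 / ?B) * (1 - v) powr (\<sigma> - 1/2)"
     using v u Beta_sigma by (simp add: nud_def divide_right_mono mult_right_mono)
    then show ?thesis using v Beta_sigma by (simp add: ennreal_mult'[symmetric] ennreal_leI)
   next
    case False then show ?thesis by (auto simp: nud_def indicator_def)
   qed
  qed
  also have "... = ennreal (2 / ?B) * (\<integral>\<^sup>+v. ennreal (indicator {0..1-u} (1 - v) * (1 - v) powr (\<sigma> - 1/2)) \<partial>lborel)"
   by (intro nn_integral_cmult) auto
  also have "(\<integral>\<^sup>+v. ennreal (indicator {0..1-u} (1 - v) * (1 - v) powr (\<sigma> - 1/2)) \<partial>lborel) =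
   (\<integral>\<^sup>+v. ennreal (indicator {0..1-u} v * v powr (\<sigma> - 1/2)) \<partial>lborel)"
   using nn_integral_real_affine[of "%v. ennreal (indicator {0..1-u} v * v powr (\<sigma> - 1/2))" "-1" 1] by simp
  also have "... = ennreal ((1 - u) powr (\<sigma> + 1/2) * Beta (\<sigma> + 1/2) 1)"
   using nn_integral_power_tail[of "\<sigma> - 1/2" "1 - u"] sigma_pos u by (simp add: add.commute)
  also have "ennreal (2 / ?B) * ... = ennreal (C1 * (1 - u) powr (\<sigma> + 1/2))"
   using Beta_sigma by (simp add: C1_def ennreal_mult'[symmetric] mult_ac)
  also have "... <= ennreal ((C1 + C2) * (1 - u) powr (\<sigma> + 1/2))"
   using C0 by (intro ennreal_leI mult_right_mono) auto
  finally show ?thesis .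
 next
  case False
  have "(\<integral>\<^sup>+v. ennreal (nud v) * indicator {u..} v \<partial>lborel) <= (\<integral>\<^sup>+v. ennreal (nud v) * 1 \<partial>lborel)"
   by (intro nn_integral_mono mult_left_mono) (auto simp: indicator_def)
  also have "... = ennreal 1" using nn_integral_nu_power[of 0] nn_integral_nu[of "%u. 1"] by simp
  also have "... <= ennreal ((C1 + C2) * (1 - u) powr (\<sigma> + 1/2))"
  proof (rule ennreal_leI)
   have "1 = C2 * (3/4) powr (\<sigma> + 1/2)" by (simp add: C2_def powr_add[symmetric])
   also have "... <= (C1 + C2) * (1 - u) powr (\<sigma> + 1/2)"
    using C0 False sigma_pos by (intro mult_mono powr_mono2) auto
   finally show "1 <= (C1 + C2) * (1 - u) powr (\<sigma> + 1/2)" .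
  qed
  finally show ?thesis .
 qed
 then show ?thesis using C0 by (intro exI[of _ "C1 + C2"]) auto
qed

text \<open>Coefficients of the Green function: \<open>\<Sum>j. green_coeff a j * BD j\<close> inverts the differential
operator on the difference between \<open>BD K\<close> and the operator with symbol \<open>\<Sum>k. a k * ww k
* mm k l\<close>; see \<open>green_symbol\<close>.\<close>

definition green_coeff :: "(nat => real) => nat => real" where
 "green_coeff a j = (\<Sum>k<j. a k * ww k) / (real j * (real j + \<sigma>))"

definition green_poly :: "(nat => real) => nat => real => real" where
 "green_poly a K u = (\<Sum>j=1..K. green_coeff a j / ww j * u ^ j)"

definition green_deriv :: "(nat => real) => nat => real => real" where
 "green_deriv a K u = (\<Sum>j=1..K. green_coeff a j / ww j * (real j * u ^ (j - 1)))"

lemma green_poly_deriv: "(green_poly a K has_real_derivative green_deriv a K u) (at u)"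
 unfolding green_poly_def[abs_def] green_deriv_def
proof (intro DERIV_sum DERIV_cmult)
 fix j show "((%u. u ^ j) has_real_derivative real j * u ^ (j - 1)) (at u)"
  using DERIV_pow[of j u UNIV] by simp
qed

definition flux :: "(nat => real) => nat => real => real" where
 "flux a K u = u powr (1/2) * (1 - u) powr (\<sigma> + 1/2) * green_deriv a K u"

text \<open>In one variable the Green polynomial solves a first order equation for its flux; the sum telescopes because of
the recursion of \<open>ww\<close>.\<close>

lemma green_equation:
 assumes K: "1 <= K"
 shows "(\<Sum>j=1..K. green_coeff a j / ww j * real j * ((real j - 1/2) * u ^ (j - 1) * (1 - u) - (\<sigma> + 1/2) * u ^ j))
  = (\<Sum>k<K. a k * u ^ k) - (\<Sum>k<K. a k * ww k) / ww K * u ^ K"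
 using K
proof (induction K rule: nat_induct_at_least)
 case base
 have s1: "\<sigma> + 1 ~= 0" "ww 1 * (\<sigma> + 1) = 1/2" "ww 1 ~= 0"
  using sigma_pos ww_Suc[of 0] ww_pos[of 1] by simp_all
 have K1: "A / B / w * ((1 - 1/2) * (1 - u) - (B - 1/2) * u) = A - A / w * u" if "B ~= 0" "w * B = 1/2" "w ~= 0" for A B w :: real
 proof -
  have "A / B / w * ((1 - 1/2) * (1 - u) - (B - 1/2) * u) = A * ((1/2) - B * u) / (w * B)" using that by (simp add: field_simps)
  also have "... = A * (1/2) / (w * B) - A * u / w" using that(1,3) by (simp add: right_diff_distrib diff_divide_distrib)
  finally show ?thesis unfolding that(2) by simp
 qed
 have "green_coeff a 1 = a 0 / (\<sigma> + 1)" by (simp add: green_coeff_def add.commute)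
 then have "(\<Sum>j=1..1. green_coeff a j / ww j * real j * ((real j - 1/2) * u ^ (j - 1) * (1 - u) - (\<sigma> + 1/2) * u ^ j)) =
  a 0 / (\<sigma> + 1) / ww 1 * ((1 - 1/2) * (1 - u) - ((\<sigma> + 1) - 1/2) * u)" by simp
 also have "... = a 0 - a 0 / ww 1 * u" by (rule K1) (use s1 in auto)
 finally show ?case by simp
next
 case (Suc K)
 define A where "A = (\<Sum>k<Suc K. a k * ww k)"
 define N where "N = real (Suc K)"
 define B where "B = N + \<sigma>"
 define w where "w = ww K"
 define w' where "w' = ww (Suc K)"
 have B: "B ~= 0" unfolding B_def N_def using sigma_nat_pos(1)[of "Suc K"] by simp
 have N: "N ~= 0" by (simp add: N_def)
 have w: "w ~= 0" "w' ~= 0" unfolding w_def w'_def using ww_pos[of K] ww_pos[of "Suc K"] by auto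
 have ww: "w' * B = w * (N - 1/2)" unfolding w_def w'_def B_def N_def using ww_Suc[of K] by (simp add: add_ac)
 have s: "\<sigma> + 1/2 = B - (N - 1/2)" by (simp add: B_def)
 have "green_coeff a (Suc K) / ww (Suc K) * real (Suc K) * ((real (Suc K) - 1/2) * u ^ (Suc K - 1) * (1 - u) - (\<sigma> + 1/2) * u ^ Suc K)
  = A / (N * B) / w' * N * ((N - 1/2) * u ^ K * (1 - u) - (B - (N - 1/2)) * (u ^ K * u))"
  unfolding green_coeff_def s by (simp add: A_def N_def B_def w'_def mult.commute)
 also have "... = A * u ^ K * (N - 1/2) / (w' * B) - A * (u ^ K * u) / w'"
  using B N w by (simp add: field_simps)
 also have "A * u ^ K * (N - 1/2) / (w' * B) = A / w * u ^ K"
  unfolding ww using w B ww by (cases "N - 1/2 = 0") (auto simp: field_simps)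
 finally have step: "green_coeff a (Suc K) / ww (Suc K) * real (Suc K) * ((real (Suc K) - 1/2) * u ^ (Suc K - 1) * (1 - u) - (\<sigma> + 1/2) * u ^ Suc K)
  = A / w * u ^ K - A / w' * u ^ Suc K" by (simp add: mult.commute)
 have Aw: "A / w = (\<Sum>k<K. a k * ww k) / w + a K" unfolding A_def w_def using w by (simp add: w_def add_divide_distrib)
 have sp: "(\<Sum>j=1..Suc K. f j) = (\<Sum>j=1..K. f j) + f (Suc K)" for f :: "nat => real" by simp
 show ?case
  unfolding sp Suc(2) step unfolding w'_def[symmetric] w_def[symmetric] A_def[symmetric] Aw
  by (simp add: algebra_simps)
qed

lemma flux_summand_deriv:
 assumes u: "0 < u" "u < 1" and j: "1 <= j"
 shows "((%u. u powr (1/2) * (1 - u) powr (\<sigma> + 1/2) * (real j * u ^ (j - 1))) has_real_derivative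
  u powr (-1/2) * (1 - u) powr (\<sigma> - 1/2) * (real j * ((real j - 1/2) * u ^ (j - 1) * (1 - u) - (\<sigma> + 1/2) * u ^ j))) (at u)"
proof -
 define p where "p = u powr (-1/2)"
 define q where "q = (1 - u) powr (\<sigma> - 1/2)"
 have p: "u powr (1/2) = u * p" using u powr_mult_base[of u "-1/2"] by (simp add: p_def)
 have q: "(1 - u) powr (\<sigma> + 1/2) = (1 - u) * q" using u powr_mult_base[of "1 - u" "\<sigma> - 1/2"] by (simp add: q_def add.commute)
 have 1: "((%u. u powr (1/2)) has_real_derivative (1/2) * p) (at u)"
  using u by (auto intro!: derivative_eq_intros simp: p_def powr_diff powr_minus divide_simps)
 have 2: "((%u. (1 - u) powr (\<sigma> + 1/2)) has_real_derivative - ((\<sigma> + 1/2) * q)) (at u)"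
 proof -
  have "((%u. (1 - u) powr (\<sigma> + 1/2)) has_real_derivative (\<sigma> + 1/2) * (1 - u) powr (\<sigma> + 1/2 - 1) * (0 - 1)) (at u)"
   using u by (intro DERIV_fun_powr derivative_intros) auto
  then show ?thesis by (simp add: q_def)
 qed
 have 3: "((%u. real j * u ^ (j - 1)) has_real_derivative real j * (real (j - 1) * u ^ (j - 1 - Suc 0))) (at u)"
  by (intro DERIV_cmult DERIV_pow)
 obtain i where i: "j = Suc i" using j by (cases j) auto
 have 4: "real i * u ^ (i - Suc 0) * u = real i * u ^ i" by (cases i) auto
 have "((%u. u powr (1/2) * (1 - u) powr (\<sigma> + 1/2) * (real j * u ^ (j - 1))) has_real_derivative
  ((1/2) * p * (1 - u) powr (\<sigma> + 1/2) + - ((\<sigma> + 1/2) * q) * u powr (1/2)) * (real j * u ^ (j - 1)) +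
  real j * (real (j - 1) * u ^ (j - 1 - Suc 0)) * (u powr (1/2) * (1 - u) powr (\<sigma> + 1/2))) (at u)"
  by (intro DERIV_mult 1 2 3)
 also have "((1/2) * p * (1 - u) powr (\<sigma> + 1/2) + - ((\<sigma> + 1/2) * q) * u powr (1/2)) * (real j * u ^ (j - 1)) +
  real j * (real (j - 1) * u ^ (j - 1 - Suc 0)) * (u powr (1/2) * (1 - u) powr (\<sigma> + 1/2)) =
  p * q * (real j * (((1/2) * (1 - u) - (\<sigma> + 1/2) * u) * u ^ i + (real i * u ^ (i - Suc 0) * u) * (1 - u)))"
  unfolding p q i by (simp add: algebra_simps)
 also have "... = p * q * (real j * ((real j - 1/2) * u ^ (j - 1) * (1 - u) - (\<sigma> + 1/2) * u ^ j))"
  unfolding 4 unfolding i by (simp add: algebra_simps)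
 finally show ?thesis by (simp add: p_def q_def)
qed

lemma flux_deriv:
 assumes u: "0 < u" "u < 1" and K: "1 <= K" and n: "(\<Sum>k<K. a k * ww k) = 1"
 shows "(flux a K has_real_derivative
  u powr (-1/2) * (1 - u) powr (\<sigma> - 1/2) * ((\<Sum>k<K. a k * u ^ k) - u ^ K / ww K)) (at u)"
proof -
 have f: "flux a K = (%u. \<Sum>j=1..K. green_coeff a j / ww j * (u powr (1/2) * (1 - u) powr (\<sigma> + 1/2) * (real j * u ^ (j - 1))))"
  by (rule ext) (simp only: flux_def green_deriv_def sum_distrib_left mult_ac)
 have "(\<Sum>j=1..K. green_coeff a j / ww j * (u powr (-1/2) * (1 - u) powr (\<sigma> - 1/2) * (real j * ((real j - 1/2) * u ^ (j - 1) * (1 - u) - (\<sigma> + 1/2) * u ^ j)))) =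
  u powr (-1/2) * (1 - u) powr (\<sigma> - 1/2) * ((\<Sum>k<K. a k * u ^ k) - u ^ K / ww K)"
 proof -
  have "(\<Sum>j=1..K. green_coeff a j / ww j * (u powr (-1/2) * (1 - u) powr (\<sigma> - 1/2) * (real j * ((real j - 1/2) * u ^ (j - 1) * (1 - u) - (\<sigma> + 1/2) * u ^ j)))) =
   u powr (-1/2) * (1 - u) powr (\<sigma> - 1/2) * (\<Sum>j=1..K. green_coeff a j / ww j * real j * ((real j - 1/2) * u ^ (j - 1) * (1 - u) - (\<sigma> + 1/2) * u ^ j))"
   by (simp only: sum_distrib_left mult_ac)
  then show ?thesis unfolding green_equation[OF K] n by simp
 qed
 note e = this
 have "(flux a K has_real_derivative (\<Sum>j=1..K. green_coeff a j / ww j * (u powr (-1/2) * (1 - u) powr (\<sigma> - 1/2) * (real j * ((real j - 1/2) * u ^ (j - 1) * (1 - u) - (\<sigma> + 1/2) * u ^ j))))) (at u)"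
  unfolding f by (intro DERIV_sum DERIV_cmult flux_summand_deriv[OF u]) auto
 then show ?thesis unfolding e .
qed

lemma flux_continuous: "continuous_on {0..1} (flux a K)"
 unfolding flux_def[abs_def] green_deriv_def using sigma_pos
 by (intro continuous_intros continuous_on_powr') auto

lemma green_deriv_measurable [measurable]: "green_deriv a K \<in> borel_measurable borel" "green_poly a K \<in> borel_measurable borel"
 unfolding green_deriv_def[abs_def] green_poly_def[abs_def] by measurable

lemma nn_integral_inverse_root:
 assumes v: "0 < v" "v <= 1"
 shows "(\<integral>\<^sup>+u. ennreal (u powr (-1/2)) * indicator {v..1} u \<partial>lborel) <= ennreal (2 * (1 - v))"
proof -
 have "(\<integral>\<^sup>+u. ennreal (u powr (-1/2)) * indicator {v..1} u \<partial>lborel) = ennreal (2 * 1 powr (1/2) - 2 * v powr (1/2))"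
  using v by (intro nn_integral_FTC_Icc) (auto intro!: derivative_eq_intros simp: powr_minus powr_diff divide_simps)
 moreover have "v <= v powr (1/2)" using v powr_mono'[of "1/2" 1 v] by simp
 ultimately show ?thesis by (auto intro!: ennreal_leI)
qed

text \<open>The flux starts at 0 and its derivative is the difference of two probability densities, \<open>p\<close> and
the normalised \<open>u ^ K\<close>. Integrating twice and exchanging the integrals leaves the first moments
of \<open>1 - u\<close> under both.\<close>

lemma green_estimate:
 "\<exists>C\<ge>0. \<forall>a K. 1 <= K --> (\<forall>u. 0 <= u --> u <= 1 --> 0 <= (\<Sum>k<K. a k * u ^ k)) --> (\<Sum>k<K. a k * ww k) = 1 -->
  (\<integral>\<^sup>+u. ennreal \<bar>green_poly a K u\<bar> \<partial>nu) \<le>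
   ennreal (C * ((\<Sum>k<K. a k * (ww k - ww (Suc k))) + (\<sigma> + 1/2) / (real K + \<sigma> + 1)))"
proof -
 let ?B = "Beta (1/2) (\<sigma> + 1/2)"
 obtain C where C: "0 <= C" "!!u. 0 <= u ==> u <= 1 ==> (\<integral>\<^sup>+v. ennreal (nud v) * indicator {u..} v \<partial>lborel) <= ennreal (C * (1 - u) powr (\<sigma> + 1/2))"
  using nu_tail by blast
 have "(\<integral>\<^sup>+u. ennreal \<bar>green_poly a K u\<bar> \<partial>nu) \<le>
   ennreal (2 * C * ?B * ((\<Sum>k<K. a k * (ww k - ww (Suc k))) + (\<sigma> + 1/2) / (real K + \<sigma> + 1)))"
  if K: "1 <= K" and a: "!!u. 0 <= u ==> u <= 1 ==> 0 <= (\<Sum>k<K. a k * u ^ k)" and n: "(\<Sum>k<K. a k * ww k) = 1" for a K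
 proof -
  define p where "p u = (\<Sum>k<K. a k * u ^ k)" for u
  define e where "e u = u ^ K / ww K" for u
  define f where "f u = u powr (-1/2) * (1 - u) powr (\<sigma> - 1/2) * (p u - e u)" for u
  define h where "h u = p u + e u" for u
  have [measurable]: "p \<in> borel_measurable borel" "e \<in> borel_measurable borel"
   unfolding p_def[abs_def] e_def[abs_def] by measurable
  then have [measurable]: "f \<in> borel_measurable borel" "h \<in> borel_measurable borel"
   unfolding f_def[abs_def] h_def[abs_def] by measurable
  have e0: "0 <= e u" if "0 <= u" for u using that ww_pos[of K] by (simp add: e_def)
  have h0: "0 <= h u" if "0 <= u" "u <= 1" for u using a[OF that] e0[OF that(1)] by (simp add: h_def p_def)
  have G: "ennreal \<bar>green_poly a K v\<bar> <= (\<integral>\<^sup>+u. indicator {0..v} u * ennreal \<bar>green_deriv a K u\<bar> \<partial>lborel)" if "0 <= v" for v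
  proof -
   have "green_poly a K 0 = 0" by (simp add: green_poly_def)
   moreover have "continuous_on {0..v} (green_poly a K)"
    unfolding green_poly_def[abs_def] by (intro continuous_intros)
   ultimately show ?thesis
    using increment_le_nn_integral_derivative[OF that, of "green_poly a K" "green_deriv a K"] green_poly_deriv by simp
  qed
  have F: "ennreal \<bar>flux a K u\<bar> <= (\<integral>\<^sup>+v. indicator {0..u} v * ennreal (?B * (nud v * h v)) \<partial>lborel)" if u: "0 <= u" "u <= 1" for u
  proof -
   have z: "flux a K 0 = 0" by (simp add: flux_def)
   have "ennreal \<bar>flux a K u - flux a K 0\<bar> <= (\<integral>\<^sup>+v. indicator {0..u} v * ennreal \<bar>f v\<bar> \<partial>lborel)"
   proof (rule increment_le_nn_integral_derivative)
    show "continuous_on {0..u} (flux a K)" by (rule continuous_on_subset[OF flux_continuous]) (use u in auto)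
    show "(flux a K has_real_derivative f v) (at v)" if "0 < v" "v < u" for v
     using flux_deriv[OF _ _ K n, of v] that u by (simp add: f_def p_def e_def)
   qed (use u in auto)
   also have "... <= (\<integral>\<^sup>+v. indicator {0..u} v * ennreal (?B * (nud v * h v)) \<partial>lborel)"
   proof (intro nn_integral_mono)
    fix v
    show "indicator {0..u} v * ennreal \<bar>f v\<bar> <= indicator {0..u} v * ennreal (?B * (nud v * h v))"
    proof (cases "0 <= v \<and> v <= u")
     case True
     then have v: "0 <= v" "v <= 1" using u by auto
     have "\<bar>p v - e v\<bar> <= h v" using a[OF v] e0[OF v(1)] by (simp add: h_def p_def abs_le_iff)
     then have "\<bar>f v\<bar> <= v powr (-1/2) * (1 - v) powr (\<sigma> - 1/2) * h v"
      by (simp add: f_def abs_mult mult_left_mono)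
     also have "... = ?B * (nud v * h v)" using v Beta_sigma by (simp add: nud_def)
     finally show ?thesis by (intro mult_left_mono ennreal_leI) auto
    qed (auto simp: indicator_def)
   qed
   finally show ?thesis by (simp add: z)
  qed
  have "(\<integral>\<^sup>+v. ennreal \<bar>green_poly a K v\<bar> \<partial>nu) = (\<integral>\<^sup>+v. ennreal (nud v) * ennreal \<bar>green_poly a K v\<bar> \<partial>lborel)"
   by (rule nn_integral_nu) measurable
  also have "... <= (\<integral>\<^sup>+v. ennreal (nud v) * (\<integral>\<^sup>+u. indicator {0..v} u * ennreal \<bar>green_deriv a K u\<bar> \<partial>lborel) \<partial>lborel)"
  proof (intro nn_integral_mono)
   fix v :: real
   show "ennreal (nud v) * ennreal \<bar>green_poly a K v\<bar> <= ennreal (nud v) * (\<integral>\<^sup>+u. indicator {0..v} u * ennreal \<bar>green_deriv a K u\<bar> \<partial>lborel)"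
   proof (cases "0 <= v")
    case True then show ?thesis by (intro mult_left_mono G) auto
   next
    case False then show ?thesis using nud_outside[of v] by simp
   qed
  qed
  also have "... = (\<integral>\<^sup>+v. \<integral>\<^sup>+u. (indicator {0..} u * ennreal \<bar>green_deriv a K u\<bar>) * (ennreal (nud v) * indicator {u..} v) \<partial>lborel \<partial>lborel)"
   by (intro nn_integral_cong, subst nn_integral_cmult[symmetric]) (auto intro!: nn_integral_cong simp: indicator_def mult.commute)
  also have "... = (\<integral>\<^sup>+u. \<integral>\<^sup>+v. (indicator {0..} u * ennreal \<bar>green_deriv a K u\<bar>) * (ennreal (nud v) * indicator {u..} v) \<partial>lborel \<partial>lborel)"
  proof (rule lborel_pair.Fubini')
   have "Measurable.pred (borel \<Otimes>\<^sub>M borel) (%x :: real \<times> real. fst x <= snd x)" by measurable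
   then have [measurable]: "(%x :: real \<times> real. indicator {fst x..} (snd x) :: ennreal) \<in> borel_measurable (borel \<Otimes>\<^sub>M borel)"
    by (simp add: indicator_def)
   show "(%(u, v). (indicator {0..} u * ennreal \<bar>green_deriv a K u\<bar>) * (ennreal (nud v) * indicator {u..} v)) \<in> borel_measurable (lborel \<Otimes>\<^sub>M lborel)"
    unfolding case_prod_beta by measurable
  qed
  also have "... = (\<integral>\<^sup>+u. (indicator {0..} u * ennreal \<bar>green_deriv a K u\<bar>) * (\<integral>\<^sup>+v. ennreal (nud v) * indicator {u..} v \<partial>lborel) \<partial>lborel)"
   by (intro nn_integral_cong nn_integral_cmult) measurable
  also have "... <= (\<integral>\<^sup>+u. \<integral>\<^sup>+v. (ennreal C * ennreal (u powr (-1/2)) * indicator {0..1} u) * (indicator {0..u} v * ennreal (?B * (nud v * h v))) \<partial>lborel \<partial>lborel)"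
  proof (rule nn_integral_mono_AE)
   show "AE u in lborel. (indicator {0..} u * ennreal \<bar>green_deriv a K u\<bar>) * (\<integral>\<^sup>+v. ennreal (nud v) * indicator {u..} v \<partial>lborel) \<le>
    (\<integral>\<^sup>+v. (ennreal C * ennreal (u powr (-1/2)) * indicator {0..1} u) * (indicator {0..u} v * ennreal (?B * (nud v * h v))) \<partial>lborel)"
    using AE_lborel_singleton[of 0]
   proof eventually_elim
    case (elim u)
    consider "u < 0" | "0 < u" "u <= 1" | "1 < u" using elim by linarith
    then show ?case
    proof cases
     case 3
     then have "(\<integral>\<^sup>+v. ennreal (nud v) * indicator {u..} v \<partial>lborel) = (\<integral>\<^sup>+v. 0 \<partial>(lborel :: real measure))"
      by (intro nn_integral_cong) (auto simp: indicator_def nud_outside)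
     then show ?thesis by simp
    next
     case 2
     have "u powr (1/2) * u powr (-1/2) = 1" using 2 by (simp add: powr_add[symmetric])
     then have fl: "\<bar>green_deriv a K u\<bar> * (C * (1 - u) powr (\<sigma> + 1/2)) = C * u powr (-1/2) * \<bar>flux a K u\<bar>"
      by (simp add: flux_def abs_mult mult_ac)
     have "(indicator {0..} u * ennreal \<bar>green_deriv a K u\<bar>) * (\<integral>\<^sup>+v. ennreal (nud v) * indicator {u..} v \<partial>lborel) \<le>
      ennreal \<bar>green_deriv a K u\<bar> * ennreal (C * (1 - u) powr (\<sigma> + 1/2))"
      using 2 C(2)[of u] by (simp add: mult_left_mono)
     also have "... = ennreal (C * u powr (-1/2)) * ennreal \<bar>flux a K u\<bar>"
      using C(1) fl by (simp flip: ennreal_mult')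
     also have "... <= ennreal (C * u powr (-1/2)) * (\<integral>\<^sup>+v. indicator {0..u} v * ennreal (?B * (nud v * h v)) \<partial>lborel)"
      using 2 by (intro mult_left_mono F) auto
     also have "... = (\<integral>\<^sup>+v. (ennreal C * ennreal (u powr (-1/2)) * indicator {0..1} u) * (indicator {0..u} v * ennreal (?B * (nud v * h v))) \<partial>lborel)"
      using 2 C(1) by (subst nn_integral_cmult[symmetric]) (auto simp: ennreal_mult')
     finally show ?thesis .
    qed simp
   qed
  qed
  also have "... = (\<integral>\<^sup>+u. \<integral>\<^sup>+v. (ennreal C * ennreal (?B * (nud v * h v))) * (ennreal (u powr (-1/2)) * indicator {v..1} u) \<partial>lborel \<partial>lborel)"
  proof (intro nn_integral_cong)
   fix u v :: real
   show "(ennreal C * ennreal (u powr (-1/2)) * indicator {0..1} u) * (indicator {0..u} v * ennreal (?B * (nud v * h v))) =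
    (ennreal C * ennreal (?B * (nud v * h v))) * (ennreal (u powr (-1/2)) * indicator {v..1} u)"
   proof (cases "0 <= v")
    case True then show ?thesis by (auto simp: indicator_def mult_ac)
   next
    case False then show ?thesis using nud_outside[of v] by (simp add: indicator_def)
   qed
  qed
  also have "... = (\<integral>\<^sup>+v. \<integral>\<^sup>+u. (ennreal C * ennreal (?B * (nud v * h v))) * (ennreal (u powr (-1/2)) * indicator {v..1} u) \<partial>lborel \<partial>lborel)"
  proof (rule lborel_pair.Fubini')
   have "Measurable.pred (borel \<Otimes>\<^sub>M borel) (%x :: real \<times> real. fst x <= snd x \<and> snd x <= 1)" by measurable
   then have [measurable]: "(%x :: real \<times> real. indicator {fst x..1} (snd x) :: ennreal) \<in> borel_measurable (borel \<Otimes>\<^sub>M borel)"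
    by (simp add: indicator_def)
   show "(%(v, u). (ennreal C * ennreal (?B * (nud v * h v))) * (ennreal (u powr (-1/2)) * indicator {v..1} u)) \<in> borel_measurable (lborel \<Otimes>\<^sub>M lborel)"
    unfolding case_prod_beta by measurable
  qed
  also have "... = (\<integral>\<^sup>+v. (ennreal C * ennreal (?B * (nud v * h v))) * (\<integral>\<^sup>+u. ennreal (u powr (-1/2)) * indicator {v..1} u \<partial>lborel) \<partial>lborel)"
   by (intro nn_integral_cong nn_integral_cmult) measurable
  also have "... <= (\<integral>\<^sup>+v. ennreal (nud v) * ennreal (2 * C * ?B * (h v * (1 - v))) \<partial>lborel)"
  proof (intro nn_integral_mono)
   fix v :: real
   show "(ennreal C * ennreal (?B * (nud v * h v))) * (\<integral>\<^sup>+u. ennreal (u powr (-1/2)) * indicator {v..1} u \<partial>lborel) <= ennreal (nud v) * ennreal (2 * C * ?B * (h v * (1 - v)))"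
   proof (cases "0 < v \<and> v <= 1")
    case True
    then have "(ennreal C * ennreal (?B * (nud v * h v))) * (\<integral>\<^sup>+u. ennreal (u powr (-1/2)) * indicator {v..1} u \<partial>lborel) \<le>
     (ennreal C * ennreal (?B * (nud v * h v))) * ennreal (2 * (1 - v))"
     by (intro mult_left_mono nn_integral_inverse_root) auto
    also have "... = ennreal (C * (?B * (nud v * h v)) * (2 * (1 - v)))"
     using True C(1) h0[of v] nud_nonneg[of v] Beta_sigma by (simp add: ennreal_mult')
    also have "C * (?B * (nud v * h v)) * (2 * (1 - v)) = nud v * (2 * C * ?B * (h v * (1 - v)))" by (simp only: mult_ac)
    finally show ?thesis using nud_nonneg[of v] by (simp add: ennreal_mult')
   next
    case False then show ?thesis using nud_outside[of v] by auto
   qed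
  qed
  also have "... = (\<integral>\<^sup>+v. ennreal (2 * C * ?B * (h v * (1 - v))) \<partial>nu)"
   by (rule nn_integral_nu[symmetric]) measurable
  also have "... = ennreal (2 * C * ?B * ((\<Sum>k<K. a k * (ww k - ww (Suc k))) + (\<sigma> + 1/2) / (real K + \<sigma> + 1)))"
  proof -
   have hv: "h v * (1 - v) = (\<Sum>k<K. a k * (v ^ k - v ^ Suc k)) + (v ^ K - v ^ Suc K) / ww K" for v
    by (simp add: h_def p_def e_def sum_distrib_left algebra_simps add_divide_distrib diff_divide_distrib sum_subtractf)
   have i: "integrable nu (%v. v ^ k - v ^ Suc k)" "(LINT v|nu. v ^ k - v ^ Suc k) = ww k - ww (Suc k)" for k
    using integrable_nu_power[of k] integrable_nu_power[of "Suc k"] integral_nu_power[of k] integral_nu_power[of "Suc k"] by (auto simp del: power_Suc)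
   have "ww (Suc K) = ww K * (real K + 1/2) / (real K + \<sigma> + 1)"
    using ww_Suc[of K] sigma_nat_pos(2)[of K 0] by (simp add: eq_divide_eq)
   then have wK: "(ww K - ww (Suc K)) / ww K = (\<sigma> + 1/2) / (real K + \<sigma> + 1)"
    using ww_pos[of K] sigma_nat_pos(2)[of K 0] by (simp add: field_simps)
   have hi: "integrable nu (%v. h v * (1 - v))" unfolding hv using i(1) by (intro Bochner_Integration.integrable_add Bochner_Integration.integrable_sum integrable_mult_right integrable_divide_zero) auto
   have he: "(LINT v|nu. h v * (1 - v)) = (\<Sum>k<K. a k * (ww k - ww (Suc k))) + (\<sigma> + 1/2) / (real K + \<sigma> + 1)"
    unfolding hv wK[symmetric] using i by (simp add: Bochner_Integration.integral_sum Bochner_Integration.integral_add del: power_Suc)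
   have "AE v in nu. 0 <= 2 * C * ?B * (h v * (1 - v))"
    using AE_nu by eventually_elim (use h0 C(1) Beta_sigma in auto)
   then show ?thesis using hi he by (subst nn_integral_eq_integral) auto
  qed
  finally show ?thesis .
 qed
 then show ?thesis using C(1) Beta_sigma by (intro exI[of _ "2 * C * ?B"]) auto
qed

end

text \<open>The Fejer kernel \<open>(sin (m t) / sin t)\<^sup>2\<close> as a polynomial in \<open>(cos t)\<^sup>2\<close>.
The recursion is the addition theorem, and it keeps the degree visible.\<close>

fun fejer :: "nat => real poly" where
 "fejer 0 = 0"
| "fejer (Suc 0) = 1"
| "fejer (Suc (Suc m)) = smult 2 ([:- 1, 2:] * fejer (Suc m)) - fejer m + [:2:]"

lemma degree_fejer: "degree (fejer m) <= m - 1"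
proof (induction m rule: fejer.induct)
 case (3 m)
 have "degree ([:- 1, 2:] * fejer (Suc m)) <= Suc m"
  using degree_mult_le[of "[:- 1, 2:]" "fejer (Suc m)"] 3 by simp
 then have "degree (smult 2 ([:- 1, 2:] * fejer (Suc m))) <= Suc m" by simp
 then have "degree (smult 2 ([:- 1, 2:] * fejer (Suc m)) - fejer m + [:2:]) <= Suc m"
  using 3 by (intro degree_add_le degree_diff_le) auto
 then show ?case by simp
qed simp_all

lemma fejer_sin: "poly (fejer m) ((cos t)\<^sup>2) * (sin t)\<^sup>2 = (sin (real m * t))\<^sup>2"
proof (induction m rule: fejer.induct)
 case (3 m)
 define x where "x = real (Suc m) * t"
 have 1: "real (Suc (Suc m)) * t = x + t" and 2: "real m * t = x - t" by (simp_all add: x_def algebra_simps)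
 have c: "(cos t)\<^sup>2 = 1 - (sin t)\<^sup>2" "(cos x)\<^sup>2 = 1 - (sin x)\<^sup>2" by (simp_all add: cos_squared_eq)
 have "(sin (x + t))\<^sup>2 + (sin (x - t))\<^sup>2 = 2 * ((sin x)\<^sup>2 * (cos t)\<^sup>2 + (cos x)\<^sup>2 * (sin t)\<^sup>2)"
  by (simp add: sin_add sin_diff power2_eq_square algebra_simps)
 also have "... = 2 * ((2 * (cos t)\<^sup>2 - 1) * (sin x)\<^sup>2) + 2 * (sin t)\<^sup>2"
  unfolding c by (simp add: algebra_simps)
 finally have i: "(sin (x + t))\<^sup>2 = 2 * ((2 * (cos t)\<^sup>2 - 1) * (sin x)\<^sup>2) - (sin (x - t))\<^sup>2 + 2 * (sin t)\<^sup>2" by simp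
 have "poly (fejer (Suc (Suc m))) ((cos t)\<^sup>2) * (sin t)\<^sup>2 =
  2 * ((2 * (cos t)\<^sup>2 - 1) * (poly (fejer (Suc m)) ((cos t)\<^sup>2) * (sin t)\<^sup>2)) - poly (fejer m) ((cos t)\<^sup>2) * (sin t)\<^sup>2 + 2 * (sin t)\<^sup>2"
  by (simp add: algebra_simps)
 also have "... = (sin (real (Suc (Suc m)) * t))\<^sup>2"
  unfolding 3 unfolding 1 2 i x_def[symmetric] ..
 finally show ?case .
qed simp_all

lemma fejer_1: "poly (fejer m) 1 = (real m)\<^sup>2"
 by (induction m rule: fejer.induct) (simp_all add: power2_eq_square algebra_simps)

lemma abs_sin_mult_le: "\<bar>sin (real m * t)\<bar> <= real m * \<bar>sin t\<bar>"
proof (induction m)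
 case (Suc m)
 have "\<bar>sin (real (Suc m) * t)\<bar> = \<bar>sin (real m * t) * cos t + cos (real m * t) * sin t\<bar>"
  by (simp add: distrib_right sin_add) (simp add: mult.commute add.commute)
 also have "... <= \<bar>sin (real m * t)\<bar> * \<bar>cos t\<bar> + \<bar>cos (real m * t)\<bar> * \<bar>sin t\<bar>"
  by (metis abs_mult abs_triangle_ineq)
 also have "... <= \<bar>sin (real m * t)\<bar> * 1 + 1 * \<bar>sin t\<bar>"
  by (intro add_mono mult_mono) auto
 finally show ?case using Suc by (simp add: algebra_simps)
qed simp

lemma fejer_bounds:
 assumes u: "0 <= u" "u <= 1"
 shows "0 <= poly (fejer m) u" "poly (fejer m) u <= (real m)\<^sup>2" "poly (fejer m) u * (1 - u) <= 1"
  and "1 <= m ==> 1 - u <= 1 / (4 * (real m)\<^sup>2) ==> (real m)\<^sup>2 / 4 <= poly (fejer m) u"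
proof -
 define t where "t = arccos (sqrt u)"
 have t: "0 <= t" "t <= pi / 2" "cos t = sqrt u"
 proof -
  have a: "- 1 <= sqrt u" "0 <= sqrt u" "sqrt u <= 1" using u real_sqrt_ge_zero[of u] by (auto simp del: real_sqrt_ge_0_iff)
  show "0 <= t" "t <= pi / 2" "cos t = sqrt u"
   unfolding t_def by (rule arccos_lbound[OF a(1,3)] arccos_le_pi2[OF a(2,3)] cos_arccos[OF a(1,3)])+
 qed
 have c: "(cos t)\<^sup>2 = u" using u t by simp
 have s: "(sin t)\<^sup>2 = 1 - u" by (simp add: sin_squared_eq c)
 have e: "poly (fejer m) u * (1 - u) = (sin (real m * t))\<^sup>2" using fejer_sin[of m t] by (simp add: c s)
 have s0: "0 <= sin t" using t by (intro sin_ge_zero) auto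
 show "poly (fejer m) u * (1 - u) <= 1" unfolding e by (simp add: abs_square_le_1)
 show "0 <= poly (fejer m) u"
 proof (cases "u = 1")
  case False
  then have "0 < 1 - u" using u by simp
  then show ?thesis using e zero_le_power2[of "sin (real m * t)"] by (metis mult_nonneg_nonneg zero_le_mult_iff not_less)
 qed (simp add: fejer_1)
 show "poly (fejer m) u <= (real m)\<^sup>2"
 proof (cases "u = 1")
  case False
  then have u1: "0 < 1 - u" using u by simp
  have "(sin (real m * t))\<^sup>2 <= (real m * \<bar>sin t\<bar>)\<^sup>2"
   using abs_sin_mult_le[of m t] by (metis abs_ge_zero power2_abs power_mono)
  also have "... = (real m)\<^sup>2 * (1 - u)" by (simp add: power_mult_distrib s)
  finally show ?thesis using e u1 by (metis mult_le_cancel_right_pos)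
 qed (simp add: fejer_1)
 assume m: "1 <= m" and d: "1 - u <= 1 / (4 * (real m)\<^sup>2)"
 show "(real m)\<^sup>2 / 4 <= poly (fejer m) u"
 proof (cases "u = 1")
  case False
  then have u1: "0 < 1 - u" using u by simp
  have tan: "x * cos x <= sin x" if "0 <= x" "x < pi / 2" for x
  proof -
   have "x <= tan x" using abs_tan_ge[of x] that tan_pos_pi2_le[of x] by simp
   moreover have "0 < cos x" using that by (intro cos_gt_zero_pi) auto
   ultimately show ?thesis by (simp add: tan_def field_simps)
  qed
  have "1 <= (real m)\<^sup>2" using m by simp
  then have "1 / (4 * (real m)\<^sup>2) <= 1/4" using m by (intro divide_left_mono) auto
  then have u34: "3/4 <= u" using d by linarith
  then have ct: "4/5 <= cos t" unfolding t(3) by (intro real_le_rsqrt) (simp add: power2_eq_square)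
  then have t2: "t < pi / 2" using t(2) cos_pi_half by (cases "t = pi / 2") auto
  have "(sin t)\<^sup>2 <= (1 / (2 * real m))\<^sup>2" using d by (simp add: s power_divide power_mult_distrib)
  then have st: "sin t <= 1 / (2 * real m)" by (rule power2_le_imp_le) simp
  have "t * (4/5) <= t * cos t" using t(1) ct by (intro mult_left_mono)
  also have "... <= 1 / (2 * real m)" using tan[OF t(1) t2] st by linarith
  finally have "real m * t <= 5/8" using m by (simp add: field_simps)
  then have mt: "0 <= real m * t" "real m * t <= pi / 4" using t pi_gt3 by auto
  then have mt2: "real m * t < pi / 2" using pi_gt_zero by linarith
  have "sin t <= t" using t by (intro sin_x_le_x)
  then have "(1/2) * (real m * sin t) <= (1/2) * (real m * t)" by (intro mult_left_mono) auto
  also have "... <= cos (real m * t) * (real m * t)"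
  proof (intro mult_right_mono)
   have "1/2 <= cos (pi / 4)" by (simp add: cos_45)
   also have "... <= cos (real m * t)" using mt pi_gt_zero by (intro cos_monotone_0_pi_le) auto
   finally show "1/2 <= cos (real m * t)" .
  qed (use mt in auto)
  also have "... <= sin (real m * t)" using tan[OF mt(1) mt2] by (simp add: mult.commute)
  finally have "(1/2) * (real m * sin t) <= sin (real m * t)" .
  then have "((1/2) * (real m * sin t))\<^sup>2 <= (sin (real m * t))\<^sup>2" using s0 by (intro power_mono) auto
  then have "(real m)\<^sup>2 / 4 * (1 - u) <= poly (fejer m) u * (1 - u)" unfolding e by (simp add: power_mult_distrib s power_divide)
  then show ?thesis using u1 by (metis mult_le_cancel_right_pos)
 qed (simp add: fejer_1)
qed

context jacobi
begin

lemma nn_integral_nu_poly_comp: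
 assumes a: "!!u. 0 <= u ==> u <= 1 ==> 0 <= (\<Sum>k\<in>A. a k * u ^ k)"
 shows "(\<integral>\<^sup>+v. ennreal ((\<Sum>k\<in>A. a k * v ^ k) * (1 - v)) \<partial>nu) = ennreal (\<Sum>k\<in>A. a k * (ww k - ww (Suc k)))"
  "0 <= (\<Sum>k\<in>A. a k * (ww k - ww (Suc k)))"
proof -
 have hv: "(\<Sum>k\<in>A. a k * v ^ k) * (1 - v) = (\<Sum>k\<in>A. a k * (v ^ k - v ^ Suc k))" for v
  unfolding sum_distrib_right by (intro sum.cong refl) (simp add: algebra_simps)
 have i: "integrable nu (%v. v ^ k - v ^ Suc k)" "(LINT v|nu. v ^ k - v ^ Suc k) = ww k - ww (Suc k)" for k
  using integrable_nu_power[of k] integrable_nu_power[of "Suc k"] integral_nu_power[of k] integral_nu_power[of "Suc k"] by (auto simp del: power_Suc)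
 have hi: "integrable nu (%v. (\<Sum>k\<in>A. a k * v ^ k) * (1 - v))"
  unfolding hv using i(1) by (intro Bochner_Integration.integrable_sum integrable_mult_right) auto
 have he: "(LINT v|nu. (\<Sum>k\<in>A. a k * v ^ k) * (1 - v)) = (\<Sum>k\<in>A. a k * (ww k - ww (Suc k)))"
  unfolding hv using i by (simp add: Bochner_Integration.integral_sum del: power_Suc)
 have ae: "AE v in nu. 0 <= (\<Sum>k\<in>A. a k * v ^ k) * (1 - v)"
  using AE_nu by eventually_elim (use a in auto)
 show "(\<integral>\<^sup>+v. ennreal ((\<Sum>k\<in>A. a k * v ^ k) * (1 - v)) \<partial>nu) = ennreal (\<Sum>k\<in>A. a k * (ww k - ww (Suc k)))"
  using nn_integral_eq_integral[OF hi ae] he by simp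
 show "0 <= (\<Sum>k\<in>A. a k * (ww k - ww (Suc k)))" unfolding he[symmetric] by (rule integral_nonneg_AE[OF ae])
qed

text \<open>The integrand is the derivative of \<open>- ((1 - u) / (1 + M * (1 - u))) powr b / b\<close>.\<close>

lemma nn_integral_tail_decay:
 assumes M: "1 <= M" and b: "b > 1"
 shows "(\<integral>\<^sup>+u. ennreal (indicator {0..1} u * ((1 - u) powr (b - 1) * (1 + M * (1 - u)) powr (- b - 1))) \<partial>lborel) <= ennreal (M powr (- b) / b)"
proof -
 define F where "F u = - (((1 - u) / (1 + M * (1 - u))) powr b / b)" for u
 define f where "f u = (1 - u) powr (b - 1) * (1 + M * (1 - u)) powr (- b - 1)" for u
 have pos: "0 < 1 + M * (1 - u)" if "u <= 1" for u using that M by (intro add_pos_nonneg mult_nonneg_nonneg) auto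
 have "(f has_integral (F 1 - F 0)) {0..1}"
 proof (rule fundamental_theorem_of_calculus_interior)
  show "continuous_on {0..1} F"
   unfolding F_def using b pos
   by (intro continuous_intros continuous_on_powr') (auto simp: less_imp_neq[symmetric] less_imp_le intro!: divide_nonneg_nonneg)
  show "(F has_vector_derivative f u) (at u)" if "u \<in> {0<..<1}" for u
  proof -
   have u: "0 < u" "u < 1" using that by auto
   define q where "q = 1 + M * (1 - u)"
   have q: "0 < q" unfolding q_def using pos[of u] u by simp
   have "((%u. (1 - u) / (1 + M * (1 - u))) has_real_derivative ((0 - 1) * q - (1 - u) * (0 + M * (0 - 1))) / (q * q)) (at u)"
    unfolding q_def using pos[of u] u by (intro DERIV_divide derivative_intros DERIV_add DERIV_cmult DERIV_diff DERIV_const DERIV_ident) auto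
   also have "((0 - 1) * q - (1 - u) * (0 + M * (0 - 1))) / (q * q) = - (1 / (q * q))"
    by (simp add: q_def algebra_simps)
   finally have "((%u. ((1 - u) / (1 + M * (1 - u))) powr b) has_real_derivative b * ((1 - u) / (1 + M * (1 - u))) powr (b - 1) * - (1 / (q * q))) (at u)"
    using DERIV_fun_powr[where r=b] u q by (fastforce simp: q_def)
   then have "(F has_real_derivative - (b * ((1 - u) / q) powr (b - 1) * - (1 / (q * q)) / b)) (at u)"
    unfolding F_def[abs_def] q_def[symmetric] by (intro DERIV_minus DERIV_cdivide) (simp add: q_def)
   also have "- (b * ((1 - u) / q) powr (b - 1) * - (1 / (q * q)) / b) = f u"
   proof -
    have "q powr (- b - 1) = 1 / (q powr (b - 1) * (q * q))"
     using q by (simp add: powr_diff powr_minus divide_simps)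
    then show ?thesis using u q b by (simp add: f_def q_def[symmetric] powr_divide)
   qed
   finally show ?thesis by (simp add: has_real_derivative_iff_has_vector_derivative)
  qed
 qed simp
 from nn_integral_has_integral_lebesgue[OF _ this]
 have "(\<integral>\<^sup>+u. ennreal (indicator {0..1} u * f u) \<partial>lborel) = ennreal (F 1 - F 0)" by (simp add: f_def)
 moreover have "F 1 - F 0 <= M powr (- b) / b"
 proof -
  have "(1 / (1 + M)) powr b <= (1 / M) powr b" using M b by (intro powr_mono2) (auto simp: field_simps)
  then show ?thesis using b M by (simp add: F_def powr_divide powr_minus divide_right_mono field_simps)
 qed
 ultimately show ?thesis unfolding f_def by (simp add: ennreal_leI)
qed

text \<open>A high power of the Fejer kernel, concentrated within distance \<open>1 / m\<^sup>2\<close> of 1. The extra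
factor \<open>u\<close> removes the singularity of the density at 0.\<close>

lemma jackson_kernel:
 "\<exists>C R. 0 <= C \<and> (\<forall>m::nat. 1 <= m --> (\<exists>a. (\<forall>k>R * m. a k = 0) \<and>
   (\<forall>u. 0 <= u --> u <= 1 --> 0 <= (\<Sum>k\<le>R * m. a k * u ^ k)) \<and> (\<Sum>k\<le>R * m. a k * ww k) = 1 \<and>
   (\<Sum>k\<le>R * m. a k * (ww k - ww (Suc k))) <= C / (real m)\<^sup>2))"
proof -
 let ?B = "Beta (1/2) (\<sigma> + 1/2)"
 define R where "R = nat \<lceil>\<sigma> + 5/2\<rceil>"
 have R: "\<sigma> + 5/2 <= real R" unfolding R_def using sigma_pos by linarith
 define b where "b = \<sigma> + 3/2"
 define c1 where "c1 = (1/4) ^ R / (2 * ?B) * (1/4) powr (\<sigma> + 1/2) * Beta (\<sigma> + 1/2) 1"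
 define c2 where "c2 = 2 ^ R / (?B * b)"
 have c1: "0 < c1" unfolding c1_def using Beta_sigma sigma_pos Beta_real_pos[of "\<sigma> + 1/2" 1] by (intro mult_pos_pos divide_pos_pos) auto
 have b: "b > 1" using sigma_pos by (simp add: b_def)
 have c2: "0 < c2" unfolding c2_def using Beta_sigma b by (intro divide_pos_pos mult_pos_pos) auto
 have main: "\<exists>a. (\<forall>k>Suc R * m. a k = 0) \<and>
   (\<forall>u. 0 <= u --> u <= 1 --> 0 <= (\<Sum>k\<le>Suc R * m. a k * u ^ k)) \<and> (\<Sum>k\<le>Suc R * m. a k * ww k) = 1 \<and>
   (\<Sum>k\<le>Suc R * m. a k * (ww k - ww (Suc k))) <= (c2 / c1) / (real m)\<^sup>2" if m: "1 <= m" for m :: nat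
 proof -
  define M where "M = (real m)\<^sup>2"
  have M: "1 <= M" using m by (simp add: M_def)
  define p where "p = [:0, 1:] * fejer m ^ R"
  let ?n = "Suc R * m"
  have "degree p <= 1 + (m - 1) * R"
  proof -
   have "degree (fejer m ^ R) <= (m - 1) * R"
    using degree_power_le[of "fejer m" R] degree_fejer[of m] by (meson mult_le_mono1 order_trans)
   then show ?thesis unfolding p_def using degree_mult_le[of "[:0, 1:] :: real poly" "fejer m ^ R"] by simp
  qed
  also have "... <= 1 + m * R" by simp
  also have "... <= ?n" using m by simp
  finally have dp: "degree p <= ?n" .
  have pe: "poly p u = (\<Sum>k\<le>?n. coeff p k * u ^ k)" for u
   unfolding poly_altdef by (rule sum.mono_neutral_left) (use dp in \<open>auto simp: coeff_eq_0\<close>)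
  have pv: "poly p u = u * poly (fejer m) u ^ R" for u by (simp add: p_def)
  have p0: "0 <= poly p u" if "0 <= u" "u <= 1" for u using fejer_bounds(1)[OF that] that by (simp add: pv)
  then have p0': "0 <= u ==> u <= 1 ==> 0 <= (\<Sum>k\<le>?n. coeff p k * u ^ k)" for u by (simp add: pe)
  have [measurable]: "poly p \<in> borel_measurable borel"
   by (intro borel_measurable_continuous_onI continuous_on_poly continuous_on_id)
  define X where "X = (\<Sum>k\<le>?n. coeff p k * ww k)"
  define Y where "Y = (\<Sum>k\<le>?n. coeff p k * (ww k - ww (Suc k)))"
  have X: "(\<integral>\<^sup>+u. ennreal (poly p u) \<partial>nu) = ennreal X" "0 <= X"
   using nn_integral_nu_poly[where A="{..?n}" and a="coeff p"] p0' by (simp_all add: pe X_def)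
  have Y: "(\<integral>\<^sup>+u. ennreal (poly p u * (1 - u)) \<partial>nu) = ennreal Y" "0 <= Y"
   using nn_integral_nu_poly_comp[where A="{..?n}" and a="coeff p"] p0' by (simp_all add: pe Y_def)
  have Xl: "c1 * M ^ R * M powr (- (\<sigma> + 1/2)) <= X"
  proof -
   let ?d = "1 / (4 * M)"
   have d: "0 <= ?d" "?d <= 1/4" using M by (auto simp: field_simps)
   have "ennreal ((M / 4) ^ R / (2 * ?B)) * ennreal (?d powr (\<sigma> - 1/2 + 1) * Beta (\<sigma> - 1/2 + 1) 1) =
    ennreal ((M / 4) ^ R / (2 * ?B)) * (\<integral>\<^sup>+y. ennreal (indicator {0..?d} y * y powr (\<sigma> - 1/2)) \<partial>lborel)"
    using sigma_pos d by (subst nn_integral_power_tail) auto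
   also have "... = ennreal ((M / 4) ^ R / (2 * ?B)) * (\<integral>\<^sup>+u. ennreal (indicator {0..?d} (1 - u) * (1 - u) powr (\<sigma> - 1/2)) \<partial>lborel)"
    using nn_integral_real_affine[of "%v. ennreal (indicator {0..?d} v * v powr (\<sigma> - 1/2))" "-1" 1] by simp
   also have "... = (\<integral>\<^sup>+u. ennreal ((M / 4) ^ R / (2 * ?B)) * ennreal (indicator {0..?d} (1 - u) * (1 - u) powr (\<sigma> - 1/2)) \<partial>lborel)"
    by (intro nn_integral_cmult[symmetric]) auto
   also have "... <= (\<integral>\<^sup>+u. ennreal (nud u) * ennreal (poly p u) \<partial>lborel)"
   proof (intro nn_integral_mono)
    fix u :: real
    show "ennreal ((M / 4) ^ R / (2 * ?B)) * ennreal (indicator {0..?d} (1 - u) * (1 - u) powr (\<sigma> - 1/2)) <= ennreal (nud u) * ennreal (poly p u)"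
    proof (cases "0 <= 1 - u \<and> 1 - u <= ?d")
     case True
     then have u: "1/4 <= u" "u <= 1" using d by auto
     have "(M / 4) ^ R <= poly (fejer m) u ^ R"
      using fejer_bounds(4)[of u m] u True m M by (intro power_mono) (auto simp: M_def)
     moreover have "1/2 <= u powr (1/2)"
      using powr_mono2[of "1/2" "1/4" u] u by (simp add: powr_half_sqrt real_sqrt_divide)
     ultimately have "(1/2) * (M / 4) ^ R <= u powr (1/2) * poly (fejer m) u ^ R"
      using M by (intro mult_mono) auto
     also have "u powr (1/2) = u powr (-1/2) * u" using u powr_mult_base[of u "-1/2"] by (simp add: mult.commute)
     finally have "(1/2) * (M / 4) ^ R <= u powr (-1/2) * poly p u" by (simp add: pv mult_ac)
     then have "(1/2) * (M / 4) ^ R * ((1 - u) powr (\<sigma> - 1/2) / ?B) <= u powr (-1/2) * poly p u * ((1 - u) powr (\<sigma> - 1/2) / ?B)"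
      using Beta_sigma by (intro mult_right_mono) auto
     then have "(M / 4) ^ R / (2 * ?B) * (1 - u) powr (\<sigma> - 1/2) <= nud u * poly p u"
      using u by (simp add: nud_def mult_ac)
     then show ?thesis
      using True M Beta_sigma nud_nonneg[of u] by (simp add: ennreal_mult'[symmetric] ennreal_leI)
    qed (auto simp: indicator_def)
   qed
   also have "... = ennreal X" unfolding X(1)[symmetric] by (rule nn_integral_nu[symmetric]) measurable
   finally have "ennreal ((M / 4) ^ R / (2 * ?B) * (?d powr (\<sigma> - 1/2 + 1) * Beta (\<sigma> - 1/2 + 1) 1)) <= ennreal X"
    using M Beta_sigma by (subst ennreal_mult') auto
   then have "(M / 4) ^ R / (2 * ?B) * (?d powr (\<sigma> - 1/2 + 1) * Beta (\<sigma> - 1/2 + 1) 1) <= X" using X(2) by (simp only: ennreal_le_iff)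
   moreover have "?d powr (\<sigma> - 1/2 + 1) = (1/4) powr (\<sigma> + 1/2) * M powr (- (\<sigma> + 1/2))"
   proof -
    have "?d = (1/4) * (1 / M)" by simp
    then have "?d powr (\<sigma> - 1/2 + 1) = (1/4) powr (\<sigma> - 1/2 + 1) * (1 / M) powr (\<sigma> - 1/2 + 1)" using M by (simp only: powr_mult)
    also have "\<sigma> - 1/2 + 1 = \<sigma> + 1/2" by simp
    finally show ?thesis using M by (simp add: powr_divide powr_minus field_simps)
   qed
   moreover have "\<sigma> - 1/2 + 1 = \<sigma> + 1/2" by simp
   ultimately show ?thesis by (simp only: c1_def power_divide power_one mult_ac times_divide_eq_left times_divide_eq_right mult_1_left)
  qed
  have Yu: "Y <= c2 * M ^ R * M powr (- b)"
  proof -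
   have "ennreal Y = (\<integral>\<^sup>+u. ennreal (nud u) * ennreal (poly p u * (1 - u)) \<partial>lborel)"
    unfolding Y(1)[symmetric] by (rule nn_integral_nu) measurable
   also have "... <= (\<integral>\<^sup>+u. ennreal ((2 * M) ^ R / ?B) * ennreal (indicator {0..1} u * ((1 - u) powr (b - 1) * (1 + M * (1 - u)) powr (- b - 1))) \<partial>lborel)"
   proof (intro nn_integral_mono)
    fix u :: real
    show "ennreal (nud u) * ennreal (poly p u * (1 - u)) <= ennreal ((2 * M) ^ R / ?B) * ennreal (indicator {0..1} u * ((1 - u) powr (b - 1) * (1 + M * (1 - u)) powr (- b - 1)))"
    proof (cases "0 < u \<and> u <= 1")
     case True
     define q where "q = 1 + M * (1 - u)"
     have q: "1 <= q" using True M by (simp add: q_def)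
     have A0: "0 <= poly (fejer m) u" using fejer_bounds(1)[of u m] True by simp
     have "poly (fejer m) u * q = poly (fejer m) u + M * (poly (fejer m) u * (1 - u))" by (simp add: q_def algebra_simps)
     also have "... <= M + M * 1" using fejer_bounds(2,3)[of u m] True M by (intro add_mono mult_left_mono) (auto simp: M_def)
     finally have "poly (fejer m) u <= 2 * M / q" using q by (simp add: field_simps)
     then have "poly (fejer m) u ^ R <= (2 * M / q) ^ R" using A0 by (intro power_mono) auto
     also have "... = (2 * M) ^ R * q powr (- real R)" using q by (simp add: power_divide powr_minus powr_realpow divide_inverse power_mult_distrib power_inverse)
     also have "... <= (2 * M) ^ R * q powr (- b - 1)" using q R M by (intro mult_left_mono powr_mono) (auto simp: b_def)
     finally have f: "poly (fejer m) u ^ R <= (2 * M) ^ R * q powr (- b - 1)" .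
     have "u powr (-1/2) * u = u powr (1/2)" using True powr_mult_base[of u "-1/2"] by (simp add: mult.commute)
     also have "... <= 1 powr (1/2)" using True by (intro powr_mono2) auto
     finally have r: "u powr (-1/2) * u <= 1" by simp
     have s: "(1 - u) powr (\<sigma> - 1/2) * (1 - u) = (1 - u) powr (b - 1)"
      using True powr_mult_base[of "1 - u" "\<sigma> - 1/2"] by (simp add: b_def mult.commute add.commute)
     have "nud u * (poly p u * (1 - u)) = (u powr (-1/2) * u) * poly (fejer m) u ^ R * (((1 - u) powr (\<sigma> - 1/2) * (1 - u)) / ?B)"
      using True by (simp add: nud_def pv mult_ac)
     also have "... <= 1 * ((2 * M) ^ R * q powr (- b - 1)) * ((1 - u) powr (b - 1) / ?B)"
      unfolding s using r f A0 Beta_sigma True M by (intro mult_mono) auto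
     finally have "nud u * (poly p u * (1 - u)) <= (2 * M) ^ R / ?B * (indicator {0..1} u * ((1 - u) powr (b - 1) * q powr (- b - 1)))"
      using True by (simp add: mult_ac)
     then show ?thesis unfolding q_def[symmetric]
      using M Beta_sigma by (subst (1 2) ennreal_mult'[symmetric]) (auto intro!: ennreal_leI nud_nonneg)
    next
     case False then show ?thesis using nud_outside[of u] by auto
    qed
   qed
   also have "... = ennreal ((2 * M) ^ R / ?B) * (\<integral>\<^sup>+u. ennreal (indicator {0..1} u * ((1 - u) powr (b - 1) * (1 + M * (1 - u)) powr (- b - 1))) \<partial>lborel)"
    by (intro nn_integral_cmult) auto
   also have "... <= ennreal ((2 * M) ^ R / ?B) * ennreal (M powr (- b) / b)"
    by (intro mult_left_mono nn_integral_tail_decay M b) auto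
   also have "... = ennreal (c2 * M ^ R * M powr (- b))"
    using M Beta_sigma by (subst ennreal_mult'[symmetric]) (auto simp: c2_def power_mult_distrib mult_ac)
   finally show ?thesis using c2 M by (simp add: ennreal_le_iff)
  qed
  have Xp: "0 < X" using Xl c1 M by (intro less_le_trans[OF _ Xl] mult_pos_pos) auto
  have Mb: "M powr (- b) = M powr (- (\<sigma> + 1/2)) / M" 
  proof -
   have "M * M powr (- b) = M powr (1 + - b)" using M by (intro powr_mult_base) auto
   also have "1 + - b = - (\<sigma> + 1/2)" by (simp add: b_def)
   finally show ?thesis using M by (simp add: field_simps)
  qed
  have "Y <= (c2 / c1) / M * (c1 * M ^ R * M powr (- (\<sigma> + 1/2)))"
   using Yu c1 M unfolding Mb by (simp add: mult_ac)
  also have "... <= (c2 / c1) / M * X" using Xl c1 c2 M by (intro mult_left_mono) auto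
  finally have YX: "Y / X <= (c2 / c1) / M" using Xp by (simp add: field_simps)
  show ?thesis
  proof (intro exI[of _ "%k. coeff p k / X"] conjI allI impI)
   show "k > ?n ==> coeff p k / X = 0" for k using dp by (simp add: coeff_eq_0)
   show "0 <= (\<Sum>k\<le>?n. coeff p k / X * u ^ k)" if "0 <= u" "u <= 1" for u
    using p0'[OF that] Xp by (simp add: sum_divide_distrib[symmetric])
   show "(\<Sum>k\<le>?n. coeff p k / X * ww k) = 1" 
    using Xp unfolding times_divide_eq_left sum_divide_distrib[symmetric] X_def[symmetric] by simp
   show "(\<Sum>k\<le>?n. coeff p k / X * (ww k - ww (Suc k))) <= c2 / c1 / (real m)\<^sup>2"
    using YX unfolding times_divide_eq_left sum_divide_distrib[symmetric] Y_def[symmetric] M_def[symmetric] .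
  qed
 qed
 then show ?thesis using c1 c2 by (intro exI[of _ "c2 / c1"] exI[of _ "Suc R"]) auto
qed

end

section \<open>Multipliers\<close>

locale jacobi_norm = jacobi \<alpha> + N: function_norm "jacobi_measure \<alpha>" N
 for \<alpha> :: "'d::finite option => real" and N :: "(real^'d => real) => ennreal"
begin

abbreviation "B \<equiv> B_space \<alpha> N"
abbreviation "nB \<equiv> nrm N"

lemma B_measurable [measurable_dest]: "f \<in> B ==> f \<in> borel_measurable borel"
 by (simp add: space_of_def cong: measurable_cong_sets)

lemma B_finite: "f \<in> B ==> N f = ennreal (nB f)" "f \<in> B ==> N f < \<infinity>"
 by (auto simp: space_of_def nrm_def less_top)

lemma B_I: "f \<in> borel_measurable borel ==> N f <= ennreal c ==> f \<in> B"
 by (auto simp: space_of_def less_top[symmetric] top_unique cong: measurable_cong_sets)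

lemma nB_nonneg [simp]: "0 <= nB f" by (simp add: nrm_def)

lemma nB_leI: "N f <= ennreal c ==> 0 <= c ==> nB f <= c"
 unfolding nrm_def by (rule enn2real_leI)

lemma B_scale: assumes "f \<in> B" shows "(%x. c * f x) \<in> B" "nB (%x. c * f x) <= \<bar>c\<bar> * nB f"
proof -
 have "N (%x. c * f x) <= ennreal (\<bar>c\<bar> * nB f)"
  using N.norm_cmult[of f c] assms by (simp add: B_finite(1) B_measurable ennreal_mult cong: measurable_cong_sets)
 then show "(%x. c * f x) \<in> B" "nB (%x. c * f x) <= \<bar>c\<bar> * nB f"
  using assms by (auto intro!: B_I nB_leI simp: B_measurable)
qed

lemma B_add: assumes "f \<in> B" "g \<in> B" shows "(%x. f x + g x) \<in> B" "nB (%x. f x + g x) <= nB f + nB g"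
proof -
 have "N (%x. f x + g x) <= ennreal (nB f + nB g)"
  using N.norm_triangle[of f g] assms by (simp add: B_finite(1) B_measurable ennreal_plus[symmetric] cong: measurable_cong_sets del: ennreal_plus)
 then show "(%x. f x + g x) \<in> B" "nB (%x. f x + g x) <= nB f + nB g"
  using assms by (auto intro!: B_I nB_leI simp: B_measurable simp del: ennreal_plus)
qed

lemma B_diff: assumes "f \<in> B" "g \<in> B" shows "(%x. f x - g x) \<in> B" "nB (%x. f x - g x) <= nB f + nB g"
 using B_add[OF assms(1) B_scale(1)[OF assms(2), of "-1"]] B_scale(2)[OF assms(2), of "-1"] by auto

lemma B_sum: "finite A ==> (!!i. i \<in> A ==> f i \<in> B) ==> (%x. \<Sum>i\<in>A. f i x) \<in> B \<and> nB (%x. \<Sum>i\<in>A. f i x) <= (\<Sum>i\<in>A. nB (f i))"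
proof (induction A rule: finite_induct)
 case empty
 have "N (%x. 0 * 1) <= 0" using N.norm_cmult[of "%_. 1" 0] by simp
 then show ?case using B_I[of "%x. 0" 0] nB_leI[of "%x. 0" 0] by simp
next
 case (insert i A)
 then show ?case using B_add[of "f i" "%x. \<Sum>i\<in>A. f i x"] by fastforce
qed

lemma B_AE_mono:
 assumes f: "f \<in> B" and g: "g \<in> borel_measurable borel" and le: "AE x in mu. \<bar>g x\<bar> <= \<bar>f x\<bar>"
 shows "g \<in> B" "nB g <= nB f"
proof -
 have "N g <= ennreal (nB f)"
  using N.norm_mono[of g f] f g le by (simp add: B_finite(1) B_measurable cong: measurable_cong_sets)
 then show "g \<in> B" "nB g <= nB f" using g by (auto intro!: B_I nB_leI)
qed

lemma nB_AE_eq: "f \<in> B ==> g \<in> B ==> AE x in mu. f x = g x ==> nB f = nB g"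
 by (intro antisym B_AE_mono(2)) (auto simp: B_measurable elim: eventually_mono)

lemma B_integrable: assumes "f \<in> B" shows "integrable mu f"
proof -
 obtain C :: real where C: "0 <= C" "!!f. f \<in> borel_measurable mu ==> (\<integral>\<^sup>+x. ennreal \<bar>f x\<bar> \<partial>mu) <= ennreal C * N f"
  using N.norm_L1 by blast
 have "(\<integral>\<^sup>+x. ennreal \<bar>f x\<bar> \<partial>mu) <= ennreal C * ennreal (nB f)"
  using C(2)[of f] assms by (simp add: B_finite(1) B_measurable cong: measurable_cong_sets)
 also have "... < \<infinity>" by (simp add: ennreal_mult_less_top)
 finally show ?thesis using assms by (intro integrableI_bounded) (simp_all add: B_measurable cong: measurable_cong_sets)
qed

lemma Poly_B: assumes p: "p \<in> Poly_deg k" shows "p \<in> B"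
proof -
 obtain C where C: "!!x. x \<in> simplex_S ==> \<bar>p x\<bar> <= C"
  using bounded_on_simplex[OF p] by blast
 have one: "(%x. 1) \<in> B" using N.norm_one by (simp add: space_of_def)
 have "AE x in mu. \<bar>p x\<bar> <= \<bar>C * 1\<bar>" using AE_jacobi[of \<alpha>] by eventually_elim (use C in force)
 then show ?thesis by (rule B_AE_mono(1)[OF B_scale(1)[OF one] Poly_deg_measurable[OF p]])
qed

lemma nB_limit:
 assumes f: "!!n. f n \<in> B" and g: "g \<in> borel_measurable borel" and lim: "AE x in mu. (%n. f n x) \<longlonglongrightarrow> g x"
  and le: "eventually (%n. nB (f n) <= c n) sequentially" and c: "c \<longlonglongrightarrow> L"
 shows "g \<in> B" "nB g <= L"
proof -
 have *: "g \<in> B \<and> nB g <= L + e" if e: "e > 0" for e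
 proof -
  have "eventually (%n. c n < L + e) sequentially" using order_tendstoD(2)[OF c, of "L + e"] e by simp
  then have "eventually (%n. nB (f n) <= L + e) sequentially" using le by eventually_elim simp
  then obtain n0 where n0: "!!n. n0 <= n ==> nB (f n) <= L + e" unfolding eventually_sequentially by blast
  then have Le: "0 <= L + e" using nB_nonneg[of "f n0"] by (meson order_trans order_refl)
  have "N g <= ennreal (L + e)"
  proof (rule N.norm_fatou[of "%n. f (n + n0)"])
   show "AE x in mu. (%n. f (n + n0) x) \<longlonglongrightarrow> g x"
    using lim by eventually_elim (rule LIMSEQ_ignore_initial_segment)
   show "N (f (n + n0)) <= ennreal (L + e)" for n
    using n0[of "n + n0"] B_finite(1)[OF f[of "n + n0"]] by (simp add: ennreal_leI)
  qed (use f g in \<open>auto simp: B_measurable cong: measurable_cong_sets\<close>)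
  then show ?thesis using g Le by (auto intro!: B_I nB_leI)
 qed
 show "g \<in> B" using *[of 1] by simp
 show "nB g <= L" by (rule field_le_epsilon) (rule conjunct2[OF *])
qed

text \<open>The space on which multipliers act. Working with polynomials keeps every expansion finite; the passage to
\<open>B\<close> uses \<open>norm_fatou\<close>.\<close>

definition polys :: "(real^'d => real) set" where "polys = (\<Union>k. Poly_deg k)"

lemma polys_B: "f \<in> polys ==> f \<in> B" by (auto simp: polys_def intro: Poly_B)

lemma polys_integrable: "f \<in> polys ==> integrable mu f" by (rule B_integrable[OF polys_B])

lemma BD_polys: "BD n f \<in> polys" using BD_Poly by (auto simp: polys_def)

text \<open>The function of the differential operator with symbol \<open>q\<close>: it multiplies the projection to
\<open>H_space \<alpha> l\<close> by \<open>q l\<close>.\<close>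

definition mult :: "(nat => real) => (real^'d => real) => real^'d => real" where
 "mult q f x = (\<Sum>l | H_proj \<alpha> l f ~= (%x. 0). q l * H_proj \<alpha> l f x)"

lemma mult_Poly: assumes "f \<in> Poly_deg k" shows "mult q f x = (\<Sum>l\<le>k. q l * H_proj \<alpha> l f x)"
 unfolding mult_def using Poly_expansion(2)[OF assms]
 by (intro sum.mono_neutral_left) (auto simp: not_le[symmetric])

lemma polys_cases: assumes "f \<in> polys" obtains k where "f \<in> Poly_deg k"
 using assms by (auto simp: polys_def)

lemma mult_in_Poly: assumes "f \<in> Poly_deg k" shows "mult q f \<in> Poly_deg k"
proof -
 have "mult q f = (%x. \<Sum>l\<le>k. q l * H_proj \<alpha> l f x)" using mult_Poly[OF assms] by (simp add: fun_eq_iff)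
 also have "... \<in> Poly_deg k"
 proof (intro Poly_deg_sum Poly_deg_scale)
  fix l assume "l \<in> {..k}"
  then show "H_proj \<alpha> l f \<in> Poly_deg k"
   using Poly_deg_mono[OF H_proj_Poly[OF integrable_Poly[OF assms], of l], of k] by auto
 qed
 finally show ?thesis .
qed

lemma mult_polys: "f \<in> polys ==> mult q f \<in> polys"
 by (erule polys_cases) (auto simp: polys_def intro: mult_in_Poly)

lemma mult_B: "f \<in> polys ==> mult q f \<in> B" by (intro polys_B mult_polys)

lemma H_proj_mult: assumes "f \<in> polys" shows "H_proj \<alpha> l (mult q f) = (%x. q l * H_proj \<alpha> l f x)"
proof -
 obtain k where k: "f \<in> Poly_deg k" using assms by (rule polys_cases)
 have fi: "integrable mu f" by (rule integrable_Poly[OF k])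
 have pi: "integrable mu (H_proj \<alpha> j f)" for j by (rule integrable_Poly[OF H_proj_Poly[OF fi]])
 have "mult q f = (%x. \<Sum>j\<le>k. q j * H_proj \<alpha> j f x)" using mult_Poly[OF k] by (simp add: fun_eq_iff)
 then have "H_proj \<alpha> l (mult q f) = (%x. \<Sum>j\<le>k. H_proj \<alpha> l (%x. q j * H_proj \<alpha> j f x) x)"
  using pi by (simp only:) (intro H_proj_sum, auto)
 also have "... = (%x. \<Sum>j\<le>k. q j * (if l = j then H_proj \<alpha> j f else (%x. 0)) x)"
  by (simp only: H_proj_scale[OF pi] H_proj_H_space[OF H_proj_in_orth(1)[OF fi]])
 also have "... = (%x. if l <= k then q l * H_proj \<alpha> l f x else 0)"
  by (auto simp: fun_eq_iff if_distrib[of "%h. h _"] if_distrib[of "(*) _"] cong: if_cong)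
 also have "... = (%x. q l * H_proj \<alpha> l f x)" using Poly_expansion(2)[OF k, of l] by (auto simp: fun_eq_iff)
 finally show ?thesis .
qed

lemma mult_mult: assumes "f \<in> polys" shows "mult p (mult q f) = mult (%l. p l * q l) f"
proof -
 obtain k where k: "f \<in> Poly_deg k" using assms by (rule polys_cases)
 show ?thesis by (rule ext) (simp add: mult_Poly[OF k] mult_Poly[OF mult_in_Poly[OF k]] H_proj_mult[OF assms] mult_ac)
qed

lemma mult_one: assumes "f \<in> polys" shows "mult (%_. 1) f = f"
proof -
 obtain k where k: "f \<in> Poly_deg k" using assms by (rule polys_cases)
 show ?thesis using Poly_expansion(1)[OF k] by (simp add: mult_Poly[OF k] fun_eq_iff)
qed

lemma mult_add: assumes "f \<in> polys" shows "mult (%l. p l + q l) f x = mult p f x + mult q f x"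
 by (rule polys_cases[OF assms]) (simp add: mult_Poly distrib_right sum.distrib)

lemma mult_diff: assumes "f \<in> polys" shows "mult (%l. p l - q l) f x = mult p f x - mult q f x"
 by (rule polys_cases[OF assms]) (simp add: mult_Poly left_diff_distrib sum_subtractf)

lemma mult_cmult: assumes "f \<in> polys" shows "mult (%l. c * q l) f x = c * mult q f x"
 by (rule polys_cases[OF assms]) (simp add: mult_Poly sum_distrib_left mult.assoc)

lemma mult_sum: assumes "f \<in> polys" shows "mult (%l. \<Sum>i\<in>A. q i l) f x = (\<Sum>i\<in>A. mult (q i) f x)"
 by (rule polys_cases[OF assms]) (simp add: mult_Poly sum_distrib_right sum.swap[of _ A])

lemma mult_mm: assumes "f \<in> polys" shows "mult (mm n) f = BD n f"
proof -
 obtain k where k: "f \<in> Poly_deg k" using assms by (rule polys_cases)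
 have "(\<Sum>l\<le>k. mm n l * H_proj \<alpha> l f x) = (\<Sum>l\<le>n. mm n l * H_proj \<alpha> l f x)" for x
  using Poly_expansion(2)[OF k] mm_eq_0[of n]
  by (intro sum.mono_neutral_cong) (auto simp: not_le)
 then show ?thesis by (simp add: fun_eq_iff mult_Poly[OF k] BD_expansion[OF integrable_Poly[OF k]])
qed

lemma mult_nB_limit:
 assumes f: "f \<in> polys" and q: "!!l. (%n. q n l) \<longlonglongrightarrow> q' l"
  and le: "eventually (%n. nB (mult (q n) f) <= c n) sequentially" and c: "c \<longlonglongrightarrow> L"
 shows "nB (mult q' f) <= L"
proof -
 obtain k where k: "f \<in> Poly_deg k" using f by (rule polys_cases)
 show ?thesis
 proof (rule nB_limit(2)[OF mult_B[OF f] B_measurable[OF mult_B[OF f]] _ le c])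
  show "AE x in mu. (%n. mult (q n) f x) \<longlonglongrightarrow> mult q' f x"
   unfolding mult_Poly[OF k] by (intro AE_I2 tendsto_sum tendsto_mult_right q)
 qed
qed

text \<open>The multiplier with symbol \<open>q\<close> has norm at most \<open>c\<close>. The class is closed under sums,
products and, by \<open>norm_fatou\<close>, pointwise limits of symbols.\<close>

definition mbd :: "real => (nat => real) => bool" where
 "mbd c q \<longleftrightarrow> 0 <= c \<and> (\<forall>f\<in>polys. nB (mult q f) <= c * nB f)"

lemma mbdD: "mbd c q ==> f \<in> polys ==> nB (mult q f) <= c * nB f" by (simp add: mbd_def)

lemma mbd_nonneg: "mbd c q ==> 0 <= c" by (simp add: mbd_def)

lemma mbd_mono: "mbd c q ==> c <= c' ==> mbd c' q"
 unfolding mbd_def by (meson mult_right_mono nB_nonneg order_trans)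

lemma mbd_one: "mbd 1 (%_. 1)" by (simp add: mbd_def mult_one)

lemma mbd_mult: assumes p: "mbd c p" and q: "mbd c' q" shows "mbd (c * c') (%l. p l * q l)"
 unfolding mbd_def
proof (intro conjI ballI)
 fix f assume f: "f \<in> polys"
 have "nB (mult (%l. p l * q l) f) <= c * nB (mult q f)"
  unfolding mult_mult[OF f, symmetric] by (rule mbdD[OF p mult_polys[OF f]])
 also have "... <= c * (c' * nB f)" using mbdD[OF q f] mbd_nonneg[OF p] by (rule mult_left_mono)
 finally show "nB (mult (%l. p l * q l) f) <= c * c' * nB f" by simp
qed (use mbd_nonneg[OF p] mbd_nonneg[OF q] in simp)

lemma mbd_power: assumes "mbd c p" shows "mbd (c ^ n) (%l. p l ^ n)"
 by (induction n) (auto intro: mbd_one mbd_mult assms)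

lemma mbd_cmult: assumes "mbd c p" shows "mbd (\<bar>a\<bar> * c) (%l. a * p l)"
 unfolding mbd_def
proof (intro conjI ballI)
 fix f assume f: "f \<in> polys"
 have "mult (%l. a * p l) f = (%x. a * mult p f x)" using mult_cmult[OF f] by (simp add: fun_eq_iff)
 then have "nB (mult (%l. a * p l) f) <= \<bar>a\<bar> * nB (mult p f)" using B_scale(2)[OF mult_B[OF f]] by simp
 also have "... <= \<bar>a\<bar> * (c * nB f)" by (intro mult_left_mono mbdD[OF assms f]) auto
 finally show "nB (mult (%l. a * p l) f) <= \<bar>a\<bar> * c * nB f" by simp
qed (use mbd_nonneg[OF assms] in simp)

lemma mbd_sum: assumes "finite A" "!!i. i \<in> A ==> mbd (c i) (p i)" shows "mbd (\<Sum>i\<in>A. c i) (%l. \<Sum>i\<in>A. p i l)"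
 unfolding mbd_def
proof (intro conjI ballI)
 fix f assume f: "f \<in> polys"
 have "mult (%l. \<Sum>i\<in>A. p i l) f = (%x. \<Sum>i\<in>A. mult (p i) f x)" by (intro ext mult_sum[OF f])
 then have "nB (mult (%l. \<Sum>i\<in>A. p i l) f) <= (\<Sum>i\<in>A. nB (mult (p i) f))"
  using B_sum[OF assms(1), of "%i. mult (p i) f"] mult_B[OF f] by simp
 also have "... <= (\<Sum>i\<in>A. c i * nB f)" by (intro sum_mono mbdD[OF assms(2) f])
 finally show "nB (mult (%l. \<Sum>i\<in>A. p i l) f) <= (\<Sum>i\<in>A. c i) * nB f" by (simp add: sum_distrib_right)
qed (use assms mbd_nonneg in \<open>auto intro: sum_nonneg\<close>)

lemma mbd_add: "mbd c p ==> mbd d q ==> mbd (c + d) (%l. p l + q l)"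
 using mbd_sum[of "{True, False}" "%b. if b then c else d" "%b. if b then p else q"] by (simp add: if_distrib)

lemma mbd_diff: assumes "mbd c p" "mbd d q" shows "mbd (c + d) (%l. p l - q l)"
 using mbd_add[OF assms(1) mbd_cmult[OF assms(2), of "-1"]] by simp

lemma mbd_limit:
 assumes "eventually (%n. mbd (c n) (q n)) sequentially" "c \<longlonglongrightarrow> L" "!!l. (%n. q n l) \<longlonglongrightarrow> q' l"
 shows "mbd L q'"
 unfolding mbd_def
proof (intro conjI ballI)
 show "0 <= L" by (rule tendsto_lowerbound[OF assms(2)]) (use assms(1) in \<open>auto elim: eventually_mono dest: mbd_nonneg\<close>)
 fix f assume f: "f \<in> polys"
 show "nB (mult q' f) <= L * nB f"
 proof (rule mult_nB_limit[OF f assms(3)])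
  show "\<forall>\<^sub>F n in sequentially. nB (mult (q n) f) <= c n * nB f" using assms(1) by eventually_elim (rule mbdD[OF _ f])
  show "(%n. c n * nB f) \<longlonglongrightarrow> L * nB f" by (intro tendsto_mult_right assms(2))
 qed
qed

lemma nB_le_from_N: "f \<in> B ==> 0 <= c ==> N g <= ennreal c * N f ==> nB g <= c * nB f"
 by (intro nB_leI) (simp_all add: B_finite(1) ennreal_mult)

lemma mbd_mm: "mbd 1 (mm n)"
 unfolding mbd_def
proof (intro conjI ballI)
 fix f assume f: "f \<in> polys"
 show "nB (mult (mm n) f) <= 1 * nB f"
  unfolding mult_mm[OF f]
  by (rule nB_le_from_N[OF polys_B[OF f]]) (use BD_norm_contraction[OF N.function_norm_axioms polys_integrable[OF f], of n] in simp_all)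
qed simp

text \<open>Weierstrass approximation gives a polynomial slightly above the modulus of the given one. By
\<open>Kn_positive\<close> it majorises the kernel, and its mass is close to the integral of the modulus.\<close>

lemma mbd_kernel:
 assumes c: "(\<integral>\<^sup>+u. ennreal \<bar>\<Sum>k\<le>n. a k * u ^ k\<bar> \<partial>nu) <= ennreal c" "0 <= c"
 shows "mbd c (%l. \<Sum>k\<le>n. a k * ww k * mm k l)"
proof -
 define p where "p u = (\<Sum>k\<le>n. a k * u ^ k)" for u
 have eps: "mbd (c + 3 * e) (%l. \<Sum>k\<le>n. a k * ww k * mm k l)" if e: "0 < e" for e :: real
 proof -
  have "continuous_on {0..1} (%u. \<bar>p u\<bar> + 2 * e)" unfolding p_def by (intro continuous_intros)
  then obtain g where g: "real_polynomial_function g" "!!u. u \<in> {0..1} ==> \<bar>\<bar>p u\<bar> + 2 * e - g u\<bar> < e"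
   using Stone_Weierstrass_real_polynomial_function[of "{0..1::real}" "%u. \<bar>p u\<bar> + 2 * e" e] e by auto
  obtain b n' where b: "g = (%u. \<Sum>i\<le>n'. b i * u ^ i)" using g(1) unfolding real_polynomial_function_iff_sum by blast
  define m where "m = max n n'"
  define a' where "a' k = (if k <= n then a k else 0)" for k
  define b' where "b' k = (if k <= n' then b k else 0)" for k
  have sa: "(\<Sum>k\<le>m. a' k * F k) = (\<Sum>k\<le>n. a k * F k)" for F :: "nat => real"
   by (rule sum.mono_neutral_cong_right) (auto simp: m_def a'_def)
  have sb: "(\<Sum>k\<le>m. b' k * F k) = (\<Sum>k\<le>n'. b k * F k)" for F :: "nat => real"
   by (rule sum.mono_neutral_cong_right) (auto simp: m_def b'_def)
  have bp: "\<bar>\<Sum>k\<le>m. a' k * u ^ k\<bar> + e <= (\<Sum>k\<le>m. b' k * u ^ k)" "(\<Sum>k\<le>m. b' k * u ^ k) <= \<bar>\<Sum>k\<le>m. a' k * u ^ k\<bar> + 3 * e"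
   if "0 <= u" "u <= 1" for u
   using g(2)[of u] that unfolding sa sb p_def b by (auto simp: abs_less_iff)
  have b0: "0 <= (\<Sum>k\<le>m. b' k * u ^ k)" if "0 <= u" "u <= 1" for u using bp(1)[OF that] e by linarith
  interpret nu: finite_measure nu by (rule finite_measure_nu)
  have one: "(\<integral>\<^sup>+u. ennreal d \<partial>nu) = ennreal d" if "0 <= d" for d
   using nn_integral_nu_power[of 0] that by simp
  have I: "(\<integral>\<^sup>+u. ennreal (\<Sum>k\<le>m. b' k * u ^ k) \<partial>nu) = ennreal (\<Sum>k\<le>m. b' k * ww k)" "0 <= (\<Sum>k\<le>m. b' k * ww k)"
   using nn_integral_nu_poly[OF b0] by auto
  have "ennreal e = (\<integral>\<^sup>+u. ennreal e \<partial>nu)" by (rule one[OF less_imp_le[OF e], symmetric])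
  also have "... <= (\<integral>\<^sup>+u. ennreal (\<Sum>k\<le>m. b' k * u ^ k) \<partial>nu)"
  proof (rule nn_integral_mono_AE)
   show "AE u in nu. ennreal e <= ennreal (\<Sum>k\<le>m. b' k * u ^ k)"
    using AE_nu
   proof eventually_elim
    case (elim u)
    then have u: "0 <= u" "u <= 1" by auto
    have "e <= \<bar>\<Sum>k\<le>m. a' k * u ^ k\<bar> + e" by (rule le_add_same_cancel2[THEN iffD2, OF abs_ge_zero])
    also have "... <= (\<Sum>k\<le>m. b' k * u ^ k)" by (rule bp(1)[OF u])
    finally have "e <= (\<Sum>k\<le>m. b' k * u ^ k)" .
    then show ?case by (rule ennreal_leI)
   qed
  qed
  finally have be: "e <= (\<Sum>k\<le>m. b' k * ww k)" unfolding I(1) using I(2) by simp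
  have "(\<integral>\<^sup>+u. ennreal (\<Sum>k\<le>m. b' k * u ^ k) \<partial>nu) <= (\<integral>\<^sup>+u. ennreal \<bar>\<Sum>k\<le>n. a k * u ^ k\<bar> + ennreal (3 * e) \<partial>nu)"
  proof (rule nn_integral_mono_AE)
   show "AE u in nu. ennreal (\<Sum>k\<le>m. b' k * u ^ k) <= ennreal \<bar>\<Sum>k\<le>n. a k * u ^ k\<bar> + ennreal (3 * e)"
    using AE_nu
   proof eventually_elim
    case (elim u)
    then have u: "0 <= u" "u <= 1" by auto
    have "(\<Sum>k\<le>m. b' k * u ^ k) <= \<bar>\<Sum>k\<le>n. a k * u ^ k\<bar> + 3 * e" using bp(2)[OF u] by (simp only: sa)
    then have "ennreal (\<Sum>k\<le>m. b' k * u ^ k) <= ennreal (\<bar>\<Sum>k\<le>n. a k * u ^ k\<bar> + 3 * e)" by (rule ennreal_leI)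
    also have "... = ennreal \<bar>\<Sum>k\<le>n. a k * u ^ k\<bar> + ennreal (3 * e)" by (rule ennreal_plus) (use e in auto)
    finally show ?case .
   qed
  qed
  also have "... = (\<integral>\<^sup>+u. ennreal \<bar>\<Sum>k\<le>n. a k * u ^ k\<bar> \<partial>nu) + ennreal (3 * e)"
   using one[of "3 * e"] e by (subst nn_integral_add) auto
  also have "... <= ennreal c + ennreal (3 * e)" by (intro add_mono c) auto
  finally have bc: "(\<Sum>k\<le>m. b' k * ww k) <= c + 3 * e" unfolding I(1) using c(2) e by (simp flip: ennreal_plus)
  show ?thesis
   unfolding mbd_def
  proof (intro conjI ballI)
   fix f assume f: "f \<in> polys"
   have "mult (%l. \<Sum>k\<le>n. a k * ww k * mm k l) f = (%x. \<Sum>k\<le>m. a' k * ww k * BD k f x)"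
    using mult_sum[OF f, of "%k l. a k * ww k * mm k l" "{..n}"] sa[of "%k. ww k * BD k f _"]
    by (simp add: fun_eq_iff mult_cmult[OF f] mult_mm[OF f] mult.assoc)
   moreover have "N (%x. \<Sum>k\<le>m. a' k * ww k * BD k f x) <= ennreal (\<Sum>k\<le>m. b' k * ww k) * N f"
   proof (rule kernel_norm_bound[OF N.function_norm_axioms _ _ polys_integrable[OF f]])
    show "0 < (\<Sum>k\<le>m. b' k * ww k)" using be e by linarith
    fix x y :: "real^'d" assume xy: "x \<in> simplex_S" "y \<in> simplex_S"
    have "0 <= (\<Sum>k\<le>m. (b' k - a' k) * ww k * Kn k x y)"
    proof (rule Kn_positive[OF _ xy])
     fix u :: real assume "0 <= u" "u <= 1"
     then show "0 <= (\<Sum>k\<le>m. (b' k - a' k) * u ^ k)" using bp(1)[of u] e by (simp add: left_diff_distrib sum_subtractf abs_le_iff)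
    qed
    moreover have "0 <= (\<Sum>k\<le>m. (b' k + a' k) * ww k * Kn k x y)"
    proof (rule Kn_positive[OF _ xy])
     fix u :: real assume "0 <= u" "u <= 1"
     then show "0 <= (\<Sum>k\<le>m. (b' k + a' k) * u ^ k)" using bp(1)[of u] e by (simp add: distrib_right sum.distrib abs_le_iff)
    qed
    ultimately show "\<bar>\<Sum>k\<le>m. a' k * ww k * Kn k x y\<bar> <= (\<Sum>k\<le>m. b' k * ww k * Kn k x y)"
     by (simp add: left_diff_distrib distrib_right sum_subtractf sum.distrib abs_le_iff)
   qed
   ultimately have "nB (mult (%l. \<Sum>k\<le>n. a k * ww k * mm k l) f) <= (\<Sum>k\<le>m. b' k * ww k) * nB f"
    using nB_le_from_N[OF polys_B[OF f]] I(2) by simp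
   also have "... <= (c + 3 * e) * nB f" by (intro mult_right_mono bc) auto
   finally show "nB (mult (%l. \<Sum>k\<le>n. a k * ww k * mm k l) f) <= (c + 3 * e) * nB f" .
  qed (use c(2) e in simp)
 qed
 show ?thesis
 proof (rule mbd_limit[of "%i. c + 3 * (1 / real (Suc i))" "%i l. \<Sum>k\<le>n. a k * ww k * mm k l"])
  have "(%i. c + 3 * (1 / real (Suc i))) \<longlonglongrightarrow> c + 3 * 0" by (intro tendsto_intros LIMSEQ_Suc[OF lim_1_over_n])
  then show "(%i. c + 3 * (1 / real (Suc i))) \<longlonglongrightarrow> c" by simp
  show "\<forall>\<^sub>F i in sequentially. mbd (c + 3 * (1 / real (Suc i))) (%l. \<Sum>k\<le>n. a k * ww k * mm k l)"
   by (intro always_eventually allI eps) simp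
 qed simp
qed

end

context jacobi
begin

text \<open>Summation by parts, using that \<open>mm (Suc K) l - mm K l\<close> is divisible by \<open>lam l\<close>.\<close>

lemma green_symbol: "(\<Sum>k<K. a k * ww k * (mm K l - mm k l)) = lam l * (\<Sum>j=1..K. green_coeff a j * mm j l)"
proof (induction K)
 case (Suc K)
 have "(\<Sum>k<Suc K. a k * ww k * (mm (Suc K) l - mm k l)) =
  (\<Sum>k<Suc K. a k * ww k * (mm (Suc K) l - mm K l)) + (\<Sum>k<Suc K. a k * ww k * (mm K l - mm k l))"
  unfolding sum.distrib[symmetric] by (intro sum.cong refl) (simp add: algebra_simps)
 also have "... = (\<Sum>k<Suc K. a k * ww k) * (mm (Suc K) l - mm K l) + (\<Sum>k<K. a k * ww k * (mm K l - mm k l))"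
  unfolding sum_distrib_right[symmetric] by simp
 also have "... = lam l * (green_coeff a (Suc K) * mm (Suc K) l) + lam l * (\<Sum>j=1..K. green_coeff a j * mm j l)"
  unfolding Suc mm_step green_coeff_def by simp
 also have "... = lam l * (\<Sum>j=1..Suc K. green_coeff a j * mm j l)" by (simp add: distrib_left)
 finally show ?case .
qed simp

end

context jacobi_norm
begin

text \<open>For \<open>K \<longlonglongrightarrow> \<infinity>\<close> the symbol \<open>mm K l\<close> tends to 1, while
the factor by which it differs from the symbol of the positive kernel is \<open>lam l\<close> times a Green
function of small norm.\<close>

lemma jackson_single:
 "\<exists>C\<ge>0. \<forall>a n \<delta>. (\<forall>k>n. a k = 0) --> (\<forall>u. 0 <= u --> u <= 1 --> 0 <= (\<Sum>k\<le>n. a k * u ^ k)) -->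
   (\<Sum>k\<le>n. a k * ww k) = 1 --> (\<Sum>k\<le>n. a k * (ww k - ww (Suc k))) <= \<delta> -->
   (\<exists>v. mbd 1 v \<and> (\<forall>l>n. v l = 0) \<and> (\<forall>f\<in>polys. nB (mult (%l. 1 - v l) f) <= C * \<delta> * nB (mult lam f)))"
proof -
 obtain C where C: "0 <= C" "!!a K. 1 <= K ==> (!!u. 0 <= u ==> u <= 1 ==> 0 <= (\<Sum>k<K. a k * u ^ k)) ==> (\<Sum>k<K. a k * ww k) = 1 ==>
  (\<integral>\<^sup>+u. ennreal \<bar>green_poly a K u\<bar> \<partial>nu) <= ennreal (C * ((\<Sum>k<K. a k * (ww k - ww (Suc k))) + (\<sigma> + 1/2) / (real K + \<sigma> + 1)))"
  using green_estimate by blast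
 have "\<exists>v. mbd 1 v \<and> (\<forall>l>n. v l = 0) \<and> (\<forall>f\<in>polys. nB (mult (%l. 1 - v l) f) <= C * \<delta> * nB (mult lam f))"
  if a: "!!k. n < k ==> a k = 0" and p: "!!u. 0 <= u ==> u <= 1 ==> 0 <= (\<Sum>k\<le>n. a k * u ^ k)"
   and one: "(\<Sum>k\<le>n. a k * ww k) = 1" and d: "(\<Sum>k\<le>n. a k * (ww k - ww (Suc k))) <= \<delta>" for a n \<delta>
 proof -
  define v where "v l = (\<Sum>k\<le>n. a k * ww k * mm k l)" for l
  have ext: "(\<Sum>k<K. a k * F k) = (\<Sum>k\<le>n. a k * F k)" if "n < K" for K and F :: "nat => real"
   by (rule sum.mono_neutral_right) (use that a in auto)
  have "mbd 1 v"
   unfolding v_def[abs_def]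
  proof (rule mbd_kernel)
   have "(\<integral>\<^sup>+u. ennreal \<bar>\<Sum>k\<le>n. a k * u ^ k\<bar> \<partial>nu) = (\<integral>\<^sup>+u. ennreal (\<Sum>k\<le>n. a k * u ^ k) \<partial>nu)"
   proof (rule nn_integral_cong_AE)
    show "AE u in nu. ennreal \<bar>\<Sum>k\<le>n. a k * u ^ k\<bar> = ennreal (\<Sum>k\<le>n. a k * u ^ k)"
     using AE_nu by eventually_elim (simp add: p)
   qed
   then show "(\<integral>\<^sup>+u. ennreal \<bar>\<Sum>k\<le>n. a k * u ^ k\<bar> \<partial>nu) <= ennreal 1"
    using nn_integral_nu_poly(1)[OF p] one by simp
  qed simp
  moreover have "v l = 0" if "n < l" for l unfolding v_def using that by (intro sum.neutral) (auto simp: mm_eq_0)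
  moreover have "nB (mult (%l. 1 - v l) f) <= C * \<delta> * nB (mult lam f)" if f: "f \<in> polys" for f
  proof (rule mult_nB_limit[OF f])
   define c where "c K = C * (\<delta> + (\<sigma> + 1/2) / (real K + \<sigma> + 1))" for K :: nat
   show "(%K. mm K l - v l) \<longlonglongrightarrow> 1 - v l" for l by (intro tendsto_intros mm_tendsto)
   show "(%K. c K * nB (mult lam f)) \<longlonglongrightarrow> C * \<delta> * nB (mult lam f)"
   proof -
    have "(%K. (\<sigma> + 1/2) / (real K + \<sigma> + 1)) \<longlonglongrightarrow> 0"
    proof -
     have "(%K. (\<sigma> + 1/2) * (1 / (real K + (\<sigma> + 1)))) \<longlonglongrightarrow> (\<sigma> + 1/2) * 0"
      by (intro tendsto_mult_left tendsto_reciprocal)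
     then show ?thesis by (simp add: add.assoc)
    qed
    then have "(%K. c K * nB (mult lam f)) \<longlonglongrightarrow> C * (\<delta> + 0) * nB (mult lam f)"
     unfolding c_def by (intro tendsto_intros)
    then show ?thesis by simp
   qed
   show "\<forall>\<^sub>F K in sequentially. nB (mult (%l. mm K l - v l) f) <= c K * nB (mult lam f)"
    using eventually_gt_at_top[of n]
   proof eventually_elim
    case (elim K)
    define g where "g k = (if 1 <= k then green_coeff a k / ww k else 0)" for k
    have gs: "(\<Sum>k\<le>K. g k * ww k * mm k l) = (\<Sum>j=1..K. green_coeff a j * mm j l)" for l
    proof -
     have "(\<Sum>j=1..K. green_coeff a j * mm j l) = (\<Sum>j=1..K. g j * ww j * mm j l)"
      using ww_pos by (intro sum.cong refl) (auto simp: g_def less_imp_neq[symmetric])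
     also have "... = (\<Sum>k\<le>K. g k * ww k * mm k l)" by (rule sum.mono_neutral_left) (auto simp: g_def)
     finally show ?thesis ..
    qed
    have gp: "(\<Sum>k\<le>K. g k * u ^ k) = green_poly a K u" for u
     unfolding green_poly_def by (rule sum.mono_neutral_cong_right) (auto simp: g_def)
    have m: "mbd (c K) (%l. \<Sum>k\<le>K. g k * ww k * mm k l)"
    proof (rule mbd_kernel)
     have q0: "0 <= (\<Sum>k\<le>n. a k * (ww k - ww (Suc k)))" by (rule nn_integral_nu_poly_comp(2)[OF p])
     have "(\<integral>\<^sup>+u. ennreal \<bar>green_poly a K u\<bar> \<partial>nu) <= ennreal (C * ((\<Sum>k<K. a k * (ww k - ww (Suc k))) + (\<sigma> + 1/2) / (real K + \<sigma> + 1)))"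
      by (rule C(2)) (use elim p one ext in auto)
     also have "... <= ennreal (c K)" unfolding ext[OF elim] c_def using d C(1) by (intro ennreal_leI mult_left_mono) auto
     finally show "(\<integral>\<^sup>+u. ennreal \<bar>\<Sum>k\<le>K. g k * u ^ k\<bar> \<partial>nu) <= ennreal (c K)" unfolding gp .
     show "0 <= c K" unfolding c_def using C(1) d q0 sigma_pos by (intro mult_nonneg_nonneg add_nonneg_nonneg divide_nonneg_nonneg) auto
    qed
    have "mm K l - v l = (\<Sum>k\<le>K. g k * ww k * mm k l) * lam l" for l
    proof -
     have "mm K l - v l = (\<Sum>k<K. a k * (ww k * (mm K l - mm k l)))"
      unfolding ext[OF elim] using one by (simp add: v_def right_diff_distrib sum_subtractf sum_distrib_right[symmetric] mult.assoc[symmetric])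
     also have "... = (\<Sum>k\<le>K. g k * ww k * mm k l) * lam l"
      using green_symbol[of a K l] unfolding gs by (simp add: mult.assoc mult.commute)
     finally show ?thesis .
    qed
    then have "mult (%l. mm K l - v l) f = mult (%l. \<Sum>k\<le>K. g k * ww k * mm k l) (mult lam f)"
     by (simp only: mult_mult[OF f])
    then show ?case using mbdD[OF m mult_polys[OF f]] by simp
   qed
  qed
  ultimately show ?thesis by blast
 qed
 then show ?thesis using C(1) by (intro exI[of _ C]) auto
qed

text \<open>Polynomials of degree below the size of the Jackson kernel are handled by the mean value, since only the
constant matters there.\<close>

lemma jackson_multiplier:
 "\<exists>C\<ge>0. \<forall>n\<ge>1. \<exists>v. mbd 1 v \<and> (\<forall>l>n. v l = 0) \<and>
   (\<forall>f\<in>polys. nB (mult (%l. 1 - v l) f) <= C / (real n)\<^sup>2 * nB (mult lam f))"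
proof -
 obtain C where C: "0 <= C" "!!a n \<delta>. (!!k. n < k ==> a k = 0) ==> (!!u. 0 <= u ==> u <= 1 ==> 0 <= (\<Sum>k\<le>n. a k * u ^ k)) ==>
   (\<Sum>k\<le>n. a k * ww k) = 1 ==> (\<Sum>k\<le>n. a k * (ww k - ww (Suc k))) <= \<delta> ==>
   (\<exists>v. mbd 1 v \<and> (\<forall>l>n. v l = 0) \<and> (\<forall>f\<in>polys. nB (mult (%l. 1 - v l) f) <= C * \<delta> * nB (mult lam f)))"
  using jackson_single by blast
 obtain C2 R where R: "0 <= C2" "!!m::nat. 1 <= m ==> (\<exists>a. (\<forall>k>R * m. a k = 0) \<and>
   (\<forall>u. 0 <= u --> u <= 1 --> 0 <= (\<Sum>k\<le>R * m. a k * u ^ k)) \<and> (\<Sum>k\<le>R * m. a k * ww k) = 1 \<and>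
   (\<Sum>k\<le>R * m. a k * (ww k - ww (Suc k))) <= C2 / (real m)\<^sup>2)"
  using jackson_kernel by blast
 define S where "S = Suc R"
 define D where "D = C * (real S ^ 2 + C2 * (2 * real S)\<^sup>2)"
 have D: "0 <= D" using C(1) R(1) by (simp add: D_def)
 have "\<exists>v. mbd 1 v \<and> (\<forall>l>n. v l = 0) \<and> (\<forall>f\<in>polys. nB (mult (%l. 1 - v l) f) <= D / (real n)\<^sup>2 * nB (mult lam f))"
  if n: "1 <= n" for n
 proof (cases "n < S")
  case True
  have "\<exists>v. mbd 1 v \<and> (\<forall>l>0. v l = 0) \<and> (\<forall>f\<in>polys. nB (mult (%l. 1 - v l) f) <= C * 1 * nB (mult lam f))"
   by (rule C(2)[of 0 "%k. of_bool (k = 0)"]) (use ww_pos[of 1] in auto)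
  then obtain v where v: "mbd 1 v" "!!l. l > 0 ==> v l = 0" "!!f. f \<in> polys ==> nB (mult (%l. 1 - v l) f) <= C * nB (mult lam f)" by auto
  have "C <= D / (real n)\<^sup>2"
  proof -
   have "C * (real n)\<^sup>2 <= C * real S ^ 2" using True C(1) by (intro mult_left_mono power_mono) auto
   also have "... <= D" unfolding D_def using C(1) R(1) by (intro mult_left_mono) auto
   finally show ?thesis using n by (simp add: field_simps)
  qed
  then have "nB (mult (%l. 1 - v l) f) <= D / (real n)\<^sup>2 * nB (mult lam f)" if "f \<in> polys" for f
   using v(3)[OF that] by (meson mult_right_mono nB_nonneg order_trans)
  then show ?thesis using v(1,2) by (intro exI[of _ v]) auto
 next
  case False
  define m where "m = n div S"
  have S: "1 <= S" by (simp add: S_def)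
  have m: "1 <= m" unfolding m_def using False S by (simp add: Suc_le_eq div_greater_zero_iff)
  have "S * m <= n" unfolding m_def by simp
  then have Rm: "R * m <= n" by (simp add: S_def)
  have "n < S * m + S" unfolding m_def using S by (metis add.commute dividend_less_times_div less_le_trans zero_less_one)
  also have "... <= S * m + S * m" using m by simp
  finally have "real n <= 2 * real S * real m" by (metis less_imp_le mult.assoc mult_2 of_nat_le_iff of_nat_mult of_nat_numeral)
  then have nm: "(real n)\<^sup>2 <= (2 * real S)\<^sup>2 * (real m)\<^sup>2" unfolding power_mult_distrib[symmetric] by (intro power_mono) auto
  obtain a where a: "!!k. R * m < k ==> a k = 0" "!!u. 0 <= u ==> u <= 1 ==> 0 <= (\<Sum>k\<le>R * m. a k * u ^ k)" "(\<Sum>k\<le>R * m. a k * ww k) = 1"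
   "(\<Sum>k\<le>R * m. a k * (ww k - ww (Suc k))) <= C2 / (real m)\<^sup>2" using R(2)[OF m] by blast
  obtain v where v: "mbd 1 v" "!!l. l > R * m ==> v l = 0" "!!f. f \<in> polys ==> nB (mult (%l. 1 - v l) f) <= C * (C2 / (real m)\<^sup>2) * nB (mult lam f)"
   using C(2)[OF a] by blast
  have "C * (C2 / (real m)\<^sup>2) <= D / (real n)\<^sup>2"
  proof -
   have "C * C2 * (real n)\<^sup>2 <= C * C2 * ((2 * real S)\<^sup>2 * (real m)\<^sup>2)" using nm C(1) R(1) by (intro mult_left_mono) auto
   also have "... <= D * (real m)\<^sup>2" using C(1) by (simp add: D_def algebra_simps)
   finally show ?thesis using n m by (simp add: field_simps)
  qed
  then have "nB (mult (%l. 1 - v l) f) <= D / (real n)\<^sup>2 * nB (mult lam f)" if "f \<in> polys" for f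
   using v(3)[OF that] by (meson mult_right_mono nB_nonneg order_trans)
  then show ?thesis using v(1,2) Rm by (intro exI[of _ v]) auto
 qed
 then show ?thesis using D by blast
qed

section \<open>Resolvents\<close>

text \<open>A suitable convex combination of \<open>BD 0, \<dots>, BD K\<close> equals the resolvent applied to \<open>BD
K\<close>: the weights \<open>c\<close> are chosen so that the sum telescopes under \<open>1 + b P\<close>.\<close>

lemma mbd_resolvent:
 assumes b: "0 < b"
 shows "mbd 1 (%l. 1 / (1 + b * lam l))"
proof -
 define c where "c = rec_nat 1 (%k x. x * (1 + b * lam k) / (b * lam (Suc k)))"
 have c0: "c 0 = 1" and cS: "c (Suc k) = c k * (1 + b * lam k) / (b * lam (Suc k))" for k by (simp_all add: c_def)
 have pos: "0 < 1 + b * lam k" for k using b lam_nonneg[of k] by (intro add_pos_nonneg) auto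
 have cpos: "0 < c k" for k
  by (induction k) (use b lam_pos pos in \<open>auto simp: c0 cS intro!: divide_pos_pos mult_pos_pos\<close>)
 have cS': "c (Suc k) * (b * lam (Suc k)) = c k * (1 + b * lam k)" for k
  unfolding cS using b lam_pos[of "Suc k"] by simp
 have sym: "(1 + b * lam l) * (\<Sum>k\<le>K. c k * mm k l) = c K * (1 + b * lam K) * mm K l" for K l
 proof (induction K)
  case 0 show ?case by (cases "l = 0") (simp_all add: c0 mm_eq_0)
 next
  case (Suc K)
  have "(1 + b * lam l) * (\<Sum>k\<le>Suc K. c k * mm k l) = c K * (1 + b * lam K) * mm K l + (1 + b * lam l) * (c (Suc K) * mm (Suc K) l)"
   using Suc by (simp add: distrib_left)
  also have "c K * (1 + b * lam K) * mm K l = c (Suc K) * b * (lam (Suc K) * mm K l)" unfolding cS'[symmetric] by simp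
  also have "lam (Suc K) * mm K l = (lam (Suc K) - lam l) * mm (Suc K) l" using mm_recursion[of K l] by (simp only: lam_alt[of "Suc K"])
  also have "c (Suc K) * b * ((lam (Suc K) - lam l) * mm (Suc K) l) + (1 + b * lam l) * (c (Suc K) * mm (Suc K) l) = c (Suc K) * (1 + b * lam (Suc K)) * mm (Suc K) l"
   by (simp add: algebra_simps)
  finally show ?case .
 qed
 define S where "S K = c K * (1 + b * lam K)" for K
 have S0: "0 < S K" for K unfolding S_def using cpos pos by simp
 have Ssum: "(\<Sum>k\<le>K. c k) = S K" for K using sym[of 0 K] by (simp add: S_def)
 have e: "mm K l / (1 + b * lam l) = (\<Sum>k\<le>K. (c k / S K) * mm k l)" for K l
 proof -
  have "mm K l = (1 + b * lam l) * (\<Sum>k\<le>K. (c k / S K) * mm k l)"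
   using sym[of l K] S0[of K] unfolding S_def[symmetric] by (simp add: sum_divide_distrib[symmetric] field_simps)
  then show ?thesis using pos[of l] by (metis nonzero_mult_div_cancel_left less_irrefl)
 qed
 show ?thesis
 proof (rule mbd_limit[of "%_. 1" "%K l. mm K l / (1 + b * lam l)"])
  have "mbd (\<Sum>k\<le>K. \<bar>c k / S K\<bar> * 1) (%l. \<Sum>k\<le>K. (c k / S K) * mm k l)" for K
   by (intro mbd_sum mbd_cmult mbd_mm) auto
  moreover have "(\<Sum>k\<le>K. \<bar>c k / S K\<bar> * 1) = 1" for K
   using cpos S0[of K] by (simp add: abs_of_pos sum_divide_distrib[symmetric] Ssum)
  ultimately show "\<forall>\<^sub>F K in sequentially. mbd 1 (%l. mm K l / (1 + b * lam l))" unfolding e by simp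
  show "(%K. mm K l / (1 + b * lam l)) \<longlonglongrightarrow> 1 / (1 + b * lam l)" for l
   by (intro tendsto_divide mm_tendsto tendsto_const) (use pos[of l] in simp)
 qed simp
qed

text \<open>A geometric series with nonnegative coefficients of sum 1.\<close>

lemma mbd_geometric:
 assumes A: "mbd 1 A" and A1: "!!l. 0 <= A l \<and> A l <= 1" and k: "0 < \<kappa>"
 shows "mbd 1 (%l. 1 / (1 + \<kappa> * (1 - A l)))"
proof -
 define th where "th = \<kappa> / (1 + \<kappa>)"
 have th: "0 <= th" "th < 1" using k by (auto simp: th_def)
 have k1: "1 / (1 + \<kappa>) = 1 - th" using k by (simp add: th_def field_simps)
 show ?thesis
 proof (rule mbd_limit[of "%_. 1" "%K l. \<Sum>n<K. ((1 - th) * th ^ n) * A l ^ n"])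
  have "mbd (\<Sum>n<K. \<bar>(1 - th) * th ^ n\<bar> * 1 ^ n) (%l. \<Sum>n<K. ((1 - th) * th ^ n) * A l ^ n)" for K
   by (intro mbd_sum mbd_cmult mbd_power A) auto
  moreover have "(\<Sum>n<K. \<bar>(1 - th) * th ^ n\<bar> * 1 ^ n) <= 1" for K
  proof -
   have "(\<Sum>n<K. \<bar>(1 - th) * th ^ n\<bar> * 1 ^ n) = (1 - th) * (\<Sum>n<K. th ^ n)" using th by (simp add: sum_distrib_left abs_mult)
   also have "... = 1 - th ^ K" using th by (simp add: one_diff_power_eq)
   finally show ?thesis using th by simp
  qed
  ultimately show "\<forall>\<^sub>F K in sequentially. mbd 1 (%l. \<Sum>n<K. ((1 - th) * th ^ n) * A l ^ n)"
   by (intro always_eventually allI) (rule mbd_mono)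
  show "(%K. \<Sum>n<K. ((1 - th) * th ^ n) * A l ^ n) \<longlonglongrightarrow> 1 / (1 + \<kappa> * (1 - A l))" for l
  proof -
   have "th * A l <= th * 1" using th A1[of l] by (intro mult_left_mono) auto
   then have n: "norm (th * A l) < 1" using th A1[of l] by (simp add: abs_mult abs_of_nonneg)
   have "(%K. \<Sum>n<K. (th * A l) ^ n) \<longlonglongrightarrow> 1 / (1 - th * A l)" using geometric_sums[OF n] by (simp add: sums_def)
   then have "(%K. (1 - th) * (\<Sum>n<K. (th * A l) ^ n)) \<longlonglongrightarrow> (1 - th) * (1 / (1 - th * A l))" by (rule tendsto_mult_left)
   moreover have "(1 - th) * (1 / (1 - th * A l)) = 1 / (1 + \<kappa> * (1 - A l))"
    unfolding k1[symmetric] using k by (simp add: th_def field_simps)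
   ultimately show ?thesis by (simp add: sum_distrib_left power_mult_distrib mult_ac)
  qed
 qed simp
qed

text \<open>The iteration increases to \<open>1 - sqrt (1 - x)\<close> and uses only averages and squares, which preserve
contractions.\<close>

fun visser :: "nat => real => real" where
 "visser 0 x = 0"
| "visser (Suc n) x = (x + (visser n x)\<^sup>2) / 2"

lemma visser_bounds:
 assumes x: "0 <= x" "x <= 1"
 shows "0 <= visser n x" "visser n x <= 1 - sqrt (1 - x)" "visser n x <= visser (Suc n) x"
proof -
 have L: "0 <= 1 - sqrt (1 - x)" using x by simp
 have fp: "(x + (1 - sqrt (1 - x))\<^sup>2) / 2 = 1 - sqrt (1 - x)" using x by (simp add: power2_diff)
 show 1: "0 <= visser n x" for n by (induction n) (use x in auto)
 show "visser n x <= 1 - sqrt (1 - x)"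
 proof (induction n)
  case (Suc n)
  have "(visser n x)\<^sup>2 <= (1 - sqrt (1 - x))\<^sup>2" using Suc 1 by (intro power_mono)
  then show ?case using fp by simp
 qed (use L in simp)
 show "visser n x <= visser (Suc n) x"
 proof (induction n)
  case (Suc n)
  have "(visser n x)\<^sup>2 <= (visser (Suc n) x)\<^sup>2" using Suc 1 by (intro power_mono)
  then show ?case by simp
 qed (use x in simp)
qed

lemma visser_tendsto:
 assumes x: "0 <= x" "x <= 1"
 shows "(%n. visser n x) \<longlonglongrightarrow> 1 - sqrt (1 - x)"
proof -
 have "incseq (%n. visser n x)" by (intro incseq_SucI visser_bounds(3) x)
 then obtain L where L: "(%n. visser n x) \<longlonglongrightarrow> L"
  using incseq_convergent[of "%n. visser n x" "1 - sqrt (1 - x)"] visser_bounds(2)[OF x] by blast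
 have "(%n. visser (Suc n) x) \<longlonglongrightarrow> (x + L\<^sup>2) / 2" by (auto intro!: tendsto_intros L)
 then have e: "(x + L\<^sup>2) / 2 = L" using LIMSEQ_Suc[OF L] LIMSEQ_unique by blast
 have le: "L <= 1 - sqrt (1 - x)" by (rule LIMSEQ_le_const2[OF L]) (use visser_bounds(2)[OF x] in auto)
 have "(1 - L)\<^sup>2 = 1 - x" using e by (simp add: power2_diff field_simps)
 moreover have "0 <= 1 - L" using le x by (smt (verit) real_sqrt_ge_zero)
 ultimately have "sqrt (1 - x) = 1 - L" by (metis real_sqrt_unique)
 then have "L = 1 - sqrt (1 - x)" by simp
 then show ?thesis using L by simp
qed

lemma mbd_sqrt:
 assumes R: "mbd 1 R" and R1: "!!l. 0 <= R l \<and> R l <= 1"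
 shows "mbd 1 (%l. 1 - sqrt (1 - R l))"
proof (rule mbd_limit[of "%_. 1" "%n l. visser n (R l)"])
 have "mbd 1 (%l. visser n (R l))" for n
 proof (induction n)
  case 0 show ?case using mbd_mono[OF mbd_cmult[OF mbd_one, of 0]] by simp
 next
  case (Suc n)
  from mbd_cmult[OF mbd_add[OF R mbd_power[OF Suc, of 2]], of "1/2"] show ?case by simp
 qed
 then show "\<forall>\<^sub>F n in sequentially. mbd 1 (%l. visser n (R l))" by simp
 show "(%n. visser n (R l)) \<longlonglongrightarrow> 1 - sqrt (1 - R l)" for l using R1[of l] by (intro visser_tendsto) auto
qed simp

text \<open>The symbol of the square root of the differential operator.\<close>

definition qq :: "nat => real" where "qq l = sqrt (lam l)"

text \<open>The resolvent of the square root. Because \<open>r/2\<close> is half-integral for odd \<open>r\<close>,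
everything below is expressed by it.\<close>

definition JJ :: "real => nat => real" where "JJ \<tau> l = 1 / (1 + \<tau> * qq l)"

lemma qq_nonneg [simp]: "0 <= qq l" by (simp add: qq_def lam_nonneg)

lemma qq_square: "qq l * qq l = lam l" by (simp add: qq_def lam_nonneg)

text \<open>For the bounded approximation \<open>lam l / (1 + e * lam l)\<close>, which is \<open>(1 - R) / e\<close> for
a resolvent \<open>R\<close>, the claim follows from the square root and the geometric series; then
\<open>e\<close> tends to 0.\<close>

lemma mbd_JJ:
 assumes t: "0 < \<tau>"
 shows "mbd 1 (JJ \<tau>)"
proof (rule mbd_limit[of "%_. 1" "%n l. 1 / (1 + \<tau> * sqrt (lam l / (1 + (1 / real (Suc n)) * lam l)))"])
 have "mbd 1 (%l. 1 / (1 + \<tau> * sqrt (lam l / (1 + e * lam l))))" if e: "0 < e" for e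
 proof -
  define R where "R l = 1 / (1 + e * lam l)" for l
  have pos: "1 <= 1 + e * lam l" for l using e lam_nonneg[of l] by simp
  have R1: "0 <= R l \<and> R l <= 1" for l using pos[of l] by (simp add: R_def)
  have R: "mbd 1 R" unfolding R_def[abs_def] by (rule mbd_resolvent[OF e])
  have s: "(\<tau> / sqrt e) * (1 - (1 - sqrt (1 - R l))) = \<tau> * sqrt (lam l / (1 + e * lam l))" for l
  proof -
   have "1 - R l = e * (lam l / (1 + e * lam l))" using pos[of l] by (simp add: R_def field_simps)
   then have "sqrt (1 - R l) = sqrt e * sqrt (lam l / (1 + e * lam l))" by (simp only: real_sqrt_mult)
   then show ?thesis using e by (simp del: real_sqrt_divide)
  qed
  have "mbd 1 (%l. 1 / (1 + (\<tau> / sqrt e) * (1 - (1 - sqrt (1 - R l)))))"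
   by (rule mbd_geometric[OF mbd_sqrt[OF R R1]]) (use R1 t e in auto)
  then show ?thesis unfolding s .
 qed
 then show "\<forall>\<^sub>F n in sequentially. mbd 1 (%l. 1 / (1 + \<tau> * sqrt (lam l / (1 + (1 / real (Suc n)) * lam l))))"
  by (intro always_eventually allI) (simp only: zero_less_divide_1_iff of_nat_0_less_iff zero_less_Suc)
 show "(%n. 1 / (1 + \<tau> * sqrt (lam l / (1 + (1 / real (Suc n)) * lam l)))) \<longlonglongrightarrow> JJ \<tau> l" for l
 proof -
  have "(%n. 1 / (1 + \<tau> * sqrt (lam l / (1 + (1 / real (Suc n)) * lam l)))) \<longlonglongrightarrow> 1 / (1 + \<tau> * sqrt (lam l / (1 + 0 * lam l)))"
   using t lam_nonneg[of l] by (intro tendsto_intros LIMSEQ_Suc[OF lim_1_over_n]) (auto simp: add_nonneg_eq_0_iff)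
  then show ?thesis by (simp add: JJ_def qq_def)
 qed
qed simp

lemma JJ_props:
 assumes "0 < \<tau>"
 shows "0 < 1 + \<tau> * qq l" "1 - JJ \<tau> l = \<tau> * (qq l * JJ \<tau> l)" "JJ \<tau> l * (1 + \<tau> * qq l) = 1"
proof -
 show p: "0 < 1 + \<tau> * qq l" using assms qq_nonneg[of l] by (intro add_pos_nonneg) auto
 then show "1 - JJ \<tau> l = \<tau> * (qq l * JJ \<tau> l)" "JJ \<tau> l * (1 + \<tau> * qq l) = 1" by (simp_all add: JJ_def field_simps)
qed

text \<open>Split \<open>f\<close> by \<open>JJ \<delta>\<close>: the rough part is \<open>\<delta>\<close> times a
contraction of the square root applied to \<open>f\<close>, the smooth part is estimated by the hypothesis.\<close>

lemma interpolation:
 assumes w: "mbd c w" and d: "0 < \<delta>" and le: "!!f. f \<in> polys ==> nB (mult w f) <= \<delta>\<^sup>2 * nB (mult lam f)" and f: "f \<in> polys"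
 shows "nB (mult w f) <= (c + 2) * \<delta> * nB (mult qq f)"
proof -
 let ?h = "mult qq f"
 have h: "?h \<in> polys" by (rule mult_polys[OF f])
 have J: "mbd 1 (JJ \<delta>)" by (rule mbd_JJ[OF d])
 have 1: "nB (mult (%l. w l * (\<delta> * JJ \<delta> l)) ?h) <= c * \<delta> * nB ?h"
  using mbdD[OF mbd_mult[OF w mbd_cmult[OF J, of \<delta>]] h] d by simp
 have "nB (mult w (mult (JJ \<delta>) f)) <= \<delta>\<^sup>2 * nB (mult lam (mult (JJ \<delta>) f))" by (rule le[OF mult_polys[OF f]])
 also have "mult lam (mult (JJ \<delta>) f) = mult (%l. (1 / \<delta>) * (1 - JJ \<delta> l)) ?h"
 proof -
  have "lam l * JJ \<delta> l = (1 / \<delta>) * (1 - JJ \<delta> l) * qq l" for l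
   unfolding JJ_props(2)[OF d] using d by (simp add: qq_square[symmetric] mult_ac)
  then show ?thesis by (simp only: mult_mult[OF f])
 qed
 also have "nB ... <= (1 / \<delta> * 2) * nB ?h"
  using mbdD[OF mbd_cmult[OF mbd_diff[OF mbd_one J], of "1 / \<delta>"] h] d by simp
 finally have "nB (mult w (mult (JJ \<delta>) f)) <= \<delta>\<^sup>2 * (1 / \<delta> * 2 * nB ?h)" using d by (simp add: mult_left_mono)
 also have "... = 2 * \<delta> * nB ?h" using d by (simp add: power2_eq_square)
 finally have 2: "nB (mult w (mult (JJ \<delta>) f)) <= 2 * \<delta> * nB ?h" .
 have "mult w f = (%x. mult (%l. w l * (\<delta> * JJ \<delta> l)) ?h x + mult w (mult (JJ \<delta>) f) x)"
 proof -
  have "w l = w l * (\<delta> * JJ \<delta> l) * qq l + w l * JJ \<delta> l" for l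
  proof -
   have "w l * (\<delta> * JJ \<delta> l) * qq l + w l * JJ \<delta> l = w l * ((1 - JJ \<delta> l) + JJ \<delta> l)"
    unfolding JJ_props(2)[OF d] by (simp add: distrib_left mult_ac)
   then show ?thesis by simp
  qed
  then have "mult w f = mult (%l. w l * (\<delta> * JJ \<delta> l) * qq l + w l * JJ \<delta> l) f" by presburger
  then show ?thesis using mult_add[OF f] by (simp add: fun_eq_iff mult_mult[OF f])
 qed
 then have "nB (mult w f) <= nB (mult (%l. w l * (\<delta> * JJ \<delta> l)) ?h) + nB (mult w (mult (JJ \<delta>) f))"
  using B_add(2)[OF mult_B[OF h] mult_B[OF mult_polys[OF f]]] by metis
 then show ?thesis using 1 2 by (simp add: algebra_simps)
qed

text \<open>Interpolation gives the first power, and multipliers commute, so the estimate can be iterated.\<close>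

lemma jackson_power:
 "\<exists>C\<ge>0. \<forall>n\<ge>1. \<exists>v. mbd 1 v \<and> (\<forall>l>n. v l = 0) \<and>
   (\<forall>R. \<forall>f\<in>polys. nB (mult (%l. (1 - v l) ^ R) f) <= (C / real n) ^ R * nB (mult (%l. qq l ^ R) f))"
proof -
 obtain C where C: "0 <= C" "!!n. 1 <= n ==> \<exists>v. mbd 1 v \<and> (\<forall>l>n. v l = 0) \<and>
   (\<forall>f\<in>polys. nB (mult (%l. 1 - v l) f) <= C / (real n)\<^sup>2 * nB (mult lam f))" using jackson_multiplier by blast
 define D where "D = 4 * sqrt (C + 1)"
 have "\<exists>v. mbd 1 v \<and> (\<forall>l>n. v l = 0) \<and>
   (\<forall>R. \<forall>f\<in>polys. nB (mult (%l. (1 - v l) ^ R) f) <= (D / real n) ^ R * nB (mult (%l. qq l ^ R) f))" if n: "1 <= n" for n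
 proof -
  obtain v where v: "mbd 1 v" "\<forall>l>n. v l = 0" "!!f. f \<in> polys ==> nB (mult (%l. 1 - v l) f) <= C / (real n)\<^sup>2 * nB (mult lam f)"
   using C(2)[OF n] by blast
  define d where "d = sqrt (C + 1) / real n"
  have d: "0 < d" unfolding d_def using C(1) n by simp
  have d2: "d\<^sup>2 = (C + 1) / (real n)\<^sup>2" using C(1) by (simp add: d_def power_divide)
  have le: "nB (mult (%l. 1 - v l) f) <= d\<^sup>2 * nB (mult lam f)" if f: "f \<in> polys" for f
  proof -
   have "C / (real n)\<^sup>2 * nB (mult lam f) <= d\<^sup>2 * nB (mult lam f)" unfolding d2 by (intro mult_right_mono divide_right_mono) auto
   then show ?thesis using v(3)[OF f] by linarith
  qed
  have w: "mbd 2 (%l. 1 - v l)" using mbd_diff[OF mbd_one v(1)] by simp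
  have st: "nB (mult (%l. 1 - v l) f) <= D / real n * nB (mult qq f)" if "f \<in> polys" for f
   using interpolation[OF w d le that] by (simp add: D_def d_def)
  have "nB (mult (%l. (1 - v l) ^ R) f) <= (D / real n) ^ R * nB (mult (%l. qq l ^ R) f)" if f: "f \<in> polys" for R f
   using f
  proof (induction R arbitrary: f)
   case (Suc R)
   have "nB (mult (%l. (1 - v l) ^ Suc R) f) = nB (mult (%l. 1 - v l) (mult (%l. (1 - v l) ^ R) f))"
    by (simp add: mult_mult[OF Suc.prems])
   also have "... <= D / real n * nB (mult qq (mult (%l. (1 - v l) ^ R) f))" by (rule st[OF mult_polys[OF Suc.prems]])
   also have "mult qq (mult (%l. (1 - v l) ^ R) f) = mult (%l. (1 - v l) ^ R) (mult qq f)"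
    by (simp add: mult_mult[OF Suc.prems] mult.commute)
   also have "D / real n * nB ... <= D / real n * ((D / real n) ^ R * nB (mult (%l. qq l ^ R) (mult qq f)))"
    by (intro mult_left_mono Suc.IH mult_polys Suc.prems) (use C(1) in \<open>simp add: D_def\<close>)
   also have "mult (%l. qq l ^ R) (mult qq f) = mult (%l. qq l ^ Suc R) f"
    by (simp add: mult_mult[OF Suc.prems] mult.commute)
   finally show ?case by (simp add: mult.assoc)
  qed simp
  then show ?thesis using v(1,2) by (intro exI[of _ v]) auto
 qed
 moreover have "0 <= D" using C(1) by (simp add: D_def)
 ultimately show ?thesis by blast
qed

end

context jacobi_norm
begin

section \<open>Powers of the operator and K-functionals\<close>

lemma lam_powr: assumes "1 <= R" shows "lam l powr (real R / 2) = qq l ^ R"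
proof (cases "lam l = 0")
 case True then show ?thesis using assms by (simp add: qq_def)
next
 case False
 then have l: "0 < lam l" using lam_nonneg[of l] by simp
 have "lam l powr (real R / 2) = (lam l powr (1/2)) powr real R" by (simp add: powr_powr)
 also have "... = qq l ^ R" using l by (simp add: powr_half_sqrt qq_def powr_realpow)
 finally show ?thesis .
qed

lemma P_power_is: "g \<in> P_domain \<alpha> N b ==> is_P_power \<alpha> N b g (P_power \<alpha> N b g)"
 unfolding P_domain_def P_power_def by (auto intro: someI[where P="is_P_power \<alpha> N b g"])

text \<open>The projections determine the function almost everywhere.\<close>

lemma P_power_norm:
 assumes p: "is_P_power \<alpha> N b g \<psi>"
 shows "nB (P_power \<alpha> N b g) = nB \<psi>"
proof -
 have q: "is_P_power \<alpha> N b g (P_power \<alpha> N b g)" unfolding P_power_def by (rule someI[where P="is_P_power \<alpha> N b g", OF p])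
 have "AE x in mu. P_power \<alpha> N b g x = \<psi> x"
  using p q by (intro AE_eq_if_H_proj_eq B_integrable) (auto simp: is_P_power_def)
 then show ?thesis using p q by (intro nB_AE_eq) (auto simp: is_P_power_def)
qed

lemma polys_P_power:
 assumes f: "f \<in> polys" and R: "1 <= R"
 shows "is_P_power \<alpha> N (real R / 2) f (mult (%l. qq l ^ R) f)"
 unfolding is_P_power_def lam_powr[OF R] using H_proj_mult[OF f] mult_B[OF f] by auto

lemma polys_P_domain: "f \<in> polys ==> 1 <= R ==> f \<in> P_domain \<alpha> N (real R / 2)"
 unfolding P_domain_def using polys_P_power polys_B by auto

lemma K_fun_bdd: "0 <= u ==> bdd_below ((%g. nB (%x. f x - g x) + u * nB (P_power \<alpha> N b g)) ` A)"
 by (intro bdd_belowI2[of _ 0]) simp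

lemma K_fun_le: "g \<in> P_domain \<alpha> N (real R / 2) ==> 0 <= u ==>
  K_fun \<alpha> N R f u <= nB (%x. f x - g x) + u * nB (P_power \<alpha> N (real R / 2) g)"
 unfolding K_fun_def by (intro cINF_lower K_fun_bdd)

lemma K_fun_le_polys: "h \<in> polys ==> 1 <= R ==> 0 <= u ==>
  K_fun \<alpha> N R f u <= nB (%x. f x - h x) + u * nB (mult (%l. qq l ^ R) h)"
 using K_fun_le[OF polys_P_domain, of h R u f] P_power_norm[OF polys_P_power] by simp

lemma zero_polys: "(%x. 0) \<in> polys" using Poly_deg_zero by (auto simp: polys_def)

lemma P_domain_nonempty: "1 <= R ==> P_domain \<alpha> N (real R / 2) ~= {}"
 using polys_P_domain[OF zero_polys] by blast

lemma K_fun_nonneg: "1 <= R ==> 0 <= u ==> 0 <= K_fun \<alpha> N R f u"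
 unfolding K_fun_def by (intro cINF_greatest P_domain_nonempty) simp_all

lemma K_fun_mono: assumes "1 <= R" "0 <= u" "u <= v" shows "K_fun \<alpha> N R f u <= K_fun \<alpha> N R f v"
 unfolding K_fun_def
proof (rule cINF_mono[OF P_domain_nonempty[OF assms(1)] K_fun_bdd[OF assms(2)]])
 fix g assume "g \<in> P_domain \<alpha> N (real R / 2)"
 then show "\<exists>h\<in>P_domain \<alpha> N (real R / 2). nB (%x. f x - h x) + u * nB (P_power \<alpha> N (real R / 2) h) \<le>
   nB (%x. f x - g x) + v * nB (P_power \<alpha> N (real R / 2) g)"
  using assms(3) by (intro bexI[of _ g] add_left_mono mult_right_mono) auto
qed

lemma K_fun_approx:
 assumes "1 <= R" "0 <= u" "0 < e"
 obtains g \<psi> where "g \<in> B" "is_P_power \<alpha> N (real R / 2) g \<psi>" "nB (%x. f x - g x) + u * nB \<psi> < K_fun \<alpha> N R f u + e"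
proof -
 have "\<exists>g\<in>P_domain \<alpha> N (real R / 2). nB (%x. f x - g x) + u * nB (P_power \<alpha> N (real R / 2) g) < K_fun \<alpha> N R f u + e"
  unfolding K_fun_def using assms
  by (subst cINF_less_iff[symmetric, OF P_domain_nonempty K_fun_bdd]) auto
 then obtain g where g: "g \<in> P_domain \<alpha> N (real R / 2)"
  "nB (%x. f x - g x) + u * nB (P_power \<alpha> N (real R / 2) g) < K_fun \<alpha> N R f u + e" by blast
 show ?thesis by (rule that[OF _ P_power_is[OF g(1)] g(2)]) (use g(1) in \<open>simp add: P_domain_def\<close>)
qed

section \<open>Polynomial approximation in the domain\<close>

lemma mult_BD: assumes g: "g \<in> B" shows "mult z (BD k g) x = (\<Sum>l\<le>k. z l * (mm k l * H_proj \<alpha> l g x))"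
 using mult_Poly[OF BD_Poly] H_proj_BD[OF B_integrable[OF g]] by simp

lemma mult_BD_tendsto:
 assumes g: "g \<in> B" and z: "!!l. n < l ==> z l = 0"
 shows "(%k. mult z (BD k g) x) \<longlonglongrightarrow> mult (%l. z l / mm n l) (BD n g) x"
proof -
 have "mult z (BD k g) x = (\<Sum>l\<le>n. z l * (mm k l * H_proj \<alpha> l g x))" for k
  unfolding mult_BD[OF g] using z mm_eq_0[of k] by (intro sum.mono_neutral_cong) (auto simp: not_le)
 moreover have "(%k. \<Sum>l\<le>n. z l * (mm k l * H_proj \<alpha> l g x)) \<longlonglongrightarrow> (\<Sum>l\<le>n. z l * (1 * H_proj \<alpha> l g x))"
  by (intro tendsto_intros mm_tendsto)
 moreover have "mult (%l. z l / mm n l) (BD n g) x = (\<Sum>l\<le>n. z l * (1 * H_proj \<alpha> l g x))"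
  unfolding mult_BD[OF g] using mm_pos[of _ n] by (intro sum.cong refl) (auto simp: less_imp_neq[symmetric])
 ultimately show ?thesis by simp
qed

lemma BD_B: "g \<in> B ==> nB (BD n g) <= nB g"
 using nB_le_from_N[of g 1 "BD n g"] BD_norm_contraction[OF N.function_norm_axioms B_integrable, of g n] by simp

text \<open>The approximant has the symbol \<open>1 - (1 - v l) ^ R\<close> with the Jackson multiplier \<open>v\<close>.
The estimates hold for the polynomials \<open>BD k g\<close> uniformly in \<open>k\<close> and pass to
\<open>g\<close> by \<open>norm_fatou\<close> along a subsequence that converges almost everywhere.\<close>

lemma domain_approximation:
 "\<exists>C\<ge>0. \<forall>n\<ge>1. \<forall>R\<ge>1. \<forall>g \<psi>. g \<in> B --> is_P_power \<alpha> N (real R / 2) g \<psi> -->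
  (\<exists>p\<in>Poly_deg n. nB (%x. g x - p x) <= (C / real n) ^ R * nB \<psi> \<and> nB (mult (%l. qq l ^ R) p) <= (1 + 2 ^ R) * nB \<psi>)"
proof -
 obtain C where C: "0 <= C" "!!n. 1 <= n ==> \<exists>v. mbd 1 v \<and> (\<forall>l>n. v l = 0) \<and>
   (\<forall>R. \<forall>f\<in>polys. nB (mult (%l. (1 - v l) ^ R) f) <= (C / real n) ^ R * nB (mult (%l. qq l ^ R) f))"
  using jackson_power by blast
 have "\<exists>p\<in>Poly_deg n. nB (%x. g x - p x) <= (C / real n) ^ R * nB \<psi> \<and> nB (mult (%l. qq l ^ R) p) <= (1 + 2 ^ R) * nB \<psi>"
  if n: "1 <= n" and R: "1 <= R" and g: "g \<in> B" and P: "is_P_power \<alpha> N (real R / 2) g \<psi>" for n R g \<psi>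
 proof -
  obtain v where v: "mbd 1 v" "!!l. n < l ==> v l = 0"
   "!!f. f \<in> polys ==> nB (mult (%l. (1 - v l) ^ R) f) <= (C / real n) ^ R * nB (mult (%l. qq l ^ R) f)"
   using C(2)[OF n] by metis
  have psi: "\<psi> \<in> B" and pr: "H_proj \<alpha> l \<psi> x = qq l ^ R * H_proj \<alpha> l g x" for l x
   using P by (simp_all add: is_P_power_def lam_powr[OF R])
  have qB: "mult (%l. qq l ^ R) (BD k g) = BD k \<psi>" for k
   by (rule ext) (simp add: mult_BD[OF g] BD_expansion[OF B_integrable[OF psi]] pr mult_ac)
  define z where "z l = 1 - (1 - v l) ^ R" for l
  have z0: "n < l ==> z l = 0" for l using v(2)[of l] by (simp add: z_def)
  have zb: "mbd (1 + 2 ^ R) z"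
   unfolding z_def[abs_def] using mbd_diff[OF mbd_one mbd_power[OF mbd_diff[OF mbd_one v(1)], of R]] by simp
  define p where "p = mult (%l. z l / mm n l) (BD n g)"
  have pP: "p \<in> Poly_deg n" unfolding p_def by (rule mult_in_Poly[OF BD_Poly])
  obtain r where r: "strict_mono r" "AE x in mu. (%k. BD (r k) g x) \<longlonglongrightarrow> g x"
   using BD_AE_subseq[OF B_integrable[OF g]] by blast
  have "nB (%x. g x - p x) <= (C / real n) ^ R * nB \<psi>"
  proof (rule nB_limit(2)[of "%k x. BD (r k) g x - mult z (BD (r k) g) x"])
   show "(%x. BD (r k) g x - mult z (BD (r k) g) x) \<in> B" for k
    by (intro B_diff polys_B BD_polys mult_polys)
   show "(%x. g x - p x) \<in> borel_measurable borel" using B_measurable[OF g] Poly_deg_measurable[OF pP] by simp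
   show "AE x in mu. (%k. BD (r k) g x - mult z (BD (r k) g) x) \<longlonglongrightarrow> g x - p x"
    using r(2)
   proof eventually_elim
    case (elim x)
    have "(%k. mult z (BD (r k) g) x) \<longlonglongrightarrow> p x"
     using LIMSEQ_subseq_LIMSEQ[OF mult_BD_tendsto[of g n z x, OF g z0] r(1)] by (simp add: p_def o_def)
    then show ?case using elim by (intro tendsto_diff)
   qed
   show "\<forall>\<^sub>F k in sequentially. nB (%x. BD (r k) g x - mult z (BD (r k) g) x) <= (C / real n) ^ R * nB \<psi>"
   proof (intro always_eventually allI)
    fix k
    have "mult (%l. (1 - v l) ^ R) (BD (r k) g) = mult (%l. 1 - z l) (BD (r k) g)" by (simp add: z_def)
    also have "... = (%x. BD (r k) g x - mult z (BD (r k) g) x)"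
     by (simp add: fun_eq_iff mult_diff[OF BD_polys] mult_one[OF BD_polys])
    finally have "nB (%x. BD (r k) g x - mult z (BD (r k) g) x) <= (C / real n) ^ R * nB (BD (r k) \<psi>)"
     using v(3)[OF BD_polys, of "r k" g] unfolding qB by simp
    also have "... <= (C / real n) ^ R * nB \<psi>" using C(1) by (intro mult_left_mono BD_B psi) auto
    finally show "nB (%x. BD (r k) g x - mult z (BD (r k) g) x) <= (C / real n) ^ R * nB \<psi>" .
   qed
  qed simp
  moreover have "nB (mult (%l. qq l ^ R) p) <= (1 + 2 ^ R) * nB \<psi>"
  proof (rule nB_limit(2)[of "%k. mult z (BD k \<psi>)"])
   show "mult z (BD k \<psi>) \<in> B" for k by (rule mult_B[OF BD_polys])
   show "mult (%l. qq l ^ R) p \<in> borel_measurable borel" by (rule Poly_deg_measurable[OF mult_in_Poly[OF pP]])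
   have "mult (%l. qq l ^ R) p = mult (%l. z l / mm n l) (mult (%l. qq l ^ R) (BD n g))"
    unfolding p_def by (simp only: mult_mult[OF BD_polys] mult.commute)
   then have "mult (%l. qq l ^ R) p = mult (%l. z l / mm n l) (BD n \<psi>)" unfolding qB .
   then show "AE x in mu. (%k. mult z (BD k \<psi>) x) \<longlonglongrightarrow> mult (%l. qq l ^ R) p x"
    using mult_BD_tendsto[of \<psi> n z, OF psi z0] by simp
   show "\<forall>\<^sub>F k in sequentially. nB (mult z (BD k \<psi>)) <= (1 + 2 ^ R) * nB \<psi>"
   proof (intro always_eventually allI)
    fix k
    have "nB (mult z (BD k \<psi>)) <= (1 + 2 ^ R) * nB (BD k \<psi>)" by (rule mbdD[OF zb BD_polys])
    also have "... <= (1 + 2 ^ R) * nB \<psi>" by (intro mult_left_mono BD_B psi) auto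
    finally show "nB (mult z (BD k \<psi>)) <= (1 + 2 ^ R) * nB \<psi>" .
   qed
  qed simp
  ultimately show ?thesis using pP by blast
 qed
 then show ?thesis using C(1) by blast
qed

lemma best_approx_le_K:
 assumes R: "1 <= R"
 shows "\<exists>C>0. \<forall>f\<in>B. \<forall>n\<ge>1. best_approx N n f <= C * K_fun \<alpha> N R f ((1 / real n) ^ R)"
proof -
 obtain C where C: "0 <= C" "!!n g \<psi>. 1 <= n ==> g \<in> B ==> is_P_power \<alpha> N (real R / 2) g \<psi> ==>
  (\<exists>p\<in>Poly_deg n. nB (%x. g x - p x) <= (C / real n) ^ R * nB \<psi>)"
  using domain_approximation R by blast
 define D where "D = 1 + C ^ R"
 have D: "1 <= D" using C(1) by (simp add: D_def)
 have "best_approx N n f <= D * K_fun \<alpha> N R f ((1 / real n) ^ R)" if f: "f \<in> B" and n: "1 <= n" for f n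
 proof (rule field_le_epsilon)
  fix e :: real assume e: "0 < e"
  let ?u = "(1 / real n) ^ R"
  have "0 < e / D" using e D by simp
  then obtain g \<psi> where g: "g \<in> B" "is_P_power \<alpha> N (real R / 2) g \<psi>" "nB (%x. f x - g x) + ?u * nB \<psi> < K_fun \<alpha> N R f ?u + e / D"
   by (rule K_fun_approx[OF R, of ?u "e / D" f, rotated]) auto
  obtain p where p: "p \<in> Poly_deg n" "nB (%x. g x - p x) <= (C / real n) ^ R * nB \<psi>" using C(2)[OF n g(1,2)] by blast
  have "best_approx N n f <= nB (%x. f x - p x)"
   unfolding best_approx_def by (intro cINF_lower p bdd_belowI2[of _ 0]) simp
  also have "(%x. f x - p x) = (%x. (f x - g x) + (g x - p x))" by simp
  also have "nB ... <= nB (%x. f x - g x) + nB (%x. g x - p x)"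
   by (intro B_add(2) B_diff(1) f g(1) Poly_B[OF p(1)])
  also have "... <= nB (%x. f x - g x) + C ^ R * (?u * nB \<psi>)" using p(2) by (simp add: power_divide)
  also have "... <= D * nB (%x. f x - g x) + D * (?u * nB \<psi>)"
  proof (intro add_mono mult_right_mono)
   show "nB (%x. f x - g x) <= D * nB (%x. f x - g x)" using mult_right_mono[OF D, of "nB (%x. f x - g x)"] by simp
  qed (auto simp: D_def)
  also have "... <= D * (K_fun \<alpha> N R f ?u + e / D)" unfolding distrib_left[symmetric] using g(3) D by (intro mult_left_mono) auto
  also have "... = D * K_fun \<alpha> N R f ?u + e" using D by (simp add: distrib_left)
  finally show "best_approx N n f <= D * K_fun \<alpha> N R f ?u + e" .
 qed
 then show ?thesis using D by (intro exI[of _ D]) auto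
qed

section \<open>The telescoping argument\<close>

text \<open>In terms of \<open>z = \<tau> * qq l\<close> this is \<open>z / ((1 + z) * (1 + z/2))\<close>.\<close>

definition phi :: "real => nat => real" where
 "phi \<tau> l = \<tau> * qq l * JJ \<tau> l * JJ (\<tau> / 2) l"

lemma JJ_half:
 assumes t: "0 < \<tau>"
 shows "(1 + JJ \<tau> l) * JJ (\<tau> / 2) l = 2 * JJ \<tau> l"
proof -
 have "0 < 1 + \<tau> * qq l" "0 < 1 + \<tau> / 2 * qq l" using JJ_props(1)[of \<tau> l] JJ_props(1)[of "\<tau> / 2" l] t by auto
 then show ?thesis by (simp add: JJ_def divide_simps)
qed

text \<open>The heart of the proof. Apply the convexity hypothesis to the half sum and half difference of \<open>f = J
\<psi>\<close> and \<open>J' f\<close>, where \<open>J\<close> and \<open>J'\<close> are the resolvents at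
\<open>2 ^ i * t\<close> and \<open>2 ^ Suc i * t\<close>. Both are contractions, so the maximum is at most
the norm of \<open>f\<close>. The half sum is exactly \<open>J' \<psi>\<close>, so the inequalities chain up,
and the half difference is half of \<open>phi\<close> applied to \<open>\<psi>\<close>.\<close>

lemma telescoping_sum:
 assumes s: "0 < s" and m: "0 < m"
  and cvx: "!!F G. F \<in> B ==> G \<in> B ==>
   max (nB (%x. F x + G x)) (nB (%x. F x - G x)) >= (nB F powr s + m * nB G powr s) powr (1 / s)"
  and p: "\<psi> \<in> polys" and t: "0 < t"
 shows "(\<Sum>i=1..n. nB (mult (phi (2 ^ i * t)) \<psi>) powr s) <= 2 powr s / m * nB \<psi> powr s"
proof -
 define J where "J i = mult (JJ (2 ^ i * t)) \<psi>" for i :: nat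
 define G where "G i = mult (%l. (1/2) * phi (2 ^ i * t) l) \<psi>" for i :: nat
 have ti: "0 < 2 ^ i * t" for i :: nat using t by simp
 have Jp: "J i \<in> polys" and Gp: "G i \<in> polys" for i unfolding J_def G_def by (intro mult_polys p)+
 have step: "nB (J (Suc i)) powr s + m * nB (G (Suc i)) powr s <= nB (J i) powr s" for i
 proof -
  let ?T = "2 ^ Suc i * t"
  have h: "?T / 2 = 2 ^ i * t" by simp
  have half: "(1 + JJ ?T l) * JJ (2 ^ i * t) l = 2 * JJ ?T l" for l using JJ_half[OF ti[of "Suc i"], of l] unfolding h .
  have ph: "phi ?T l = (1 - JJ ?T l) * JJ (2 ^ i * t) l" for l
   unfolding phi_def h JJ_props(2)[OF ti] by (simp only: mult.assoc)
  have 1: "(%x. J (Suc i) x + G (Suc i) x) = J i"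
  proof -
   have "JJ ?T l + (1/2) * phi ?T l = JJ (2 ^ i * t) l" for l using half[of l] unfolding ph by (simp add: algebra_simps)
   then show ?thesis unfolding J_def G_def by (simp only: mult_add[OF p, symmetric])
  qed
  have 2: "(%x. J (Suc i) x - G (Suc i) x) = mult (JJ ?T) (J i)"
  proof -
   have "JJ ?T l - (1/2) * phi ?T l = JJ ?T l * JJ (2 ^ i * t) l" for l using half[of l] unfolding ph by (simp add: algebra_simps)
   then show ?thesis unfolding J_def G_def by (simp only: mult_diff[OF p, symmetric] mult_mult[OF p])
  qed
  have "nB (mult (JJ ?T) (J i)) <= nB (J i)" using mbdD[OF mbd_JJ[OF ti[of "Suc i"]] Jp[of i]] by simp
  then have "(nB (J (Suc i)) powr s + m * nB (G (Suc i)) powr s) powr (1 / s) <= nB (J i)"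
   using cvx[OF polys_B[OF Jp[of "Suc i"]] polys_B[OF Gp[of "Suc i"]]] unfolding 1 2 by simp
  then have "((nB (J (Suc i)) powr s + m * nB (G (Suc i)) powr s) powr (1 / s)) powr s <= nB (J i) powr s"
   using s by (intro powr_mono2) auto
  then show ?thesis using s m by (simp add: powr_powr)
 qed
 have tel: "nB (J n) powr s + m * (\<Sum>i=1..n. nB (G i) powr s) <= nB (J 0) powr s" for n
 proof (induction n)
  case (Suc n) then show ?case using step[of n] by (simp add: distrib_left)
 qed simp
 have "nB (J 0) <= nB \<psi>" using mbdD[OF mbd_JJ[OF t] p] by (simp add: J_def)
 then have J0: "nB (J 0) powr s <= nB \<psi> powr s" using s by (intro powr_mono2) auto
 have "nB (mult (phi (2 ^ i * t)) \<psi>) <= 2 * nB (G i)" for i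
 proof -
  have gx: "G i x = (1/2) * mult (phi (2 ^ i * t)) \<psi> x" for x unfolding G_def by (rule mult_cmult[OF p])
  have "mult (phi (2 ^ i * t)) \<psi> x = 2 * G i x" for x using gx[of x] by simp
  then have "mult (phi (2 ^ i * t)) \<psi> = (%x. 2 * G i x)" by (rule ext)
  then show ?thesis using B_scale(2)[OF polys_B[OF Gp[of i]], of 2] by simp
 qed
 then have "(\<Sum>i=1..n. nB (mult (phi (2 ^ i * t)) \<psi>) powr s) <= (\<Sum>i=1..n. 2 powr s * nB (G i) powr s)"
  using s by (intro sum_mono) (simp add: powr_mult[symmetric] powr_mono2)
 also have "... = 2 powr s * (\<Sum>i=1..n. nB (G i) powr s)" by (simp add: sum_distrib_left)
 also have "... <= 2 powr s * (nB \<psi> powr s / m)"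
 proof (intro mult_left_mono)
  have "m * (\<Sum>i=1..n. nB (G i) powr s) <= nB \<psi> powr s" using tel[of n] J0 powr_ge_zero[of "nB (J n)" s] by linarith
  then show "(\<Sum>i=1..n. nB (G i) powr s) <= nB \<psi> powr s / m" using m by (simp add: field_simps)
 qed simp
 finally show ?thesis by simp
qed

text \<open>The near-minimiser is \<open>g\<close> with symbol \<open>1 - (1 - (1 + z) ^ (-2)) ^ (r + 1)\<close>, where
\<open>z = \<tau> * qq l\<close>. Both terms of the K-functional are then \<open>\<tau> ^ r\<close> times a
polynomial in \<open>JJ \<tau>\<close> times \<open>phi \<tau>\<close> applied to the \<open>r\<close>-th
power, which is bounded.\<close>

lemma K_realization:
 assumes r: "1 <= r" and t: "0 < \<tau>" and g: "g \<in> polys"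
 shows "\<exists>h\<in>polys. nB (%x. g x - h x) + \<tau> ^ Suc r * nB (mult (%l. qq l ^ Suc r) h) \<le>
  \<tau> ^ r * 2 ^ (r + 2) * nB (mult (phi \<tau>) (mult (%l. qq l ^ r) g))"
proof -
 define J where "J = JJ \<tau>"
 define J' where "J' = JJ (\<tau> / 2)"
 let ?q = "mult (phi \<tau>) (mult (%l. qq l ^ r) g)"
 have qp: "?q \<in> polys" by (intro mult_polys g)
 have half: "(1 + J l) * J' l = 2 * J l" for l unfolding J_def J'_def by (rule JJ_half[OF t])
 have oneJ: "1 - J l = \<tau> * qq l * J l" for l unfolding J_def JJ_props(2)[OF t] by simp
 have Jb: "mbd 1 J" unfolding J_def by (rule mbd_JJ[OF t])
 have J2: "mbd 2 (%l. 1 + J l)" using mbd_add[OF mbd_one Jb] by simp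
 define w where "w l = (1 - J l ^ 2) ^ Suc r" for l
 define M1 where "M1 l = (1/2) * (J l ^ (r - 1) * (1 + J l) ^ (r + 2))" for l
 define S where "S l = (\<Sum>k<Suc r. (1 - J l ^ 2) ^ k)" for l
 define M2 where "M2 l = (1/2) * ((1 + J l) * S l)" for l
 have ph: "phi \<tau> l = \<tau> * qq l * J l * J' l" for l by (simp add: phi_def J_def J'_def)
 have M1b: "mbd (2 ^ (r + 1)) M1"
 proof -
  have "mbd (\<bar>1/2\<bar> * (1 ^ (r - 1) * 2 ^ (r + 2))) M1"
   unfolding M1_def[abs_def] by (intro mbd_cmult mbd_mult mbd_power Jb J2)
  then show ?thesis by simp
 qed
 have M2b: "mbd (2 ^ (r + 1)) M2"
 proof -
  have "mbd 2 (%l. 1 - J l ^ 2)" using mbd_diff[OF mbd_one mbd_power[OF Jb, of 2]] by simp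
  then have "mbd (\<Sum>k<Suc r. 2 ^ k) S" unfolding S_def[abs_def] by (intro mbd_sum mbd_power) auto
  then have "mbd (\<bar>1/2\<bar> * (2 * (\<Sum>k<Suc r. 2 ^ k))) M2" unfolding M2_def[abs_def] by (intro mbd_cmult mbd_mult J2)
  moreover have "(\<Sum>k<n. 2 ^ k) <= (2 ^ n :: real)" for n by (induction n) auto
  from this[of "Suc r"] have "\<bar>1/2\<bar> * (2 * (\<Sum>k<Suc r. 2 ^ k)) <= (2 ^ (r + 1) :: real)" by simp
  ultimately show ?thesis by (rule mbd_mono)
 qed
 have id1: "w l = \<tau> ^ r * (M1 l * (phi \<tau> l * qq l ^ r))" for l
 proof -
  have rr: "J l ^ r = J l * J l ^ (r - 1)" using r by (cases r) auto
  have "w l = ((1 - J l) * (1 + J l)) ^ Suc r" by (simp add: w_def power2_eq_square algebra_simps)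
  also have "... = (\<tau> * qq l * J l) ^ Suc r * (1 + J l) ^ Suc r" by (simp only: oneJ power_mult_distrib)
  also have "... = \<tau> ^ r * qq l ^ r * (\<tau> * qq l * J l ^ r * (1 + J l) ^ Suc r * (1/2) * (2 * J l))"
   by (simp add: power_mult_distrib mult_ac)
  also have "2 * J l = (1 + J l) * J' l" by (rule half[symmetric])
  also have "\<tau> ^ r * qq l ^ r * (\<tau> * qq l * J l ^ r * (1 + J l) ^ Suc r * (1/2) * ((1 + J l) * J' l)) = \<tau> ^ r * (M1 l * (phi \<tau> l * qq l ^ r))"
   unfolding rr by (simp add: M1_def ph mult_ac)
  finally show ?thesis .
 qed
 have id2: "\<tau> ^ Suc r * (qq l ^ Suc r * (1 - w l)) = \<tau> ^ r * (M2 l * (phi \<tau> l * qq l ^ r))" for l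
 proof -
  have "1 - w l = J l ^ 2 * S l" unfolding w_def S_def using one_diff_power_eq[of "1 - J l ^ 2" "Suc r"] by simp
  then have "\<tau> ^ Suc r * (qq l ^ Suc r * (1 - w l)) = \<tau> ^ r * qq l ^ r * (\<tau> * qq l * J l * S l * (1/2) * (2 * J l))"
   by (simp add: power2_eq_square mult_ac)
  also have "2 * J l = (1 + J l) * J' l" by (rule half[symmetric])
  also have "\<tau> ^ r * qq l ^ r * (\<tau> * qq l * J l * S l * (1/2) * ((1 + J l) * J' l)) = \<tau> ^ r * (M2 l * (phi \<tau> l * qq l ^ r))"
   by (simp add: M2_def ph mult_ac)
  finally show ?thesis .
 qed
 define h where "h = mult (%l. 1 - w l) g"
 have "(%x. g x - h x) = (%x. \<tau> ^ r * mult M1 ?q x)"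
 proof
  fix x
  have "g x - h x = mult w g x" unfolding h_def by (simp add: mult_diff[OF g] mult_one[OF g])
  also have "... = mult (%l. \<tau> ^ r * (M1 l * (phi \<tau> l * qq l ^ r))) g x" by (simp only: id1[symmetric])
  finally show "g x - h x = \<tau> ^ r * mult M1 ?q x" by (simp only: mult_cmult[OF g] mult_mult[OF g] mult_mult[OF mult_polys[OF g]])
 qed
 then have "nB (%x. g x - h x) <= \<tau> ^ r * nB (mult M1 ?q)"
  using B_scale(2)[OF mult_B[OF qp], of "\<tau> ^ r" M1] t by simp
 also have "... <= \<tau> ^ r * (2 ^ (r + 1) * nB ?q)" using t by (intro mult_left_mono mbdD[OF M1b qp]) auto
 finally have 1: "nB (%x. g x - h x) <= \<tau> ^ r * (2 ^ (r + 1) * nB ?q)" .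
 have "mult (%l. qq l ^ Suc r) h = (%x. (1 / \<tau>) * mult M2 ?q x)"
 proof
  fix x
  have "mult (%l. qq l ^ Suc r) h x = mult (%l. (1 / \<tau>) * (M2 l * (phi \<tau> l * qq l ^ r))) g x"
  proof -
   have "qq l ^ Suc r * (1 - w l) = (1 / \<tau>) * (M2 l * (phi \<tau> l * qq l ^ r))" for l
   proof -
    have "\<tau> ^ r * (\<tau> * (qq l ^ Suc r * (1 - w l))) = \<tau> ^ r * (M2 l * (phi \<tau> l * qq l ^ r))"
     using id2[of l] by (simp only: power_Suc mult_ac)
    then have "\<tau> * (qq l ^ Suc r * (1 - w l)) = M2 l * (phi \<tau> l * qq l ^ r)"
     using t by (simp only: mult_cancel_left) simp
    then show ?thesis using t by (simp add: field_simps)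
   qed
   then show ?thesis unfolding h_def by (simp only: mult_mult[OF g])
  qed
  then show "mult (%l. qq l ^ Suc r) h x = (1 / \<tau>) * mult M2 ?q x" by (simp only: mult_cmult[OF g] mult_mult[OF g] mult_mult[OF mult_polys[OF g]])
 qed
 then have "nB (mult (%l. qq l ^ Suc r) h) <= (1 / \<tau>) * nB (mult M2 ?q)"
  using B_scale(2)[OF mult_B[OF qp], of "1 / \<tau>" M2] t by simp
 also have "... <= (1 / \<tau>) * (2 ^ (r + 1) * nB ?q)" using t by (intro mult_left_mono mbdD[OF M2b qp]) auto
 finally have "\<tau> ^ Suc r * nB (mult (%l. qq l ^ Suc r) h) <= \<tau> ^ Suc r * ((1 / \<tau>) * (2 ^ (r + 1) * nB ?q))"
  using t by (intro mult_left_mono) auto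
 also have "... = \<tau> ^ r * (2 ^ (r + 1) * nB ?q)" using t by simp
 finally have "nB (%x. g x - h x) + \<tau> ^ Suc r * nB (mult (%l. qq l ^ Suc r) h) <= \<tau> ^ r * 2 ^ (r + 2) * nB ?q" using 1 by simp
 then show ?thesis unfolding h_def using mult_polys[OF g] by blast
qed

end

context jacobi_norm
begin

text \<open>For \<open>g\<close> in the domain, replaced by a polynomial up to \<open>e\<close>, the terms split into a
geometric series in \<open>f - g\<close> and the telescoping sum for the power of \<open>g\<close>.\<close>

lemma finite_sum_bound:
 fixes s m :: real and r :: nat
 assumes r: "1 <= r" and s: "2 <= s" and m: "0 < m"
  and cvx: "!!F G. F \<in> B ==> G \<in> B ==>
   max (nB (%x. F x + G x)) (nB (%x. F x - G x)) >= (nB F powr s + m * nB G powr s) powr (1 / s)"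
 shows "\<exists>D>0. \<forall>f\<in>B. \<forall>t>0. \<forall>n::nat.
  (\<Sum>j=1..n. 2 powr (- (real j * real r * s)) * K_fun \<alpha> N (r + 1) f (t ^ (r + 1) * 2 ^ (j * (r + 1))) powr s)
   <= (D * K_fun \<alpha> N r f (t ^ r)) powr s"
proof -
 obtain C where C: "0 <= C" "!!n g \<psi>. 1 <= n ==> g \<in> B ==> is_P_power \<alpha> N (real r / 2) g \<psi> ==>
  (\<exists>p\<in>Poly_deg n. nB (%x. g x - p x) <= (C / real n) ^ r * nB \<psi> \<and> nB (mult (%l. qq l ^ r) p) <= (1 + 2 ^ r) * nB \<psi>)"
  using domain_approximation r by blast
 define c1 where "c1 = (2 ^ (r + 2) * (1 + 2 ^ r) :: real)"
 define E where "E = 2 powr s * (1 + 2 powr s / m * c1 powr s)"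
 have s0: "0 < s" using s by simp
 have E: "0 < E" unfolding E_def using m by (intro mult_pos_pos add_pos_nonneg) auto
 define D where "D = E powr (1 / s)"
 have D: "0 < D" "D powr s = E" using E s0 by (auto simp: D_def powr_powr)
 have add_powr: "(x + y) powr s <= 2 powr s * (x powr s + y powr s)" if "0 <= x" "0 <= y" for x y
 proof -
  have "(x + y) powr s <= (2 * max x y) powr s" using that s0 by (intro powr_mono2) auto
  also have "... = 2 powr s * max x y powr s" using that by (simp add: powr_mult)
  also have "max x y powr s <= x powr s + y powr s" by (simp add: max_def)
  finally show ?thesis by simp
 qed
 have "(\<Sum>j=1..n. 2 powr (- (real j * real r * s)) * K_fun \<alpha> N (r + 1) f (t ^ (r + 1) * 2 ^ (j * (r + 1))) powr s)
   <= (D * K_fun \<alpha> N r f (t ^ r)) powr s" if f: "f \<in> B" and t: "0 < t" for f t n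
 proof -
  define \<kappa> where "\<kappa> = K_fun \<alpha> N r f (t ^ r)"
  define X where "X = (\<Sum>j=1..n. 2 powr (- (real j * real r * s)) * K_fun \<alpha> N (r + 1) f (t ^ (r + 1) * 2 ^ (j * (r + 1))) powr s)"
  have k0: "0 <= \<kappa>" unfolding \<kappa>_def using r t by (intro K_fun_nonneg) auto
  have X0: "0 <= X" unfolding X_def by (intro sum_nonneg) auto
  have Xe: "X <= E * (\<kappa> + 2 * e) powr s" if e: "0 < e" for e
  proof -
   obtain g \<psi> where g: "g \<in> B" "is_P_power \<alpha> N (real r / 2) g \<psi>" "nB (%x. f x - g x) + t ^ r * nB \<psi> < \<kappa> + e"
    unfolding \<kappa>_def by (rule K_fun_approx[OF r, of "t ^ r" e f]) (use t e in auto)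
   have "(%k. (C / real k) ^ r * nB \<psi>) \<longlonglongrightarrow> 0 ^ r * nB \<psi>"
   proof (intro tendsto_mult tendsto_power tendsto_const)
    show "(%k. C / real k) \<longlonglongrightarrow> 0" by (rule lim_const_over_n)
   qed
   then have "(%k. (C / real k) ^ r * nB \<psi>) \<longlonglongrightarrow> 0" using r by (simp add: power_0_left)
   then have "\<forall>\<^sub>F k in sequentially. (C / real k) ^ r * nB \<psi> < e" using e by (rule order_tendstoD(2))
   then have "\<forall>\<^sub>F k in sequentially. 1 <= k \<and> (C / real k) ^ r * nB \<psi> < e" using eventually_ge_at_top[of 1] by eventually_elim simp
   then obtain k where k: "1 <= k" "(C / real k) ^ r * nB \<psi> < e" by (auto simp: eventually_sequentially)
   obtain p where p: "p \<in> Poly_deg k" "nB (%x. g x - p x) <= e" "nB (mult (%l. qq l ^ r) p) <= (1 + 2 ^ r) * nB \<psi>"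
    using C(2)[OF k(1) g(1,2)] k(2) by force
   have pp: "p \<in> polys" using p(1) by (auto simp: polys_def)
   define q where "q = mult (%l. qq l ^ r) p"
   have qp: "q \<in> polys" unfolding q_def by (rule mult_polys[OF pp])
   define a where "a = nB (%x. f x - g x) + e"
   define b where "b j = nB (mult (phi (2 ^ j * t)) q)" for j :: nat
   define L where "L = t ^ r * 2 ^ (r + 2)"
   have a0: "0 <= a" using e by (simp add: a_def)
   have L0: "0 <= L" using t by (simp add: L_def)
   have bound: "2 powr (- (real j * real r * s)) * K_fun \<alpha> N (r + 1) f (t ^ (r + 1) * 2 ^ (j * (r + 1))) powr s
    <= 2 powr s * ((1/2) ^ j * a powr s + L powr s * b j powr s)" if j: "1 <= j" for j
   proof -
    define \<tau> where "\<tau> = 2 ^ j * t"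
    have tau: "0 < \<tau>" using t by (simp add: \<tau>_def)
    have u: "t ^ (r + 1) * 2 ^ (j * (r + 1)) = \<tau> ^ Suc r" by (simp only: \<tau>_def Suc_eq_plus1 power_mult_distrib power_mult[of 2 j] mult.commute[of "t ^ (r + 1)"])
    obtain h where h: "h \<in> polys" "nB (%x. p x - h x) + \<tau> ^ Suc r * nB (mult (%l. qq l ^ Suc r) h) <= \<tau> ^ r * 2 ^ (r + 2) * b j"
     using K_realization[OF r tau pp] unfolding b_def q_def \<tau>_def by blast
    have "K_fun \<alpha> N (r + 1) f (\<tau> ^ Suc r) <= nB (%x. f x - h x) + \<tau> ^ Suc r * nB (mult (%l. qq l ^ Suc r) h)"
     using K_fun_le_polys[OF h(1), of "Suc r" "\<tau> ^ Suc r" f] tau by simp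
    also have "(%x. f x - h x) = (%x. ((f x - g x) + (g x - p x)) + (p x - h x))" by simp
    also have "nB ... <= nB (%x. (f x - g x) + (g x - p x)) + nB (%x. p x - h x)"
     by (intro B_add B_diff f g(1) polys_B pp h(1))
    also have "nB (%x. (f x - g x) + (g x - p x)) <= nB (%x. f x - g x) + nB (%x. g x - p x)"
     by (intro B_add(2) B_diff f g(1) polys_B pp)
    finally have "K_fun \<alpha> N (r + 1) f (\<tau> ^ Suc r) <= a + \<tau> ^ r * 2 ^ (r + 2) * b j" using p(2) h(2) by (simp add: a_def)
    then have "(1 / 2 ^ (j * r)) * K_fun \<alpha> N (r + 1) f (\<tau> ^ Suc r) <= (1 / 2 ^ (j * r)) * (a + \<tau> ^ r * 2 ^ (r + 2) * b j)"
     by (intro mult_left_mono) auto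
    also have "... = (1 / 2 ^ (j * r)) * a + L * b j"
     by (simp add: \<tau>_def L_def power_mult_distrib power_mult distrib_left)
    finally have le: "(1 / 2 ^ (j * r)) * K_fun \<alpha> N (r + 1) f (\<tau> ^ Suc r) <= (1 / 2 ^ (j * r)) * a + L * b j" .
    have Kn: "0 <= K_fun \<alpha> N (r + 1) f (\<tau> ^ Suc r)" using tau by (intro K_fun_nonneg) auto
    have p2: "(1 / 2 ^ (j * r)) powr s = 2 powr (- (real j * real r * s))"
    proof -
     have "(1 / 2 ^ (j * r) :: real) = 2 powr (- real (j * r))" by (simp add: powr_minus powr_realpow inverse_eq_divide del: of_nat_mult)
     then show ?thesis by (simp add: powr_powr)
    qed
    have "2 powr (- (real j * real r * s)) * K_fun \<alpha> N (r + 1) f (\<tau> ^ Suc r) powr s = ((1 / 2 ^ (j * r)) * K_fun \<alpha> N (r + 1) f (\<tau> ^ Suc r)) powr s"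
     unfolding p2[symmetric] by (rule powr_mult[symmetric])
    also have "... <= ((1 / 2 ^ (j * r)) * a + L * b j) powr s"
     using le Kn s0 by (intro powr_mono2 mult_nonneg_nonneg) auto
    also have "... <= 2 powr s * (((1 / 2 ^ (j * r)) * a) powr s + (L * b j) powr s)"
     using a0 L0 by (intro add_powr mult_nonneg_nonneg) (auto simp: b_def)
    also have "((1 / 2 ^ (j * r)) * a) powr s = 2 powr (- (real j * real r * s)) * a powr s"
     unfolding p2[symmetric] by (rule powr_mult)
    also have "(L * b j) powr s = L powr s * b j powr s" by (rule powr_mult)
    also have "2 powr (- (real j * real r * s)) <= (1/2) ^ j"
    proof -
     have "real j * 1 <= real j * (real r * s)"
     proof (intro mult_left_mono)
      have "1 * 1 <= real r * s" using r s by (intro mult_mono) auto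
      then show "1 <= real r * s" by simp
     qed auto
     then have "2 powr (- (real j * real r * s)) <= 2 powr (- real j)" by (intro powr_mono) (auto simp: mult.assoc)
     then show ?thesis by (simp add: powr_minus powr_realpow power_one_over inverse_eq_divide)
    qed
    finally show ?thesis unfolding u by (simp add: mult_left_mono mult_right_mono)
   qed
   have half: "(\<Sum>j=1..n. (1/2) ^ j) <= (1::real)"
   proof -
    have "(\<Sum>j=1..n. (1/2) ^ j) = 1 - (1/2 :: real) ^ n" by (induction n) auto
    then show ?thesis by simp
   qed
   have bs: "(\<Sum>j=1..n. b j powr s) <= 2 powr s / m * ((1 + 2 ^ r) * nB \<psi>) powr s"
   proof -
    have "(\<Sum>j=1..n. b j powr s) <= 2 powr s / m * nB q powr s"
     unfolding b_def by (rule telescoping_sum[OF s0 m cvx qp t])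
    also have "... <= 2 powr s / m * ((1 + 2 ^ r) * nB \<psi>) powr s"
     using p(3) m s0 by (intro mult_left_mono powr_mono2) (auto simp: q_def)
    finally show ?thesis .
   qed
   have "X <= (\<Sum>j=1..n. 2 powr s * ((1/2) ^ j * a powr s + L powr s * b j powr s))"
    unfolding X_def by (intro sum_mono bound) auto
   also have "... = 2 powr s * ((\<Sum>j=1..n. (1/2) ^ j) * a powr s + L powr s * (\<Sum>j=1..n. b j powr s))"
    by (simp only: distrib_left sum_distrib_left sum_distrib_right sum.distrib)
   also have "... <= 2 powr s * (1 * (\<kappa> + 2 * e) powr s + L powr s * (2 powr s / m * ((1 + 2 ^ r) * nB \<psi>) powr s))"
   proof (intro mult_left_mono add_mono mult_mono half bs)
    have "0 <= t ^ r * nB \<psi>" using t by simp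
    then show "a powr s <= (\<kappa> + 2 * e) powr s" using g(3) a0 s0 by (intro powr_mono2) (auto simp: a_def)
   qed auto
   also have "L powr s * (2 powr s / m * ((1 + 2 ^ r) * nB \<psi>) powr s) = 2 powr s / m * (c1 powr s * (t ^ r * nB \<psi>) powr s)"
   proof -
    have "L powr s * ((1 + 2 ^ r) * nB \<psi>) powr s = (L * ((1 + 2 ^ r) * nB \<psi>)) powr s"
     by (rule powr_mult[symmetric])
    also have "L * ((1 + 2 ^ r) * nB \<psi>) = c1 * (t ^ r * nB \<psi>)" by (simp only: L_def c1_def mult_ac)
    also have "... powr s = c1 powr s * (t ^ r * nB \<psi>) powr s" by (rule powr_mult)
    finally show ?thesis by simp
   qed
   also have "... <= 2 powr s / m * (c1 powr s * (\<kappa> + 2 * e) powr s)"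
   proof (intro mult_left_mono powr_mono2)
    show "t ^ r * nB \<psi> <= \<kappa> + 2 * e" using g(3) e nB_nonneg[of "%x. f x - g x"] by linarith
   qed (use t s0 m in auto)
   finally show ?thesis by (simp add: E_def algebra_simps)
  qed
  have "(X / E) powr (1 / s) <= \<kappa>"
  proof (rule field_le_epsilon)
   fix e :: real assume e: "0 < e"
   have "X / E <= (\<kappa> + e) powr s" using Xe[of "e / 2"] e E by (simp add: field_simps)
   then have "(X / E) powr (1 / s) <= ((\<kappa> + e) powr s) powr (1 / s)" using X0 E s0 by (intro powr_mono2) auto
   then show "(X / E) powr (1 / s) <= \<kappa> + e" using s0 k0 e by (simp add: powr_powr)
  qed
  then have "((X / E) powr (1 / s)) powr s <= \<kappa> powr s" using s0 by (intro powr_mono2) auto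
  then have "X / E <= \<kappa> powr s" using s0 X0 E by (simp add: powr_powr)
  then have "X <= E * \<kappa> powr s" using E by (simp add: field_simps)
  also have "... = (D * \<kappa>) powr s" using D k0 by (simp add: powr_mult)
  finally show ?thesis unfolding X_def \<kappa>_def .
 qed
 then show ?thesis using D(1) by blast
qed

text \<open>The first inequality is the limit of its finite sections. For the second take \<open>t = 2 ^ (- n -
1)\<close>, so that \<open>j = n + 1 - i\<close> runs through the scales \<open>2 ^ (- i)\<close>, and bound
\<open>E\<close> by the K-functional of order \<open>r + 1\<close>.\<close>

theorem sharp_inequalities:
 fixes s m :: real and r :: nat
 assumes r: "1 <= r" and s: "2 <= s" and m: "0 < m"
  and cvx: "!!F G. F \<in> B ==> G \<in> B ==>
   max (nB (%x. F x + G x)) (nB (%x. F x - G x)) >= (nB F powr s + m * nB G powr s) powr (1 / s)"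
 shows "\<exists>C C1 :: real. C > 0 \<and> C1 > 0 \<and> (\<forall>f\<in>B.
   (\<forall>t::real. t > 0 -->
    (%j::nat. 2 powr (- (real j * real r * s)) *
      K_fun \<alpha> N (r + 1) f (t ^ (r + 1) * 2 ^ (j * (r + 1))) powr s) summable_on {1..} \<and>
    K_fun \<alpha> N r f (t ^ r) \<ge>
     C * (\<Sum>\<^sub>\<infinity>j\<in>{1::nat..}. 2 powr (- (real j * real r * s)) *
      K_fun \<alpha> N (r + 1) f (t ^ (r + 1) * 2 ^ (j * (r + 1))) powr s) powr (1 / s)) \<and>
   (\<forall>n::nat.
    K_fun \<alpha> N r f (2 powr (- (real n * real r))) \<ge>
     C1 * 2 powr (- (real n * real r)) *
      (\<Sum>j=0..n. 2 powr (real j * real r * s) * best_approx N (2 ^ j) f powr s) powr (1 / s)))"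
proof -
 obtain D where D: "0 < D" "!!f t n. f \<in> B ==> 0 < t ==>
  (\<Sum>j=1..n. 2 powr (- (real j * real r * s)) * K_fun \<alpha> N (r + 1) f (t ^ (r + 1) * 2 ^ (j * (r + 1))) powr s)
   <= (D * K_fun \<alpha> N r f (t ^ r)) powr s" using finite_sum_bound[OF r s m cvx] by blast
 obtain A where A: "0 < A" "!!f n. f \<in> B ==> 1 <= n ==> best_approx N n f <= A * K_fun \<alpha> N (r + 1) f ((1 / real n) ^ (r + 1))"
  using best_approx_le_K[of "r + 1"] by auto
 have s0: "0 < s" using s by simp
 have first: "(%j::nat. 2 powr (- (real j * real r * s)) * K_fun \<alpha> N (r + 1) f (t ^ (r + 1) * 2 ^ (j * (r + 1))) powr s) summable_on {1..} \<and>
   K_fun \<alpha> N r f (t ^ r) >= 1 / D * (\<Sum>\<^sub>\<infinity>j\<in>{1::nat..}. 2 powr (- (real j * real r * s)) *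
      K_fun \<alpha> N (r + 1) f (t ^ (r + 1) * 2 ^ (j * (r + 1))) powr s) powr (1 / s)"
  if f: "f \<in> B" and t: "0 < t" for f t
 proof -
  define F where "F j = 2 powr (- (real j * real r * s)) * K_fun \<alpha> N (r + 1) f (t ^ (r + 1) * 2 ^ (j * (r + 1))) powr s" for j :: nat
  define \<kappa> where "\<kappa> = K_fun \<alpha> N r f (t ^ r)"
  have k0: "0 <= \<kappa>" unfolding \<kappa>_def using r t by (intro K_fun_nonneg) auto
  have F0: "0 <= F j" for j by (simp add: F_def)
  have fin: "sum F Y <= (D * \<kappa>) powr s" if Y: "finite Y" "Y \<subseteq> {1..}" for Y
  proof -
   have "sum F Y <= sum F {1..Max (insert 0 Y)}"
    using Y F0 by (intro sum_mono2) auto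
   also have "... <= (D * \<kappa>) powr s" unfolding F_def \<kappa>_def by (rule D(2)[OF f t])
   finally show ?thesis .
  qed
  have sm: "F summable_on {1..}"
   by (rule nonneg_bdd_above_summable_on) (use F0 fin in \<open>auto intro!: bdd_aboveI2[of _ _ "(D * \<kappa>) powr s"]\<close>)
  have "infsum F {1..} <= (D * \<kappa>) powr s" by (rule infsum_le_finite_sums[OF sm fin])
  moreover have "0 <= infsum F {1..}" by (rule infsum_nonneg) (rule F0)
  ultimately have "infsum F {1..} powr (1 / s) <= ((D * \<kappa>) powr s) powr (1 / s)" using s0 by (intro powr_mono2) auto
  also have "... = D * \<kappa>" using s0 D(1) k0 by (simp add: powr_powr)
  finally have "1 / D * infsum F {1..} powr (1 / s) <= \<kappa>" using D(1) by (simp add: field_simps)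
  then show ?thesis using sm unfolding F_def \<kappa>_def by simp
 qed
 have second: "K_fun \<alpha> N r f (2 powr (- (real n * real r))) \<ge>
     1 / (A * D * 2 ^ r) * 2 powr (- (real n * real r)) *
      (\<Sum>j=0..n. 2 powr (real j * real r * s) * best_approx N (2 ^ j) f powr s) powr (1 / s)"
  if f: "f \<in> B" for f and n :: nat
 proof -
  define t where "t = (1 / 2 :: real) ^ (n + 1)"
  have t: "0 < t" by (simp add: t_def)
  define \<kappa> where "\<kappa> = K_fun \<alpha> N r f (2 powr (- (real n * real r)))"
  have k0: "0 <= \<kappa>" unfolding \<kappa>_def using r by (intro K_fun_nonneg) auto
  have "t ^ r <= 2 powr (- (real n * real r))"
  proof -
   have "t ^ r = (1/2) ^ ((n + 1) * r)" by (simp only: t_def power_mult)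
   also have "... <= (1/2) ^ (n * r)" by (intro power_decreasing) auto
   also have "... = 2 powr (- real (n * r))" by (simp add: powr_minus powr_realpow power_one_over inverse_eq_divide del: of_nat_mult)
   finally show ?thesis by simp
  qed
  then have kk: "K_fun \<alpha> N r f (t ^ r) <= \<kappa>" unfolding \<kappa>_def using r t by (intro K_fun_mono) auto
  have kt: "0 <= K_fun \<alpha> N r f (t ^ r)" using r t by (intro K_fun_nonneg) auto
  define G where "G j = 2 powr (- (real j * real r * s)) * K_fun \<alpha> N (r + 1) f (t ^ (r + 1) * 2 ^ (j * (r + 1))) powr s" for j :: nat
  define c where "c = A powr s * 2 powr (real (n + 1) * real r * s)"
  have bound: "2 powr (real i * real r * s) * best_approx N (2 ^ i) f powr s <= c * G (n + 1 - i)" if i: "i \<in> {0..n}" for i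
  proof -
   define j where "j = n + 1 - i"
   have j: "n + 1 = i + j" using i by (simp add: j_def)
   have tj: "t * 2 ^ j = 1 / 2 ^ i" unfolding t_def j by (simp add: power_add power_one_over)
   have "t ^ (r + 1) * 2 ^ (j * (r + 1)) = (t * 2 ^ j) ^ (r + 1)" by (simp only: power_mult_distrib power_mult)
   then have u: "t ^ (r + 1) * 2 ^ (j * (r + 1)) = (1 / real (2 ^ i)) ^ (r + 1)" unfolding tj by simp
   have Kn: "0 <= K_fun \<alpha> N (r + 1) f ((1 / real (2 ^ i)) ^ (r + 1))" by (intro K_fun_nonneg) auto
   have b0: "0 <= best_approx N (2 ^ i) f"
    unfolding best_approx_def using Poly_deg_zero by (intro cINF_greatest) auto
   have "best_approx N (2 ^ i) f powr s <= (A * K_fun \<alpha> N (r + 1) f ((1 / real (2 ^ i)) ^ (r + 1))) powr s"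
    using b0 s0 A(2)[OF f, of "2 ^ i"] by (intro powr_mono2) auto
   also have "... = A powr s * K_fun \<alpha> N (r + 1) f ((1 / real (2 ^ i)) ^ (r + 1)) powr s"
    by (rule powr_mult)
   finally have "2 powr (real i * real r * s) * best_approx N (2 ^ i) f powr s \<le>
    2 powr (real i * real r * s) * (A powr s * K_fun \<alpha> N (r + 1) f ((1 / real (2 ^ i)) ^ (r + 1)) powr s)" by (intro mult_left_mono) auto
   also have "... = (2 powr (real (n + 1) * real r * s) * 2 powr (- (real j * real r * s))) *
    (A powr s * K_fun \<alpha> N (r + 1) f ((1 / real (2 ^ i)) ^ (r + 1)) powr s)"
   proof -
    have "2 powr (real i * real r * s) = 2 powr (real (n + 1) * real r * s) * 2 powr (- (real j * real r * s))"
     unfolding j by (simp add: powr_add[symmetric] algebra_simps)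
    then show ?thesis by (simp only:)
   qed
   also have "... = c * G j" unfolding G_def u c_def by (simp only: mult_ac)
   finally show ?thesis unfolding j_def .
  qed
  define Y where "Y = (\<Sum>j=0..n. 2 powr (real j * real r * s) * best_approx N (2 ^ j) f powr s)"
  have Y0: "0 <= Y" unfolding Y_def by (intro sum_nonneg) auto
  have "Y <= (\<Sum>i\<in>{0..n}. c * G (n + 1 - i))" unfolding Y_def by (intro sum_mono bound)
  also have "... = c * (\<Sum>i\<in>{0..n}. G (n + 1 - i))" by (simp add: sum_distrib_left)
  also have "(\<Sum>i\<in>{0..n}. G (n + 1 - i)) = (\<Sum>j\<in>{1..n+1}. G j)"
   by (rule sum.reindex_bij_witness[where i="%j. n + 1 - j" and j="%i. n + 1 - i"]) auto
  also have "c * (\<Sum>j\<in>{1..n+1}. G j) <= c * (D * K_fun \<alpha> N r f (t ^ r)) powr s"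
   unfolding G_def by (intro mult_left_mono D(2)[OF f t]) (simp add: c_def)
  also have "... <= c * (D * \<kappa>) powr s"
   using kk kt D(1) s0 by (intro mult_left_mono powr_mono2) (auto simp: c_def)
  also have "... = (A * 2 powr (real (n + 1) * real r) * (D * \<kappa>)) powr s"
   using A(1) D(1) k0 by (simp add: c_def powr_mult powr_powr)
  finally have "Y powr (1 / s) <= ((A * 2 powr (real (n + 1) * real r) * (D * \<kappa>)) powr s) powr (1 / s)"
   using Y0 s0 by (intro powr_mono2) auto
  also have "... = A * 2 powr (real (n + 1) * real r) * (D * \<kappa>)"
   using s0 A(1) D(1) k0 by (simp add: powr_powr)
  also have "2 powr (real (n + 1) * real r) = 2 powr (real n * real r) * 2 ^ r"
   by (simp add: distrib_right powr_add powr_realpow)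
  finally have "2 powr (- (real n * real r)) * Y powr (1 / s) <= 2 powr (- (real n * real r)) * (A * (2 powr (real n * real r) * 2 ^ r) * (D * \<kappa>))"
   by (intro mult_left_mono) auto
  also have "... = (A * D * 2 ^ r) * \<kappa>" by (simp add: powr_minus mult_ac)
  finally have "1 / (A * D * 2 ^ r) * (2 powr (- (real n * real r)) * Y powr (1 / s)) <= \<kappa>"
   using A(1) D(1) by (simp add: field_simps)
  then show ?thesis unfolding \<kappa>_def Y_def by (simp only: mult.assoc)
 qed
 show ?thesis
  by (rule exI[of _ "1 / D"], rule exI[of _ "1 / (A * D * 2 ^ r)"]) (use first second A(1) D(1) in auto)
qed

end

theorem theorem6p1:
  fixes \<alpha> :: "'d::finite option \<Rightarrow> real"
    and N :: "(real^'d \<Rightarrow> real) \<Rightarrow> ennreal"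
    and r :: nat and s m :: real
  assumes alpha: "\<And>i. \<alpha> i > - 1 / 2"
    and r: "r \<ge> 1"
    and B: "Lp_or_Orlicz_norm (jacobi_measure \<alpha>) N"
    and s: "2 \<le> s" and m: "m > 0"
    and cvx: "\<And>F G. F \<in> B_space \<alpha> N \<Longrightarrow> G \<in> B_space \<alpha> N \<Longrightarrow>
      max (nrm N (\<lambda>x. F x + G x)) (nrm N (\<lambda>x. F x - G x))
        \<ge> (nrm N F powr s + m * nrm N G powr s) powr (1 / s)"
  shows "\<exists>C C1 :: real. C > 0 \<and> C1 > 0 \<and> (\<forall>f\<in>B_space \<alpha> N.
     (\<forall>t::real. t > 0 \<longrightarrow>
        (\<lambda>j::nat. 2 powr (- (real j * real r * s)) *
            K_fun \<alpha> N (r + 1) f (t ^ (r + 1) * 2 ^ (j * (r + 1))) powr s) summable_on {1..} \<and>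
        K_fun \<alpha> N r f (t ^ r) \<ge>
          C * (\<Sum>\<^sub>\<infinity>j\<in>{1::nat..}. 2 powr (- (real j * real r * s)) *
            K_fun \<alpha> N (r + 1) f (t ^ (r + 1) * 2 ^ (j * (r + 1))) powr s) powr (1 / s)) \<and>
     (\<forall>n::nat.
        K_fun \<alpha> N r f (2 powr (- (real n * real r))) \<ge>
          C1 * 2 powr (- (real n * real r)) *
            (\<Sum>j=0..n. 2 powr (real j * real r * s) * best_approx N (2 ^ j) f powr s) powr (1 / s)))"
proof -
  interpret jacobi \<alpha> by unfold_locales (rule alpha)
  interpret function_norm "jacobi_measure \<alpha>" N
    by (rule function_norm_Lp_or_Orlicz[OF finite_measure_jacobi B])
  interpret jacobi_norm \<alpha> N by unfold_locales
  show ?thesis by (rule sharp_inequalities[OF r s m cvx])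
qed

end
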